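(* Let $\kappa>0$ and $I_0\in\mathcal{B}_*$. Consider the set of all perturbations $H_1\in C^\omega_\kappa$ such that both of the following hold: (i) there is an open set $U^-=\mathcal{I}\times\mathcal{J}$, with $\mathcal{I}$ a ball in $\mathcal{B}_*$ and $\mathcal{J}$ an open set in $\mathbb{T}^d\times\mathbb{T}$, with $\{I=I_0\}\cap U^-\ne\emptyset$, such that for each $(I,\varphi,s)\in U^-$ the map $\tau\in\mathbb{R}^n\mapsto L(\tau,I,\varphi,s)$ has a non-degenerate critical point $\tau^*$, given locally by a $C^{r-1}$ function $\tau^*=\tau^*(I,\varphi,s)$; (ii) the associated reduced Poincaré function $\mathcal{L}^*$ satisfies $\dfrac{\partial\mathcal{L}^*}{\partial\theta}(I_0,\theta_0)\neq0$ for some $\theta_0\in\mathbb{T}^d$ with $(I_0,\theta_0)\in\mathrm{Dom}(\mathcal{L}^* )$. Then this set is dense and open in the $C^\omega_\kappa$ topology. Actually, it is also $C^3$ open.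
   Context: Let $n,d\ge1$ be integers, $\mathbb{T}=\mathbb{R}/2\pi\mathbb{Z}$. Let $\mathcal{B}\subset\mathbb{R}^d$ and $\mathcal{D}\subset\mathbb{R}^n$ be open balls centered at $0$ of suitably large radii, and $\mathcal{B}_*\subset\mathcal{B}$, $\mathcal{D}_*\subset\mathcal{D}$ fixed (suitably large) closed balls, with $\mathcal{D}_*$ containing the momentum components of the homoclinic orbits below. The unperturbed Hamiltonian is $H_0(p,q,I)=h(I)+\sum_{i=1}^n\pm[\frac12p_i^2+V_i(q_i)]$ on $\mathcal{D}\times\mathbb{T}^n\times\mathcal{B}\times\mathbb{T}^d$, with arbitrary fixed signs. Standing assumptions: $h$ and each $V_i:\mathbb{T}\to\mathbb{R}$ are $C^r$ with $r\in[3,\infty)\cup\{\infty,\omega\}$ an extended integer; each $V_i$ has a unique maximum point, located at $0$, with $V_i''(0)<0$. For each $i$ fix one homoclinic orbit $(p_i^0(t),q_i^0(t))$ of the $i$-th (signed) pendulum to the hyperbolic equilibrium $(0,0)$; it converges exponentially to $(0,0)$ as $t\to\pm\infty$. For $\tau\in\mathbb{R}^n$, $\bar1=(1,\dots,1)\in\mathbb{R}^n$, put $p^0(\tau+t\bar1)=(p_1^0(\tau_1+t),\dots,p_n^0(\tau_n+t))$ and $q^0(\tau+t\bar1)=(q_1^0(\tau_1+t),\dots,q_n^0(\tau_n+t))$. Let $\widetilde{\mathcal{M}}=\mathcal{D}\times\mathbb{T}^n\times\mathcal{B}\times\mathbb{T}^d\times\mathbb{T}$. For $\kappa>0$, $\widetilde{\mathcal{M}}_\kappa$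 is the set of $(p,q,I,\varphi,t)\in\mathbb{C}^n\times\mathbb{C}^n/(2\pi\mathbb{Z})^n\times\mathbb{C}^d\times\mathbb{C}^d/(2\pi\mathbb{Z})^d\times\mathbb{C}/(2\pi\mathbb{Z})$ with $\mathrm{dist}(p,\mathcal{D})<\kappa$, $\mathrm{dist}(I,\mathcal{B})<\kappa$, $|\mathrm{Im}\,\iota|<\kappa$ for $\iota=q_i,\varphi_i,t$. $C^\omega_\kappa$ is the Banach space of bounded analytic $f:\widetilde{\mathcal{M}}_\kappa\to\mathbb{C}$ with $f(\widetilde{\mathcal{M}})\subset\mathbb{R}$, with norm $\|f\|_\kappa=\sup_{\widetilde{\mathcal{M}}_\kappa}|f|$. "$C^3$ open" means open with respect to the $C^3$ topology (sup norm of derivatives up to order 3 on $\widetilde{\mathcal{M}}$). For a perturbation $H_1=H_1(p,q,I,\varphi,t)$ the Poincaré function (Melnikov potential) is $$L(\tau,I,\varphi,s)=-\int_{-\infty}^{\infty}\Big[H_1\big(p^0(\tau+t\bar1),q^0(\tau+t\bar1),I,\varphi+\omega(I)t,s+t\big)-H_1\big(0,0,I,\varphi+\omega(I)t,s+t\big)\Big]dt,$$ where $\omega(I)=(\omega_1(I),\dots,\omega_d(I))=Dh(I)$. A critical point $\tau^*$ of $\tau\mapsto L$ is non-degenerate if $\det[\partial^2L/\partial\tau_i\partial\tau_j]\ne0$ there. Given $U^-$ and $\tau^*$ as in (i), the reduced Poincaré function is $$\mathcal{L}^*(I,\theta)=L(\tau^*(I,\varphi,s),I,\varphi,s),\qquad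 \varphi=\theta+\omega(I)s,\ (I,\varphi,s)\in U^-,$$ defined on $\mathrm{Dom}(\mathcal{L}^* )=\{(I,\theta)\in\mathbb{R}^d\times\mathbb{T}^d:\exists s\in\mathbb{T}\text{ with }(I,\theta+\omega(I)s,s)\in U^-\}$. In products $\omega(I)s$, $s$ is taken in a fixed real lift; $U^-$ is taken small enough that $\mathcal{L}^*$ is well defined. The value is independent of the admissible $s$, because $L(\tau+\sigma\bar1,I,\varphi,s)=L(\tau,I,\varphi-\omega(I)\sigma,s-\sigma)$; equivalently $\mathcal{L}^*(I,\theta)=L(\tau^*(I,\theta,0),I,\theta,0)$ with $\tau^*(I,\theta,0)=\tau^*(I,\theta+\omega(I)s,s)-s\bar1$.
   Formalization: For r = ω the function τ* is only required to be C^∞, since with analytic τ* openness fails (L need not be analytic in I); and a ball in B_* is a relative ball of B_*, since for I_0 on the boundary of B_* no open ball inside B_* contains I_0. *)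

theory Defs
  imports "HOL-Analysis.Analysis"
begin

section \<open>Regularity classes\<close>

datatype regularity = Fin nat | Infty | Omega

definition at_least_three :: "regularity \<Rightarrow> bool" where
  "at_least_three r \<longleftrightarrow> (case r of Fin k \<Rightarrow> 3 \<le> k | Infty \<Rightarrow> True | Omega \<Rightarrow> True)"

text \<open>The index \<open>r - 1\<close>. In the order \<open>3 < 4 < \<dots> < \<infinity> < \<omega>\<close> the predecessor of \<open>\<omega>\<close> is \<open>\<infinity>\<close>.
  The value \<open>\<omega>\<close> would be too strong here: even if all data are analytic, the Melnikov potential
  is in general only smooth in the action \<open>I\<close>. Complexifying \<open>I\<close> moves \<open>\<phi> + Dh(I) t\<close> out of the
  strip of analyticity for large \<open>t\<close>.\<close>
fun reg_pred :: "regularity \<Rightarrow> regularity" where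
  "reg_pred (Fin k) = Fin (k - 1)"
| "reg_pred Infty = Infty"
| "reg_pred Omega = Infty"

fun Ck_on :: "nat \<Rightarrow> 'a set \<Rightarrow> ('a::euclidean_space \<Rightarrow> 'b::euclidean_space) \<Rightarrow> bool" where
  "Ck_on 0 S f \<longleftrightarrow> continuous_on S f"
| "Ck_on (Suc k) S f \<longleftrightarrow>
     (\<forall>x\<in>S. f differentiable (at x)) \<and> (\<forall>v. Ck_on k S (\<lambda>x. frechet_derivative f (at x) v))"

text \<open>Local power series expansions; the multi-indices \<open>\<alpha>\<close> are indexed by \<open>Basis\<close>.\<close>
definition real_analytic_on :: "'a set \<Rightarrow> ('a::euclidean_space \<Rightarrow> 'b::euclidean_space) \<Rightarrow> bool" where
  "real_analytic_on S f \<longleftrightarrow>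
     (\<forall>x\<in>S. \<exists>e>0. \<exists>c. \<forall>y\<in>ball x e.
        ((\<lambda>\<alpha>. (\<Prod>b\<in>Basis. ((y - x) \<bullet> b) ^ \<alpha> b) *\<^sub>R c \<alpha>) has_sum f y)
          {\<alpha> :: 'a \<Rightarrow> nat. \<forall>b. b \<notin> Basis \<longrightarrow> \<alpha> b = 0})"

fun regular_open :: "regularity \<Rightarrow> 'a set \<Rightarrow> ('a::euclidean_space \<Rightarrow> 'b::euclidean_space) \<Rightarrow> bool" where
  "regular_open (Fin k) S f \<longleftrightarrow> Ck_on k S f"
| "regular_open Infty S f \<longleftrightarrow> (\<forall>k. Ck_on k S f)"
| "regular_open Omega S f \<longleftrightarrow> real_analytic_on S f"

text \<open>On a set that need not be open, regularity means having regular local extensions.\<close>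
definition regular_on :: "regularity \<Rightarrow> 'a set \<Rightarrow> ('a::euclidean_space \<Rightarrow> 'b::euclidean_space) \<Rightarrow> bool" where
  "regular_on r S f \<longleftrightarrow>
     (\<forall>x\<in>S. \<exists>W g. open W \<and> x \<in> W \<and> regular_open r W g \<and> (\<forall>y\<in>W \<inter> S. g y = f y))"

text \<open>\<open>dirs_deriv [v\<^sub>1, \<dots>, v\<^sub>k] g = D\<^bsub>v\<^sub>1\<^esub> \<cdots> D\<^bsub>v\<^sub>k\<^esub> g\<close>\<close>
fun dirs_deriv :: "'a::real_normed_vector list \<Rightarrow> ('a \<Rightarrow> real) \<Rightarrow> 'a \<Rightarrow> real" where
  "dirs_deriv [] g = g"
| "dirs_deriv (v # vs) g = (\<lambda>x. frechet_derivative (dirs_deriv vs g) (at x) v)"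

definition hessian :: "(real^'n \<Rightarrow> real) \<Rightarrow> real^'n \<Rightarrow> real^'n^'n" where
  "hessian g x = (\<chi> i j. dirs_deriv [axis i 1, axis j 1] g x)"

definition nondegenerate_critical_point :: "(real^'n \<Rightarrow> real) \<Rightarrow> real^'n \<Rightarrow> bool" where
  "nondegenerate_critical_point g x \<longleftrightarrow>
     (g has_derivative (\<lambda>_. 0)) (at x) \<and> det (hessian g x) \<noteq> 0"

section \<open>Phase space and perturbations\<close>

text \<open>The tuples are \<open>(p, q, I, \<phi>, t)\<close>. Angles are represented by real (or complex) lifts:
  a function on a torus is a \<open>2\<pi>\<close>-periodic function of the lifts, and a subset of a torus
  is a set of lifts that is invariant under \<open>2\<pi>\<close>-translations.\<close>
type_synonym ('n, 'd) rphase = "(real^'n) \<times> (real^'n) \<times> (real^'d) \<times> (real^'d) \<times> real"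
type_synonym ('n, 'd) cphase =
  "(complex^'n) \<times> (complex^'n) \<times> (complex^'d) \<times> (complex^'d) \<times> complex"

definition cvec :: "real^'n \<Rightarrow> complex^'n" where
  "cvec x = (\<chi> i. complex_of_real (x $ i))"

definition period :: "('n \<Rightarrow> int) \<Rightarrow> real^'n" where
  "period k = (\<chi> i. 2 * pi * of_int (k i))"

fun embed :: "('n::finite, 'd::finite) rphase \<Rightarrow> ('n, 'd) cphase" where
  "embed (p, q, I, \<phi>, t) = (cvec p, cvec q, cvec I, cvec \<phi>, complex_of_real t)"

fun cscale :: "complex \<Rightarrow> ('n::finite, 'd::finite) cphase \<Rightarrow> ('n, 'd) cphase" where
  "cscale c (p, q, I, \<phi>, t) = (c *s p, c *s q, c *s I, c *s \<phi>, c * t)"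

definition Mreal :: "(real^'n) set \<Rightarrow> (real^'d) set \<Rightarrow> ('n::finite, 'd::finite) rphase set" where
  "Mreal D B = {(p, q, I, \<phi>, t). p \<in> D \<and> I \<in> B}"

definition Mkappa :: "real \<Rightarrow> (real^'n) set \<Rightarrow> (real^'d) set \<Rightarrow> ('n::finite, 'd::finite) cphase set" where
  "Mkappa \<kappa> D B =
     {(p, q, I, \<phi>, t). infdist p (cvec ` D) < \<kappa> \<and> infdist I (cvec ` B) < \<kappa> \<and>
        (\<forall>i. \<bar>Im (q $ i)\<bar> < \<kappa>) \<and> (\<forall>j. \<bar>Im (\<phi> $ j)\<bar> < \<kappa>) \<and> \<bar>Im t\<bar> < \<kappa>}"

definition cphase_periodic_on :: "('n::finite, 'd::finite) cphase set \<Rightarrow> (('n, 'd) cphase \<Rightarrow> complex) \<Rightarrow> bool" where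
  "cphase_periodic_on S f \<longleftrightarrow>
     (\<forall>p q I \<phi> t k l m. (p, q, I, \<phi>, t) \<in> S \<longrightarrow>
        f (p, q + cvec (period k), I, \<phi> + cvec (period l), t + complex_of_real (2 * pi * of_int m))
          = f (p, q, I, \<phi>, t))"

text \<open>Analyticity of a function of several complex variables on an open set is complex
  differentiability, as for \<^const>\<open>analytic_on\<close>.\<close>
definition cphase_holomorphic_on :: "('n::finite, 'd::finite) cphase set \<Rightarrow> (('n, 'd) cphase \<Rightarrow> complex) \<Rightarrow> bool" where
  "cphase_holomorphic_on S f \<longleftrightarrow>
     (\<forall>z\<in>S. \<exists>f'. (f has_derivative f') (at z) \<and> (\<forall>c v. f' (cscale c v) = c * f' v))"

text \<open>The value \<open>0\<close> off \<open>Mkappa\<close> makes elements correspond exactly to functions on \<open>Mkappa\<close>.\<close>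
definition Comega :: "real \<Rightarrow> (real^'n) set \<Rightarrow> (real^'d) set \<Rightarrow> (('n::finite, 'd::finite) cphase \<Rightarrow> complex) set" where
  "Comega \<kappa> D B =
     {f. cphase_periodic_on (Mkappa \<kappa> D B) f \<and> cphase_holomorphic_on (Mkappa \<kappa> D B) f \<and>
         bounded (f ` Mkappa \<kappa> D B) \<and> (\<forall>x\<in>Mreal D B. f (embed x) \<in> \<real>) \<and>
         (\<forall>z. z \<notin> Mkappa \<kappa> D B \<longrightarrow> f z = 0)}"

definition kappa_norm :: "real \<Rightarrow> (real^'n) set \<Rightarrow> (real^'d) set \<Rightarrow> (('n::finite, 'd::finite) cphase \<Rightarrow> complex) \<Rightarrow> real" where
  "kappa_norm \<kappa> D B f = (SUP z\<in>Mkappa \<kappa> D B. cmod (f z))"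

definition real_part :: "(('n::finite, 'd::finite) cphase \<Rightarrow> complex) \<Rightarrow> ('n, 'd) rphase \<Rightarrow> real" where
  "real_part f x = Re (f (embed x))"

definition C3_norm :: "(real^'n) set \<Rightarrow> (real^'d) set \<Rightarrow> (('n::finite, 'd::finite) cphase \<Rightarrow> complex) \<Rightarrow> real" where
  "C3_norm D B f =
     Sup {\<bar>dirs_deriv vs (real_part f) x\<bar> | vs x. length vs \<le> 3 \<and> set vs \<subseteq> Basis \<and> x \<in> Mreal D B}"

definition norm_topology :: "('a \<Rightarrow> complex) set \<Rightarrow> (('a \<Rightarrow> complex) \<Rightarrow> real) \<Rightarrow> ('a \<Rightarrow> complex) topology" where
  "norm_topology C N =
     topology (\<lambda>U. U \<subseteq> C \<and> (\<forall>f\<in>U. \<exists>\<epsilon>>0. \<forall>g\<in>C. N (\<lambda>x. f x - g x) < \<epsilon> \<longrightarrow> g \<in> U))"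

lemma openin_norm_topology:
  "openin (norm_topology C N) U \<longleftrightarrow>
     U \<subseteq> C \<and> (\<forall>f\<in>U. \<exists>\<epsilon>>0. \<forall>g\<in>C. N (\<lambda>x. f x - g x) < \<epsilon> \<longrightarrow> g \<in> U)"
proof -
  let ?P = "\<lambda>U. U \<subseteq> C \<and> (\<forall>f\<in>U. \<exists>\<epsilon>>0. \<forall>g\<in>C. N (\<lambda>x. f x - g x) < \<epsilon> \<longrightarrow> g \<in> U)"
  have "istopology ?P"
    unfolding istopology_def
  proof (intro conjI allI impI)
    fix S T assume S: "?P S" and T: "?P T"
    show "S \<inter> T \<subseteq> C" using S by blast
    show "\<forall>f\<in>S \<inter> T. \<exists>\<epsilon>>0. \<forall>g\<in>C. N (\<lambda>x. f x - g x) < \<epsilon> \<longrightarrow> g \<in> S \<inter> T"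
    proof
      fix f assume f: "f \<in> S \<inter> T"
      obtain a where a: "a > 0" "\<forall>g\<in>C. N (\<lambda>x. f x - g x) < a \<longrightarrow> g \<in> S" using S f by blast
      obtain b where b: "b > 0" "\<forall>g\<in>C. N (\<lambda>x. f x - g x) < b \<longrightarrow> g \<in> T" using T f by blast
      have "min a b > 0" "\<forall>g\<in>C. N (\<lambda>x. f x - g x) < min a b \<longrightarrow> g \<in> S \<inter> T"
        using a b by auto
      then show "\<exists>\<epsilon>>0. \<forall>g\<in>C. N (\<lambda>x. f x - g x) < \<epsilon> \<longrightarrow> g \<in> S \<inter> T" by blast
    qed
  next
    fix K assume K: "\<forall>S\<in>K. ?P S"
    show "\<Union>K \<subseteq> C" using K by blast
    show "\<forall>f\<in>\<Union>K. \<exists>\<epsilon>>0. \<forall>g\<in>C. N (\<lambda>x. f x - g x) < \<epsilon> \<longrightarrow> g \<in> \<Union>K"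
    proof
      fix f assume "f \<in> \<Union>K"
      then obtain S where S: "S \<in> K" "f \<in> S" by blast
      then obtain a where "a > 0" "\<forall>g\<in>C. N (\<lambda>x. f x - g x) < a \<longrightarrow> g \<in> S" using K by blast
      then show "\<exists>\<epsilon>>0. \<forall>g\<in>C. N (\<lambda>x. f x - g x) < \<epsilon> \<longrightarrow> g \<in> \<Union>K" using S(1) by blast
    qed
  qed
  then show ?thesis
    unfolding norm_topology_def by (simp add: topology_inverse')
qed

lemma topspace_norm_topology: "topspace (norm_topology C N) = C"
proof (rule antisym)
  show "topspace (norm_topology C N) \<subseteq> C"
    using openin_topspace[of "norm_topology C N"] unfolding openin_norm_topology by (rule conjunct1)
  have "openin (norm_topology C N) C"
    unfolding openin_norm_topology by (auto intro: zero_less_one)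
  then show "C \<subseteq> topspace (norm_topology C N)" by (rule openin_subset)
qed

lemma norm_topology_eq_mtopology:
  assumes "Metric_space C (\<lambda>f g. N (\<lambda>x. f x - g x))"
  shows "norm_topology C N = Metric_space.mtopology C (\<lambda>f g. N (\<lambda>x. f x - g x))"
proof -
  interpret M: Metric_space C "\<lambda>f g. N (\<lambda>x. f x - g x)" by fact
  have ball: "M.mball f e \<subseteq> U \<longleftrightarrow> (\<forall>g\<in>C. N (\<lambda>x. f x - g x) < e \<longrightarrow> g \<in> U)"
    if "f \<in> C" for f e U
    using that by (simp add: subset_iff M.in_mball) blast
  have "openin (norm_topology C N) U \<longleftrightarrow> openin M.mtopology U" for U
  proof (cases "U \<subseteq> C")
    case True
    then have "(\<forall>f\<in>U. \<exists>e>0. \<forall>g\<in>C. N (\<lambda>x. f x - g x) < e \<longrightarrow> g \<in> U) \<longleftrightarrow>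
        (\<forall>f\<in>U. \<exists>e>0. M.mball f e \<subseteq> U)"
      by (intro ball_cong refl) (simp add: ball subsetD)
    then show ?thesis
      using True unfolding openin_norm_topology M.openin_mtopology by (simp add: Ball_def)
  next
    case False
    then show ?thesis unfolding openin_norm_topology M.openin_mtopology by simp
  qed
  then show ?thesis by (simp add: topology_eq)
qed

section \<open>The pendulums and the Melnikov potential\<close>

definition pendulum_potential :: "regularity \<Rightarrow> (real \<Rightarrow> real) \<Rightarrow> bool" where
  "pendulum_potential r V \<longleftrightarrow>
     regular_on r UNIV V \<and> (\<forall>x. V (x + 2 * pi) = V x) \<and>
     (\<forall>x. x \<notin> range (\<lambda>k::int. 2 * pi * of_int k) \<longrightarrow> V x < V 0) \<and>
     deriv (deriv V) 0 < 0"

text \<open>Hamilton's equations of \<open>\<sigma> (p\<^sup>2 / 2 + V q)\<close>, \<open>\<sigma> = \<plusminus>1\<close>. In lifted coordinates the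
  equilibrium is \<open>(0, 2\<pi>k)\<close> for any integer \<open>k\<close>, and the two limits may have different \<open>k\<close>.\<close>
definition homoclinic_orbit :: "real \<Rightarrow> (real \<Rightarrow> real) \<Rightarrow> (real \<Rightarrow> real) \<Rightarrow> (real \<Rightarrow> real) \<Rightarrow> bool" where
  "homoclinic_orbit \<sigma> V p q \<longleftrightarrow>
     (\<forall>t. (q has_real_derivative \<sigma> * p t) (at t)) \<and>
     (\<forall>t. (p has_real_derivative - \<sigma> * deriv V (q t)) (at t)) \<and>
     (p \<longlongrightarrow> 0) at_top \<and> (p \<longlongrightarrow> 0) at_bot \<and>
     (\<exists>k::int. (q \<longlongrightarrow> 2 * pi * of_int k) at_top) \<and>
     (\<exists>k::int. (q \<longlongrightarrow> 2 * pi * of_int k) at_bot) \<and>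
     (\<exists>t. (p t, q t) \<notin> range (\<lambda>k::int. (0, 2 * pi * of_int k)))"

definition freq :: "(real^'d \<Rightarrow> real) \<Rightarrow> real^'d \<Rightarrow> real^'d" where
  "freq h I = (\<chi> j. frechet_derivative h (at I) (axis j 1))"

definition orbit_at :: "('n \<Rightarrow> real \<Rightarrow> real) \<Rightarrow> real^'n \<Rightarrow> real^'n" where
  "orbit_at x \<tau> = (\<chi> i. x i (\<tau> $ i))"

abbreviation ones :: "real^'n" where
  "ones \<equiv> (\<chi> i. 1)"

definition poincare_fun ::
  "(real^'d \<Rightarrow> real) \<Rightarrow> ('n \<Rightarrow> real \<Rightarrow> real) \<Rightarrow> ('n \<Rightarrow> real \<Rightarrow> real)
     \<Rightarrow> (('n::finite, 'd::finite) cphase \<Rightarrow> complex) \<Rightarrow> real^'n \<Rightarrow> real^'d \<Rightarrow> real^'d \<Rightarrow> real \<Rightarrow> real" where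
  "poincare_fun h p0 q0 H1 \<tau> I \<phi> s =
     - (LINT t|lborel.
          real_part H1 (orbit_at p0 (\<tau> + t *\<^sub>R ones), orbit_at q0 (\<tau> + t *\<^sub>R ones),
                        I, \<phi> + t *\<^sub>R freq h I, s + t)
        - real_part H1 (0, 0, I, \<phi> + t *\<^sub>R freq h I, s + t))"

section \<open>The two conditions\<close>

definition torus_open :: "((real^'d) \<times> real) set \<Rightarrow> bool" where
  "torus_open J \<longleftrightarrow> open J \<and>
     (\<forall>\<phi> s l m. (\<phi>, s) \<in> J \<longrightarrow> (\<phi> + period l, s + 2 * pi * of_int m) \<in> J)"

text \<open>Balls in \<open>Bs\<close> are those of the metric space \<open>Bs\<close>, so that \<open>U = \<I> \<times> J\<close> is open in
  \<open>Bs \<times> \<T>\<^sup>d \<times> \<T>\<close>. This only matters for \<open>I0\<close> on the boundary of the closed ball \<open>Bs\<close>, which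
  no open ball of the ambient space contained in \<open>Bs\<close> contains.\<close>
definition condition_i ::
  "regularity \<Rightarrow> (real^'d) set \<Rightarrow> real^'d \<Rightarrow> (real^'n \<Rightarrow> real^'d \<Rightarrow> real^'d \<Rightarrow> real \<Rightarrow> real)
     \<Rightarrow> ((real^'d) \<times> (real^'d) \<times> real) set \<Rightarrow> ((real^'d) \<times> (real^'d) \<times> real \<Rightarrow> real^'n) \<Rightarrow> bool" where
  "condition_i r Bs I0 L U \<tau>s \<longleftrightarrow>
     (\<exists>c \<rho> J. c \<in> Bs \<and> \<rho> > 0 \<and> torus_open J \<and> U = (Bs \<inter> ball c \<rho>) \<times> J) \<and>
     {x. fst x = I0} \<inter> U \<noteq> {} \<and>
     (\<forall>I \<phi> s l m. (I, \<phi>, s) \<in> U \<longrightarrow> \<tau>s (I, \<phi> + period l, s + 2 * pi * of_int m) = \<tau>s (I, \<phi>, s)) \<and>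
     regular_on (reg_pred r) U \<tau>s \<and>
     (\<forall>(I, \<phi>, s)\<in>U. nondegenerate_critical_point (\<lambda>\<tau>. L \<tau> I \<phi> s) (\<tau>s (I, \<phi>, s)))"

text \<open>In the next definitions \<open>w\<close> is the frequency map, and the real lift of \<open>s\<close> used in
  \<open>\<phi> = \<theta> + \<omega>(I) s\<close> is the one in \<open>[a, a + 2\<pi>)\<close>.\<close>
definition admissible_times ::
  "(real^'d \<Rightarrow> real^'d) \<Rightarrow> real \<Rightarrow> ((real^'d) \<times> (real^'d) \<times> real) set \<Rightarrow> real^'d \<Rightarrow> real^'d \<Rightarrow> real set" where
  "admissible_times w a U I \<theta> = {s. a \<le> s \<and> s < a + 2 * pi \<and> (I, \<theta> + s *\<^sub>R w I, s) \<in> U}"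

definition reduced_values ::
  "(real^'d \<Rightarrow> real^'d) \<Rightarrow> real \<Rightarrow> (real^'n \<Rightarrow> real^'d \<Rightarrow> real^'d \<Rightarrow> real \<Rightarrow> real)
     \<Rightarrow> ((real^'d) \<times> (real^'d) \<times> real) set \<Rightarrow> ((real^'d) \<times> (real^'d) \<times> real \<Rightarrow> real^'n)
     \<Rightarrow> real^'d \<Rightarrow> real^'d \<Rightarrow> real set" where
  "reduced_values w a L U \<tau>s I \<theta> =
     (\<lambda>s. L (\<tau>s (I, \<theta> + s *\<^sub>R w I, s)) I (\<theta> + s *\<^sub>R w I) s) ` admissible_times w a U I \<theta>"

definition reduced_dom ::
  "(real^'d \<Rightarrow> real^'d) \<Rightarrow> real \<Rightarrow> ((real^'d) \<times> (real^'d) \<times> real) set \<Rightarrow> ((real^'d) \<times> (real^'d)) set" where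
  "reduced_dom w a U = {(I, \<theta>). admissible_times w a U I \<theta> \<noteq> {}}"

definition reduced_poincare ::
  "(real^'d \<Rightarrow> real^'d) \<Rightarrow> real \<Rightarrow> (real^'n \<Rightarrow> real^'d \<Rightarrow> real^'d \<Rightarrow> real \<Rightarrow> real)
     \<Rightarrow> ((real^'d) \<times> (real^'d) \<times> real) set \<Rightarrow> ((real^'d) \<times> (real^'d) \<times> real \<Rightarrow> real^'n)
     \<Rightarrow> real^'d \<Rightarrow> real^'d \<Rightarrow> real" where
  "reduced_poincare w a L U \<tau>s I \<theta> = (THE v. v \<in> reduced_values w a L U \<tau>s I \<theta>)"

text \<open>The first conjunct says that the reduced Poincare function is well defined.\<close>
definition condition_ii ::
  "(real^'d \<Rightarrow> real^'d) \<Rightarrow> real \<Rightarrow> real^'d \<Rightarrow> (real^'n \<Rightarrow> real^'d \<Rightarrow> real^'d \<Rightarrow> real \<Rightarrow> real)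
     \<Rightarrow> ((real^'d) \<times> (real^'d) \<times> real) set \<Rightarrow> ((real^'d) \<times> (real^'d) \<times> real \<Rightarrow> real^'n) \<Rightarrow> bool" where
  "condition_ii w a I0 L U \<tau>s \<longleftrightarrow>
     (\<forall>(I, \<theta>)\<in>reduced_dom w a U. \<exists>!v. v \<in> reduced_values w a L U \<tau>s I \<theta>) \<and>
     (\<exists>\<theta>0 d. (I0, \<theta>0) \<in> reduced_dom w a U \<and>
        (reduced_poincare w a L U \<tau>s I0 has_derivative d) (at \<theta>0) \<and> d \<noteq> (\<lambda>_. 0))"

definition good_perturbations ::
  "regularity \<Rightarrow> real \<Rightarrow> (real^'n) set \<Rightarrow> (real^'d) set \<Rightarrow> (real^'d) set \<Rightarrow> (real^'d \<Rightarrow> real)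
     \<Rightarrow> ('n \<Rightarrow> real \<Rightarrow> real) \<Rightarrow> ('n \<Rightarrow> real \<Rightarrow> real) \<Rightarrow> real^'d \<Rightarrow> real
     \<Rightarrow> (('n::finite, 'd::finite) cphase \<Rightarrow> complex) set" where
  "good_perturbations r \<kappa> D B Bs h p0 q0 I0 a =
     {H1 \<in> Comega \<kappa> D B. \<exists>U \<tau>s.
        condition_i r Bs I0 (poincare_fun h p0 q0 H1) U \<tau>s \<and>
        condition_ii (freq h) a I0 (poincare_fun h p0 q0 H1) U \<tau>s}"

end

theory Submission
  imports Defs "HOL-Complex_Analysis.Cauchy_Integral_Formula"
begin

text \<open>Shifting time in the integral gives \<open>L(\<tau>, I, \<phi>, s) = F(\<tau> - s, I, \<phi> - \<omega>(I) s)\<close> with \<open>F = L(\<cdot>, \<cdot>, \<cdot>, 0)\<close>.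
  By the implicit function theorem a perturbation is therefore good iff, for some \<open>\<tau>\<close> and \<open>\<theta>\<close>, the
  gradient of \<open>F(\<cdot>, I\<^sub>0, \<theta>)\<close> vanishes at \<open>\<tau>\<close>, its Hessian there is invertible and
  \<open>\<partial>F/\<partial>\<theta> \<noteq> 0\<close>. These derivatives of \<open>F\<close> are controlled by the derivatives of \<open>H\<^sub>1\<close> up to order two,
  because the homoclinic orbits decay exponentially; so \<open>C\<^sup>3\<close> openness is the stability of
  nondegenerate zeros, and openness in the analytic norm follows from Cauchy's estimates.

  For density, \<open>F(\<cdot>, I\<^sub>0, 0)\<close> is bounded, so minimising \<open>F + \<epsilon>|\<tau>|\<^sup>2\<close> yields points \<open>\<tau>\<close> with arbitrarily
  small gradient. The perturbations \<open>\<psi>(q\<^sub>i) cos t\<close>, \<open>\<psi>(q\<^sub>i) sin t\<close>, with a trigonometric polynomial \<open>\<psi>\<close>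
  concentrated at one point of the \<open>i\<close>-th orbit, add arbitrary multiples of \<open>cos \<tau>\<^sub>i\<close> and \<open>sin \<tau>\<^sub>i\<close> to \<open>F\<close>:
  they cancel the gradient and shift the Hessian by a small multiple of the identity. In the same
  way \<open>\<psi>(q\<^sub>i) cos \<phi>\<^sub>j\<close>, \<open>\<psi>(q\<^sub>i) sin \<phi>\<^sub>j\<close> make \<open>\<partial>F/\<partial>\<theta>\<^sub>j\<close> nonzero.\<close>


section \<open>Differentiation under the integral sign\<close>

text \<open>The obstacle is that the phase \<open>\<phi> + t *\<^sub>R freq h I\<close> produces a
  factor \<open>t\<close> with every derivative in \<open>I\<close>, while differentiation has to
  pass under an integral over the whole line. Hence integrands are graded by weights: slow ones grow
  less than any exponential, fast ones decay exponentially, and a derivative in \<tau> always brings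
  out a fast factor. The frequency is a derivative of \<open>h\<close>; this costs one order of
  smoothness and explains \<open>reg_pred r\<close>.

  Only the partial derivative of \<open>F\<close> in \<theta> enters the criterion, because the part
  of the derivative of the reduced function that passes through the critical point is multiplied by
  the vanishing gradient.

  The shifts \<tau> range over a noncompact space, so a bounded potential need not have any critical
  point; this forces the detour through almost critical points. The corrections made for density
  must not undo one another: the one for the phase derivative comes first, and those for gradient
  and Hessian that follow are independent of \<theta>.\<close>

lemma has_derivative_imp_directional_LIMSEQ:
  fixes f :: "'a::real_normed_vector \<Rightarrow> 'b::real_normed_vector"
  assumes "(f has_derivative f') (at x)"
  shows "(\<lambda>n. real (Suc n) *\<^sub>R (f (x + (1 / real (Suc n)) *\<^sub>R v) - f x)) \<longlonglongrightarrow> f' v"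
proof -
  have lin: "bounded_linear f'"
    using assms by (rule has_derivative_bounded_linear)
  have "((\<lambda>s. f (x + s *\<^sub>R v)) has_derivative (\<lambda>s. f' (s *\<^sub>R v))) (at 0)"
    by (rule has_derivative_compose[where g = f, of "\<lambda>s. x + s *\<^sub>R v" "\<lambda>s. s *\<^sub>R v" 0 UNIV])
      (auto intro!: derivative_eq_intros simp: assms)
  then have "((\<lambda>s. norm (f (x + s *\<^sub>R v) - f x - f' (s *\<^sub>R v)) / norm s) \<longlongrightarrow> 0) (at 0)"
    by (simp add: has_derivative_at)
  moreover have "(\<lambda>n. 1 / real (Suc n)) \<longlonglongrightarrow> 0"
    by (rule LIMSEQ_Suc[OF lim_1_over_n])
  then have "filterlim (\<lambda>n. 1 / real (Suc n)) (at 0) sequentially"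
    by (intro filterlim_atI) (auto simp: eventually_sequentially)
  ultimately have "(\<lambda>n. norm (f (x + (1 / real (Suc n)) *\<^sub>R v) - f x - f' ((1 / real (Suc n)) *\<^sub>R v)) / norm (1 / real (Suc n))) \<longlonglongrightarrow> 0"
    by (rule filterlim_compose)
  moreover have "norm (f (x + (1 / real (Suc n)) *\<^sub>R v) - f x - f' ((1 / real (Suc n)) *\<^sub>R v)) / norm (1 / real (Suc n))
    = norm (real (Suc n) *\<^sub>R (f (x + (1 / real (Suc n)) *\<^sub>R v) - f x) - f' v)" for n
  proof -
    have "real (Suc n) *\<^sub>R (f (x + (1 / real (Suc n)) *\<^sub>R v) - f x) - f' v
       = real (Suc n) *\<^sub>R (f (x + (1 / real (Suc n)) *\<^sub>R v) - f x - f' ((1 / real (Suc n)) *\<^sub>R v))"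
      by (simp add: linear_simps[OF lin] scaleR_diff_right)
    then show ?thesis by (simp del: of_nat_Suc)
  qed
  ultimately have "(\<lambda>n. norm (real (Suc n) *\<^sub>R (f (x + (1 / real (Suc n)) *\<^sub>R v) - f x) - f' v)) \<longlonglongrightarrow> 0"
    by (simp only:)
  then show ?thesis by (rule LIM_zero_cancel[OF tendsto_norm_zero_cancel])
qed

text \<open>Dominated convergence for the difference quotients. The Lipschitz bound compares only
  with the centre \<open>x0\<close>, so it can be supplied by a mean value estimate on a ball, and
  the derivative is obtained at the centre alone.\<close>

lemma has_derivative_integral:
  fixes F :: "'m \<Rightarrow> 'a::euclidean_space \<Rightarrow> 'b::euclidean_space"
  assumes e: "e > 0"
    and meas: "\<And>x. x \<in> ball x0 e \<Longrightarrow> (\<lambda>t. F t x) \<in> borel_measurable M"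
    and int0: "integrable M (\<lambda>t. F t x0)"
    and deriv: "\<And>t. t \<in> space M \<Longrightarrow> (F t has_derivative F' t) (at x0)"
    and lip: "\<And>t x. t \<in> space M \<Longrightarrow> x \<in> ball x0 e \<Longrightarrow> norm (F t x - F t x0) \<le> g t * norm (x - x0)"
    and g: "integrable M g"
  shows "integrable M (\<lambda>t. F' t v)"
    and "((\<lambda>x. \<integral>t. F t x \<partial>M) has_derivative (\<lambda>v. \<integral>t. F' t v \<partial>M)) (at x0)"
proof -
  have lin: "bounded_linear (F' t)" if "t \<in> space M" for t
    using deriv[OF that] by (rule has_derivative_bounded_linear)
  have small: "\<exists>N. \<forall>n\<ge>N. x0 + (1 / real (Suc n)) *\<^sub>R v \<in> ball x0 e" for v
  proof -
    have "(\<lambda>n. x0 + (1 / real (Suc n)) *\<^sub>R v) \<longlonglongrightarrow> x0 + 0 *\<^sub>R v"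
      by (intro tendsto_intros LIMSEQ_Suc[OF lim_1_over_n])
    then show ?thesis
      using e unfolding lim_sequentially by (auto simp: mem_ball dist_commute)
  qed
  \<comment> \<open>Directional derivatives are limits of difference quotients and inherit the bound
    \<open>g t\<close> from the Lipschitz hypothesis.\<close>
  have bound: "norm (F' t v) \<le> g t * norm v" if t: "t \<in> space M" for t v
  proof -
    obtain N where N: "\<forall>n\<ge>N. x0 + (1 / real (Suc n)) *\<^sub>R v \<in> ball x0 e" using small by blast
    have "norm (real (Suc n) *\<^sub>R (F t (x0 + (1 / real (Suc n)) *\<^sub>R v) - F t x0)) \<le> g t * norm v" if "n \<ge> N" for n
    proof -
      have "norm (F t (x0 + (1 / real (Suc n)) *\<^sub>R v) - F t x0) \<le> g t * (norm v / real (Suc n))"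
        using lip[OF t N[rule_format, OF that]] by simp
      from mult_left_mono[OF this, of "real (Suc n)"] show ?thesis
        by (simp del: of_nat_Suc)
    qed
    then show ?thesis
      using has_derivative_imp_directional_LIMSEQ[OF deriv[OF t], of v]
      by (intro LIMSEQ_le_const2[OF tendsto_norm]) blast+
  qed
  \<comment> \<open>The same limits give measurability; the index is shifted by \<open>N\<close> so
    that all points lie in the ball, where the measurability of \<open>F\<close> is known.\<close>
  have meas': "(\<lambda>t. F' t v) \<in> borel_measurable M" for v
  proof -
    obtain N where N: "\<forall>n\<ge>N. x0 + (1 / real (Suc n)) *\<^sub>R v \<in> ball x0 e" using small by blast
    have "(\<lambda>t. real (Suc (n + N)) *\<^sub>R (F t (x0 + (1 / real (Suc (n + N))) *\<^sub>R v) - F t x0)) \<in> borel_measurable M" for n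
      using meas[OF N[rule_format, of "n + N"]] meas[of x0] e by simp
    then show ?thesis
      by (rule borel_measurable_LIMSEQ_metric)
        (rule LIMSEQ_ignore_initial_segment[OF has_derivative_imp_directional_LIMSEQ[OF deriv]])
  qed
  have int': "integrable M (\<lambda>t. F' t v)" for v
  proof (rule Bochner_Integration.integrable_bound[of M "\<lambda>t. g t * norm v"])
    show "integrable M (\<lambda>t. g t * norm v)" using g by simp
    show "AE t in M. norm (F' t v) \<le> norm (g t * norm v)"
      using order_trans[OF bound abs_ge_self] by (intro AE_I2) auto
  qed (rule meas')
  then show "integrable M (\<lambda>t. F' t v)" .
  have intF: "integrable M (\<lambda>t. F t x)" if x: "x \<in> ball x0 e" for x
  proof -
    have "integrable M (\<lambda>t. F t x - F t x0)"
    proof (rule Bochner_Integration.integrable_bound[of M "\<lambda>t. g t * norm (x - x0)"])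
      show "AE t in M. norm (F t x - F t x0) \<le> norm (g t * norm (x - x0))"
        using order_trans[OF lip[OF _ x] abs_ge_self] by (intro AE_I2) auto
    qed (use g meas[OF x] meas[of x0] e in auto)
    from Bochner_Integration.integrable_add[OF this int0] show ?thesis by simp
  qed
  have lin_int: "bounded_linear (\<lambda>v. \<integral>t. F' t v \<partial>M)"
  proof (rule bounded_linear_intro)
    fix u v :: 'a and c :: real
    have "(\<integral>t. F' t (u + v) \<partial>M) = (\<integral>t. F' t u + F' t v \<partial>M)"
      by (intro Bochner_Integration.integral_cong refl) (simp add: linear_simps[OF lin])
    then show "(\<integral>t. F' t (u + v) \<partial>M) = (\<integral>t. F' t u \<partial>M) + (\<integral>t. F' t v \<partial>M)"
      by (simp add: int')
    have "(\<integral>t. F' t (c *\<^sub>R u) \<partial>M) = (\<integral>t. c *\<^sub>R F' t u \<partial>M)"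
      by (intro Bochner_Integration.integral_cong refl) (simp add: linear_simps[OF lin])
    then show "(\<integral>t. F' t (c *\<^sub>R u) \<partial>M) = c *\<^sub>R (\<integral>t. F' t u \<partial>M)"
      by simp
    have "norm (\<integral>t. F' t u \<partial>M) \<le> (\<integral>t. g t * norm u \<partial>M)"
      by (rule order_trans[OF integral_norm_bound integral_mono]) (use bound g int' in auto)
    then show "norm (\<integral>t. F' t u \<partial>M) \<le> norm u * (\<integral>t. g t \<partial>M)" by (simp add: mult.commute)
  qed
  show "((\<lambda>x. \<integral>t. F t x \<partial>M) has_derivative (\<lambda>v. \<integral>t. F' t v \<partial>M)) (at x0)"
    unfolding has_derivative_at
  proof (intro conjI lin_int, unfold tendsto_at_iff_sequentially comp_def, intro allI impI)
    fix X :: "nat \<Rightarrow> 'a"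
    assume X0: "\<forall>i. X i \<in> UNIV - {0}" and X: "X \<longlonglongrightarrow> 0"
    obtain N where N: "\<forall>n\<ge>N. norm (X n) < e"
      using X e unfolding lim_sequentially by auto
    define Y where "Y = (\<lambda>n. X (n + N))"
    have Y: "Y \<longlonglongrightarrow> 0" unfolding Y_def using X by (rule LIMSEQ_ignore_initial_segment)
    have Yne: "Y n \<noteq> 0" and Yb: "x0 + Y n \<in> ball x0 e" for n
      using X0 N by (auto simp: Y_def mem_ball dist_norm)
    \<comment> \<open>The remainder quotient tends to 0 for each \<open>t\<close> and is at most
      \<open>2 * g t\<close>: one \<open>g t\<close> from the Lipschitz bound, one from the
      derivative.\<close>
    let ?R = "\<lambda>n t. (F t (x0 + Y n) - F t x0 - F' t (Y n)) /\<^sub>R norm (Y n)"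
    have "(\<lambda>n. \<integral>t. ?R n t \<partial>M) \<longlonglongrightarrow> (\<integral>t. 0 \<partial>M)"
    proof (rule integral_dominated_convergence[where w = "\<lambda>t. 2 * g t"])
      show "AE t in M. (\<lambda>n. ?R n t) \<longlonglongrightarrow> 0"
      proof (intro AE_I2)
        fix t assume t: "t \<in> space M"
        from deriv[OF t] have "(\<lambda>n. norm (F t (x0 + Y n) - F t x0 - F' t (Y n)) / norm (Y n)) \<longlonglongrightarrow> 0"
          unfolding has_derivative_at tendsto_at_iff_sequentially comp_def using Y Yne by auto
        then have "(\<lambda>n. norm (?R n t)) \<longlonglongrightarrow> 0" by (simp add: divide_inverse mult.commute)
        then show "(\<lambda>n. ?R n t) \<longlonglongrightarrow> 0" by (rule tendsto_norm_zero_cancel)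
      qed
      show "AE t in M. norm (?R n t) \<le> 2 * g t" for n
      proof (intro AE_I2)
        fix t assume t: "t \<in> space M"
        have "norm (F t (x0 + Y n) - F t x0 - F' t (Y n)) \<le> g t * norm (Y n) + g t * norm (Y n)"
          using norm_triangle_ineq4[of "F t (x0 + Y n) - F t x0" "F' t (Y n)"] lip[OF t Yb, of n] bound[OF t, of "Y n"]
          by simp
        then show "norm (?R n t) \<le> 2 * g t"
          using Yne[of n] by (simp add: pos_divide_le_eq divide_inverse_commute[symmetric])
      qed
    qed (use g meas Yb meas' meas[of x0] e in auto)
    then have "(\<lambda>n. norm (\<integral>t. ?R n t \<partial>M)) \<longlonglongrightarrow> 0"
      by (intro tendsto_norm_zero) (simp only: Bochner_Integration.integral_zero)
    moreover have "norm (\<integral>t. ?R n t \<partial>M) =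
        norm ((\<integral>t. F t (x0 + Y n) \<partial>M) - (\<integral>t. F t x0 \<partial>M) - (\<integral>t. F' t (Y n) \<partial>M)) / norm (Y n)" for n
    proof -
      have "(\<integral>t. ?R n t \<partial>M) = ((\<integral>t. F t (x0 + Y n) \<partial>M) - (\<integral>t. F t x0 \<partial>M) - (\<integral>t. F' t (Y n) \<partial>M)) /\<^sub>R norm (Y n)"
        using intF[OF Yb, of n] int0 int'[of "Y n"] by (subst Bochner_Integration.integral_scaleR_right) simp
      then show ?thesis by (simp only: norm_scaleR) (simp only: divide_inverse mult.commute abs_inverse abs_norm_cancel)
    qed
    ultimately have "(\<lambda>n. norm ((\<integral>t. F t (x0 + Y n) \<partial>M) - (\<integral>t. F t x0 \<partial>M) - (\<integral>t. F' t (Y n) \<partial>M)) / norm (Y n)) \<longlonglongrightarrow> 0"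
      by simp
    then show "(\<lambda>n. norm ((\<integral>t. F t (x0 + X n) \<partial>M) - (\<integral>t. F t x0 \<partial>M) - (\<integral>t. F' t (X n) \<partial>M)) / norm (X n)) \<longlonglongrightarrow> 0"
      unfolding Y_def by (rule LIMSEQ_offset)
  qed
qed

section \<open>Families of functions dominated by weights\<close>

definition dominated :: "'m measure \<Rightarrow> ('m \<Rightarrow> real) set \<Rightarrow> 'a set \<Rightarrow> ('m \<Rightarrow> 'a::euclidean_space \<Rightarrow> real) \<Rightarrow> bool" where
  "dominated M w W \<Phi> \<longleftrightarrow>
     (\<forall>x\<in>W. (\<lambda>t. \<Phi> t x) \<in> borel_measurable M) \<and> (\<forall>t\<in>space M. continuous_on W (\<Phi> t)) \<and>
     (\<forall>x\<in>W. \<exists>e>0. \<exists>g\<in>w. \<forall>y\<in>ball x e \<inter> W. \<forall>t\<in>space M. \<bar>\<Phi> t y\<bar> \<le> g t)"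

text \<open>The recursion copies that of \<open>Ck_on\<close>, with the integration variable
  \<open>t\<close> as an extra argument. Bounds are local in \<open>x\<close>, since no single
  integrable weight serves all shifts of an orbit. The weight set is a parameter: integrable weights
  give smooth integrals, and \<open>UNIV\<close> over a one-point measure gives back plain
  \<open>C\<^sup>k\<close> functions.\<close>

fun dom_Ck :: "'m measure \<Rightarrow> ('m \<Rightarrow> real) set \<Rightarrow> nat \<Rightarrow> 'a set \<Rightarrow> ('m \<Rightarrow> 'a::euclidean_space \<Rightarrow> real) \<Rightarrow> bool" where
  "dom_Ck M w 0 W \<Phi> \<longleftrightarrow> dominated M w W \<Phi>"
| "dom_Ck M w (Suc k) W \<Phi> \<longleftrightarrow> dominated M w W \<Phi> \<and>
     (\<forall>t\<in>space M. \<forall>x\<in>W. \<Phi> t differentiable at x) \<and>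
     (\<forall>v. dom_Ck M w k W (\<lambda>t x. frechet_derivative (\<Phi> t) (at x) v))"

text \<open>What the sum rule and the expansion of a direction in the basis require of a set of
  weights. Products are treated separately, since they may lead from one set to another.\<close>

definition weight_cone :: "('m \<Rightarrow> real) set \<Rightarrow> bool" where
  "weight_cone w \<longleftrightarrow> (\<lambda>t. 0) \<in> w \<and> (\<forall>f\<in>w. \<forall>g\<in>w. (\<lambda>t. f t + g t) \<in> w) \<and>
     (\<forall>f\<in>w. \<forall>c\<ge>0. (\<lambda>t. c * f t) \<in> w)"

lemma dominatedI:
  assumes "\<And>x. x \<in> W \<Longrightarrow> (\<lambda>t. \<Phi> t x) \<in> borel_measurable M"
    and "\<And>t. t \<in> space M \<Longrightarrow> continuous_on W (\<Phi> t)"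
    and "\<And>x. x \<in> W \<Longrightarrow> \<exists>e>0. \<exists>g\<in>w. \<forall>y\<in>ball x e \<inter> W. \<forall>t\<in>space M. \<bar>\<Phi> t y\<bar> \<le> g t"
  shows "dominated M w W \<Phi>"
  using assms unfolding dominated_def by blast

lemma dominatedE:
  assumes "dominated M w W \<Phi>" "x \<in> W"
  obtains e g where "e > 0" "g \<in> w" "\<forall>y\<in>ball x e \<inter> W. \<forall>t\<in>space M. \<bar>\<Phi> t y\<bar> \<le> g t"
proof -
  have "\<exists>e>0. \<exists>g\<in>w. \<forall>y\<in>ball x e \<inter> W. \<forall>t\<in>space M. \<bar>\<Phi> t y\<bar> \<le> g t"
    using assms(1)[unfolded dominated_def, THEN conjunct2, THEN conjunct2] assms(2) by (rule bspec)
  then show ?thesis using that by (elim exE bexE conjE)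
qed

lemma dom_Ck_imp_dominated: "dom_Ck M w k W \<Phi> \<Longrightarrow> dominated M w W \<Phi>"
  by (cases k) auto

lemma dom_Ck_Suc_imp: "dom_Ck M w (Suc k) W \<Phi> \<Longrightarrow> dom_Ck M w k W \<Phi>"
  by (induction k arbitrary: \<Phi>) auto

lemma frechet_derivative_cong_open:
  assumes "open W" "x \<in> W" "\<And>y. y \<in> W \<Longrightarrow> f y = g y"
  shows "frechet_derivative f (at x) = frechet_derivative g (at x)"
    and "f differentiable at x \<longleftrightarrow> g differentiable at x"
proof -
  have *: "(f has_derivative D) (at x) \<longleftrightarrow> (g has_derivative D) (at x)" for D
    using has_derivative_transform_within_open[of f D x UNIV W g]
      has_derivative_transform_within_open[of g D x UNIV W f] assms by auto
  show "frechet_derivative f (at x) = frechet_derivative g (at x)"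
    unfolding frechet_derivative_def * ..
  show "f differentiable at x \<longleftrightarrow> g differentiable at x"
    unfolding differentiable_def * ..
qed

lemma frechet_derivative_eqI: "(f has_derivative D) (at x) \<Longrightarrow> frechet_derivative f (at x) = D"
  by (rule frechet_derivative_at[symmetric])

lemma differentiable_has_derivative:
  "f differentiable at x \<Longrightarrow> (f has_derivative frechet_derivative f (at x)) (at x)"
  by (simp add: frechet_derivative_works)

lemma dominated_cong:
  assumes "\<And>t x. t \<in> space M \<Longrightarrow> x \<in> W \<Longrightarrow> \<Phi> t x = \<Psi> t x" "dominated M w W \<Phi>"
  shows "dominated M w W \<Psi>"
proof (rule dominatedI)
  show "(\<lambda>t. \<Psi> t x) \<in> borel_measurable M" if "x \<in> W" for x
    using assms that measurable_cong[of M "\<lambda>t. \<Psi> t x" "\<lambda>t. \<Phi> t x"] unfolding dominated_def by simp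
  show "continuous_on W (\<Psi> t)" if "t \<in> space M" for t
    using assms that continuous_on_cong[of W W "\<Psi> t" "\<Phi> t"] unfolding dominated_def by simp
  show "\<exists>e>0. \<exists>g\<in>w. \<forall>y\<in>ball x e \<inter> W. \<forall>t\<in>space M. \<bar>\<Psi> t y\<bar> \<le> g t" if x: "x \<in> W" for x
  proof -
    obtain e g where "e > 0" "g \<in> w" "\<forall>y\<in>ball x e \<inter> W. \<forall>t\<in>space M. \<bar>\<Phi> t y\<bar> \<le> g t"
      by (rule dominatedE[OF assms(2) x])
    then show ?thesis using assms(1) by (intro exI[of _ e] conjI bexI[of _ g]) auto
  qed
qed

lemma dom_Ck_cong:
  assumes "open W" "\<And>t x. t \<in> space M \<Longrightarrow> x \<in> W \<Longrightarrow> \<Phi> t x = \<Psi> t x" "dom_Ck M w k W \<Phi>"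
  shows "dom_Ck M w k W \<Psi>"
  using assms(2,3)
proof (induction k arbitrary: \<Phi> \<Psi>)
  case 0
  then show ?case using dominated_cong by (metis dom_Ck.simps(1))
next
  case (Suc k)
  have "dominated M w W \<Psi>" using dominated_cong[OF Suc.prems(1)] Suc.prems(2) by auto
  moreover have "\<Psi> t differentiable at x" if "t \<in> space M" "x \<in> W" for t x
    using frechet_derivative_cong_open(2)[OF assms(1) that(2), of "\<Phi> t" "\<Psi> t"] Suc.prems that by auto
  moreover have "dom_Ck M w k W (\<lambda>t x. frechet_derivative (\<Psi> t) (at x) v)" for v
    by (rule Suc.IH[of "\<lambda>t x. frechet_derivative (\<Phi> t) (at x) v"])
      (use Suc.prems in \<open>auto intro!: fun_cong[OF frechet_derivative_cong_open(1)[OF assms(1)]]\<close>)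
  ultimately show ?case by simp
qed

lemma dominated_add:
  assumes w: "weight_cone w" and "dominated M w W \<Phi>" "dominated M w W \<Psi>"
  shows "dominated M w W (\<lambda>t x. \<Phi> t x + \<Psi> t x)"
proof (rule dominatedI)
  fix x assume x: "x \<in> W"
  obtain e g where g: "e > 0" "g \<in> w" "\<forall>y\<in>ball x e \<inter> W. \<forall>t\<in>space M. \<bar>\<Phi> t y\<bar> \<le> g t"
    by (rule dominatedE[OF assms(2) x])
  obtain d h where h: "d > 0" "h \<in> w" "\<forall>y\<in>ball x d \<inter> W. \<forall>t\<in>space M. \<bar>\<Psi> t y\<bar> \<le> h t"
    by (rule dominatedE[OF assms(3) x])
  show "\<exists>e>0. \<exists>g\<in>w. \<forall>y\<in>ball x e \<inter> W. \<forall>t\<in>space M. \<bar>\<Phi> t y + \<Psi> t y\<bar> \<le> g t"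
  proof (intro exI bexI conjI ballI)
    show "min e d > 0" using g h by simp
    show "(\<lambda>t. g t + h t) \<in> w" using w g(2) h(2) unfolding weight_cone_def by auto
    fix y t assume "y \<in> ball x (min e d) \<inter> W" "t \<in> space M"
    then have "\<bar>\<Phi> t y\<bar> \<le> g t" "\<bar>\<Psi> t y\<bar> \<le> h t" using g h by auto
    then show "\<bar>\<Phi> t y + \<Psi> t y\<bar> \<le> g t + h t" by linarith
  qed
qed (use assms in \<open>auto simp: dominated_def intro!: continuous_on_add borel_measurable_add\<close>)

lemma dom_Ck_add:
  assumes "open W" "weight_cone w" "dom_Ck M w k W \<Phi>" "dom_Ck M w k W \<Psi>"
  shows "dom_Ck M w k W (\<lambda>t x. \<Phi> t x + \<Psi> t x)"
  using assms(3,4)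
proof (induction k arbitrary: \<Phi> \<Psi>)
  case 0
  then show ?case using dominated_add[OF assms(2)] by auto
next
  case (Suc k)
  have "dom_Ck M w k W (\<lambda>t x. frechet_derivative (\<lambda>x. \<Phi> t x + \<Psi> t x) (at x) v)" for v
  proof (rule dom_Ck_cong[OF assms(1)])
    show "dom_Ck M w k W (\<lambda>t x. frechet_derivative (\<Phi> t) (at x) v + frechet_derivative (\<Psi> t) (at x) v)"
      using Suc.prems by (intro Suc.IH) auto
    fix t x assume tx: "t \<in> space M" "x \<in> W"
    have "((\<lambda>x. \<Phi> t x + \<Psi> t x) has_derivative
        (\<lambda>v. frechet_derivative (\<Phi> t) (at x) v + frechet_derivative (\<Psi> t) (at x) v)) (at x)"
      using Suc.prems tx by (intro has_derivative_add differentiable_has_derivative) auto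
    then show "frechet_derivative (\<Phi> t) (at x) v + frechet_derivative (\<Psi> t) (at x) v =
       frechet_derivative (\<lambda>x. \<Phi> t x + \<Psi> t x) (at x) v"
      by (simp add: frechet_derivative_eqI)
  qed
  then show ?case
    using Suc.prems dominated_add[OF assms(2)] by (auto intro: differentiable_add)
qed

lemma dominated_mult:
  assumes w: "\<And>f g. f \<in> w1 \<Longrightarrow> g \<in> w2 \<Longrightarrow> (\<lambda>t. f t * g t) \<in> w3"
    and "dominated M w1 W \<Phi>" "dominated M w2 W \<Psi>"
  shows "dominated M w3 W (\<lambda>t x. \<Phi> t x * \<Psi> t x)"
proof (rule dominatedI)
  fix x assume x: "x \<in> W"
  obtain e g where g: "e > 0" "g \<in> w1" "\<forall>y\<in>ball x e \<inter> W. \<forall>t\<in>space M. \<bar>\<Phi> t y\<bar> \<le> g t"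
    by (rule dominatedE[OF assms(2) x])
  obtain d h where h: "d > 0" "h \<in> w2" "\<forall>y\<in>ball x d \<inter> W. \<forall>t\<in>space M. \<bar>\<Psi> t y\<bar> \<le> h t"
    by (rule dominatedE[OF assms(3) x])
  show "\<exists>e>0. \<exists>g\<in>w3. \<forall>y\<in>ball x e \<inter> W. \<forall>t\<in>space M. \<bar>\<Phi> t y * \<Psi> t y\<bar> \<le> g t"
  proof (intro exI bexI conjI ballI)
    show "min e d > 0" using g h by simp
    show "(\<lambda>t. g t * h t) \<in> w3" using w g(2) h(2) by auto
    fix y t assume "y \<in> ball x (min e d) \<inter> W" "t \<in> space M"
    then have "\<bar>\<Phi> t y\<bar> \<le> g t" "\<bar>\<Psi> t y\<bar> \<le> h t" using g h by auto
    then show "\<bar>\<Phi> t y * \<Psi> t y\<bar> \<le> g t * h t" unfolding abs_mult by (intro mult_mono) auto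
  qed
qed (use assms in \<open>auto simp: dominated_def intro!: continuous_on_mult borel_measurable_times\<close>)

text \<open>Leibniz rule with a separate weight set for each factor, so that fast times slow can be
  recorded as fast. In each summand one factor is undifferentiated and enters at the lower
  order.\<close>

lemma dom_Ck_mult:
  assumes "open W" "weight_cone w3" "\<And>f g. f \<in> w1 \<Longrightarrow> g \<in> w2 \<Longrightarrow> (\<lambda>t. f t * g t) \<in> w3"
    and "dom_Ck M w1 k W \<Phi>" "dom_Ck M w2 k W \<Psi>"
  shows "dom_Ck M w3 k W (\<lambda>t x. \<Phi> t x * \<Psi> t x)"
  using assms(4,5)
proof (induction k arbitrary: \<Phi> \<Psi>)
  case 0
  then show ?case using dominated_mult[of w1 w2 w3 M W \<Phi> \<Psi>] assms(3) by auto
next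
  case (Suc k)
  have "dom_Ck M w3 k W (\<lambda>t x. frechet_derivative (\<lambda>x. \<Phi> t x * \<Psi> t x) (at x) v)" for v
  proof (rule dom_Ck_cong[OF assms(1)])
    show "dom_Ck M w3 k W (\<lambda>t x. \<Phi> t x * frechet_derivative (\<Psi> t) (at x) v + frechet_derivative (\<Phi> t) (at x) v * \<Psi> t x)"
      using Suc.prems by (intro dom_Ck_add assms(1,2) Suc.IH dom_Ck_Suc_imp[OF Suc.prems(1)] dom_Ck_Suc_imp[OF Suc.prems(2)]) auto
    fix t x assume tx: "t \<in> space M" "x \<in> W"
    have "((\<lambda>x. \<Phi> t x * \<Psi> t x) has_derivative
        (\<lambda>v. \<Phi> t x * frechet_derivative (\<Psi> t) (at x) v + frechet_derivative (\<Phi> t) (at x) v * \<Psi> t x)) (at x)"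
      using Suc.prems tx by (intro has_derivative_mult differentiable_has_derivative) auto
    then show "\<Phi> t x * frechet_derivative (\<Psi> t) (at x) v + frechet_derivative (\<Phi> t) (at x) v * \<Psi> t x =
       frechet_derivative (\<lambda>x. \<Phi> t x * \<Psi> t x) (at x) v"
      by (simp add: frechet_derivative_eqI)
  qed
  then show ?case
    using Suc.prems dominated_mult[of w1 w2 w3 M W \<Phi> \<Psi>] assms(3) by (auto intro: differentiable_mult)
qed

lemma dom_Ck_const:
  assumes "weight_cone w" "c \<in> borel_measurable M" "g \<in> w" "\<And>t. t \<in> space M \<Longrightarrow> \<bar>c t\<bar> \<le> g t"
  shows "dom_Ck M w k W (\<lambda>t x. c t)"
  using assms(2,3,4)
proof (induction k arbitrary: c g)
  case 0
  then show ?case by (auto simp: dominated_def intro!: exI[of _ 1])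
next
  case (Suc k)
  have "dominated M w W (\<lambda>t x. c t)"
    using Suc.prems by (auto simp: dominated_def intro!: exI[of _ 1])
  moreover have "dom_Ck M w k W (\<lambda>t x. 0)"
    using Suc.IH[of "\<lambda>t. 0" "\<lambda>t. 0"] assms(1) by (auto simp: weight_cone_def)
  ultimately show ?case by simp
qed

lemma dom_Ck_zero: "weight_cone w \<Longrightarrow> dom_Ck M w k W (\<lambda>t x. 0)"
  by (rule dom_Ck_const[of w _ _ "\<lambda>t. 0"]) (auto simp: weight_cone_def)

lemma dom_Ck_scale:
  fixes M :: "'m measure"
  assumes "open W" "weight_cone w" "dom_Ck M w k W \<Phi>"
  shows "dom_Ck M w k W (\<lambda>t x. c * \<Phi> t x)"
proof -
  \<comment> \<open>The constant \<open>c\<close> is treated as a family of its own, dominated by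
    nonnegative constants; multiplying a weight by such a constant stays in
    \<open>w\<close>.\<close>
  have "weight_cone {f::'m \<Rightarrow> real. \<exists>c\<ge>0. f = (\<lambda>t. c)}"
    by (auto simp: weight_cone_def) (metis add_nonneg_nonneg, metis mult_nonneg_nonneg)
  then have c: "dom_Ck M {f. \<exists>c\<ge>0. f = (\<lambda>t. c)} k W (\<lambda>t x. c)"
    by (rule dom_Ck_const[of _ _ _ "\<lambda>t. \<bar>c\<bar>"]) (auto intro: exI[of _ "\<bar>c\<bar>"])
  show ?thesis
    by (rule dom_Ck_mult[OF assms(1,2) _ c assms(3)]) (use assms(2) in \<open>auto simp: weight_cone_def\<close>)
qed

lemma dom_Ck_sum:
  assumes "open W" "weight_cone w" "\<And>i. i \<in> A \<Longrightarrow> dom_Ck M w k W (\<Phi> i)"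
  shows "dom_Ck M w k W (\<lambda>t x. \<Sum>i\<in>A. \<Phi> i t x)"
proof (cases "finite A")
  case True
  then show ?thesis using assms(3)
    by (induction A) (auto simp: dom_Ck_zero assms(2) intro!: dom_Ck_add[OF assms(1,2)])
qed (simp add: dom_Ck_zero assms(2))

lemma linear_Basis_expand:
  fixes f :: "'a::euclidean_space \<Rightarrow> 'b::real_vector"
  assumes "linear f"
  shows "f v = (\<Sum>b\<in>Basis. (v \<bullet> b) *\<^sub>R f b)"
proof -
  have "f v = f (\<Sum>b\<in>Basis. (v \<bullet> b) *\<^sub>R b)" by (simp add: euclidean_representation)
  also have "\<dots> = (\<Sum>b\<in>Basis. (v \<bullet> b) *\<^sub>R f b)"
    using assms by (simp add: linear_sum linear_cmul)
  finally show ?thesis .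
qed

text \<open>A derivative in an arbitrary direction is a fixed combination of those along
  \<open>Basis\<close>, so only the latter have to be estimated, and the derivative may be given by
  any formula \<open>D\<close>.\<close>

lemma dom_Ck_SucI:
  assumes "open W" "weight_cone w" "dominated M w W \<Phi>"
    and D: "\<And>t x. t \<in> space M \<Longrightarrow> x \<in> W \<Longrightarrow> (\<Phi> t has_derivative D t x) (at x)"
    and "\<And>b. b \<in> Basis \<Longrightarrow> dom_Ck M w k W (\<lambda>t x. D t x b)"
  shows "dom_Ck M w (Suc k) W \<Phi>"
proof -
  have "dom_Ck M w k W (\<lambda>t x. frechet_derivative (\<Phi> t) (at x) v)" for v
  proof (rule dom_Ck_cong[OF assms(1)])
    show "dom_Ck M w k W (\<lambda>t x. \<Sum>b\<in>Basis. (v \<bullet> b) * D t x b)"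
      by (intro dom_Ck_sum dom_Ck_scale assms) auto
    fix t x assume "t \<in> space M" "x \<in> W"
    from D[OF this] have "linear (D t x)" "frechet_derivative (\<Phi> t) (at x) = D t x"
      by (auto simp: frechet_derivative_eqI dest: has_derivative_linear)
    then show "(\<Sum>b\<in>Basis. (v \<bullet> b) * D t x b) = frechet_derivative (\<Phi> t) (at x) v"
      using linear_Basis_expand[of "D t x" v] by simp
  qed
  then show ?thesis using assms(3) D by (auto simp: differentiable_def)
qed

lemma dominated_linear_compose:
  assumes "dominated M w W \<Phi>" "bounded_linear A" "A ` W' \<subseteq> W"
  shows "dominated M w W' (\<lambda>t x. \<Phi> t (A x))"
proof (rule dominatedI)
  interpret A: bounded_linear A by fact
  show "continuous_on W' (\<lambda>x. \<Phi> t (A x))" if "t \<in> space M" for t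
    by (rule continuous_on_compose2[of W "\<Phi> t"])
      (use assms that in \<open>auto simp: dominated_def intro!: A.continuous_on\<close>)
  fix x assume x: "x \<in> W'"
  obtain e g where g: "e > 0" "g \<in> w" "\<forall>y\<in>ball (A x) e \<inter> W. \<forall>t\<in>space M. \<bar>\<Phi> t y\<bar> \<le> g t"
    by (rule dominatedE[OF assms(1), of "A x"]) (use assms(3) x in auto)
  have "continuous (at x) A" by (rule A.continuous) simp
  then obtain d where d: "d > 0" "\<And>y. dist y x < d \<Longrightarrow> dist (A y) (A x) < e"
    using g(1) unfolding continuous_at_eps_delta by blast
  show "\<exists>e>0. \<exists>g\<in>w. \<forall>y\<in>ball x e \<inter> W'. \<forall>t\<in>space M. \<bar>\<Phi> t (A y)\<bar> \<le> g t"
    using d g assms(3) by (intro exI[of _ d] conjI bexI[of _ g]) (auto simp: dist_commute)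
qed (use assms in \<open>auto simp: dominated_def\<close>)

lemma dom_Ck_linear_compose:
  assumes "open W" "open W'" "bounded_linear A" "A ` W' \<subseteq> W" "dom_Ck M w k W \<Phi>"
  shows "dom_Ck M w k W' (\<lambda>t x. \<Phi> t (A x))"
  using assms(5)
proof (induction k arbitrary: \<Phi>)
  case 0
  then show ?case using dominated_linear_compose[OF _ assms(3,4)] by auto
next
  case (Suc k)
  have D: "((\<lambda>x. \<Phi> t (A x)) has_derivative (\<lambda>v. frechet_derivative (\<Phi> t) (at (A x)) (A v))) (at x)"
    if "t \<in> space M" "x \<in> W'" for t x
    using that assms Suc.prems
    by (intro has_derivative_compose[OF bounded_linear_imp_has_derivative[OF assms(3)]] differentiable_has_derivative)
       auto
  have "dom_Ck M w k W' (\<lambda>t x. frechet_derivative (\<lambda>x. \<Phi> t (A x)) (at x) v)" for v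
    by (rule dom_Ck_cong[OF assms(2) _ Suc.IH[of "\<lambda>t x. frechet_derivative (\<Phi> t) (at x) (A v)"]])
      (use Suc.prems in \<open>auto simp: frechet_derivative_eqI[OF D]\<close>)
  then show ?case
    using Suc.prems dominated_linear_compose[OF _ assms(3,4), of M w \<Phi>] by (auto intro!: differentiableI[OF D])
qed

lemma Ck_on_cong:
  assumes "open W" "\<And>x. x \<in> W \<Longrightarrow> f x = g x" "Ck_on k W f"
  shows "Ck_on k W g"
  using assms(2,3)
proof (induction k arbitrary: f g)
  case 0
  then show ?case by (simp cong: continuous_on_cong)
next
  case (Suc k)
  have "Ck_on k W (\<lambda>x. frechet_derivative g (at x) v)" for v
    by (rule Suc.IH[of "\<lambda>x. frechet_derivative f (at x) v"])
      (use Suc.prems in \<open>auto intro!: fun_cong[OF frechet_derivative_cong_open(1)[OF assms(1)]]\<close>)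
  then show ?case
    using Suc.prems frechet_derivative_cong_open(2)[OF assms(1), of _ f g] by simp
qed

lemma integrable_dominated:
  assumes "\<And>g. g \<in> w \<Longrightarrow> integrable M g" and dom: "dominated M w W \<Phi>" and x: "x \<in> W"
  shows "integrable M (\<lambda>t. \<Phi> t x)"
proof -
  obtain e g where g: "e > 0" "g \<in> w" "\<forall>y\<in>ball x e \<inter> W. \<forall>t\<in>space M. \<bar>\<Phi> t y\<bar> \<le> g t"
    by (rule dominatedE[OF dom x])
  show ?thesis
  proof (rule Bochner_Integration.integrable_bound[OF assms(1)[OF g(2)]])
    show "AE t in M. norm (\<Phi> t x) \<le> norm (g t)"
      using g(3)[rule_format, of x] g(1) x by (intro AE_I2) (auto intro: order_trans[OF _ abs_ge_self])
  qed (use dom x in \<open>auto simp: dominated_def\<close>)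
qed

text \<open>Continuity follows from the local bound by dominated convergence, differentiability from
  \<open>has_derivative_integral\<close>, with the sum of the local bounds on the basis derivatives
  as Lipschitz constant. Induction on \<open>k\<close> then differentiates the integral
  repeatedly.\<close>

lemma dom_Ck_integral:
  fixes M :: "'m measure" and W :: "'a::euclidean_space set"
  assumes "open W" "\<And>g. g \<in> w \<Longrightarrow> integrable M g" "dom_Ck M w k W \<Phi>"
  shows "Ck_on k W (\<lambda>x. \<integral>t. \<Phi> t x \<partial>M)"
    and "k > 0 \<Longrightarrow> x \<in> W \<Longrightarrow>
      ((\<lambda>x. \<integral>t. \<Phi> t x \<partial>M) has_derivative (\<lambda>v. \<integral>t. frechet_derivative (\<Phi> t) (at x) v \<partial>M)) (at x)"
proof -
  have cont: "continuous_on W (\<lambda>x. \<integral>t. \<Phi> t x \<partial>M)" if dom: "dominated M w W \<Phi>" for \<Phi>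
    unfolding continuous_on_sequentially comp_def
  proof (intro allI ballI impI)
    fix X :: "nat \<Rightarrow> 'a" and a assume a: "a \<in> W" and X: "(\<forall>n. X n \<in> W) \<and> X \<longlonglongrightarrow> a"
    obtain e g where g: "e > 0" "g \<in> w" "\<forall>y\<in>ball a e \<inter> W. \<forall>t\<in>space M. \<bar>\<Phi> t y\<bar> \<le> g t"
      by (rule dominatedE[OF dom a])
    obtain N where N: "\<And>n. n \<ge> N \<Longrightarrow> dist (X n) a < e"
      using X g(1) unfolding lim_sequentially by blast
    have XN: "(\<lambda>n. X (n + N)) \<longlonglongrightarrow> a" using X by (intro LIMSEQ_ignore_initial_segment) auto
    have "(\<lambda>n. \<integral>t. \<Phi> t (X (n + N)) \<partial>M) \<longlonglongrightarrow> (\<integral>t. \<Phi> t a \<partial>M)"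
    proof (rule integral_dominated_convergence[where w = g])
      show "AE t in M. (\<lambda>n. \<Phi> t (X (n + N))) \<longlonglongrightarrow> \<Phi> t a"
        using dom X XN a unfolding dominated_def continuous_on_sequentially comp_def
        by (intro AE_I2) auto
      show "AE t in M. norm (\<Phi> t (X (n + N))) \<le> g t" for n
        using g(3) N[of "n + N"] X by (intro AE_I2) (auto simp: dist_commute)
    qed (use dom X a g assms(2) in \<open>auto simp: dominated_def\<close>)
    then show "(\<lambda>n. \<integral>t. \<Phi> t (X n) \<partial>M) \<longlonglongrightarrow> (\<integral>t. \<Phi> t a \<partial>M)"
      by (rule LIMSEQ_offset)
  qed
  have deriv: "((\<lambda>x. \<integral>t. \<Phi> t x \<partial>M) has_derivative (\<lambda>v. \<integral>t. frechet_derivative (\<Phi> t) (at x) v \<partial>M)) (at x)"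
    if \<Phi>: "dom_Ck M w (Suc k) W \<Phi>" and x: "x \<in> W" for k \<Phi> and x :: 'a
  proof -
    have dom: "dominated M w W (\<lambda>t x. frechet_derivative (\<Phi> t) (at x) v)" for v
      using \<Phi> by (auto intro: dom_Ck_imp_dominated)
    have "\<exists>e>0. \<exists>g\<in>w. \<forall>y\<in>ball x e \<inter> W. \<forall>t\<in>space M. \<bar>frechet_derivative (\<Phi> t) (at y) v\<bar> \<le> g t" for v
      by (rule dominatedE[OF dom[of v] x]) blast
    then obtain e g where eg: "\<And>v. e v > 0" "\<And>v. g v \<in> w"
      "\<And>v y t. y \<in> ball x (e v) \<inter> W \<Longrightarrow> t \<in> space M \<Longrightarrow> \<bar>frechet_derivative (\<Phi> t) (at y) v\<bar> \<le> g v t"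
      by metis
    obtain e0 where e0: "e0 > 0" "ball x e0 \<subseteq> W" using assms(1) x open_contains_ball by blast
    \<comment> \<open>The bounds for the finitely many basis directions hold on balls of different
      radii; \<open>d\<close> is the smallest of them and also keeps the ball inside
      \<open>W\<close>.\<close>
    define d where "d = Min (insert e0 (e ` Basis))"
    have d: "d > 0" using eg(1) e0 by (simp add: d_def)
    have "d \<le> e0" and de: "\<And>b. b \<in> Basis \<Longrightarrow> d \<le> e b"
      unfolding d_def by (intro Min_le; simp)+
    note d = d this
    then have dW: "ball x d \<subseteq> W" using e0 by force
    show ?thesis
    proof (rule has_derivative_integral(2)[where e = d and g = "\<lambda>t. \<Sum>b\<in>Basis. g b t"])
      show "(\<Phi> t has_derivative frechet_derivative (\<Phi> t) (at x)) (at x)" if "t \<in> space M" for t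
        using \<Phi> that x by (intro differentiable_has_derivative) auto
      fix t y assume t: "t \<in> space M" and y: "y \<in> ball x d"
      have "norm (\<Phi> t y - \<Phi> t x) \<le> (\<Sum>b\<in>Basis. g b t) * norm (y - x)"
      proof (rule differentiable_bound[OF convex_ball[of x d]])
        fix z assume z: "z \<in> ball x d"
        have D: "(\<Phi> t has_derivative frechet_derivative (\<Phi> t) (at z)) (at z)"
          using \<Phi> t z dW by (intro differentiable_has_derivative) auto
        then show "(\<Phi> t has_derivative frechet_derivative (\<Phi> t) (at z)) (at z within ball x d)"
          by (rule has_derivative_at_withinI)
        show "onorm (frechet_derivative (\<Phi> t) (at z)) \<le> (\<Sum>b\<in>Basis. g b t)"
        proof (rule onorm_le)
          fix v
          have "norm (frechet_derivative (\<Phi> t) (at z) v) = \<bar>\<Sum>b\<in>Basis. (v \<bullet> b) * frechet_derivative (\<Phi> t) (at z) b\<bar>"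
            using linear_Basis_expand[OF has_derivative_linear[OF D], of v] by simp
          also have "\<dots> \<le> (\<Sum>b\<in>Basis. norm v * g b t)"
          proof (rule order_trans[OF sum_abs sum_mono])
            fix b :: 'a assume b: "b \<in> Basis"
            have "\<bar>frechet_derivative (\<Phi> t) (at z) b\<bar> \<le> g b t"
              using eg(3)[of z b t] z d(3)[OF b] dW t by auto
            then show "\<bar>(v \<bullet> b) * frechet_derivative (\<Phi> t) (at z) b\<bar> \<le> norm v * g b t"
              using b unfolding abs_mult by (intro mult_mono Basis_le_norm) auto
          qed
          finally show "norm (frechet_derivative (\<Phi> t) (at z) v) \<le> (\<Sum>b\<in>Basis. g b t) * norm v"
            by (simp add: sum_distrib_left mult.commute)
        qed
      qed (use y d in auto)
      then show "norm (\<Phi> t y - \<Phi> t x) \<le> (\<Sum>b\<in>Basis. g b t) * norm (y - x)" .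
    qed (use d dW \<Phi> x integrable_dominated[OF assms(2) dom_Ck_imp_dominated[OF \<Phi>] x] assms(2) eg(2) in \<open>auto simp: dominated_def\<close>)
  qed
  show "Ck_on k W (\<lambda>x. \<integral>t. \<Phi> t x \<partial>M)"
    using assms(3)
  proof (induction k arbitrary: \<Phi>)
    case 0
    then show ?case using cont by simp
  next
    case (Suc k)
    have eq: "frechet_derivative (\<lambda>x. \<integral>t. \<Phi> t x \<partial>M) (at x) = (\<lambda>v. \<integral>t. frechet_derivative (\<Phi> t) (at x) v \<partial>M)"
      if "x \<in> W" for x
      using deriv[OF Suc.prems that] by (rule frechet_derivative_eqI)
    have "Ck_on k W (\<lambda>x. frechet_derivative (\<lambda>x. \<integral>t. \<Phi> t x \<partial>M) (at x) v)" for v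
      by (rule Ck_on_cong[OF assms(1) _ Suc.IH[of "\<lambda>t x. frechet_derivative (\<Phi> t) (at x) v"]]) (use Suc.prems eq in auto)
    then show ?case using deriv[OF Suc.prems] by (auto simp: differentiable_def)
  qed
  show "((\<lambda>x. \<integral>t. \<Phi> t x \<partial>M) has_derivative (\<lambda>v. \<integral>t. frechet_derivative (\<Phi> t) (at x) v \<partial>M)) (at x)"
    if "k > 0" "x \<in> W"
    using deriv[OF _ that(2), of "k - 1" \<Phi>] assms(3) that(1) by simp
qed

section \<open>Functions of class \<open>C\<^sup>k\<close> and the implicit function theorem\<close>

lemma Ck_on_imp_continuous_on: "Ck_on k S f \<Longrightarrow> continuous_on S f"
  by (cases k) (auto intro!: continuous_at_imp_continuous_on differentiable_imp_continuous_within)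

lemma Ck_on_Suc_imp: "Ck_on (Suc k) S f \<Longrightarrow> Ck_on k S f"
proof (induction k arbitrary: f)
  case 0
  then show ?case using Ck_on_imp_continuous_on by (metis Ck_on.simps(1))
qed auto

lemma Ck_on_mono: "Ck_on k S f \<Longrightarrow> j \<le> k \<Longrightarrow> Ck_on j S f"
  by (induction k) (auto simp: le_Suc_eq dest: Ck_on_Suc_imp simp del: Ck_on.simps)

lemma Ck_on_SucD:
  "Ck_on (Suc k) S f \<Longrightarrow> Ck_on k S (\<lambda>x. frechet_derivative f (at x) v)"
  "Ck_on (Suc k) S f \<Longrightarrow> x \<in> S \<Longrightarrow> f differentiable at x"
  by simp_all

lemma Ck_on_subset: "Ck_on k S f \<Longrightarrow> T \<subseteq> S \<Longrightarrow> Ck_on k T f"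
  by (induction k arbitrary: f) (auto intro: continuous_on_subset)

text \<open>\<open>Ck_on\<close> uses derivatives at a point rather than within the set, so it may
  be checked on small neighbourhoods of the points.\<close>

lemma Ck_on_local:
  assumes "\<And>x. x \<in> W \<Longrightarrow> \<exists>A. open A \<and> x \<in> A \<and> Ck_on k A f"
  shows "Ck_on k W f"
  using assms
proof (induction k arbitrary: f)
  case 0
  show ?case unfolding Ck_on.simps
  proof (rule continuous_at_imp_continuous_on, rule ballI)
    fix x assume "x \<in> W"
    from 0[OF this] obtain A where "open A" "x \<in> A" "Ck_on 0 A f" by (elim exE conjE)
    then show "continuous (at x) f" using continuous_on_eq_continuous_at[of A f] by simp
  qed
next
  case (Suc k)
  have "f differentiable at x" if "x \<in> W" for x
  proof -
    from Suc.prems[OF that] obtain A where "x \<in> A" "Ck_on (Suc k) A f" by (elim exE conjE)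
    then show ?thesis by simp
  qed
  moreover have "Ck_on k W (\<lambda>x. frechet_derivative f (at x) v)" for v
  proof (rule Suc.IH)
    fix x assume "x \<in> W"
    from Suc.prems[OF this] obtain A where "open A" "x \<in> A" "Ck_on (Suc k) A f" by (elim exE conjE)
    then show "\<exists>A. open A \<and> x \<in> A \<and> Ck_on k A (\<lambda>x. frechet_derivative f (at x) v)"
      by (intro exI[of _ A]) simp
  qed
  ultimately show ?case by simp
qed

lemma frechet_derivative_inner:
  "f differentiable at x \<Longrightarrow> frechet_derivative (\<lambda>x. f x \<bullet> b) (at x) v = frechet_derivative f (at x) v \<bullet> b"
  by (rule fun_cong[OF frechet_derivative_eqI])
    (auto intro!: derivative_eq_intros differentiable_has_derivative)

lemma Ck_on_componentwise:
  fixes f :: "'a::euclidean_space \<Rightarrow> 'b::euclidean_space"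
  assumes "open W"
  shows "Ck_on k W f \<longleftrightarrow> (\<forall>b\<in>Basis. Ck_on k W (\<lambda>x. f x \<bullet> b))"
proof (induction k arbitrary: f)
  case 0
  then show ?case by (simp add: continuous_on_componentwise[of W f])
next
  case (Suc k)
  have diff: "f differentiable at x \<longleftrightarrow> (\<forall>b\<in>Basis. (\<lambda>x. f x \<bullet> b) differentiable at x)" for x
    by (rule differentiable_componentwise_within)
  have "Ck_on (Suc k) W f \<longleftrightarrow> (\<forall>x\<in>W. f differentiable at x) \<and>
      (\<forall>v. \<forall>b\<in>Basis. Ck_on k W (\<lambda>x. frechet_derivative f (at x) v \<bullet> b))"
    by (simp add: Suc.IH)
  also have "\<dots> \<longleftrightarrow> (\<forall>x\<in>W. f differentiable at x) \<and>
      (\<forall>v. \<forall>b\<in>Basis. Ck_on k W (\<lambda>x. frechet_derivative (\<lambda>x. f x \<bullet> b) (at x) v))"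
  proof (intro conj_cong refl all_cong1 ball_cong)
    fix v :: 'a and b :: 'b assume f: "\<forall>x\<in>W. f differentiable at x"
    show "Ck_on k W (\<lambda>x. frechet_derivative f (at x) v \<bullet> b) \<longleftrightarrow>
        Ck_on k W (\<lambda>x. frechet_derivative (\<lambda>x. f x \<bullet> b) (at x) v)"
      by (rule iffI; erule Ck_on_cong[OF assms, rotated]) (simp_all add: f frechet_derivative_inner)
  qed
  also have "\<dots> \<longleftrightarrow> (\<forall>b\<in>Basis. Ck_on (Suc k) W (\<lambda>x. f x \<bullet> b))"
    unfolding diff using nonempty_Basis by auto
  finally show ?case .
qed

lemma Ck_on_const: "Ck_on k W (\<lambda>x. c)"
  by (induction k arbitrary: c) auto

lemma Ck_on_bounded_linear:
  assumes "bounded_linear f"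
  shows "Ck_on k W f"
proof (cases k)
  case 0
  then show ?thesis by (simp add: assms linear_continuous_on)
next
  case (Suc j)
  have D: "(f has_derivative f) (at x)" for x by (rule bounded_linear_imp_has_derivative[OF assms])
  then show ?thesis using Suc by (auto simp: frechet_derivative_eqI[OF D] Ck_on_const intro!: differentiableI[OF D])
qed

text \<open>Over a one-point measure with all weights allowed, domination amounts to continuity with
  local boundedness, and continuity supplies the bound. The algebra of \<open>C\<^sup>k\<close>
  functions is thereby inherited from that of families.\<close>

lemma Ck_on_iff_dom_Ck:
  fixes f :: "'a::euclidean_space \<Rightarrow> real"
  assumes "open W"
  shows "Ck_on k W f \<longleftrightarrow> dom_Ck (count_space (UNIV::unit set)) UNIV k W (\<lambda>_. f)"
proof -
  have dom: "dominated (count_space (UNIV::unit set)) UNIV W (\<lambda>_. f)" if c: "continuous_on W f" for f :: "'a \<Rightarrow> real"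
  proof (rule dominatedI)
    fix x :: 'a assume x: "x \<in> W"
    obtain e where e: "e > 0" "\<And>y. y \<in> W \<Longrightarrow> dist y x < e \<Longrightarrow> dist (f y) (f x) < 1"
      using c x unfolding continuous_on_iff by (metis zero_less_one)
    have b: "\<bar>f y\<bar> \<le> \<bar>f x\<bar> + 1" if "y \<in> ball x e \<inter> W" for y
      using e(2)[of y] that by (auto simp: dist_commute dist_real_def)
    show "\<exists>e>0. \<exists>g\<in>UNIV. \<forall>y\<in>ball x e \<inter> W. \<forall>t\<in>space (count_space (UNIV::unit set)). \<bar>f y\<bar> \<le> g t"
      using e(1) b by (intro exI[of _ e] conjI bexI[of _ "\<lambda>_. \<bar>f x\<bar> + 1"]) auto
  qed (use c in auto)
  show ?thesis
  proof (induction k arbitrary: f)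
    case 0
    then show ?case using dom by (auto simp: dominated_def)
  next
    case (Suc k)
    show ?case
      using dom[of f] Ck_on_imp_continuous_on[of "Suc k" W f] Suc.IH
      by (auto simp del: Ck_on.simps(1) dest!: dom_Ck_imp_dominated)
  qed
qed

lemma weight_cone_UNIV: "weight_cone UNIV"
  by (simp add: weight_cone_def)

lemma
  fixes f g :: "'a::euclidean_space \<Rightarrow> real"
  assumes "open W" "Ck_on k W f"
  shows Ck_on_scale: "Ck_on k W (\<lambda>x. c * f x)"
    and Ck_on_minus: "Ck_on k W (\<lambda>x. - f x)"
    and Ck_on_add: "Ck_on k W g \<Longrightarrow> Ck_on k W (\<lambda>x. f x + g x)"
    and Ck_on_diff: "Ck_on k W g \<Longrightarrow> Ck_on k W (\<lambda>x. f x - g x)"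
    and Ck_on_mult: "Ck_on k W g \<Longrightarrow> Ck_on k W (\<lambda>x. f x * g x)"
proof -
  have scale: "Ck_on k W (\<lambda>x. c * f x)" if "Ck_on k W f" for c and f :: "'a \<Rightarrow> real"
    using that dom_Ck_scale[OF assms(1) weight_cone_UNIV] by (simp add: Ck_on_iff_dom_Ck[OF assms(1)])
  have add: "Ck_on k W (\<lambda>x. f x + g x)" if "Ck_on k W f" "Ck_on k W g" for f g :: "'a \<Rightarrow> real"
    using that dom_Ck_add[OF assms(1) weight_cone_UNIV] by (simp add: Ck_on_iff_dom_Ck[OF assms(1)])
  show "Ck_on k W (\<lambda>x. c * f x)" using scale[OF assms(2)] .
  show "Ck_on k W (\<lambda>x. f x + g x)" if "Ck_on k W g" using add[OF assms(2) that] .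
  show "Ck_on k W (\<lambda>x. - f x)" using scale[OF assms(2), of "-1"] by simp
  show "Ck_on k W (\<lambda>x. f x - g x)" if "Ck_on k W g" using add[OF assms(2) scale[OF that, of "-1"]] by simp
  show "Ck_on k W (\<lambda>x. f x * g x)" if "Ck_on k W g"
    using that assms(2) dom_Ck_mult[OF assms(1) weight_cone_UNIV, of UNIV UNIV] by (simp add: Ck_on_iff_dom_Ck[OF assms(1)])
qed

lemma Ck_on_sum:
  fixes f :: "'i \<Rightarrow> 'a::euclidean_space \<Rightarrow> real"
  assumes "open W" "\<And>i. i \<in> A \<Longrightarrow> Ck_on k W (f i)"
  shows "Ck_on k W (\<lambda>x. \<Sum>i\<in>A. f i x)"
proof (cases "finite A")
  case True
  then show ?thesis using assms(2)
    by (induction A) (auto simp: Ck_on_const intro!: Ck_on_add[OF assms(1)])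
qed (simp add: Ck_on_const)

lemma Ck_on_prod:
  fixes f :: "'i \<Rightarrow> 'a::euclidean_space \<Rightarrow> real"
  assumes "open W" "\<And>i. i \<in> A \<Longrightarrow> Ck_on k W (f i)"
  shows "Ck_on k W (\<lambda>x. \<Prod>i\<in>A. f i x)"
proof (cases "finite A")
  case True
  then show ?thesis using assms(2)
    by (induction A) (auto simp: Ck_on_const intro!: Ck_on_mult[OF assms(1)])
qed (simp add: Ck_on_const)

lemma Ck_on_det:
  fixes A :: "'a::euclidean_space \<Rightarrow> real^'n^'n"
  assumes "open W" "\<And>i j. Ck_on k W (\<lambda>x. A x $ i $ j)"
  shows "Ck_on k W (\<lambda>x. det (A x))"
  unfolding det_def by (intro Ck_on_sum[OF assms(1)] Ck_on_scale[OF assms(1)] Ck_on_prod[OF assms(1)] assms(2))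

text \<open>Bounds are global on \<open>S\<close>, because this class is meant for the outer
  function of a composition whose inner function runs along an orbit for all times
  \<open>t\<close>.\<close>

fun bdd_Ck :: "nat \<Rightarrow> 'a set \<Rightarrow> ('a::euclidean_space \<Rightarrow> real) \<Rightarrow> bool" where
  "bdd_Ck 0 S G \<longleftrightarrow> continuous_on S G \<and> (\<exists>B. \<forall>x\<in>S. \<bar>G x\<bar> \<le> B)"
| "bdd_Ck (Suc k) S G \<longleftrightarrow> bdd_Ck 0 S G \<and> (\<forall>x\<in>S. G differentiable at x) \<and>
     (\<forall>v. bdd_Ck k S (\<lambda>x. frechet_derivative G (at x) v))"

lemma dominated_compose:
  assumes "open S" "open W" "weight_cone w" "(\<lambda>t. 1) \<in> w"
    and \<gamma>: "\<And>t x. t \<in> space M \<Longrightarrow> x \<in> W \<Longrightarrow> \<gamma> t x \<in> S"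
    and "\<And>b. b \<in> Basis \<Longrightarrow> dominated M w' W (\<lambda>t x. \<gamma> t x \<bullet> b)" and G: "bdd_Ck 0 S G"
  shows "dominated M w W (\<lambda>t x. G (\<gamma> t x))"
proof (rule dominatedI)
  obtain B where B: "\<forall>x\<in>S. \<bar>G x\<bar> \<le> B" using G by auto
  show "continuous_on W (\<lambda>x. G (\<gamma> t x))" if "t \<in> space M" for t
  proof (rule continuous_on_compose2[of S G])
    show "continuous_on W (\<gamma> t)"
      unfolding continuous_on_componentwise[of W "\<gamma> t"] using assms(6) that by (auto simp: dominated_def)
  qed (use G \<gamma> that in auto)
  fix x assume x: "x \<in> W"
  have "(\<lambda>t. \<gamma> t x) \<in> borel_measurable M"
    unfolding borel_measurable_euclidean_space[of "\<lambda>t. \<gamma> t x"] using assms(6) x by (auto simp: dominated_def)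
  \<comment> \<open>\<open>G\<close> is continuous only on \<open>S\<close>, so measurability of the
    composition passes through the restricted Borel space.\<close>
  then have "(\<lambda>t. \<gamma> t x) \<in> measurable M (restrict_space borel S)"
    using \<gamma> x by (intro measurable_restrict_space2) auto
  moreover have "G \<in> borel_measurable (restrict_space borel S)"
    using G by (intro borel_measurable_continuous_on_restrict) auto
  ultimately show "(\<lambda>t. G (\<gamma> t x)) \<in> borel_measurable M"
    by (rule measurable_compose)
  have "\<forall>f\<in>w. \<forall>c\<ge>0. (\<lambda>t. c * f t) \<in> w" using assms(3) unfolding weight_cone_def by (elim conjE)
  from this[rule_format, OF assms(4), of "\<bar>B\<bar>"] have "(\<lambda>t. \<bar>B\<bar> * 1) \<in> w" by simp
  then show "\<exists>e>0. \<exists>g\<in>w. \<forall>y\<in>ball x e \<inter> W. \<forall>t\<in>space M. \<bar>G (\<gamma> t y)\<bar> \<le> g t"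
    using B \<gamma> by (intro exI[of _ 1] conjI bexI[of _ "\<lambda>t. \<bar>B\<bar> * 1"]) (auto intro: order_trans[OF _ abs_ge_self])
qed

text \<open>By the chain rule a derivative is a sum of products of a derivative of \<gamma> with a
  bounded function evaluated along \<gamma>, which is a composition of the same kind. Iteration
  multiplies derivatives of \<gamma>, so \<open>w\<close> has to be closed under products; the
  constant 1 accounts for the bounded factor.\<close>

lemma dom_Ck_compose:
  fixes \<gamma> :: "'m \<Rightarrow> 'a::euclidean_space \<Rightarrow> 'c::euclidean_space" and M :: "'m measure"
  assumes "open S" "open W" "weight_cone w" "(\<lambda>t. 1) \<in> w" "\<And>f g. f \<in> w \<Longrightarrow> g \<in> w \<Longrightarrow> (\<lambda>t. f t * g t) \<in> w"
    and \<gamma>: "\<And>t x. t \<in> space M \<Longrightarrow> x \<in> W \<Longrightarrow> \<gamma> t x \<in> S"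
    and "\<And>b. b \<in> Basis \<Longrightarrow> dom_Ck M w k W (\<lambda>t x. \<gamma> t x \<bullet> b)" and "bdd_Ck k S G"
  shows "dom_Ck M w k W (\<lambda>t x. G (\<gamma> t x))"
  using assms(7,8)
proof (induction k arbitrary: G)
  case 0
  then show ?case using dominated_compose[OF assms(1-4), where M = M and \<gamma> = \<gamma> and w' = w and G = G] \<gamma> by (simp del: bdd_Ck.simps)
next
  case (Suc k)
  have dom: "dominated M w W (\<lambda>t x. G (\<gamma> t x))"
    using Suc.prems 
    by (intro dominated_compose[OF assms(1-4), where M = M and \<gamma> = \<gamma> and w' = w and G = G]) (auto intro: dom_Ck_imp_dominated simp: \<gamma>)
  show ?case
  proof (rule dom_Ck_SucI[OF assms(2,3) dom])
    fix t x assume t: "t \<in> space M" and x: "x \<in> W"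
    have "(\<gamma> t has_derivative (\<lambda>v. \<Sum>b\<in>Basis. frechet_derivative (\<lambda>x. \<gamma> t x \<bullet> b) (at x) v *\<^sub>R b)) (at x)"
      unfolding has_derivative_componentwise_within[of "\<gamma> t"]
      using Suc.prems(1) t x by (auto simp: inner_sum_left_Basis intro!: differentiable_has_derivative)
    moreover have DG: "(G has_derivative frechet_derivative G (at (\<gamma> t x))) (at (\<gamma> t x))"
      using Suc.prems(2) \<gamma> t x by (intro differentiable_has_derivative) auto
    ultimately have "((\<lambda>x. G (\<gamma> t x)) has_derivative
      (\<lambda>v. frechet_derivative G (at (\<gamma> t x)) (\<Sum>b\<in>Basis. frechet_derivative (\<lambda>x. \<gamma> t x \<bullet> b) (at x) v *\<^sub>R b))) (at x)"
      by (rule has_derivative_compose)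
    then show "((\<lambda>x. G (\<gamma> t x)) has_derivative
      (\<lambda>v. \<Sum>b\<in>Basis. frechet_derivative (\<lambda>x. \<gamma> t x \<bullet> b) (at x) v * frechet_derivative G (at (\<gamma> t x)) b)) (at x)"
      using has_derivative_linear[OF DG] by (simp add: linear_sum linear_cmul)
  next
    fix v :: 'a assume "v \<in> Basis"
    show "dom_Ck M w k W (\<lambda>t x. \<Sum>b\<in>Basis. frechet_derivative (\<lambda>x. \<gamma> t x \<bullet> b) (at x) v * frechet_derivative G (at (\<gamma> t x)) b)"
    proof (intro dom_Ck_sum assms(2,3))
      fix b :: 'c assume b: "b \<in> Basis"
      have "dom_Ck M w k W (\<lambda>t x. frechet_derivative G (at (\<gamma> t x)) b)"
        using Suc.prems by (intro Suc.IH[of "\<lambda>z. frechet_derivative G (at z) b"] dom_Ck_Suc_imp[OF Suc.prems(1)]) auto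
      then show "dom_Ck M w k W (\<lambda>t x. frechet_derivative (\<lambda>x. \<gamma> t x \<bullet> b) (at x) v * frechet_derivative G (at (\<gamma> t x)) b)"
        using Suc.prems b by (intro dom_Ck_mult[OF assms(2,3,5)]) auto
    qed
  qed
qed

lemma Ck_on_imp_bdd_Ck:
  fixes f :: "'a::euclidean_space \<Rightarrow> real"
  assumes "Ck_on k S f" "compact K" "K \<subseteq> S" "A \<subseteq> K"
  shows "bdd_Ck k A f"
proof -
  have *: "bdd_Ck 0 A f" if "continuous_on S f" for f :: "'a \<Rightarrow> real"
  proof -
    have "compact (f ` K)"
      using that assms by (intro compact_continuous_image) (auto intro: continuous_on_subset)
    then obtain B where "\<forall>x\<in>f ` K. norm x \<le> B" using compact_imp_bounded bounded_iff by blast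
    then show ?thesis using assms that by (auto intro: continuous_on_subset)
  qed
  show ?thesis
    using assms(1)
  proof (induction k arbitrary: f)
    case 0
    then show ?case using *[of f] by simp
  next
    case (Suc k)
    have "bdd_Ck 0 A f" by (rule *) (rule Ck_on_imp_continuous_on[OF Suc.prems])
    moreover have "A \<subseteq> S" using assms by blast
    ultimately show ?case using Suc by (auto simp del: bdd_Ck.simps(1))
  qed
qed

text \<open>Near a point the inner function stays in a compact ball, on which the outer one has
  bounded derivatives; the composition rule for families then applies over a one-point
  measure.\<close>

lemma Ck_on_compose:
  fixes f :: "'b::euclidean_space \<Rightarrow> real" and g :: "'a::euclidean_space \<Rightarrow> 'b"
  assumes "open S" "open W" "Ck_on k S f" "Ck_on k W g" "g ` W \<subseteq> S"
  shows "Ck_on k W (\<lambda>x. f (g x))"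
proof (rule Ck_on_local)
  fix x assume x: "x \<in> W"
  obtain e where e: "e > 0" "cball (g x) e \<subseteq> S"
    using assms(1,5) x open_contains_cball by blast
  define W' where "W' = W \<inter> g -` ball (g x) e"
  have W': "open W'" unfolding W'_def
    using Ck_on_imp_continuous_on[OF assms(4)] assms(2) by (simp add: continuous_on_open_vimage Int_commute)
  have xW': "x \<in> W'" and sub: "W' \<subseteq> W" using x e by (auto simp: W'_def)
  have "bdd_Ck k (ball (g x) e) f"
    by (rule Ck_on_imp_bdd_Ck[OF assms(3) compact_cball e(2)]) auto
  moreover have "dom_Ck (count_space (UNIV::unit set)) UNIV k W' (\<lambda>_ x. g x \<bullet> b)" if "b \<in> Basis" for b
    using Ck_on_subset[OF assms(4) sub] that
    unfolding Ck_on_iff_dom_Ck[OF W', symmetric] by (subst (asm) Ck_on_componentwise[OF W']) auto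
  ultimately have "dom_Ck (count_space (UNIV::unit set)) UNIV k W' (\<lambda>_ x. f (g x))"
    by (intro dom_Ck_compose[OF open_ball W' weight_cone_UNIV, of _ "\<lambda>_. g" "g x" e k f]) (auto simp: W'_def)
  then have "Ck_on k W' (\<lambda>x. f (g x))"
    by (simp add: Ck_on_iff_dom_Ck[OF W'])
  then show "\<exists>A. open A \<and> x \<in> A \<and> Ck_on k A (\<lambda>x. f (g x))" using W' xW' by blast
qed

lemma Ck_on_inverse: "Ck_on k (- {0::real}) inverse"
proof (induction k)
  case 0
  then show ?case by (auto intro!: continuous_intros)
next
  case (Suc k)
  have D: "(inverse has_derivative (\<lambda>v::real. - (inverse x * v * inverse x))) (at x)" if "x \<noteq> 0" for x :: real
    using that by (auto intro!: derivative_eq_intros)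
  have "Ck_on k (- {0::real}) (\<lambda>x. frechet_derivative inverse (at x) v)" for v
  proof (rule Ck_on_cong)
    show "Ck_on k (- {0::real}) (\<lambda>x. - ((inverse x * v) * inverse x))"
      by (rule Ck_on_minus[OF _ Ck_on_mult[OF _ Ck_on_mult[OF _ Suc.IH Ck_on_const] Suc.IH]]) auto
  qed (auto simp: frechet_derivative_eqI[OF D])
  then show ?case using D by (auto simp: differentiable_def)
qed

lemma Ck_on_divide:
  fixes f g :: "'a::euclidean_space \<Rightarrow> real"
  assumes "open W" "Ck_on k W f" "Ck_on k W g" "\<And>x. x \<in> W \<Longrightarrow> g x \<noteq> 0"
  shows "Ck_on k W (\<lambda>x. f x / g x)"
  unfolding divide_inverse
  by (rule Ck_on_mult[OF assms(1,2) Ck_on_compose[OF _ assms(1) Ck_on_inverse assms(3)]]) (use assms(4) in auto)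

lemma Ck_on_vec_iff:
  fixes f :: "'a::euclidean_space \<Rightarrow> real^'n"
  assumes "open W"
  shows "Ck_on k W f \<longleftrightarrow> (\<forall>i. Ck_on k W (\<lambda>x. f x $ i))"
  unfolding Ck_on_componentwise[OF assms, of k f] by (auto simp: Basis_vec_def inner_axis)

lemma Ck_on_Pair:
  fixes f :: "'a::euclidean_space \<Rightarrow> 'b::euclidean_space" and g :: "'a \<Rightarrow> 'c::euclidean_space"
  assumes "open W" "Ck_on k W f" "Ck_on k W g"
  shows "Ck_on k W (\<lambda>x. (f x, g x))"
  using assms(2,3) unfolding Ck_on_componentwise[OF assms(1), of k f]
    Ck_on_componentwise[OF assms(1), of k g] Ck_on_componentwise[OF assms(1), of k "\<lambda>x. (f x, g x)"]
  by (auto simp: Basis_prod_def)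

section \<open>Implicit functions\<close>

lemma linear_on_fst_expand:
  fixes D :: "(real^'n) \<times> 'y::real_vector \<Rightarrow> real"
  assumes "linear D"
  shows "D (u, 0) = (\<Sum>j\<in>UNIV. D (axis j 1, 0) * u $ j)"
proof -
  have "(\<Sum>j\<in>UNIV. (u $ j) *\<^sub>R (axis j 1, 0::'y)) = (\<Sum>j\<in>UNIV. (u $ j *s axis j 1, 0))"
    by (simp add: scalar_mult_eq_scaleR)
  also have "\<dots> = (\<Sum>j\<in>UNIV. u $ j *s axis j 1, 0)"
    by (simp add: sum_prod)
  finally have "D (u, 0) = D (\<Sum>j\<in>UNIV. (u $ j) *\<^sub>R (axis j 1, 0::'y))"
    by (simp only: basis_expansion)
  then show ?thesis
    by (simp only: linear_sum[OF assms] linear_cmul[OF assms] real_scaleR_def mult.commute)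
qed

text \<open>Bootstrapping: differentiating \<open>G i (T y, y) = 0\<close> gives a linear system for
  the derivative of \<open>T\<close>, and Cramer's rule writes the solution as a quotient of
  determinants whose entries are as smooth as \<open>T\<close> is already known to be. Each round
  gains one order until that of \<open>G\<close> is reached.\<close>

lemma implicit_function_Ck:
  fixes G :: "'n::finite \<Rightarrow> (real^'n) \<times> 'y::euclidean_space \<Rightarrow> real" and T :: "'y \<Rightarrow> real^'n"
  assumes \<Omega>: "open \<Omega>" and V: "open V" and G: "\<And>i. Ck_on k \<Omega> (G i)"
    and in_\<Omega>: "\<And>y. y \<in> V \<Longrightarrow> (T y, y) \<in> \<Omega>"
    and zero: "\<And>i y. y \<in> V \<Longrightarrow> G i (T y, y) = 0"
    and det: "\<And>y. y \<in> V \<Longrightarrow> det (\<chi> i j. frechet_derivative (G i) (at (T y, y)) (axis j 1, 0)) \<noteq> 0"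
    and T: "\<And>y. y \<in> V \<Longrightarrow> T differentiable at y"
  shows "Ck_on k V T"
proof -
  have "Ck_on j V T" if "j \<le> k" for j
    using that
  proof (induction j)
    case 0
    show ?case
      using T by (auto intro!: continuous_at_imp_continuous_on differentiable_imp_continuous_within)
  next
    case (Suc j)
    obtain m where m: "k = Suc m" "j \<le> m" using Suc.prems by (cases k) auto
    have Gdiff: "G i differentiable at z" if "z \<in> \<Omega>" for i z
      using G[of i] that m by simp
    define g where "g = (\<lambda>y. (T y, y))"
    have TC: "Ck_on j V T" using Suc by simp
    have gC: "Ck_on j V g"
      unfolding g_def by (intro Ck_on_Pair V TC Ck_on_bounded_linear bounded_linear_ident)
    have entry: "Ck_on j V (\<lambda>y. frechet_derivative (G i) (at (g y)) w)" for i w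
    proof (rule Ck_on_compose[OF \<Omega> V _ gC])
      have "Ck_on m \<Omega> (\<lambda>z. frechet_derivative (G i) (at z) w)"
        by (rule Ck_on_SucD) (use G[of i] m in simp)
      then show "Ck_on j \<Omega> (\<lambda>z. frechet_derivative (G i) (at z) w)" using m Ck_on_mono by blast
    qed (use in_\<Omega> in \<open>auto simp: g_def\<close>)
    define A where "A = (\<lambda>y. \<chi> i j. frechet_derivative (G i) (at (g y)) (axis j 1, 0))"
    \<comment> \<open>The column that Cramer's rule replaces carries the derivative of
      \<open>G\<close> in its second variable, the others those in the first.\<close>
    have formula: "frechet_derivative T (at y) v $ l =
        det (\<chi> i j. if j = l then - frechet_derivative (G i) (at (g y)) (0, v) else A y $ i $ j) / det (A y)"
      if y: "y \<in> V" for y v l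
    proof -
      let ?u = "frechet_derivative T (at y) v"
      have eq: "A y *v ?u = (\<chi> i. - frechet_derivative (G i) (at (g y)) (0, v))"
      proof (rule vec_eq_iff[THEN iffD2], rule allI)
        fix i
        have DT: "(T has_derivative frechet_derivative T (at y)) (at y)"
          using T[OF y] by (rule differentiable_has_derivative)
        have DG: "(G i has_derivative frechet_derivative (G i) (at (g y))) (at (g y))"
          using Gdiff in_\<Omega>[OF y] by (intro differentiable_has_derivative) (simp add: g_def)
        have lin: "linear (frechet_derivative (G i) (at (g y)))" using DG by (rule has_derivative_linear)
        have "(g has_derivative (\<lambda>v. (frechet_derivative T (at y) v, v))) (at y)"
          unfolding g_def by (intro has_derivative_Pair DT has_derivative_ident)
        then have "((\<lambda>y. G i (g y)) has_derivative
            (\<lambda>v. frechet_derivative (G i) (at (g y)) (frechet_derivative T (at y) v, v))) (at y)"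
          using DG by (rule has_derivative_compose)
        moreover have "((\<lambda>y. G i (g y)) has_derivative (\<lambda>v. 0)) (at y)"
          by (rule has_derivative_transform_within_open[OF has_derivative_const[of 0] V y]) (simp add: g_def zero)
        ultimately have "frechet_derivative (G i) (at (g y)) (?u, v) = 0"
          using has_derivative_unique by (metis (no_types, lifting))
        moreover have "frechet_derivative (G i) (at (g y)) (?u, v) =
            frechet_derivative (G i) (at (g y)) (?u, 0) + frechet_derivative (G i) (at (g y)) (0, v)"
          using linear_add[OF lin, of "(?u, 0)" "(0, v)"] by simp
        ultimately have "(\<Sum>j\<in>UNIV. frechet_derivative (G i) (at (g y)) (axis j 1, 0) * ?u $ j)
            = - frechet_derivative (G i) (at (g y)) (0, v)"
          using linear_on_fst_expand[OF lin, of ?u] by linarith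
        then show "(A y *v ?u) $ i = (\<chi> i. - frechet_derivative (G i) (at (g y)) (0, v)) $ i"
          by (simp add: A_def matrix_vector_mult_def)
      qed
      have "det (A y) \<noteq> 0" using det[OF y] by (simp add: A_def g_def)
      from arg_cong[OF iffD1[OF cramer[OF this] eq], of "\<lambda>x. x $ l"] show ?thesis
        by (simp only: vec_lambda_beta)
    qed
    have "Ck_on j V (\<lambda>y. frechet_derivative T (at y) v)" for v
      unfolding Ck_on_vec_iff[OF V]
    proof
      fix l
      show "Ck_on j V (\<lambda>y. frechet_derivative T (at y) v $ l)"
      proof (rule Ck_on_cong[OF V])
        have e: "Ck_on j V (\<lambda>y. (\<chi> i j. if j = l then - frechet_derivative (G i) (at (g y)) (0, v) else A y $ i $ j) $ i $ j')" for i j'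
          using entry Ck_on_minus[OF V entry] by (cases "j' = l") (simp_all add: A_def)
        show "Ck_on j V (\<lambda>y. det (\<chi> i j. if j = l then - frechet_derivative (G i) (at (g y)) (0, v) else A y $ i $ j) / det (A y))"
          by (intro Ck_on_divide[OF V] Ck_on_det[OF V] e) (use entry det in \<open>auto simp: A_def g_def\<close>)
      qed (simp add: formula)
    qed
    then show ?case using T by simp
  qed
  then show ?thesis by simp
qed

text \<open>The inverse function theorem for the map \<open>f z = (G z, snd z)\<close>. Its inverse
  keeps the second component, so the first component of the inverse at \<open>(0, y)\<close> is the
  implicit function.\<close>

lemma implicit_function_exists:
  fixes G :: "'n::finite \<Rightarrow> (real^'n) \<times> 'y::euclidean_space \<Rightarrow> real"
  assumes \<Omega>: "open \<Omega>" "(a, y0) \<in> \<Omega>" and G: "\<And>i. Ck_on 1 \<Omega> (G i)" and zero: "\<And>i. G i (a, y0) = 0"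
    and det: "det (\<chi> i j. frechet_derivative (G i) (at (a, y0)) (axis j 1, 0)) \<noteq> 0"
  obtains V T where "open V" "y0 \<in> V" "T y0 = a" "\<And>y. y \<in> V \<Longrightarrow> (T y, y) \<in> \<Omega>"
    "\<And>y i. y \<in> V \<Longrightarrow> G i (T y, y) = 0" "\<And>y. y \<in> V \<Longrightarrow> T differentiable at y"
    "\<And>y. y \<in> V \<Longrightarrow> det (\<chi> i j. frechet_derivative (G i) (at (T y, y)) (axis j 1, 0)) \<noteq> 0"
proof -
  let ?D = "\<lambda>i z. frechet_derivative (G i) (at z)"
  let ?A = "\<lambda>z. \<chi> i j. ?D i z (axis j 1, 0)"
  have DG: "(G i has_derivative ?D i z) (at z)" if "z \<in> \<Omega>" for i z
    using G[of i] that by (intro differentiable_has_derivative) simp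
  have entry: "continuous_on \<Omega> (\<lambda>z. ?D i z w)" for i w
    using Ck_on_SucD(1)[of 0, OF G[of i, unfolded One_nat_def]] by simp
  \<comment> \<open>Restricting to the open set where the determinant is nonzero yields
    nondegeneracy along the whole graph of \<open>T\<close>, not only at the starting point.\<close>
  define U where "U = {z \<in> \<Omega>. det (?A z) \<noteq> 0}"
  have "continuous_on \<Omega> (\<lambda>z. det (?A z))"
    unfolding det_def by (simp, intro continuous_intros entry)
  from continuous_open_preimage[OF this \<Omega>(1), of "- {0}"]
  have "open (\<Omega> \<inter> (\<lambda>z. det (?A z)) -` (- {0}))" by (simp only: open_Compl closed_singleton)
  also have "\<Omega> \<inter> (\<lambda>z. det (?A z)) -` (- {0}) = U" unfolding U_def by blast
  finally have "open U" .
  have U\<Omega>: "U \<subseteq> \<Omega>" and z0U: "(a, y0) \<in> U" using \<Omega> det by (auto simp: U_def)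
  define f where "f = (\<lambda>z::(real^'n) \<times> 'y. ((\<chi> i. G i z) :: real^'n, snd z))"
  define f' where "f' = (\<lambda>z w. ((\<chi> i. ?D i z w) :: real^'n, snd w))"
  have Df: "(f has_derivative f' z) (at z)" if "z \<in> U" for z
    unfolding f_def f'_def
  proof (intro has_derivative_Pair has_derivative_snd has_derivative_ident)
    show "((\<lambda>z. \<chi> i. G i z) has_derivative (\<lambda>w. \<chi> i. ?D i z w)) (at z)"
      unfolding has_derivative_componentwise_within[of "\<lambda>z. \<chi> i. G i z"]
      using DG[OF subsetD[OF U\<Omega> that]] by (auto simp: Basis_vec_def inner_axis)
  qed
  have bl: "bounded_linear (f' z)" if "z \<in> U" for z
    using Df[OF that] by (rule has_derivative_bounded_linear)
  define F' where "F' = (\<lambda>z. Blinfun (f' z))"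
  have F'[simp]: "blinfun_apply (F' z) = f' z" if "z \<in> U" for z
    unfolding F'_def by (rule bounded_linear_Blinfun_apply[OF bl[OF that]])
  \<comment> \<open>A kernel vector has second component 0, and the invertible matrix then forces
    its first component to vanish. Injectivity provides the left inverse that the inverse function
    theorem asks for.\<close>
  have "inj (f' (a, y0))"
    unfolding linear_injective_0[OF bounded_linear.linear[OF bl[OF z0U]]]
  proof (intro allI impI)
    fix w assume w: "f' (a, y0) w = 0"
    obtain u where w2: "w = (u, 0)" using w by (cases w) (simp add: f'_def zero_prod_def)
    have lin: "linear (?D i (a, y0))" for i using DG[OF \<Omega>(2)] by (rule has_derivative_linear)
    have "?D i (a, y0) w = (?A (a, y0) *v u) $ i" for i
      using linear_on_fst_expand[OF lin, of i u] w2 by (simp add: matrix_vector_mult_def)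
    moreover have "?D i (a, y0) w = 0" for i
      using w by (simp add: f'_def zero_prod_def vec_eq_iff)
    ultimately have "?A (a, y0) *v u = 0" by (simp add: vec_eq_iff)
    moreover have "\<exists>B. B ** ?A (a, y0) = mat 1"
      using det unfolding invertible_det_nz[of "?A (a, y0)", symmetric] invertible_left_inverse .
    ultimately have "u = 0" by (simp only: matrix_left_invertible_ker)
    then show "w = 0" using w2 by (simp add: zero_prod_def)
  qed
  then obtain g0 where g0: "linear g0" "g0 \<circ> f' (a, y0) = id"
    using linear_injective_left_inverse bounded_linear.linear[OF bl[OF z0U]] by blast
  have bl0: "bounded_linear g0" using g0(1) by (simp add: linear_conv_bounded_linear)
  have inv: "Blinfun g0 o\<^sub>L F' (a, y0) = id_blinfun"
    by (rule blinfun_eqI) (use g0(2) z0U in \<open>simp add: bounded_linear_Blinfun_apply[OF bl0] pointfree_idE\<close>)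
  have cont: "continuous_on U F'"
  proof (rule continuous_on_blinfun_componentwise)
    fix w :: "(real^'n) \<times> 'y"
    have "continuous_on U (\<lambda>z. f' z w)"
      unfolding f'_def by (intro continuous_intros continuous_on_vec_lambda continuous_on_subset[OF entry U\<Omega>])
    then show "continuous_on U (\<lambda>z. blinfun_apply (F' z) w)" by (simp cong: continuous_on_cong)
  qed
  obtain U' V0 g g' where UV: "open U'" "U' \<subseteq> U" "(a, y0) \<in> U'" "open V0" "f (a, y0) \<in> V0"
    "homeomorphism U' V0 f g" "\<And>y. y \<in> V0 \<Longrightarrow> (g has_derivative (g' y)) (at y)"
  proof (rule inverse_function_theorem[OF \<open>open U\<close> _ cont z0U inv])
    show "(f has_derivative blinfun_apply (F' z)) (at z)" if "z \<in> U" for z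
      using Df[OF that] that by simp
  qed blast
  define V where "V = {y. (0, y) \<in> V0}"
  define T where "T = (\<lambda>y. fst (g (0, y)))"
  have key: "g (0, y) = (T y, y)" "(T y, y) \<in> U" "G i (T y, y) = 0" if "y \<in> V" for y i
  proof -
    have fg: "f (g (0, y)) = (0, y)" and gU: "g (0, y) \<in> U'"
      using UV(6) that unfolding homeomorphism_def V_def by auto
    then have "snd (g (0, y)) = y" and G0: "G i (g (0, y)) = 0" for i
      by (auto simp: f_def vec_eq_iff)
    then show 1: "g (0, y) = (T y, y)" by (simp add: T_def prod_eq_iff)
    show "(T y, y) \<in> U" "G i (T y, y) = 0" using gU UV(2) G0 by (auto simp: 1)
  qed
  show ?thesis
  proof (rule that[of V T])
    show "open V"
    proof -
      have "V = (\<lambda>y. (0, y)) -` V0" by (auto simp: V_def)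
      then show ?thesis using UV(4) by (auto intro!: open_vimage continuous_intros)
    qed
    have f0: "f (a, y0) = (0, y0)" by (simp add: f_def zero vec_eq_iff)
    then show "y0 \<in> V" using UV(5) by (simp add: V_def)
    show "T y0 = a" using UV(3,6) f0 unfolding homeomorphism_def T_def by (metis fst_conv)
    fix y assume y: "y \<in> V"
    show "(T y, y) \<in> \<Omega>" "G i (T y, y) = 0" "det (?A (T y, y)) \<noteq> 0" for i
      using key[OF y] by (auto simp: U_def)
    have "((\<lambda>y. g (0, y)) has_derivative (\<lambda>v. g' (0, y) (0, v))) (at y)"
      by (rule has_derivative_compose[of "\<lambda>y. (0, y)" "\<lambda>v. (0, v)"])
        (use UV(7) y in \<open>auto simp: V_def intro!: derivative_eq_intros\<close>)
    then show "T differentiable at y"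
      unfolding T_def by (auto intro!: differentiableI has_derivative_fst)
  qed
qed

section \<open>Real analytic functions\<close>

text \<open>A power series is an integral over multi-indices with respect to counting measure. A
  derivative multiplies the coefficient by at most 2 to the power of the total degree, and this loss
  is paid for by halving the radius, whence \<delta> = \<rho> / 2 ^ K. The exponents
  \<open>\<alpha> b - \<beta> b\<close> are truncated at 0; this is consistent, since a derivative
  that would lower an exponent 0 carries the coefficient 0.\<close>

lemma dom_Ck_shifted_monomials:
  fixes c d :: "('a::euclidean_space \<Rightarrow> nat) \<Rightarrow> real" and \<beta> :: "'a \<Rightarrow> nat" and x :: 'a
  assumes M_def: "M = count_space A" and \<rho>: "0 < \<rho>" "\<rho> \<le> 1" and \<delta>: "\<delta> = \<rho> / 2 ^ K"
    and c: "integrable M (\<lambda>\<alpha>. \<bar>c \<alpha>\<bar> * \<rho> ^ (\<Sum>b\<in>Basis. \<alpha> b))"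
    and "\<And>\<alpha>. \<bar>d \<alpha>\<bar> \<le> \<bar>c \<alpha>\<bar> * 2 ^ (m * (\<Sum>b\<in>Basis. \<alpha> b))" and "m + k \<le> K"
  shows "dom_Ck M {g. integrable M g} k (ball x \<delta>) (\<lambda>\<alpha> y. d \<alpha> * (\<Prod>b\<in>Basis. ((y - x) \<bullet> b) ^ (\<alpha> b - \<beta> b)))"
  using assms(6,7)
proof (induction k arbitrary: d m \<beta>)
  have \<delta>01: "0 < \<delta>" "\<delta> \<le> 1"
    using \<rho> \<delta> by (auto simp: divide_le_eq intro: order_trans[OF _ one_le_power])
  have w: "weight_cone {g. integrable M g}"
    by (auto simp: weight_cone_def)
  have dom: "dominated M {g. integrable M g} (ball x \<delta>) (\<lambda>\<alpha> y. d \<alpha> * (\<Prod>b\<in>Basis. ((y - x) \<bullet> b) ^ (\<alpha> b - \<beta> b)))"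
    if d: "\<And>\<alpha>. \<bar>d \<alpha>\<bar> \<le> \<bar>c \<alpha>\<bar> * 2 ^ (m * (\<Sum>b\<in>Basis. \<alpha> b))" and m: "m \<le> K" for d m and \<beta> :: "'a \<Rightarrow> nat"
  proof (rule dominatedI)
    let ?g = "\<lambda>\<alpha>. (\<bar>c \<alpha>\<bar> * \<rho> ^ (\<Sum>b\<in>Basis. \<alpha> b)) * (1 / (\<Prod>b\<in>Basis. \<delta> ^ \<beta> b))"
    have "\<bar>d \<alpha> * (\<Prod>b\<in>Basis. ((y - x) \<bullet> b) ^ (\<alpha> b - \<beta> b))\<bar> \<le> ?g \<alpha>" if y: "y \<in> ball x \<delta>" for y \<alpha>
    proof -
      let ?N = "\<Sum>b\<in>Basis. \<alpha> b"
      have "\<bar>\<Prod>b\<in>Basis. ((y - x) \<bullet> b) ^ (\<alpha> b - \<beta> b)\<bar> = (\<Prod>b\<in>Basis. \<bar>(y - x) \<bullet> b\<bar> ^ (\<alpha> b - \<beta> b))"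
        by (simp add: abs_prod power_abs)
      also have "\<dots> \<le> (\<Prod>b\<in>Basis. \<delta> ^ (\<alpha> b - \<beta> b))"
      proof (intro prod_mono conjI power_mono)
        fix b :: 'a assume "b \<in> Basis"
        then have "\<bar>(y - x) \<bullet> b\<bar> \<le> norm (y - x)" by (rule Basis_le_norm)
        also have "\<dots> \<le> \<delta>" using y by (simp add: dist_norm norm_minus_commute)
        finally show "\<bar>(y - x) \<bullet> b\<bar> \<le> \<delta>" .
      qed auto
      also have "\<dots> \<le> (\<Prod>b\<in>Basis. \<delta> ^ \<alpha> b / \<delta> ^ \<beta> b)"
      proof (intro prod_mono conjI)
        fix b :: 'a
        \<comment> \<open>Truncation can only raise the total exponent on the left, so the
          inequality rests on \<delta> \<le> 1.\<close>
        have "\<delta> ^ (\<alpha> b - \<beta> b) * \<delta> ^ \<beta> b \<le> \<delta> ^ \<alpha> b"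
          unfolding power_add[symmetric] using \<delta>01 by (intro power_decreasing) auto
        then show "\<delta> ^ (\<alpha> b - \<beta> b) \<le> \<delta> ^ \<alpha> b / \<delta> ^ \<beta> b" using \<delta>01 by (simp add: pos_le_divide_eq)
      qed (use \<delta>01 in auto)
      also have "\<dots> = \<delta> ^ ?N / (\<Prod>b\<in>Basis. \<delta> ^ \<beta> b)"
        by (simp add: prod_dividef power_sum)
      finally have P: "\<bar>\<Prod>b\<in>Basis. ((y - x) \<bullet> b) ^ (\<alpha> b - \<beta> b)\<bar> \<le> \<delta> ^ ?N / (\<Prod>b\<in>Basis. \<delta> ^ \<beta> b)" .
      have "\<bar>d \<alpha> * (\<Prod>b\<in>Basis. ((y - x) \<bullet> b) ^ (\<alpha> b - \<beta> b))\<bar>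
          \<le> (\<bar>c \<alpha>\<bar> * 2 ^ (m * ?N)) * (\<delta> ^ ?N / (\<Prod>b\<in>Basis. \<delta> ^ \<beta> b))"
        unfolding abs_mult by (intro mult_mono d P) auto
      also have "\<dots> = \<bar>c \<alpha>\<bar> * (2 ^ (m * ?N) * \<delta> ^ ?N) * (1 / (\<Prod>b\<in>Basis. \<delta> ^ \<beta> b))" by simp
      also have "\<dots> \<le> ?g \<alpha>"
      proof (intro mult_right_mono mult_left_mono)
        have "2 ^ (m * ?N) * \<delta> ^ ?N = (2 ^ m * \<delta>) ^ ?N"
          unfolding power_mult_distrib by (simp add: power_mult)
        also have "2 ^ m * \<delta> \<le> \<rho>"
        proof -
          have "(2::real) ^ m \<le> 2 ^ K" using m by (intro power_increasing) auto
          then have "2 ^ m * \<delta> \<le> 2 ^ K * \<delta>" using \<delta>01 by (intro mult_right_mono) auto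
          then show ?thesis by (simp add: \<delta>)
        qed
        then have "(2 ^ m * \<delta>) ^ ?N \<le> \<rho> ^ ?N" using \<delta>01 by (intro power_mono) auto
        finally show "2 ^ (m * ?N) * \<delta> ^ ?N \<le> \<rho> ^ ?N" .
      qed (use \<delta>01 in \<open>auto intro!: prod_nonneg\<close>)
      finally show ?thesis .
    qed
    moreover have "integrable M ?g" by (intro integrable_mult_left c)
    ultimately show "\<exists>e>0. \<exists>g\<in>{g. integrable M g}. \<forall>y\<in>ball x' e \<inter> ball x \<delta>. \<forall>\<alpha>\<in>space M.
        \<bar>d \<alpha> * (\<Prod>b\<in>Basis. ((y - x) \<bullet> b) ^ (\<alpha> b - \<beta> b))\<bar> \<le> g \<alpha>" for x'
      by (intro exI[of _ 1] conjI bexI[of _ ?g]) auto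
  qed (auto simp: M_def intro!: continuous_intros)
  {
    case 0
    show ?case using dom[OF 0(1), of \<beta>] 0(2) by simp
  next
    case (Suc k)
    show ?case
    proof (rule dom_Ck_SucI[OF open_ball w])
      show "dominated M {g. integrable M g} (ball x \<delta>) (\<lambda>\<alpha> y. d \<alpha> * (\<Prod>b\<in>Basis. ((y - x) \<bullet> b) ^ (\<alpha> b - \<beta> b)))"
        by (rule dom[OF Suc.prems(1)]) (use Suc.prems(2) in simp)
      show "((\<lambda>y. d \<alpha> * (\<Prod>b\<in>Basis. ((y - x) \<bullet> b) ^ (\<alpha> b - \<beta> b))) has_derivative
         (\<lambda>v. d \<alpha> * (\<Sum>i\<in>Basis. (of_nat (\<alpha> i - \<beta> i) * (v \<bullet> i) * ((y - x) \<bullet> i) ^ (\<alpha> i - \<beta> i - 1)) *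
            (\<Prod>b\<in>Basis - {i}. ((y - x) \<bullet> b) ^ (\<alpha> b - \<beta> b))))) (at y)" for \<alpha> y
        by (intro has_derivative_mult_right has_derivative_prod has_derivative_power) (auto intro!: derivative_eq_intros)
      fix b0 :: 'a assume b0: "b0 \<in> Basis"
      define \<beta>' where "\<beta>' = \<beta>(b0 := \<beta> b0 + 1)"
      have eq: "d \<alpha> * (\<Sum>i\<in>Basis. (of_nat (\<alpha> i - \<beta> i) * (b0 \<bullet> i) * ((y - x) \<bullet> i) ^ (\<alpha> i - \<beta> i - 1)) *
            (\<Prod>b\<in>Basis - {i}. ((y - x) \<bullet> b) ^ (\<alpha> b - \<beta> b))) =
          (d \<alpha> * of_nat (\<alpha> b0 - \<beta> b0)) * (\<Prod>b\<in>Basis. ((y - x) \<bullet> b) ^ (\<alpha> b - \<beta>' b))" for \<alpha> y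
      proof -
        have "(\<Sum>i\<in>Basis. (of_nat (\<alpha> i - \<beta> i) * (b0 \<bullet> i) * ((y - x) \<bullet> i) ^ (\<alpha> i - \<beta> i - 1)) *
            (\<Prod>b\<in>Basis - {i}. ((y - x) \<bullet> b) ^ (\<alpha> b - \<beta> b))) =
          (\<Sum>i\<in>Basis. if i = b0 then of_nat (\<alpha> b0 - \<beta> b0) * ((y - x) \<bullet> b0) ^ (\<alpha> b0 - \<beta> b0 - 1) *
            (\<Prod>b\<in>Basis - {b0}. ((y - x) \<bullet> b) ^ (\<alpha> b - \<beta> b)) else 0)"
          using b0 by (intro sum.cong refl) (auto simp: inner_Basis)
        also have "\<dots> = of_nat (\<alpha> b0 - \<beta> b0) * (((y - x) \<bullet> b0) ^ (\<alpha> b0 - \<beta> b0 - 1) *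
            (\<Prod>b\<in>Basis - {b0}. ((y - x) \<bullet> b) ^ (\<alpha> b - \<beta> b)))"
          using b0 by simp
        also have "((y - x) \<bullet> b0) ^ (\<alpha> b0 - \<beta> b0 - 1) * (\<Prod>b\<in>Basis - {b0}. ((y - x) \<bullet> b) ^ (\<alpha> b - \<beta> b))
           = (\<Prod>b\<in>Basis. ((y - x) \<bullet> b) ^ (\<alpha> b - \<beta>' b))"
          unfolding prod.remove[OF finite_Basis b0] by (auto simp: \<beta>'_def intro!: prod.cong)
        finally show ?thesis by simp
      qed
      show "dom_Ck M {g. integrable M g} k (ball x \<delta>) (\<lambda>\<alpha> y. d \<alpha> * (\<Sum>i\<in>Basis. (of_nat (\<alpha> i - \<beta> i) * (b0 \<bullet> i) * ((y - x) \<bullet> i) ^ (\<alpha> i - \<beta> i - 1)) *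
            (\<Prod>b\<in>Basis - {i}. ((y - x) \<bullet> b) ^ (\<alpha> b - \<beta> b))))"
        unfolding eq
      proof (rule Suc.IH)
        show "Suc m + k \<le> K" using Suc.prems by simp
        fix \<alpha> :: "'a \<Rightarrow> nat"
        have "\<alpha> b0 \<le> (\<Sum>b\<in>Basis. \<alpha> b)" using sum.remove[OF finite_Basis b0, of \<alpha>] by simp
        then have "\<alpha> b0 - \<beta> b0 \<le> 2 ^ (\<Sum>b\<in>Basis. \<alpha> b)"
          using less_exp[of "\<Sum>b\<in>Basis. \<alpha> b"] by linarith
        then have "real (\<alpha> b0 - \<beta> b0) \<le> 2 ^ (\<Sum>b\<in>Basis. \<alpha> b)"
          by (metis of_nat_le_iff of_nat_numeral of_nat_power)
        then have "\<bar>d \<alpha>\<bar> * real (\<alpha> b0 - \<beta> b0) \<le> (\<bar>c \<alpha>\<bar> * 2 ^ (m * (\<Sum>b\<in>Basis. \<alpha> b))) * 2 ^ (\<Sum>b\<in>Basis. \<alpha> b)"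
          using Suc.prems(1) by (intro mult_mono) auto
        then show "\<bar>d \<alpha> * real (\<alpha> b0 - \<beta> b0)\<bar> \<le> \<bar>c \<alpha>\<bar> * 2 ^ (Suc m * (\<Sum>b\<in>Basis. \<alpha> b))"
          by (simp add: abs_mult power_add mult_ac)
      qed
    qed
  }
qed

text \<open>Convergence at the one point whose coordinates relative to \<open>x\<close> all equal
  \<rho> makes the coefficients absolutely summable against powers of \<rho>. On a smaller ball the
  series is then a dominated family of any prescribed finite order.\<close>

lemma real_analytic_on_imp_Ck_on:
  fixes f :: "'a::euclidean_space \<Rightarrow> 'b::euclidean_space"
  assumes S: "open S" and f: "real_analytic_on S f"
  shows "Ck_on k S f"
proof (rule Ck_on_local)
  fix x assume x: "x \<in> S"
  let ?A = "{\<alpha> :: 'a \<Rightarrow> nat. \<forall>b. b \<notin> Basis \<longrightarrow> \<alpha> b = 0}"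
  let ?N = "\<lambda>\<alpha> :: 'a \<Rightarrow> nat. \<Sum>b\<in>Basis. \<alpha> b"
  obtain e c where e: "e > 0" and hs: "\<And>y. y \<in> ball x e \<Longrightarrow>
      ((\<lambda>\<alpha>. (\<Prod>b\<in>Basis. ((y - x) \<bullet> b) ^ \<alpha> b) *\<^sub>R c \<alpha>) has_sum f y) ?A"
    using f x unfolding real_analytic_on_def by blast
  \<comment> \<open>The diagonal vector has norm at most \<open>DIM('a)\<close>, so
    \<open>y0\<close> stays within half the radius of convergence; the bound 1 is required by the
    truncated exponents.\<close>
  define \<rho> where "\<rho> = min 1 (e / (2 * DIM('a)))"
  have \<rho>: "0 < \<rho>" "\<rho> \<le> 1" using e by (auto simp: \<rho>_def)
  define y0 where "y0 = x + \<rho> *\<^sub>R (\<Sum>b\<in>Basis. b)"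
  have "norm (\<Sum>b\<in>Basis. b :: 'a) \<le> DIM('a)"
    using norm_sum[of "\<lambda>b. b" "Basis :: 'a set"] by simp
  then have "norm (\<rho> *\<^sub>R (\<Sum>b\<in>Basis. b :: 'a)) \<le> e / (2 * DIM('a)) * DIM('a)"
    unfolding norm_scaleR using \<rho> e by (intro mult_mono) (auto simp: \<rho>_def)
  also have "\<dots> < e" using e by simp
  finally have y0: "y0 \<in> ball x e" by (simp add: y0_def dist_norm)
  have mono_y0: "(\<Prod>b\<in>Basis. ((y0 - x) \<bullet> b) ^ \<alpha> b) = \<rho> ^ ?N \<alpha>" for \<alpha>
    unfolding power_sum by (intro prod.cong refl) (simp add: y0_def inner_sum_left_Basis)
  define \<delta> where "\<delta> = \<rho> / 2 ^ k"
  have "\<delta> \<le> \<rho>" unfolding \<delta>_def using \<rho> by (simp add: divide_le_eq) 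
  moreover have "\<rho> < e"
  proof -
    have "\<rho> \<le> e / (2 * DIM('a))" by (simp add: \<rho>_def)
    also have "\<dots> \<le> e / 2" using e by (intro divide_left_mono) (auto simp: Suc_le_eq)
    finally show ?thesis using e by simp
  qed
  ultimately have sub: "ball x \<delta> \<subseteq> ball x e" by (intro subset_ball) simp
  have "Ck_on k (ball x \<delta>) f"
    unfolding Ck_on_componentwise[OF open_ball, of k x \<delta> f]
  proof
    fix b :: 'b
    let ?c = "\<lambda>\<alpha>. c \<alpha> \<bullet> b"
    have hsb: "((\<lambda>\<alpha>. ?c \<alpha> * (\<Prod>b\<in>Basis. ((y - x) \<bullet> b) ^ \<alpha> b)) has_sum (f y \<bullet> b)) ?A" if "y \<in> ball x e" for y
      using has_sum_bounded_linear[OF bounded_linear_inner_left hs[OF that], of b] by (simp add: o_def mult.commute)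
    \<comment> \<open>For real families unconditional summability is absolute summability, hence
      integrability for counting measure.\<close>
    have int: "integrable (count_space ?A) h" if "(\<lambda>\<alpha>. h \<alpha>) summable_on ?A" for h :: "('a \<Rightarrow> nat) \<Rightarrow> real"
      using iffD1[OF abs_summable_equivalent iffD1[OF summable_on_iff_abs_summable_on_real that]]
      by (simp only: abs_summable_on_def)
    have ints: "integral\<^sup>L (count_space ?A) h = s" if "(h has_sum s) ?A" for h :: "('a \<Rightarrow> nat) \<Rightarrow> real" and s
    proof -
      have "h summable_on ?A" using that by (rule has_sum_imp_summable)
      then have "Infinite_Set_Sum.abs_summable_on h ?A"
        by (intro iffD1[OF abs_summable_equivalent] iffD1[OF summable_on_iff_abs_summable_on_real])
      from infsetsum_infsum[OF this] show ?thesis using infsumI[OF that] by (simp add: infsetsum_def)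
    qed
    have "integrable (count_space ?A) (\<lambda>\<alpha>. ?c \<alpha> * \<rho> ^ ?N \<alpha>)"
      using has_sum_imp_summable[OF hsb[OF y0]] unfolding mono_y0 by (rule int)
    then have "integrable (count_space ?A) (\<lambda>\<alpha>. norm (?c \<alpha> * \<rho> ^ ?N \<alpha>))"
      by (rule integrable_norm)
    then have c: "integrable (count_space ?A) (\<lambda>\<alpha>. \<bar>?c \<alpha>\<bar> * \<rho> ^ ?N \<alpha>)"
      using \<rho> by (simp add: abs_mult)
    have "dom_Ck (count_space ?A) {g. integrable (count_space ?A) g} k (ball x \<delta>)
       (\<lambda>\<alpha> y. ?c \<alpha> * (\<Prod>b\<in>Basis. ((y - x) \<bullet> b) ^ (\<alpha> b - (\<lambda>_. 0) b)))"
      by (rule dom_Ck_shifted_monomials[OF refl \<rho> \<delta>_def c, of ?c 0]) auto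
    from dom_Ck_integral(1)[OF open_ball _ this]
    have "Ck_on k (ball x \<delta>) (\<lambda>y. \<integral>\<alpha>. ?c \<alpha> * (\<Prod>b\<in>Basis. ((y - x) \<bullet> b) ^ \<alpha> b) \<partial>count_space ?A)"
      by simp
    then show "Ck_on k (ball x \<delta>) (\<lambda>y. f y \<bullet> b)"
      by (rule Ck_on_cong[OF open_ball, rotated]) (use ints[OF hsb] sub in blast)
  qed
  moreover have "x \<in> ball x \<delta>" using \<rho> by (simp add: \<delta>_def)
  ultimately show "\<exists>A. open A \<and> x \<in> A \<and> Ck_on k A f" using open_ball by blast
qed

text \<open>In use, \<open>order_le (Suc k) r\<close> expresses that \<open>k\<close> is at most
  \<open>r - 1\<close>, in agreement with \<open>reg_pred\<close>.\<close>

fun order_le :: "nat \<Rightarrow> regularity \<Rightarrow> bool" where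
  "order_le k (Fin m) \<longleftrightarrow> k \<le> m"
| "order_le k Infty \<longleftrightarrow> True"
| "order_le k Omega \<longleftrightarrow> True"

lemma regular_on_imp_Ck_on:
  assumes "open S" "regular_on r S f" "order_le k r"
  shows "Ck_on k S f"
proof (rule Ck_on_local)
  fix x assume x: "x \<in> S"
  obtain W g where W: "open W" "x \<in> W" "regular_open r W g" "\<forall>y\<in>W \<inter> S. g y = f y"
    using assms(2) x unfolding regular_on_def by blast
  have "Ck_on k W g"
    using W(1,3) assms(3) by (cases r) (auto intro: Ck_on_mono real_analytic_on_imp_Ck_on)
  then have "Ck_on k (W \<inter> S) g" by (rule Ck_on_subset) simp
  then have "Ck_on k (W \<inter> S) f"
    by (rule Ck_on_cong[rotated 2]) (use W assms(1) in auto)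
  then show "\<exists>A. open A \<and> x \<in> A \<and> Ck_on k A f"
    using W assms(1) x by (intro exI[of _ "W \<inter> S"]) auto
qed

section \<open>Cauchy estimates\<close>

lemma norm_cvec: "norm (cvec x) = norm x"
  by (simp add: norm_vec_def cvec_def)

lemma bounded_linear_cvec: "bounded_linear (cvec :: real^'n \<Rightarrow> complex^'n)"
  by (rule bounded_linear_intro[of _ 1]) (auto simp: norm_cvec, auto simp: cvec_def vec_eq_iff scaleR_conv_of_real[symmetric])

lemma embed_eq: "embed x = (cvec (fst x), cvec (fst (snd x)), cvec (fst (snd (snd x))),
    cvec (fst (snd (snd (snd x)))), complex_of_real (snd (snd (snd (snd x)))))"
  by (cases x) auto

lemma bounded_linear_embed: "bounded_linear (embed :: ('n::finite, 'd::finite) rphase \<Rightarrow> _)"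
  unfolding embed_eq[abs_def]
  by (intro bounded_linear_Pair bounded_linear_compose[OF bounded_linear_cvec] bounded_linear_compose[OF bounded_linear_of_real]
      bounded_linear_fst_comp bounded_linear_snd_comp bounded_linear_fst bounded_linear_snd)

lemma norm_embed: "norm (embed x) = norm x"
  by (cases x) (simp add: norm_Pair norm_cvec)

lemma norm_smult_complex_vec: "norm (c *s (v :: complex^'n)) = cmod c * norm v"
  by (simp add: norm_vec_def vector_scalar_mult_def norm_mult L2_set_right_distrib)

lemma norm_cscale: "norm (cscale c v) = cmod c * norm v"
proof -
  have "sqrt (c\<^sup>2 * a + c\<^sup>2 * b) = \<bar>c\<bar> * sqrt (a + b)" for a b c :: real
    by (simp add: distrib_left[symmetric] real_sqrt_mult)
  then show ?thesis
    by (cases v) (simp add: norm_Pair norm_smult_complex_vec norm_mult power_mult_distrib)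
qed

lemma bounded_linear_cscale: "bounded_linear (\<lambda>c. cscale c v)"
proof (rule bounded_linear_intro[of _ "norm v"])
  show "cscale (x + y) v = cscale x v + cscale y v" for x y
    by (cases v) (simp add: vec_eq_iff distrib_right)
  show "cscale (r *\<^sub>R x) v = r *\<^sub>R cscale x v" for r x
    by (cases v) (simp add: vec_eq_iff)
qed (simp add: norm_cscale)

text \<open>Every component of \<open>w\<close> is bounded by \<open>norm w\<close>, and the strips
  are given by uniform distances. This provides the room for the circles of the Cauchy
  formula.\<close>

lemma Mkappa_shift:
  assumes "z \<in> Mkappa \<kappa> D B" "norm w < r"
  shows "z + w \<in> Mkappa (\<kappa> + r) D B"
proof -
  obtain p q I \<phi> t where z: "z = (p, q, I, \<phi>, t)" by (cases z)
  obtain p' q' I' \<phi>' t' where w: "w = (p', q', I', \<phi>', t')" by (cases w)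
  have n: "norm p' < r" "norm q' < r" "norm I' < r" "norm \<phi>' < r" "norm t' < r"
  proof -
    have "norm p' \<le> norm w" "norm (q', I', \<phi>', t') \<le> norm w"
      unfolding w using norm_fst_le[of p' "(q', I', \<phi>', t')"] norm_snd_le[of "(q', I', \<phi>', t')" p'] by auto
    moreover have "norm q' \<le> norm (q', I', \<phi>', t')" "norm (I', \<phi>', t') \<le> norm (q', I', \<phi>', t')"
      using norm_fst_le[of q' "(I', \<phi>', t')"] norm_snd_le[of "(I', \<phi>', t')" q'] by auto
    moreover have "norm I' \<le> norm (I', \<phi>', t')" "norm (\<phi>', t') \<le> norm (I', \<phi>', t')"
      using norm_fst_le[of I' "(\<phi>', t')"] norm_snd_le[of "(\<phi>', t')" I'] by auto
    moreover have "norm \<phi>' \<le> norm (\<phi>', t')" "norm t' \<le> norm (\<phi>', t')"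
      using norm_fst_le[of \<phi>' t'] norm_snd_le[of t' \<phi>'] by auto
    ultimately show "norm p' < r" "norm q' < r" "norm I' < r" "norm \<phi>' < r" "norm t' < r"
      using assms(2) by linarith+
  qed
  have im: "\<bar>Im (a + b)\<bar> < \<kappa> + r" if "\<bar>Im a\<bar> < \<kappa>" "cmod b < r" for a b
    using that abs_Im_le_cmod[of b] by simp
  have "norm (q' $ i) < r" "norm (\<phi>' $ j) < r" for i j
    using n Finite_Cartesian_Product.norm_nth_le[of q' i] Finite_Cartesian_Product.norm_nth_le[of \<phi>' j] by linarith+
  moreover have "infdist (p + p') (cvec ` D) < \<kappa> + r" "infdist (I + I') (cvec ` B) < \<kappa> + r"
    using infdist_triangle[of "p + p'" "cvec ` D" p] infdist_triangle[of "I + I'" "cvec ` B" I] n assms(1)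
    by (auto simp: z Mkappa_def dist_norm)
  ultimately show ?thesis
    using assms(1) n im unfolding z w Mkappa_def by auto
qed

lemma Mkappa_mono: "\<kappa>' \<le> \<kappa> \<Longrightarrow> Mkappa \<kappa>' D B \<subseteq> Mkappa \<kappa> D B"
  by (auto simp: Mkappa_def intro: less_le_trans)

lemma open_Mkappa: "open (Mkappa \<kappa> D B)"
proof -
  have [continuous_intros]: "continuous_on UNIV (\<lambda>x. infdist (f x) A)" if "continuous_on UNIV f"
    for f :: "'x::t2_space \<Rightarrow> 'y::metric_space" and A
    using that by (rule continuous_on_infdist)
  have "Mkappa \<kappa> D B = {z. infdist (fst z) (cvec ` D) < \<kappa>} \<inter> {z. infdist (fst (snd (snd z))) (cvec ` B) < \<kappa>}
     \<inter> (\<Inter>i. {z. \<bar>Im (fst (snd z) $ i)\<bar> < \<kappa>}) \<inter> (\<Inter>j. {z. \<bar>Im (fst (snd (snd (snd z))) $ j)\<bar> < \<kappa>})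
     \<inter> {z. \<bar>Im (snd (snd (snd (snd z))))\<bar> < \<kappa>}"
    by (auto simp: Mkappa_def)
  also have "open \<dots>"
    by (intro open_Int open_INT ballI finite open_Collect_less continuous_intros)
  finally show ?thesis .
qed

lemma embed_in_Mkappa: "0 < \<kappa> \<Longrightarrow> x \<in> Mreal D B \<Longrightarrow> embed x \<in> Mkappa \<kappa> D B"
  by (cases x) (auto simp: Mreal_def Mkappa_def cvec_def[of "fst (snd _)"] infdist_zero image_eqI, auto simp: cvec_def)

lemma open_Mreal: "open D \<Longrightarrow> open B \<Longrightarrow> open (Mreal D B)"
proof -
  assume *: "open D" "open B"
  have "Mreal D B = fst -` D \<inter> (\<lambda>x. fst (snd (snd x))) -` B"
    by (auto simp: Mreal_def)
  also have "open \<dots>" using * by (intro open_Int open_vimage continuous_intros)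
  finally show ?thesis .
qed

definition unit_circle_measure :: "real measure" where
  "unit_circle_measure = lebesgue_on {0..1}"

text \<open>On the complex line through \<open>z\<close> in direction \<open>v\<close> the function
  depends holomorphically on one variable \<zeta>, and the Cauchy formula for the first derivative
  at \<zeta> = 0 applies. The integral representation, and not only the resulting estimate, is
  recorded: it later shows that a derivative is holomorphic again.\<close>

lemma cphase_Cauchy_formula:
  fixes F :: "('n::finite, 'd::finite) cphase \<Rightarrow> complex"
  assumes F: "cphase_holomorphic_on (Mkappa \<kappa> D B) F" and z: "z \<in> Mkappa \<kappa>' D B"
    and r: "0 < r" "\<kappa>' + r * norm v < \<kappa>"
  shows "integrable unit_circle_measure (\<lambda>t. F (z + cscale (of_real r * exp (2 * pi * \<i> * of_real t)) v) * (exp (- (2 * pi * \<i> * of_real t)) / of_real r))"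
    and "frechet_derivative F (at z) v =
    (\<integral>t. F (z + cscale (of_real r * exp (2 * pi * \<i> * of_real t)) v) * (exp (- (2 * pi * \<i> * of_real t)) / of_real r) \<partial>unit_circle_measure)"
proof -
  define \<phi> where "\<phi> = (\<lambda>\<zeta>. F (z + cscale \<zeta> v))"
  \<comment> \<open>The radius is enlarged slightly, so that the closed disc of radius
    \<open>r\<close> lies in an open disc of holomorphy.\<close>
  obtain r' where r': "r < r'" "\<kappa>' + r' * norm v < \<kappa>"
  proof (cases "v = 0")
    case True
    then show ?thesis using r that[of "r + 1"] by simp
  next
    case False
    define \<epsilon> where "\<epsilon> = (\<kappa> - \<kappa>' - r * norm v) / (2 * norm v)"
    have "\<epsilon> > 0" using r False by (simp add: \<epsilon>_def)
    moreover have "\<epsilon> * norm v = (\<kappa> - \<kappa>' - r * norm v) / 2" using False by (simp add: \<epsilon>_def)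
    ultimately show ?thesis using r that[of "r + \<epsilon>"] by (simp add: distrib_right)
  qed
  have zin: "z + cscale \<zeta> v \<in> Mkappa \<kappa> D B" if "cmod \<zeta> < r'" for \<zeta>
  proof -
    have "norm (cscale \<zeta> v) < \<kappa> - \<kappa>'"
    proof -
      have "cmod \<zeta> * norm v \<le> r' * norm v" using that by (intro mult_right_mono) auto
      then show ?thesis using r' by (simp add: norm_cscale)
    qed
    from Mkappa_shift[OF z this] show ?thesis by simp
  qed
  have D: "(\<phi> has_field_derivative frechet_derivative F (at (z + cscale \<zeta> v)) v) (at \<zeta>)" if \<zeta>: "cmod \<zeta> < r'" for \<zeta>
  proof -
    obtain f' where f': "(F has_derivative f') (at (z + cscale \<zeta> v))" "\<And>c v. f' (cscale c v) = c * f' v"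
      using F zin[OF \<zeta>] unfolding cphase_holomorphic_on_def by blast
    have "((\<lambda>\<zeta>. z + cscale \<zeta> v) has_derivative (\<lambda>\<zeta>. 0 + cscale \<zeta> v)) (at \<zeta>)"
      by (intro has_derivative_add has_derivative_const bounded_linear_imp_has_derivative bounded_linear_cscale)
    from has_derivative_compose[OF this f'(1)] have "(\<phi> has_derivative (\<lambda>c. f' v * c)) (at \<zeta>)"
      by (simp add: \<phi>_def f'(2) mult.commute)
    then show ?thesis
      unfolding has_field_derivative_def frechet_derivative_eqI[OF f'(1)] .
  qed
  have hol: "\<phi> holomorphic_on ball 0 r'"
    unfolding holomorphic_on_def field_differentiable_def
  proof (intro ballI exI)
    fix \<zeta> :: complex assume "\<zeta> \<in> ball 0 r'"
    then show "(\<phi> has_field_derivative frechet_derivative F (at (z + cscale \<zeta> v)) v) (at \<zeta> within ball 0 r')"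
      by (intro has_field_derivative_at_within[OF D]) simp
  qed
  have "cball (0::complex) r \<subseteq> ball 0 r'" using r' by auto
  then have "continuous_on (cball 0 r) \<phi>" "\<phi> holomorphic_on ball 0 r"
    using holomorphic_on_imp_continuous_on[OF hol] hol r'
    by (auto intro: continuous_on_subset holomorphic_on_subset)
  from Cauchy_has_contour_integral_higher_derivative_circlepath[OF this, of 0 1]
  have "((\<lambda>u. \<phi> u / u ^ 2) has_contour_integral 2 * pi * \<i> * deriv \<phi> 0) (circlepath 0 r)"
    using r by (simp add: numeral_2_eq_2)
  then have "((\<lambda>t. \<phi> (circlepath 0 r t) / (circlepath 0 r t)\<^sup>2 * vector_derivative (circlepath 0 r) (at t within {0..1}))
      has_integral 2 * pi * \<i> * deriv \<phi> 0) {0..1}"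
    unfolding has_contour_integral_def .
  then have "((\<lambda>t. 2 * pi * \<i> * (\<phi> (of_real r * exp (2 * pi * \<i> * of_real t)) * (exp (- (2 * pi * \<i> * of_real t)) / of_real r)))
      has_integral 2 * pi * \<i> * deriv \<phi> 0) {0..1}"
  proof (rule has_integral_eq[rotated])
    fix t :: real assume "t \<in> {0..1}"
    then have vd: "vector_derivative (circlepath 0 r) (at t within {0..1}) = 2 * pi * \<i> * r * exp (2 * of_real pi * \<i> * t)"
      by (simp add: vector_derivative_circlepath01)
    show "\<phi> (circlepath 0 r t) / (circlepath 0 r t)\<^sup>2 * vector_derivative (circlepath 0 r) (at t within {0..1}) =
      2 * pi * \<i> * (\<phi> (of_real r * exp (2 * pi * \<i> * of_real t)) * (exp (- (2 * pi * \<i> * of_real t)) / of_real r))"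
      unfolding vd using r by (simp add: circlepath power2_eq_square exp_minus field_simps)
  qed
  from has_integral_mult_right[OF this, of "1 / (2 * pi * \<i>)"]
  have HI: "((\<lambda>t. \<phi> (of_real r * exp (2 * pi * \<i> * of_real t)) * (exp (- (2 * pi * \<i> * of_real t)) / of_real r))
      has_integral deriv \<phi> 0) {0..1}" by simp
  have c: "continuous_on {0..1} (\<lambda>t. \<phi> (of_real r * exp (2 * pi * \<i> * of_real t)) * (exp (- (2 * pi * \<i> * of_real t)) / of_real r))"
    using r r' by (intro continuous_intros continuous_on_compose2[OF holomorphic_on_imp_continuous_on[OF hol]])
      (auto simp: norm_mult)
  have "integrable (lebesgue_on {0..1}) (\<lambda>t. \<phi> (of_real r * exp (2 * pi * \<i> * of_real t)) * (exp (- (2 * pi * \<i> * of_real t)) / of_real r))"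
    using continuous_imp_integrable[of "0::real" 1] c by (simp only: cbox_interval)
  note int = this
  then show "integrable unit_circle_measure (\<lambda>t. F (z + cscale (of_real r * exp (2 * pi * \<i> * of_real t)) v) * (exp (- (2 * pi * \<i> * of_real t)) / of_real r))"
    by (simp add: unit_circle_measure_def \<phi>_def)
  have
    "(\<integral>t. \<phi> (of_real r * exp (2 * pi * \<i> * of_real t)) * (exp (- (2 * pi * \<i> * of_real t)) / of_real r) \<partial>unit_circle_measure) = deriv \<phi> 0"
    unfolding unit_circle_measure_def
    by (rule trans[OF lebesgue_integral_eq_integral[OF int] integral_unique[OF HI]]) simp
  moreover have "deriv \<phi> 0 = frechet_derivative F (at z) v"
  proof -
    have "cscale 0 v = 0" using bounded_linear_cscale[of v] by (rule linear_simps(3))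
    then show ?thesis using DERIV_imp_deriv[OF D[of 0]] r r' by simp
  qed
  ultimately show "frechet_derivative F (at z) v =
    (\<integral>t. F (z + cscale (of_real r * exp (2 * pi * \<i> * of_real t)) v) * (exp (- (2 * pi * \<i> * of_real t)) / of_real r) \<partial>unit_circle_measure)"
    by (simp add: \<phi>_def)
qed

section \<open>Holomorphic functions with an explicit bound\<close>

definition holo_bdd :: "real \<Rightarrow> (real^'n) set \<Rightarrow> (real^'d) set \<Rightarrow> real \<Rightarrow> (('n::finite, 'd::finite) cphase \<Rightarrow> complex) \<Rightarrow> bool" where
  "holo_bdd \<kappa> D B M F \<longleftrightarrow>
     cphase_holomorphic_on (Mkappa \<kappa> D B) F \<and> (\<forall>z\<in>Mkappa \<kappa> D B. cmod (F z) \<le> M)"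

lemma finite_measure_unit_circle: "finite_measure unit_circle_measure" "measure unit_circle_measure (space unit_circle_measure) = 1"
  by (auto simp: unit_circle_measure_def finite_measure_lebesgue_on measure_restrict_space)

lemma holo_bdd_derivative_le:
  assumes F: "holo_bdd \<kappa> D B M F" and z: "z \<in> Mkappa \<kappa>' D B"
    and r: "0 < r" "\<kappa>' + r * norm v < \<kappa>"
  shows "cmod (frechet_derivative F (at z) v) \<le> M / r"
proof -
  interpret finite_measure unit_circle_measure by (rule finite_measure_unit_circle)
  have hol: "cphase_holomorphic_on (Mkappa \<kappa> D B) F" using F by (simp add: holo_bdd_def)
  let ?h = "\<lambda>t. F (z + cscale (of_real r * exp (2 * pi * \<i> * of_real t)) v) * (exp (- (2 * pi * \<i> * of_real t)) / of_real r)"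
  note c = cphase_Cauchy_formula[OF hol z r]
  have "norm (integral\<^sup>L unit_circle_measure ?h) \<le> (\<integral>t. norm (?h t) \<partial>unit_circle_measure)"
    by (rule integral_norm_bound)
  also have "\<dots> \<le> (\<integral>t. M / r \<partial>unit_circle_measure)"
  proof (rule integral_mono)
    fix t
    have "norm (cscale (of_real r * exp (2 * pi * \<i> * of_real t)) v) < \<kappa> - \<kappa>'"
      using r by (simp add: norm_cscale norm_mult)
    from Mkappa_shift[OF z this] have "cmod (F (z + cscale (of_real r * exp (2 * pi * \<i> * of_real t)) v)) \<le> M"
      using F by (simp add: holo_bdd_def)
    then show "norm (?h t) \<le> M / r"
      using r by (simp add: norm_mult norm_divide divide_right_mono)
  qed (use c(1) in auto)
  also have "\<dots> = M / r" using finite_measure_unit_circle(2) by simp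
  finally show ?thesis unfolding c(2) .
qed

text \<open>The Cauchy radius \<open>r / norm w\<close> keeps the circle within distance
  \<open>r\<close> of \<open>z\<close>, which makes the bound linear in
  \<open>norm w\<close>.\<close>

lemma holo_bdd_onorm_le:
  assumes F: "holo_bdd \<kappa> D B M F" and z: "z \<in> Mkappa \<kappa>' D B" and r: "0 < r" "\<kappa>' + r < \<kappa>"
  shows "cmod (frechet_derivative F (at z) w) \<le> M / r * norm w"
proof (cases "w = 0")
  case True
  have "z \<in> Mkappa \<kappa> D B" using Mkappa_mono[of \<kappa>' \<kappa> D B] z r by auto
  then obtain f' where f': "(F has_derivative f') (at z)"
    using F unfolding holo_bdd_def cphase_holomorphic_on_def by blast
  then show ?thesis using True linear_0[OF has_derivative_linear[OF f']] frechet_derivative_eqI[OF f'] by simp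
next
  case False
  have "cmod (frechet_derivative F (at z) w) \<le> M / (r / norm w)"
    by (rule holo_bdd_derivative_le[OF F z]) (use r False in auto)
  then show ?thesis by simp
qed

text \<open>The Cauchy integral is differentiated under the integral sign, and complex linearity of
  the new derivative is inherited from the integrand. The strip shrinks and the bound is divided by
  \<open>r\<close>, so the statement can be iterated.\<close>

lemma holo_bdd_derivative:
  fixes F :: "('n::finite, 'd::finite) cphase \<Rightarrow> complex"
  assumes F: "holo_bdd \<kappa> D B M F" and r: "0 < r" "\<kappa>' + r * norm v < \<kappa>"
  shows "holo_bdd \<kappa>' D B (M / r) (\<lambda>z. frechet_derivative F (at z) v)"
  unfolding holo_bdd_def cphase_holomorphic_on_def
proof (intro conjI ballI)
  interpret finite_measure unit_circle_measure by (rule finite_measure_unit_circle)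
  fix z assume z: "z \<in> Mkappa \<kappa>' D B"
  show "cmod (frechet_derivative F (at z) v) \<le> M / r"
    by (rule holo_bdd_derivative_le[OF F z r])
  have hol: "cphase_holomorphic_on (Mkappa \<kappa> D B) F" using F by (simp add: holo_bdd_def)
  \<comment> \<open>The room left between the circles and the boundary of the strip. Circles around
    points of the ball of radius \<open>s / 4\<close> stay in the strip of width
    \<open>\<kappa> - s / 2\<close>, where a further Cauchy radius \<open>s / 4\<close> is available
    for the Lipschitz estimate.\<close>
  define s where "s = \<kappa> - \<kappa>' - r * norm v"
  have s: "0 < s" using r by (simp add: s_def)
  define c where "c = (\<lambda>t. cscale (of_real r * exp (2 * pi * \<i> * of_real t)) v)"
  define k where "k = (\<lambda>t. exp (- (2 * pi * \<i> * complex_of_real t)) / of_real r)"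
  have nc: "norm (c t) = r * norm v" for t using r by (simp add: c_def norm_cscale norm_mult)
  have nk: "norm (k t) = 1 / r" for t using r by (simp add: k_def norm_divide)
  have zin: "x + c t \<in> Mkappa (\<kappa> - s / 2) D B" if "x \<in> ball z (s / 4)" for x t
  proof -
    have "norm ((x - z) + c t) \<le> norm (x - z) + r * norm v" using norm_triangle_ineq[of "x - z" "c t"] nc by simp
    also have "\<dots> < r * norm v + s / 2" using that s by (simp add: dist_norm norm_minus_commute)
    finally have "z + ((x - z) + c t) \<in> Mkappa (\<kappa>' + (r * norm v + s / 2)) D B" by (rule Mkappa_shift[OF z])
    moreover have "\<kappa>' + (r * norm v + s / 2) = \<kappa> - s / 2" by (simp add: s_def field_simps)
    ultimately show ?thesis by (simp add: algebra_simps)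
  qed
  have sub: "Mkappa (\<kappa> - s / 2) D B \<subseteq> Mkappa \<kappa> D B" by (rule Mkappa_mono) (use s in simp)
  have DF: "(F has_derivative frechet_derivative F (at (x + c t))) (at (x + c t))"
    and lin: "frechet_derivative F (at (x + c t)) (cscale a w) = a * frechet_derivative F (at (x + c t)) w"
    if x: "x \<in> ball z (s / 4)" for x t a w
  proof -
    obtain f' where f': "(F has_derivative f') (at (x + c t))" "\<And>a w. f' (cscale a w) = a * f' w"
      using hol zin[OF x] sub unfolding cphase_holomorphic_on_def by blast
    then show "(F has_derivative frechet_derivative F (at (x + c t))) (at (x + c t))"
      "frechet_derivative F (at (x + c t)) (cscale a w) = a * frechet_derivative F (at (x + c t)) w"
      by (auto simp: frechet_derivative_eqI[OF f'(1)])
  qed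
  have zball: "z \<in> ball z (s / 4)" using s by simp
  have DG: "((\<lambda>x. F (x + c t) * k t) has_derivative (\<lambda>w. frechet_derivative F (at (x + c t)) w * k t)) (at x)"
    if x: "x \<in> ball z (s / 4)" for x t
  proof (intro has_derivative_mult_left)
    have "((\<lambda>x. x + c t) has_derivative (\<lambda>w. w)) (at x)" by (auto intro!: derivative_eq_intros)
    from has_derivative_compose[OF this DF[OF x]] show "((\<lambda>x. F (x + c t)) has_derivative frechet_derivative F (at (x + c t))) (at x)" .
  qed
  have int: "integrable unit_circle_measure (\<lambda>t. F (x + c t) * k t)"
    and form: "frechet_derivative F (at x) v = (\<integral>t. F (x + c t) * k t \<partial>unit_circle_measure)"
    if x: "x \<in> ball z (s / 4)" for x
  proof -
    have "norm (x - z) < s / 2" using x s by (simp add: dist_norm norm_minus_commute)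
    from Mkappa_shift[OF z this] have "x \<in> Mkappa (\<kappa>' + s / 2) D B" by simp
    then show "integrable unit_circle_measure (\<lambda>t. F (x + c t) * k t)"
      "frechet_derivative F (at x) v = (\<integral>t. F (x + c t) * k t \<partial>unit_circle_measure)"
      unfolding c_def k_def using s r
      by (intro cphase_Cauchy_formula[OF hol, of x "\<kappa>' + s / 2"]; simp add: s_def field_simps)+
  qed
  have der: "((\<lambda>x. \<integral>t. F (x + c t) * k t \<partial>unit_circle_measure) has_derivative
      (\<lambda>w. \<integral>t. frechet_derivative F (at (z + c t)) w * k t \<partial>unit_circle_measure)) (at z)"
  proof (rule has_derivative_integral(2)[where e = "s / 4" and g = "\<lambda>_. M / (s / 4) * (1 / r)"])
    fix t x assume x: "x \<in> ball z (s / 4)"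
    show "norm (F (x + c t) * k t - F (z + c t) * k t) \<le> M / (s / 4) * (1 / r) * norm (x - z)"
    proof (rule differentiable_bound[OF convex_ball[of z "s / 4"]])
      fix y assume y: "y \<in> ball z (s / 4)"
      show "((\<lambda>x. F (x + c t) * k t) has_derivative (\<lambda>w. frechet_derivative F (at (y + c t)) w * k t)) (at y within ball z (s / 4))"
        by (rule has_derivative_at_withinI[OF DG[OF y]])
      show "onorm (\<lambda>w. frechet_derivative F (at (y + c t)) w * k t) \<le> M / (s / 4) * (1 / r)"
      proof (rule onorm_le)
        fix w
        have "cmod (frechet_derivative F (at (y + c t)) w) \<le> M / (s / 4) * norm w"
          by (rule holo_bdd_onorm_le[OF F zin[OF y]]) (use s in auto)
        then have "cmod (frechet_derivative F (at (y + c t)) w) * (1 / r) \<le> M / (s / 4) * norm w * (1 / r)"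
          using r by (intro mult_right_mono) auto
        then show "norm (frechet_derivative F (at (y + c t)) w * k t) \<le> M / (s / 4) * (1 / r) * norm w"
          by (simp add: norm_mult nk mult_ac)
      qed
    qed (use x zball in auto)
  qed (use s int DG zball in auto)
  have der': "((\<lambda>x. frechet_derivative F (at x) v) has_derivative
      (\<lambda>w. \<integral>t. frechet_derivative F (at (z + c t)) w * k t \<partial>unit_circle_measure)) (at z)"
    by (rule has_derivative_transform_within_open[OF der open_ball zball]) (simp add: form)
  show "\<exists>f'. ((\<lambda>x. frechet_derivative F (at x) v) has_derivative f') (at z) \<and> (\<forall>c v. f' (cscale c v) = c * f' v)"
    by (intro exI conjI, rule der') (simp add: lin[OF zball] mult.assoc)
qed

lemma has_derivative_real_part:
  assumes "holo_bdd \<kappa> D B M F" "0 < \<kappa>" "x \<in> Mreal D B"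
  shows "(real_part F has_derivative (\<lambda>v. Re (frechet_derivative F (at (embed x)) (embed v)))) (at x)"
proof -
  have "F differentiable at (embed x)"
    using assms embed_in_Mkappa[OF assms(2,3)] unfolding holo_bdd_def cphase_holomorphic_on_def differentiable_def by blast
  then have "(F has_derivative frechet_derivative F (at (embed x))) (at (embed x))"
    by (rule differentiable_has_derivative)
  from has_derivative_compose[OF bounded_linear_imp_has_derivative[OF bounded_linear_embed] this]
  have "((\<lambda>x. F (embed x)) has_derivative (\<lambda>v. frechet_derivative F (at (embed x)) (embed v))) (at x)" .
  then show ?thesis
    unfolding real_part_def[abs_def] by (intro has_derivative_Re)
qed

lemma bdd_Ck_cong:
  assumes "open W" "\<And>x. x \<in> W \<Longrightarrow> f x = g x" "bdd_Ck k W f"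
  shows "bdd_Ck k W g"
  using assms(2,3)
proof (induction k arbitrary: f g)
  case 0
  then show ?case by (simp cong: continuous_on_cong)
next
  case (Suc k)
  have "bdd_Ck k W (\<lambda>x. frechet_derivative g (at x) v)" for v
    by (rule Suc.IH[of "\<lambda>x. frechet_derivative f (at x) v"])
      (use Suc.prems in \<open>auto intro!: fun_cong[OF frechet_derivative_cong_open(1)[OF assms(1)]]\<close>)
  then show ?case
    using Suc.prems frechet_derivative_cong_open(2)[OF assms(1), of _ f g] by (simp cong: continuous_on_cong)
qed

lemma bdd_Ck_SucD:
  "bdd_Ck (Suc k) S G \<Longrightarrow> bdd_Ck k S (\<lambda>x. frechet_derivative G (at x) v)"
  "bdd_Ck (Suc k) S G \<Longrightarrow> x \<in> S \<Longrightarrow> G differentiable at x"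
  by simp_all

lemma Comega_holo_bdd:
  assumes "f \<in> Comega \<kappa> D B"
  shows "holo_bdd \<kappa> D B (kappa_norm \<kappa> D B f) f"
proof -
  have "bdd_above ((\<lambda>z. cmod (f z)) ` Mkappa \<kappa> D B)"
    using assms bounded_iff[of "f ` Mkappa \<kappa> D B"] unfolding Comega_def bdd_above_def by auto
  then show ?thesis
    using assms unfolding holo_bdd_def kappa_norm_def Comega_def by (auto intro: cSUP_upper)
qed

lemma frechet_derivative_real_part:
  assumes "holo_bdd \<kappa> D B M F" "0 < \<kappa>" "x \<in> Mreal D B"
  shows "frechet_derivative (real_part F) (at x) v = real_part (\<lambda>z. frechet_derivative F (at z) (embed v)) x"
  using frechet_derivative_eqI[OF has_derivative_real_part[OF assms]] by (simp add: real_part_def)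

text \<open>Each derivative halves the width of the strip, so after any finite number of derivatives
  a positive width remains.\<close>

lemma bdd_Ck_real_part:
  assumes DB: "open D" "open B" and F: "holo_bdd \<kappa> D B M F" and \<kappa>: "0 < \<kappa>"
  shows "bdd_Ck k (Mreal D B) (real_part F)"
  using F \<kappa>
proof (induction k arbitrary: F \<kappa> M)
  have diff: "real_part F differentiable at x" if "holo_bdd \<kappa> D B M F" "0 < \<kappa>" "x \<in> Mreal D B" for F \<kappa> M x
    using has_derivative_real_part[OF that] by (rule differentiableI)
  have 0: "bdd_Ck 0 (Mreal D B) (real_part F)" if F: "holo_bdd \<kappa> D B M F" "0 < \<kappa>" for F \<kappa> M
  proof -
    have "\<bar>real_part F x\<bar> \<le> M" if "x \<in> Mreal D B" for x
      using F embed_in_Mkappa[OF F(2) that] abs_Re_le_cmod[of "F (embed x)"]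
      unfolding holo_bdd_def real_part_def by fastforce
    moreover have "continuous_on (Mreal D B) (real_part F)"
      using diff[OF F] by (intro continuous_at_imp_continuous_on ballI differentiable_imp_continuous_within)
    ultimately show ?thesis unfolding bdd_Ck.simps by blast
  qed
  {
    case 0
    then show ?case by (rule \<open>\<And>F \<kappa> M. holo_bdd \<kappa> D B M F \<Longrightarrow> 0 < \<kappa> \<Longrightarrow> bdd_Ck 0 (Mreal D B) (real_part F)\<close>)
  next
    case (Suc k)
    have "bdd_Ck k (Mreal D B) (\<lambda>x. frechet_derivative (real_part F) (at x) v)" for v
    proof (rule bdd_Ck_cong[OF open_Mreal[OF DB]])
      \<comment> \<open>Then \<open>r * norm v\<close> is at most \<kappa> / 4 and fits into the
        half of the strip that is given up; the summand 1 covers \<open>v = 0\<close>.\<close>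
      define r where "r = \<kappa> / (4 * (norm v + 1))"
      have r: "0 < r" "r * norm v \<le> \<kappa> / 4"
        using Suc.prems(2) by (auto simp: r_def field_simps add_pos_nonneg intro!: divide_pos_pos)
      have "holo_bdd (\<kappa> / 2) D B (M / r) (\<lambda>z. frechet_derivative F (at z) (embed v))"
        by (rule holo_bdd_derivative[OF Suc.prems(1) r(1)]) (use r Suc.prems(2) in \<open>simp add: norm_embed\<close>)
      then show "bdd_Ck k (Mreal D B) (real_part (\<lambda>z. frechet_derivative F (at z) (embed v)))"
        by (rule Suc.IH) (use Suc.prems in simp)
    qed (simp add: frechet_derivative_real_part[OF Suc.prems])
    then show ?case using 0[OF Suc.prems] diff[OF Suc.prems] by (simp del: bdd_Ck.simps(1))
  }
qed

lemma dirs_deriv_real_part_le: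
  assumes DB: "open D" "open B" and F: "holo_bdd \<kappa> D B M F" and \<kappa>: "0 < \<kappa>" and vs: "set vs \<subseteq> Basis" "length vs \<le> 3"
    and x: "x \<in> Mreal D B"
  shows "\<bar>dirs_deriv vs (real_part F) x\<bar> \<le> M * (8 / \<kappa>) ^ length vs"
proof -
  \<comment> \<open>Each derivative along a unit vector costs a quarter of the strip, with Cauchy
    radius \<kappa> / 8 inside it; after three derivatives a quarter is left.\<close>
  have "\<exists>F'. holo_bdd (\<kappa> * (1 - length vs / 4)) D B (M * (8 / \<kappa>) ^ length vs) F' \<and>
      (\<forall>x\<in>Mreal D B. dirs_deriv vs (real_part F) x = real_part F' x)"
    using vs
  proof (induction vs)
    case Nil
    then show ?case using F by auto
  next
    case (Cons v vs)
    then obtain F' where F': "holo_bdd (\<kappa> * (1 - length vs / 4)) D B (M * (8 / \<kappa>) ^ length vs) F'"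
      "\<forall>x\<in>Mreal D B. dirs_deriv vs (real_part F) x = real_part F' x" by auto
    have pos: "0 < \<kappa> * (1 - length vs / 4)" using \<kappa> Cons.prems by simp
    have nv: "norm (embed v) = 1" using Cons.prems by (simp add: norm_embed)
    have "holo_bdd (\<kappa> * (1 - length (v # vs) / 4)) D B (M * (8 / \<kappa>) ^ length vs / (\<kappa> / 8))
        (\<lambda>z. frechet_derivative F' (at z) (embed v))"
      by (rule holo_bdd_derivative[OF F'(1)]) (use \<kappa> nv in \<open>auto simp: field_simps\<close>)
    moreover have "M * (8 / \<kappa>) ^ length vs / (\<kappa> / 8) = M * (8 / \<kappa>) ^ length (v # vs)" by simp
    moreover have "dirs_deriv (v # vs) (real_part F) x = real_part (\<lambda>z. frechet_derivative F' (at z) (embed v)) x"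
      if "x \<in> Mreal D B" for x
      using frechet_derivative_cong_open(1)[OF open_Mreal[OF DB] that, of "dirs_deriv vs (real_part F)" "real_part F'"]
        F'(2) frechet_derivative_real_part[OF F'(1) pos that] by simp
    ultimately show ?case by metis
  qed
  then obtain F' where F': "holo_bdd (\<kappa> * (1 - length vs / 4)) D B (M * (8 / \<kappa>) ^ length vs) F'"
    "\<forall>x\<in>Mreal D B. dirs_deriv vs (real_part F) x = real_part F' x" by auto
  have "0 < \<kappa> * (1 - length vs / 4)" using \<kappa> vs by simp
  from embed_in_Mkappa[OF this x] have "cmod (F' (embed x)) \<le> M * (8 / \<kappa>) ^ length vs"
    using F'(1) unfolding holo_bdd_def by blast
  then show ?thesis using F'(2) x abs_Re_le_cmod[of "F' (embed x)"] by (simp add: real_part_def)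
qed

text \<open>The Cauchy estimates bound the set whose supremum is \<open>C3_norm\<close>, so that the
  supremum dominates its elements. The second claim says that the \<kappa> topology is at least as
  fine as the \<open>C\<^sup>3\<close> topology.\<close>

lemma
  fixes f :: "('n::finite, 'd::finite) cphase \<Rightarrow> complex"
  assumes DB: "open D" "open B" and ne: "D \<noteq> {}" "B \<noteq> {}" and f: "f \<in> Comega \<kappa> D B" and \<kappa>: "0 < \<kappa>"
  shows dirs_deriv_le_C3_norm:
      "set vs \<subseteq> Basis \<Longrightarrow> length vs \<le> 3 \<Longrightarrow> x \<in> Mreal D B \<Longrightarrow> \<bar>dirs_deriv vs (real_part f) x\<bar> \<le> C3_norm D B f"
    and C3_norm_le_kappa_norm: "C3_norm D B f \<le> max 1 (8 / \<kappa>) ^ 3 * kappa_norm \<kappa> D B f"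
proof -
  let ?S = "{\<bar>dirs_deriv vs (real_part f) x\<bar> | vs x. length vs \<le> 3 \<and> set vs \<subseteq> Basis \<and> x \<in> Mreal D B}"
  note F = Comega_holo_bdd[OF f]
  obtain pp II where "pp \<in> D" "II \<in> B" using ne by blast
  then obtain x0 :: "('n, 'd) rphase" where x0: "x0 \<in> Mreal D B"
    using that[of "(pp, 0, II, 0, 0)"] by (simp add: Mreal_def)
  have K: "0 \<le> kappa_norm \<kappa> D B f"
    using F embed_in_Mkappa[OF \<kappa> x0] unfolding holo_bdd_def by (meson norm_ge_zero order_trans)
  have b: "s \<le> max 1 (8 / \<kappa>) ^ 3 * kappa_norm \<kappa> D B f" if s0: "s \<in> ?S" for s
  proof -
    obtain vs x where s: "s = \<bar>dirs_deriv vs (real_part f) x\<bar>" "length vs \<le> 3" "set vs \<subseteq> Basis" "x \<in> Mreal D B"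
      using s0 by blast
    have "s \<le> kappa_norm \<kappa> D B f * (8 / \<kappa>) ^ length vs"
      unfolding s(1) by (rule dirs_deriv_real_part_le[OF DB F \<kappa> s(3,2,4)])
    also have "\<dots> \<le> kappa_norm \<kappa> D B f * max 1 (8 / \<kappa>) ^ 3"
    proof (rule mult_left_mono[OF _ K])
      have "(8 / \<kappa>) ^ length vs \<le> max 1 (8 / \<kappa>) ^ length vs" using \<kappa> by (intro power_mono) auto
      also have "\<dots> \<le> max 1 (8 / \<kappa>) ^ 3" using s(2) by (intro power_increasing) auto
      finally show "(8 / \<kappa>) ^ length vs \<le> max 1 (8 / \<kappa>) ^ 3" .
    qed
    finally show ?thesis by (simp add: mult.commute)
  qed
  then have bdd: "bdd_above ?S" unfolding bdd_above_def by blast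
  show "\<bar>dirs_deriv vs (real_part f) x\<bar> \<le> C3_norm D B f"
    if "set vs \<subseteq> Basis" "length vs \<le> 3" "x \<in> Mreal D B" for vs x
    unfolding C3_norm_def by (rule cSup_upper[OF _ bdd]) (use that in blast)
  show "C3_norm D B f \<le> max 1 (8 / \<kappa>) ^ 3 * kappa_norm \<kappa> D B f"
    unfolding C3_norm_def
  proof (rule cSup_least)
    have "\<bar>dirs_deriv [] (real_part f) x0\<bar> \<in> ?S" using x0 by (intro CollectI exI[of _ "[]"] exI[of _ x0]) simp
    then show "?S \<noteq> {}" by blast
  qed (rule b)
qed

section \<open>Operations on \<open>Comega\<close> and periodicity\<close>

lemma Comega_add:
  assumes "f \<in> Comega \<kappa> D B" "g \<in> Comega \<kappa> D B"
  shows "(\<lambda>z. f z + g z) \<in> Comega \<kappa> D B"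
proof -
  have "cphase_holomorphic_on (Mkappa \<kappa> D B) (\<lambda>z. f z + g z)"
    unfolding cphase_holomorphic_on_def
  proof
    fix z assume z: "z \<in> Mkappa \<kappa> D B"
    obtain f' where f': "(f has_derivative f') (at z)" "\<And>c v. f' (cscale c v) = c * f' v"
      using assms(1) z unfolding Comega_def cphase_holomorphic_on_def by blast
    obtain g' where g': "(g has_derivative g') (at z)" "\<And>c v. g' (cscale c v) = c * g' v"
      using assms(2) z unfolding Comega_def cphase_holomorphic_on_def by blast
    show "\<exists>h'. ((\<lambda>z. f z + g z) has_derivative h') (at z) \<and> (\<forall>c v. h' (cscale c v) = c * h' v)"
      by (rule exI[of _ "\<lambda>v. f' v + g' v"]) (use f' g' in \<open>auto intro!: has_derivative_add simp: distrib_left\<close>)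
  qed
  moreover have "bounded ((\<lambda>z. f z + g z) ` Mkappa \<kappa> D B)"
    using assms unfolding Comega_def by (auto intro: bounded_plus_comp)
  ultimately show ?thesis
    using assms unfolding Comega_def cphase_periodic_on_def by auto
qed

lemma Comega_uminus:
  assumes "f \<in> Comega \<kappa> D B"
  shows "(\<lambda>z. - f z) \<in> Comega \<kappa> D B"
proof -
  have "cphase_holomorphic_on (Mkappa \<kappa> D B) (\<lambda>z. - f z)"
    unfolding cphase_holomorphic_on_def
  proof
    fix z assume z: "z \<in> Mkappa \<kappa> D B"
    obtain f' where f': "(f has_derivative f') (at z)" "\<And>c v. f' (cscale c v) = c * f' v"
      using assms(1) z unfolding Comega_def cphase_holomorphic_on_def by blast
    show "\<exists>h'. ((\<lambda>z. - f z) has_derivative h') (at z) \<and> (\<forall>c v. h' (cscale c v) = c * h' v)"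
      by (rule exI[of _ "\<lambda>v. - f' v"]) (use f' in \<open>auto intro!: has_derivative_minus\<close>)
  qed
  moreover have "bounded ((\<lambda>z. - f z) ` Mkappa \<kappa> D B)"
    using assms bounded_uminus[of "f ` Mkappa \<kappa> D B"] unfolding Comega_def by (simp add: image_image)
  ultimately show ?thesis
    using assms unfolding Comega_def cphase_periodic_on_def by auto
qed

lemma Comega_diff:
  assumes "f \<in> Comega \<kappa> D B" "g \<in> Comega \<kappa> D B"
  shows "(\<lambda>z. f z - g z) \<in> Comega \<kappa> D B"
  using Comega_add[OF assms(1) Comega_uminus[OF assms(2)]] by simp

lemma cvec_add: "cvec (x + y) = cvec x + cvec y"
  by (rule linear_add[OF bounded_linear.linear[OF bounded_linear_cvec]])

lemma period_zero: "period (\<lambda>_. 0) = 0"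
  by (simp add: period_def vec_eq_iff)

lemma real_part_periodic:
  assumes "f \<in> Comega \<kappa> D B" "0 < \<kappa>" "p \<in> D" "I \<in> B"
  shows "real_part f (p, q + period k, I, \<phi> + period l, t + 2 * pi * of_int m) = real_part f (p, q, I, \<phi>, t)"
proof -
  have "(p, q, I, \<phi>, t) \<in> Mreal D B" using assms by (simp add: Mreal_def)
  from embed_in_Mkappa[OF assms(2) this] have "(cvec p, cvec q, cvec I, cvec \<phi>, complex_of_real t) \<in> Mkappa \<kappa> D B" by simp
  then have "f (cvec p, cvec q + cvec (period k), cvec I, cvec \<phi> + cvec (period l), complex_of_real t + complex_of_real (2 * pi * of_int m))
      = f (cvec p, cvec q, cvec I, cvec \<phi>, complex_of_real t)"
    using assms(1) unfolding Comega_def cphase_periodic_on_def by blast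
  then show ?thesis by (simp add: real_part_def cvec_add)
qed

text \<open>The features of a real perturbation that survive differentiation. Periodicity in
  \<open>q\<close> is recorded because lifted orbits end at multiples of \<open>2 * pi\<close>, yet
  are compared with the rest point at 0.\<close>

definition nice :: "(real^'n) set \<Rightarrow> (real^'d) set \<Rightarrow> (('n::finite, 'd::finite) rphase \<Rightarrow> real) \<Rightarrow> bool" where
  "nice D B g \<longleftrightarrow> (\<forall>k. bdd_Ck k (Mreal D B) g) \<and>
     (\<forall>x\<in>Mreal D B. \<forall>k. g (x + (0, period k, 0)) = g x)"

lemma nice_real_part:
  assumes "open D" "open B" "f \<in> Comega \<kappa> D B" "0 < \<kappa>"
  shows "nice D B (real_part f)"
  unfolding nice_def
proof (intro conjI allI ballI)
  show "bdd_Ck k (Mreal D B) (real_part f)" for k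
    by (rule bdd_Ck_real_part[OF assms(1,2) Comega_holo_bdd[OF assms(3)] assms(4)])
  fix x :: "('a, 'b) rphase" and k assume "x \<in> Mreal D B"
  then show "real_part f (x + (0, period k, 0)) = real_part f x"
    using real_part_periodic[OF assms(3,4), of "fst x" "fst (snd (snd x))" "fst (snd x)" k "fst (snd (snd (snd x)))" "\<lambda>_. 0" "snd (snd (snd (snd x)))" 0]
    by (cases x) (auto simp: Mreal_def period_zero zero_prod_def)
qed

lemma nice_derivative:
  assumes "open D" "open B" "nice D B g"
  shows "nice D B (\<lambda>x. frechet_derivative g (at x) v)"
  unfolding nice_def
proof (intro conjI allI ballI)
  show "bdd_Ck k (Mreal D B) (\<lambda>x. frechet_derivative g (at x) v)" for k
    using assms(3) unfolding nice_def by (intro bdd_Ck_SucD(1)) blast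
  fix x :: "('a, 'b) rphase" and k assume x: "x \<in> Mreal D B"
  let ?s = "(0, period k, 0) :: ('a, 'b) rphase"
  have sx: "x + ?s \<in> Mreal D B" using x by (cases x) (auto simp: Mreal_def zero_prod_def)
  have "g differentiable at (x + ?s)"
    using assms(3) sx bdd_Ck_SucD(2)[of 0] unfolding nice_def by blast
  then have "(g has_derivative frechet_derivative g (at (x + ?s))) (at (x + ?s))"
    by (rule differentiable_has_derivative)
  moreover have "((\<lambda>x. x + ?s) has_derivative (\<lambda>v. v)) (at x)"
    by (auto intro!: derivative_eq_intros)
  ultimately have "((\<lambda>x. g (x + ?s)) has_derivative frechet_derivative g (at (x + ?s))) (at x)"
    using has_derivative_compose by blast
  then have "(g has_derivative frechet_derivative g (at (x + ?s))) (at x)"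
    by (rule has_derivative_transform_within_open[OF _ open_Mreal[OF assms(1,2)] x])
      (use assms(3) in \<open>auto simp: nice_def\<close>)
  then show "frechet_derivative g (at (x + ?s)) v = frechet_derivative g (at x) v"
    by (simp add: frechet_derivative_eqI)
qed

section \<open>Pendulums and their homoclinic orbits\<close>

lemma Ck_on_deriv:
  fixes V :: "real \<Rightarrow> real"
  assumes "Ck_on (Suc k) UNIV V"
  shows "Ck_on k UNIV (deriv V)" and "(V has_real_derivative deriv V x) (at x)"
proof -
  have D: "(V has_real_derivative deriv V x) (at x)" for x
  proof -
    have "V differentiable at x" using assms by simp
    then show ?thesis
      using DERIV_deriv_iff_real_differentiable[of V x] by simp
  qed
  then show "(V has_real_derivative deriv V x) (at x)" .
  have "Ck_on k UNIV (\<lambda>x. frechet_derivative V (at x) 1)" using assms by simp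
  moreover have "frechet_derivative V (at x) 1 = deriv V x" for x
    using frechet_derivative_eqI[OF D[of x, unfolded has_field_derivative_def]] by simp
  ultimately show "Ck_on k UNIV (deriv V)" by simp
qed

lemma periodic_int:
  assumes "\<And>x :: real. f (x + 2 * pi) = f x"
  shows "f (x + 2 * pi * of_int k) = (f x :: real)"
proof -
  have nat: "f (x + 2 * pi * of_nat n) = f x" for x n
  proof (induction n)
    case (Suc n)
    have "f (x + 2 * pi * of_nat (Suc n)) = f ((x + 2 * pi * of_nat n) + 2 * pi)" by (simp add: algebra_simps)
    then show ?case using assms Suc by simp
  qed simp
  show ?thesis
  proof (cases "k \<ge> 0")
    case True
    then show ?thesis using nat[of x "nat k"] by simp
  next
    case False
    then show ?thesis using nat[of "x + 2 * pi * of_int k" "nat (- k)"] by simp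
  qed
qed

lemma reduce_angle: "\<exists>k::int. x + 2 * pi * of_int k \<in> {0..2 * pi}"
proof -
  let ?k = "- \<lfloor>x / (2 * pi)\<rfloor>"
  have "of_int \<lfloor>x / (2 * pi)\<rfloor> \<le> x / (2 * pi)" "x / (2 * pi) < of_int \<lfloor>x / (2 * pi)\<rfloor> + 1" by linarith+
  then have "of_int \<lfloor>x / (2 * pi)\<rfloor> * (2 * pi) \<le> x" "x < (of_int \<lfloor>x / (2 * pi)\<rfloor> + 1) * (2 * pi)"
    by (simp_all only: pos_le_divide_eq pos_divide_less_eq pi_gt_zero zero_less_mult_iff zero_less_numeral simp_thms)
  then have "x + 2 * pi * of_int ?k \<in> {0..2 * pi}" by (simp add: algebra_simps)
  then show ?thesis by blast
qed

locale pendulum =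
  fixes r :: regularity and V :: "real \<Rightarrow> real"
  assumes r: "at_least_three r" and V: "pendulum_potential r V"
begin

lemma order_le_r: "k \<le> 3 \<Longrightarrow> order_le k r"
  using r by (cases r) (auto simp: at_least_three_def)

lemma Ck_V: "order_le k r \<Longrightarrow> Ck_on k UNIV V"
  using V unfolding pendulum_potential_def by (intro regular_on_imp_Ck_on[of UNIV r]) auto

lemma DV: "(V has_real_derivative deriv V x) (at x)"
  using Ck_on_deriv(2)[of 0] Ck_V[OF order_le_r, of 1] by simp

lemma DV': "(deriv V has_real_derivative deriv (deriv V) x) (at x)"
  using Ck_on_deriv(2)[OF Ck_on_deriv(1)[of "Suc 0"]] Ck_V[OF order_le_r, of "Suc (Suc 0)"] by simp

lemma cont_V'': "continuous_on UNIV (deriv (deriv V))"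
  using Ck_on_deriv(1)[OF Ck_on_deriv(1)[of "Suc 0"]] Ck_V[OF order_le_r, of "Suc (Suc 0)"] by simp

lemma V_periodic: "V (x + 2 * pi * of_int k) = V x"
  by (rule periodic_int) (use V in \<open>simp add: pendulum_potential_def\<close>)

lemma V'_periodic: "deriv V (x + 2 * pi * of_int k) = deriv V x"
proof -
  have "((\<lambda>x. V (x + 2 * pi * of_int k)) has_real_derivative deriv V (x + 2 * pi * of_int k)) (at x)"
    using DV[of "x + 2 * pi * of_int k"] by (simp add: DERIV_shift)
  then have "(V has_real_derivative deriv V (x + 2 * pi * of_int k)) (at x)"
    by (simp add: V_periodic)
  then show ?thesis using DV DERIV_unique by blast
qed

lemma V''_periodic: "deriv (deriv V) (x + 2 * pi * of_int k) = deriv (deriv V) x"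
proof -
  have "((\<lambda>x. deriv V (x + 2 * pi * of_int k)) has_real_derivative deriv (deriv V) (x + 2 * pi * of_int k)) (at x)"
    using DV'[of "x + 2 * pi * of_int k"] by (simp add: DERIV_shift)
  then have "(deriv V has_real_derivative deriv (deriv V) (x + 2 * pi * of_int k)) (at x)"
    by (simp add: V'_periodic)
  then show ?thesis using DV' DERIV_unique by blast
qed

lemma V_max: "V x \<le> V 0"
proof (cases "x \<in> range (\<lambda>k::int. 2 * pi * of_int k)")
  case True
  then show ?thesis using V_periodic[of 0] by auto
next
  case False
  then show ?thesis using V unfolding pendulum_potential_def by (simp add: less_imp_le)
qed

lemma V'_0: "deriv V 0 = 0"
  by (rule DERIV_local_max[OF DV, of 1]) (use V_max in auto)

lemma V''_bdd: obtains C where "C > 0" "\<And>x. \<bar>deriv (deriv V) x\<bar> \<le> C"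
proof -
  have "compact (deriv (deriv V) ` {0..2 * pi})"
    by (intro compact_continuous_image continuous_on_subset[OF cont_V'']) auto
  then obtain C where "\<forall>y\<in>deriv (deriv V) ` {0..2 * pi}. norm y \<le> C"
    using compact_imp_bounded bounded_iff by blast
  then have C: "\<And>x. x \<in> {0..2 * pi} \<Longrightarrow> \<bar>deriv (deriv V) x\<bar> \<le> C" by simp
  have "\<bar>deriv (deriv V) x\<bar> \<le> \<bar>C\<bar> + 1" for x
  proof -
    obtain k :: int where "x + 2 * pi * of_int k \<in> {0..2 * pi}" using reduce_angle by blast
    then show ?thesis using C[of "x + 2 * pi * of_int k"] V''_periodic[of x k] by auto
  qed
  then show ?thesis using that[of "\<bar>C\<bar> + 1"] by simp
qed

lemma V'_bound:
  assumes "\<And>x. \<bar>deriv (deriv V) x\<bar> \<le> C"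
  shows "\<bar>deriv V (2 * pi * of_int k + x)\<bar> \<le> C * \<bar>x\<bar>"
proof -
  have "\<bar>deriv V x - deriv V 0\<bar> \<le> C * \<bar>x - 0\<bar>"
    by (rule field_differentiable_bound[of UNIV "deriv V" "deriv (deriv V)" C x 0, unfolded real_norm_def])
      (use assms DV' in \<open>auto intro: has_field_derivative_at_within\<close>)
  then show ?thesis using V'_periodic[of x k] by (simp add: V'_0 add.commute)
qed

lemma V_gap_le:
  assumes "\<And>x. \<bar>deriv (deriv V) x\<bar> \<le> C"
  shows "V 0 - V (2 * pi * of_int k + x) \<le> C * x\<^sup>2"
proof -
  have "\<bar>V x - V 0\<bar> \<le> (C * \<bar>x\<bar>) * \<bar>x - 0\<bar>"
  proof (rule field_differentiable_bound[of "closed_segment 0 x" V "deriv V" "C * \<bar>x\<bar>" x 0, unfolded real_norm_def])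
    fix y assume "y \<in> closed_segment 0 x"
    then have "\<bar>y\<bar> \<le> \<bar>x\<bar>" by (auto simp: closed_segment_eq_real_ivl split: if_splits)
    moreover have "0 \<le> C" using assms[of 0] by linarith
    ultimately have "C * \<bar>y\<bar> \<le> C * \<bar>x\<bar>" by (rule mult_left_mono)
    then show "\<bar>deriv V y\<bar> \<le> C * \<bar>x\<bar>" using V'_bound[OF assms, of 0 y] by simp
  qed (auto intro: has_field_derivative_at_within DV)
  also have "(C * \<bar>x\<bar>) * \<bar>x - 0\<bar> = C * x\<^sup>2"
    by (simp add: power2_eq_square mult.assoc flip: abs_mult)
  finally show ?thesis using V_periodic[of x k] by (simp add: add.commute)
qed

lemma V_gap_ge: obtains a \<delta> where "a > 0" "\<delta> > 0" "\<And>x k. \<bar>x\<bar> < \<delta> \<Longrightarrow> a * x\<^sup>2 \<le> V 0 - V (2 * pi * of_int k + x)"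
proof -
  \<comment> \<open>With half of the second derivative as margin, the second derivative of
    \<open>V\<close> stays below \<open>- b\<close> near 0, and Taylor's formula yields the constant
    \<open>b / 2\<close>.\<close>
  define b where "b = - deriv (deriv V) 0 / 2"
  have b: "b > 0" using V by (simp add: b_def pendulum_potential_def)
  obtain \<delta> where \<delta>: "\<delta> > 0" "\<And>x. \<bar>x\<bar> < \<delta> \<Longrightarrow> \<bar>deriv (deriv V) x - deriv (deriv V) 0\<bar> < b"
    using cont_V''[unfolded continuous_on_iff dist_real_def, rule_format, of 0 b] b by auto
  have neg: "deriv (deriv V) x \<le> - b" if "\<bar>x\<bar> < \<delta>" for x
    using \<delta>(2)[OF that] by (simp add: b_def abs_if split: if_splits)
  have "b / 2 * x\<^sup>2 \<le> V 0 - V (2 * pi * of_int k + x)" if x: "\<bar>x\<bar> < \<delta>" for x k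
  proof (cases "x = 0")
    case True
    then show ?thesis using V_periodic[of 0 k] by simp
  next
    case False
    have "\<exists>t. (if x < 0 then x < t \<and> t < 0 else 0 < t \<and> t < x) \<and>
      V x = (\<Sum>m<2. ((\<lambda>m. (deriv ^^ m) V) m 0) / fact m * (x - 0) ^ m) + ((deriv ^^ 2) V t) / fact 2 * (x - 0) ^ 2"
    proof (rule Taylor[of 2 "\<lambda>m. (deriv ^^ m) V" V "- \<bar>x\<bar>" "\<bar>x\<bar>"])
      show "\<forall>m t. m < 2 \<and> - \<bar>x\<bar> \<le> t \<and> t \<le> \<bar>x\<bar> \<longrightarrow> ((deriv ^^ m) V has_real_derivative (deriv ^^ Suc m) V t) (at t)"
        using DV DV' by (auto simp: less_2_cases_iff)
    qed (use False in auto)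
    then obtain t where t0: "if x < 0 then x < t \<and> t < 0 else 0 < t \<and> t < x"
      and t1: "V x = (\<Sum>m<2. ((\<lambda>m. (deriv ^^ m) V) m 0) / fact m * (x - 0) ^ m) + ((deriv ^^ 2) V t) / fact 2 * (x - 0) ^ 2"
      by blast
    have t: "\<bar>t\<bar> < \<bar>x\<bar>" "V x = V 0 + deriv (deriv V) t / 2 * x\<^sup>2"
      using t0 t1 by (auto simp: numeral_2_eq_2 V'_0 split: if_splits)
    have "deriv (deriv V) t \<le> - b" using neg t x by auto
    then have "deriv (deriv V) t / 2 * x\<^sup>2 \<le> - b / 2 * x\<^sup>2" by (intro mult_right_mono) auto
    then show ?thesis using t V_periodic[of x k] by (simp add: add.commute)
  qed
  then show ?thesis using that[of "b / 2" \<delta>] b \<delta> by auto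
qed

end

section \<open>Homoclinic orbits: energy, monotonicity, exponential decay\<close>

locale pendulum_orbit = pendulum +
  fixes \<sigma> :: real and p q :: "real \<Rightarrow> real"
  assumes \<sigma>: "\<sigma> = 1 \<or> \<sigma> = -1" and orbit: "homoclinic_orbit \<sigma> V p q"
begin

lemma Dq: "(q has_real_derivative \<sigma> * p t) (at t)"
  and Dp: "(p has_real_derivative - \<sigma> * deriv V (q t)) (at t)"
  using orbit unfolding homoclinic_orbit_def by auto

lemma continuous_q: "isCont q t" and continuous_p: "isCont p t"
  using DERIV_isCont Dq Dp by blast+

lemma \<sigma>_sq: "\<sigma> * \<sigma> = 1" "\<bar>\<sigma>\<bar> = 1"
  using \<sigma> by auto

text \<open>The energy is conserved; its value is read off at infinity, where \<open>p\<close> tends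
  to 0 and \<open>q\<close> to a maximum point of \<open>V\<close>.\<close>

lemma energy: "(p t)\<^sup>2 = 2 * (V 0 - V (q t))"
proof -
  let ?E = "\<lambda>t. (p t)\<^sup>2 / 2 + V (q t)"
  have "(?E has_real_derivative 0) (at t)" for t
  proof -
    have "((\<lambda>t. (p t)\<^sup>2 / 2) has_real_derivative p t * (- \<sigma> * deriv V (q t))) (at t)"
      by (auto intro!: derivative_eq_intros Dp)
    from DERIV_add[OF this DERIV_chain2[OF DV Dq]] show ?thesis by (simp add: algebra_simps)
  qed
  then have const: "?E t = ?E s" for t s by (intro DERIV_isconst_all) auto
  obtain k :: int where k: "(q \<longlongrightarrow> 2 * pi * of_int k) at_top" using orbit unfolding homoclinic_orbit_def by blast
  have "isCont V (2 * pi * of_int k)" using DV DERIV_isCont by blast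
  then have "((\<lambda>t. V (q t)) \<longlongrightarrow> V (2 * pi * of_int k)) at_top"
    using k isCont_tendsto_compose by blast
  moreover have "(p \<longlongrightarrow> 0) at_top" using orbit unfolding homoclinic_orbit_def by blast
  ultimately have "(?E \<longlongrightarrow> 0\<^sup>2 / 2 + V (2 * pi * of_int k)) at_top" by (intro tendsto_intros) auto
  moreover have "?E = (\<lambda>_. ?E t)" using const by blast
  ultimately have "((\<lambda>_::real. ?E t) \<longlongrightarrow> V 0) at_top" using V_periodic[of 0 k] by simp
  then have "?E t = V 0" by (simp add: tendsto_const_iff)
  then show ?thesis by simp
qed

text \<open>Uniqueness at the equilibrium by a Gronwall argument. For the distance \<open>u\<close>
  to the equilibrium angle, energy gives \<open>|p| \<le> b * |u|\<close>, so the square of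
  \<open>u\<close> times \<open>exp (- 2 * b * t)\<close> does not increase and its product with
  \<open>exp (2 * b * t)\<close> does not decrease. A zero of \<open>u\<close> would therefore make
  the orbit stationary in both time directions.\<close>

lemma q_ne: "q t0 \<noteq> 2 * pi * of_int k"
proof
  assume q0: "q t0 = 2 * pi * of_int k"
  obtain C where C: "C > 0" "\<And>x. \<bar>deriv (deriv V) x\<bar> \<le> C" by (rule V''_bdd) blast
  define u where "u = (\<lambda>t. q t - 2 * pi * of_int k)"
  define b where "b = sqrt (2 * C)"
  have b: "b > 0" using C by (simp add: b_def)
  have Du: "(u has_real_derivative \<sigma> * p t) (at t)" for t
    unfolding u_def by (auto intro!: derivative_eq_intros Dq)
  have pu: "\<bar>p t\<bar> \<le> b * \<bar>u t\<bar>" for t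
  proof -
    have "(p t)\<^sup>2 \<le> 2 * (C * (u t)\<^sup>2)"
      unfolding energy using V_gap_le[OF C(2), of k "u t"] by (simp add: u_def)
    also have "\<dots> = (b * \<bar>u t\<bar>)\<^sup>2" using C by (simp add: b_def power_mult_distrib)
    finally show ?thesis using b by (simp add: abs_le_square_iff[symmetric] abs_mult)
  qed
  have up: "\<bar>u t * (\<sigma> * p t)\<bar> \<le> b * (u t)\<^sup>2" for t
  proof -
    have "\<bar>u t * (\<sigma> * p t)\<bar> = \<bar>u t\<bar> * \<bar>p t\<bar>" by (simp add: abs_mult \<sigma>_sq)
    also have "\<dots> \<le> \<bar>u t\<bar> * (b * \<bar>u t\<bar>)" by (intro mult_left_mono pu) auto
    finally show ?thesis by (simp add: power2_eq_square mult_ac flip: abs_mult)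
  qed
  have "u t = 0" for t
  proof (cases "t \<ge> t0")
    case True
    have "(u t)\<^sup>2 * exp (- (2 * b) * t) \<le> (u t0)\<^sup>2 * exp (- (2 * b) * t0)"
    proof (rule DERIV_nonpos_imp_nonincreasing[OF True])
      fix x
      have "((\<lambda>t. (u t)\<^sup>2 * exp (- (2 * b) * t)) has_real_derivative
          2 * exp (- (2 * b) * x) * (u x * (\<sigma> * p x) - b * (u x)\<^sup>2)) (at x)"
        by (rule derivative_eq_intros Du refl)+ (simp add: power2_eq_square algebra_simps)
      moreover have "2 * exp (- (2 * b) * x) * (u x * (\<sigma> * p x) - b * (u x)\<^sup>2) \<le> 0"
        using up[of x] by (intro mult_nonneg_nonpos) auto
      ultimately show "\<exists>y. ((\<lambda>t. (u t)\<^sup>2 * exp (- (2 * b) * t)) has_real_derivative y) (at x) \<and> y \<le> 0" by blast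
    qed
    then have "(u t)\<^sup>2 * exp (- (2 * b) * t) \<le> 0" using q0 by (simp add: u_def)
    then have "(u t)\<^sup>2 \<le> 0" by (simp add: mult_le_0_iff)
    then show ?thesis by simp
  next
    case False
    then have le: "t \<le> t0" by simp
    have "(u t)\<^sup>2 * exp ((2 * b) * t) \<le> (u t0)\<^sup>2 * exp ((2 * b) * t0)"
    proof (rule DERIV_nonneg_imp_nondecreasing[OF le])
      fix x
      have "((\<lambda>t. (u t)\<^sup>2 * exp ((2 * b) * t)) has_real_derivative
          2 * exp ((2 * b) * x) * (u x * (\<sigma> * p x) + b * (u x)\<^sup>2)) (at x)"
        by (rule derivative_eq_intros Du refl)+ (simp add: power2_eq_square algebra_simps)
      moreover have "2 * exp ((2 * b) * x) * (u x * (\<sigma> * p x) + b * (u x)\<^sup>2) \<ge> 0"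
        using up[of x] by (intro mult_nonneg_nonneg) auto
      ultimately show "\<exists>y. ((\<lambda>t. (u t)\<^sup>2 * exp ((2 * b) * t)) has_real_derivative y) (at x) \<and> y \<ge> 0" by blast
    qed
    then have "(u t)\<^sup>2 * exp ((2 * b) * t) \<le> 0" using q0 by (simp add: u_def)
    then have "(u t)\<^sup>2 \<le> 0" by (simp add: mult_le_0_iff)
    then show ?thesis by simp
  qed
  then have "q t = 2 * pi * of_int k \<and> p t = 0" for t
    using pu[of t] by (simp add: u_def) 
  then have "(p t, q t) \<in> range (\<lambda>k::int. (0, 2 * pi * of_int k))" for t by auto
  then show False using orbit unfolding homoclinic_orbit_def by blast
qed

lemma p_ne: "p t \<noteq> 0"
proof
  assume "p t = 0"
  then have "V (q t) = V 0" using energy[of t] by simp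
  moreover have "V (q t) < V 0"
    using V q_ne[of t] unfolding pendulum_potential_def by auto
  ultimately show False by simp
qed

lemma velocity_sign: "(\<forall>t. \<sigma> * p t > 0) \<or> (\<forall>t. \<sigma> * p t < 0)"
proof (rule ccontr)
  assume "\<not> ?thesis"
  then obtain s t where s: "\<sigma> * p s \<le> 0" and t: "\<sigma> * p t \<ge> 0" by (meson not_less)
  have cont: "continuous_on A (\<lambda>t. \<sigma> * p t)" for A
    using continuous_p by (auto intro!: continuous_at_imp_continuous_on continuous_intros)
  have "\<exists>x. \<sigma> * p x = 0"
  proof (cases "s \<le> t")
    case True
    then show ?thesis using IVT'[of "\<lambda>t. \<sigma> * p t" s 0 t] s t cont by blast
  next
    case False
    then show ?thesis using IVT2'[of "\<lambda>t. \<sigma> * p t" s 0 t] s t cont by (meson le_cases)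
  qed
  then show False using p_ne \<sigma> by auto
qed

lemma q_strict_mono: "(\<forall>s t. s < t \<longrightarrow> q s < q t) \<or> (\<forall>s t. s < t \<longrightarrow> q t < q s)"
  using velocity_sign
proof (elim disjE)
  assume "\<forall>t. \<sigma> * p t > 0"
  then have "\<forall>s t. s < t \<longrightarrow> q s < q t" using DERIV_pos_imp_increasing[of _ _ q] Dq by blast
  then show ?thesis ..
next
  assume "\<forall>t. \<sigma> * p t < 0"
  then have "\<forall>s t. s < t \<longrightarrow> q t < q s" using DERIV_neg_imp_decreasing[of _ _ q] Dq by blast
  then show ?thesis ..
qed

text \<open>An interval of length at least \<open>2 * pi\<close> contains a multiple of
  \<open>2 * pi\<close>, which \<open>q\<close> would attain by continuity, against
  \<open>q_ne\<close>.\<close>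

lemma q_range: "\<bar>q t - q s\<bar> < 2 * pi"
proof (rule ccontr)
  have *: False if "q a + 2 * pi \<le> q b" for a b
  proof -
    define k where "k = \<lfloor>q b / (2 * pi)\<rfloor>"
    have "of_int k \<le> q b / (2 * pi)" "q b / (2 * pi) < of_int k + 1" unfolding k_def by linarith+
    then have "of_int k * (2 * pi) \<le> q b" "q b < (of_int k + 1) * (2 * pi)"
      by (simp_all only: pos_le_divide_eq pos_divide_less_eq pi_gt_zero zero_less_mult_iff zero_less_numeral simp_thms)
    then have k: "q a \<le> 2 * pi * of_int k" "2 * pi * of_int k \<le> q b" using that by (simp_all add: algebra_simps)
    have cont: "continuous_on A q" for A using continuous_q by (auto intro!: continuous_at_imp_continuous_on)
    have "\<exists>x. q x = 2 * pi * of_int k"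
    proof (cases "a \<le> b")
      case True
      then show ?thesis using IVT'[of q a "2 * pi * of_int k" b] k cont by blast
    next
      case False
      then show ?thesis using IVT2'[of q a "2 * pi * of_int k" b] k cont by (meson le_cases)
    qed
    then show False using q_ne by blast
  qed
  assume "\<not> ?thesis"
  then show False using *[of s t] *[of t s] by linarith
qed

text \<open>Near the limit the energy bounds the speed below by \<open>b * |u|\<close>, and the
  velocity always points towards the limit; hence the square of \<open>u\<close> times
  \<open>exp (2 * b * t)\<close> does not increase. The decay of \<open>p\<close> follows from the
  upper energy bound.\<close>

lemma decay_at_top:
  obtains c C k where "c > 0" "C \<ge> 0" "\<And>t. t \<ge> 0 \<Longrightarrow> \<bar>p t\<bar> \<le> C * exp (- c * t)"
    "\<And>t. t \<ge> 0 \<Longrightarrow> \<bar>q t - 2 * pi * of_int k\<bar> \<le> C * exp (- c * t)"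
proof -
  obtain k :: int where k: "(q \<longlongrightarrow> 2 * pi * of_int k) at_top" using orbit unfolding homoclinic_orbit_def by blast
  obtain C where C: "C > 0" "\<And>x. \<bar>deriv (deriv V) x\<bar> \<le> C" by (rule V''_bdd) blast
  obtain a \<delta> where a: "a > 0" "\<delta> > 0" "\<And>x k. \<bar>x\<bar> < \<delta> \<Longrightarrow> a * x\<^sup>2 \<le> V 0 - V (2 * pi * of_int k + x)" by (rule V_gap_ge) blast
  define u where "u = (\<lambda>t. q t - 2 * pi * of_int k)"
  define w where "w = (\<lambda>t. \<sigma> * p t)"
  have u0: "(u \<longlongrightarrow> 0) at_top" unfolding u_def using tendsto_diff[OF k tendsto_const[of "2 * pi * of_int k"]] by simp
  have Du: "(u has_real_derivative w t) (at t)" for t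
    unfolding u_def w_def by (auto intro!: derivative_eq_intros Dq)
  have wp: "\<bar>w t\<bar> = \<bar>p t\<bar>" for t by (simp add: w_def abs_mult \<sigma>_sq)
  obtain T where T: "T \<ge> 0" "\<And>t. t \<ge> T \<Longrightarrow> \<bar>u t\<bar> < \<delta>"
  proof -
    have "eventually (\<lambda>t. \<bar>u t\<bar> < \<delta>) at_top" using u0 a(2) by (auto simp: tendsto_iff dist_real_def)
    then obtain N where "\<And>t. t \<ge> N \<Longrightarrow> \<bar>u t\<bar> < \<delta>" unfolding eventually_at_top_linorder by blast
    then show ?thesis using that[of "max N 0"] by simp
  qed
  \<comment> \<open>The velocity has a constant sign, so \<open>u\<close> is strictly monotone with
    limit 0 and must have the opposite sign; this also makes \<open>|u|\<close>
    nonincreasing.\<close>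
  have sign: "u t * w t = - (\<bar>u t\<bar> * \<bar>w t\<bar>)" and mono: "s \<le> t \<Longrightarrow> \<bar>u t\<bar> \<le> \<bar>u s\<bar>" for s t
  proof -
    consider "\<forall>t. w t > 0" | "\<forall>t. w t < 0" using velocity_sign by (auto simp: w_def)
    then have "u t * w t = - (\<bar>u t\<bar> * \<bar>w t\<bar>) \<and> (s \<le> t \<longrightarrow> \<bar>u t\<bar> \<le> \<bar>u s\<bar>)"
    proof cases
      case 1
      have inc: "a < b \<Longrightarrow> u a < u b" for a b using DERIV_pos_imp_increasing[of a b u] Du 1 by blast
      have neg: "u t < 0" for t
      proof (rule ccontr)
        assume "\<not> u t < 0"
        then have "u (t + 1) > 0" using inc[of t "t + 1"] by simp
        moreover have "eventually (\<lambda>s. u (t + 1) \<le> u s) at_top"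
          unfolding eventually_at_top_linorder using inc by (metis less_eq_real_def)
        then have "u (t + 1) \<le> 0" by (rule tendsto_lowerbound[OF u0]) simp
        ultimately show False by simp
      qed
      show ?thesis using neg 1 inc[of s t] by (auto simp: abs_if less_eq_real_def not_less_iff_gr_or_eq intro: less_asym)
    next
      case 2
      have dec: "a < b \<Longrightarrow> u b < u a" for a b using DERIV_neg_imp_decreasing[of a b u] Du 2 by blast
      have pos: "u t > 0" for t
      proof (rule ccontr)
        assume "\<not> u t > 0"
        then have "u (t + 1) < 0" using dec[of t "t + 1"] by simp
        moreover have "eventually (\<lambda>s. u s \<le> u (t + 1)) at_top"
          unfolding eventually_at_top_linorder using dec by (metis less_eq_real_def)
        then have "0 \<le> u (t + 1)" by (rule tendsto_upperbound[OF u0]) simp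
        ultimately show False by simp
      qed
      show ?thesis using pos[of t] pos[of s] 2 dec[of s t] by (auto simp: abs_if less_eq_real_def not_less_iff_gr_or_eq intro: less_asym)
    qed
    then show "u t * w t = - (\<bar>u t\<bar> * \<bar>w t\<bar>)" "s \<le> t \<Longrightarrow> \<bar>u t\<bar> \<le> \<bar>u s\<bar>" by auto
  qed
  define b where "b = sqrt (2 * a)"
  have b: "b > 0" using a by (simp add: b_def)
  have wu: "b * \<bar>u t\<bar> \<le> \<bar>w t\<bar>" if "t \<ge> T" for t
  proof -
    have "(b * \<bar>u t\<bar>)\<^sup>2 = 2 * (a * (u t)\<^sup>2)" using a by (simp add: b_def power_mult_distrib)
    also have "\<dots> \<le> (p t)\<^sup>2" unfolding energy using a(3)[OF T(2)[OF that], of k] by (simp add: u_def)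
    finally show ?thesis using b by (simp add: wp abs_le_square_iff[symmetric] abs_mult)
  qed
  have uT: "\<bar>u t\<bar> \<le> \<bar>u T\<bar> * exp (b * T) * exp (- b * t)" if t: "t \<ge> T" for t
  proof -
    have "(u t)\<^sup>2 * exp ((2 * b) * t) \<le> (u T)\<^sup>2 * exp ((2 * b) * T)"
    proof (rule DERIV_nonpos_imp_nonincreasing[OF t])
      fix x assume x: "T \<le> x"
      have "((\<lambda>t. (u t)\<^sup>2 * exp ((2 * b) * t)) has_real_derivative
          2 * exp ((2 * b) * x) * (u x * w x + b * (u x)\<^sup>2)) (at x)"
        by (rule derivative_eq_intros Du refl)+ (simp add: power2_eq_square algebra_simps)
      moreover have "u x * w x + b * (u x)\<^sup>2 \<le> 0"
      proof -
        have "b * (u x)\<^sup>2 = \<bar>u x\<bar> * (b * \<bar>u x\<bar>)" by (simp add: power2_eq_square mult_ac flip: abs_mult)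
        also have "\<dots> \<le> \<bar>u x\<bar> * \<bar>w x\<bar>" by (intro mult_left_mono wu x) auto
        finally show ?thesis by (simp add: sign)
      qed
      then have "2 * exp ((2 * b) * x) * (u x * w x + b * (u x)\<^sup>2) \<le> 0" by (intro mult_nonneg_nonpos) auto
      ultimately show "\<exists>y. ((\<lambda>t. (u t)\<^sup>2 * exp ((2 * b) * t)) has_real_derivative y) (at x) \<and> y \<le> 0" by blast
    qed
    then have "(u t * exp (b * t))\<^sup>2 \<le> (u T * exp (b * T))\<^sup>2"
      by (simp add: power_mult_distrib exp_double mult.assoc)
    then have "\<bar>u t\<bar> * exp (b * t) \<le> \<bar>u T\<bar> * exp (b * T)"
      by (simp add: abs_le_square_iff[symmetric] abs_mult)
    then have "\<bar>u t\<bar> * exp (b * t) * exp (- b * t) \<le> \<bar>u T\<bar> * exp (b * T) * exp (- b * t)"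
      by (rule mult_right_mono) simp
    then show ?thesis by (simp add: mult.assoc exp_minus_inverse flip: exp_minus)
  qed
  \<comment> \<open>Before \<open>T\<close> only the monotonicity of \<open>|u|\<close> is
    available; the factor \<open>exp (b * T)\<close> makes the exponential bound hold there as
    well.\<close>
  define K where "K = \<bar>u 0\<bar> * exp (b * T)"
  have u: "\<bar>u t\<bar> \<le> K * exp (- b * t)" if t: "t \<ge> 0" for t
  proof (cases "t \<ge> T")
    case True
    have "\<bar>u T\<bar> * exp (b * T) * exp (- b * t) \<le> K * exp (- b * t)"
      unfolding K_def using mono[OF T(1)] by (intro mult_right_mono) auto
    then show ?thesis using uT[OF True] by linarith
  next
    case False
    have "1 \<le> exp (b * T) * exp (- b * t)" using False b by (simp flip: exp_add)
    then have "\<bar>u 0\<bar> * 1 \<le> \<bar>u 0\<bar> * (exp (b * T) * exp (- b * t))" by (intro mult_left_mono) auto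
    then show ?thesis using mono[OF t] by (simp add: K_def mult.assoc)
  qed
  have p: "\<bar>p t\<bar> \<le> sqrt (2 * C) * \<bar>u t\<bar>" for t
  proof -
    have "(p t)\<^sup>2 \<le> 2 * (C * (u t)\<^sup>2)"
      unfolding energy using V_gap_le[OF C(2), of k "u t"] by (simp add: u_def)
    also have "\<dots> = (sqrt (2 * C) * \<bar>u t\<bar>)\<^sup>2" using C by (simp add: power_mult_distrib)
    finally show ?thesis using C by (simp add: abs_le_square_iff[symmetric] abs_mult)
  qed
  show ?thesis
  proof (rule that[OF b])
    have K: "K \<ge> 0" by (simp add: K_def)
    let ?C = "(sqrt (2 * C) + 1) * K"
    show "?C \<ge> 0" using K C by (intro mult_nonneg_nonneg add_nonneg_nonneg) auto
    fix t :: real assume t: "t \<ge> 0"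
    have "\<bar>p t\<bar> \<le> sqrt (2 * C) * (K * exp (- b * t))"
      by (rule order_trans[OF p mult_left_mono[OF u[OF t]]]) (use C in simp)
    also have "\<dots> \<le> ?C * exp (- b * t)" using K by (simp add: algebra_simps)
    finally show "\<bar>p t\<bar> \<le> ?C * exp (- b * t)" .
    have "K * exp (- b * t) \<le> ?C * exp (- b * t)" using K C by (intro mult_right_mono) (simp_all add: algebra_simps)
    then show "\<bar>q t - 2 * pi * of_int k\<bar> \<le> ?C * exp (- b * t)" using u[OF t] by (simp add: u_def)
  qed
qed

text \<open>Time reversal changes the sign of the momentum and keeps \<sigma>. It reduces decay at
  minus infinity to decay at plus infinity.\<close>

lemma reversed: "pendulum_orbit r V \<sigma> (\<lambda>t. - p (- t)) (\<lambda>t. q (- t))"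
proof
  show "homoclinic_orbit \<sigma> V (\<lambda>t. - p (- t)) (\<lambda>t. q (- t))"
    unfolding homoclinic_orbit_def
  proof (intro conjI allI)
    fix t
    show "((\<lambda>t. q (- t)) has_real_derivative \<sigma> * - p (- t)) (at t)"
      using Dq[of "- t"] by (simp add: DERIV_mirror)
    show "((\<lambda>t. - p (- t)) has_real_derivative - \<sigma> * deriv V (q (- t))) (at t)"
      using DERIV_minus[OF iffD1[OF DERIV_mirror Dp[of "- t"]]] by simp
  next
    have p: "(p \<longlongrightarrow> 0) at_top" "(p \<longlongrightarrow> 0) at_bot" using orbit unfolding homoclinic_orbit_def by auto
    show "((\<lambda>t. - p (- t)) \<longlongrightarrow> 0) at_top"
      using tendsto_minus[OF p(2)[unfolded filterlim_at_bot_mirror]] by simp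
    show "((\<lambda>t. - p (- t)) \<longlongrightarrow> 0) at_bot"
      using tendsto_minus[OF p(1)[unfolded filterlim_at_top_mirror]] by simp
    obtain k1 k2 :: int where k: "(q \<longlongrightarrow> 2 * pi * of_int k1) at_top" "(q \<longlongrightarrow> 2 * pi * of_int k2) at_bot"
      using orbit unfolding homoclinic_orbit_def by auto
    show "\<exists>k::int. ((\<lambda>t. q (- t)) \<longlongrightarrow> 2 * pi * of_int k) at_top"
      using k(2)[unfolded filterlim_at_bot_mirror] by blast
    show "\<exists>k::int. ((\<lambda>t. q (- t)) \<longlongrightarrow> 2 * pi * of_int k) at_bot"
      using k(1)[unfolded filterlim_at_top_mirror] by blast
    show "\<exists>t. (- p (- t), q (- t)) \<notin> range (\<lambda>k::int. (0, 2 * pi * of_int k))"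
      using p_ne by (intro exI[of _ 0]) auto
  qed
qed (rule \<sigma>)

lemma decay:
  obtains c C k where "c > 0" "C \<ge> 0" "\<And>t. \<bar>p t\<bar> \<le> C * exp (- c * \<bar>t\<bar>)"
    "\<And>t. \<bar>q t - 2 * pi * of_int (k t)\<bar> \<le> C * exp (- c * \<bar>t\<bar>)"
proof -
  interpret rev: pendulum_orbit r V \<sigma> "\<lambda>t. - p (- t)" "\<lambda>t. q (- t)" by (rule reversed)
  obtain c1 C1 k1 where 1: "c1 > 0" "C1 \<ge> 0" "\<And>t. t \<ge> 0 \<Longrightarrow> \<bar>p t\<bar> \<le> C1 * exp (- c1 * t)"
    "\<And>t. t \<ge> 0 \<Longrightarrow> \<bar>q t - 2 * pi * of_int k1\<bar> \<le> C1 * exp (- c1 * t)" by (rule decay_at_top) blast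
  obtain c2 C2 k2 where 2: "c2 > 0" "C2 \<ge> 0" "\<And>t. t \<ge> 0 \<Longrightarrow> \<bar>- p (- t)\<bar> \<le> C2 * exp (- c2 * t)"
    "\<And>t. t \<ge> 0 \<Longrightarrow> \<bar>q (- t) - 2 * pi * of_int k2\<bar> \<le> C2 * exp (- c2 * t)" by (rule rev.decay_at_top) blast
  define c C where "c = min c1 c2" and "C = max C1 C2"
  have le: "C1 * exp (- c1 * \<bar>t\<bar>) \<le> C * exp (- c * \<bar>t\<bar>)" "C2 * exp (- c2 * \<bar>t\<bar>) \<le> C * exp (- c * \<bar>t\<bar>)" for t
    using 1(2) 2(2) by (auto intro!: mult_mono mult_right_mono simp: c_def C_def)
  \<comment> \<open>The two ends may be different lifts of the equilibrium, so the integer depends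
    on the sign of \<open>t\<close>.\<close>
  show ?thesis
  proof (rule that[of c C "\<lambda>t. if t \<ge> 0 then k1 else k2"])
    show "c > 0" "C \<ge> 0" using 1 2 by (auto simp: c_def C_def)
    fix t
    show "\<bar>p t\<bar> \<le> C * exp (- c * \<bar>t\<bar>)"
    proof (cases "t \<ge> 0")
      case True
      then show ?thesis using 1(3)[of t] le(1)[of t] by simp
    next
      case False
      then show ?thesis using 2(3)[of "- t"] le(2)[of t] by simp
    qed
    show "\<bar>q t - 2 * pi * of_int (if t \<ge> 0 then k1 else k2)\<bar> \<le> C * exp (- c * \<bar>t\<bar>)"
    proof (cases "t \<ge> 0")
      case True
      then show ?thesis using 1(4)[of t] le(1)[of t] by simp
    next
      case False
      then show ?thesis using 2(4)[of "- t"] le(2)[of t] by simp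
    qed
  qed
qed

end

text \<open>The phase \<open>\<phi> + t \<omega>(I)\<close> and its derivatives in \<open>I\<close> grow at most linearly in \<open>t\<close>, whereas the momenta and
  the velocities decay exponentially; products of slow and fast functions are fast.\<close>
definition slow_weights :: "(real \<Rightarrow> real) set" where
  "slow_weights = {g \<in> borel_measurable borel. \<forall>\<epsilon>>0. \<exists>C. \<forall>t. \<bar>g t\<bar> \<le> C * exp (\<epsilon> * \<bar>t\<bar>)}"

definition fast_weights :: "(real \<Rightarrow> real) set" where
  "fast_weights = {g \<in> borel_measurable borel. \<exists>c>0. \<exists>C. \<forall>t. \<bar>g t\<bar> \<le> C * exp (- c * \<bar>t\<bar>)}"

lemma slow_weightsI:
  "g \<in> borel_measurable borel \<Longrightarrow> (\<And>\<epsilon>. \<epsilon> > 0 \<Longrightarrow> \<exists>C. \<forall>t. \<bar>g t\<bar> \<le> C * exp (\<epsilon> * \<bar>t\<bar>)) \<Longrightarrow> g \<in> slow_weights"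
  by (simp add: slow_weights_def)

lemma fast_weightsI:
  "g \<in> borel_measurable borel \<Longrightarrow> c > 0 \<Longrightarrow> (\<And>t. \<bar>g t\<bar> \<le> C * exp (- c * \<bar>t\<bar>)) \<Longrightarrow> g \<in> fast_weights"
  unfolding fast_weights_def by blast

lemma exp_bound_nonneg: "(\<And>t. \<bar>g t\<bar> \<le> C * exp (h t)) \<Longrightarrow> 0 \<le> C"
  for g h :: "real \<Rightarrow> real"
  by (metis abs_ge_zero exp_gt_zero order_trans zero_le_mult_iff not_le)

lemma weight_cone_slow: "weight_cone slow_weights"
  unfolding weight_cone_def
proof (intro conjI ballI allI impI)
  show "(\<lambda>t. 0) \<in> slow_weights" by (intro slow_weightsI) (auto intro: exI[of _ 0])
  fix f assume f: "f \<in> slow_weights"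
  show "(\<lambda>t. c * f t) \<in> slow_weights" if c: "c \<ge> 0" for c
  proof (rule slow_weightsI)
    fix \<epsilon> :: real assume "\<epsilon> > 0"
    then obtain C where "\<And>t. \<bar>f t\<bar> \<le> C * exp (\<epsilon> * \<bar>t\<bar>)" using f unfolding slow_weights_def by blast
    then have "\<bar>c * f t\<bar> \<le> c * C * exp (\<epsilon> * \<bar>t\<bar>)" for t
      using c mult_left_mono[of "\<bar>f t\<bar>" "C * exp (\<epsilon> * \<bar>t\<bar>)" c] by (simp add: abs_mult mult.assoc)
    then show "\<exists>C. \<forall>t. \<bar>c * f t\<bar> \<le> C * exp (\<epsilon> * \<bar>t\<bar>)" by blast
  qed (use f in \<open>auto simp: slow_weights_def\<close>)
  fix g assume g: "g \<in> slow_weights"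
  show "(\<lambda>t. f t + g t) \<in> slow_weights"
  proof (rule slow_weightsI)
    fix \<epsilon> :: real assume "\<epsilon> > 0"
    then obtain C C' where "\<And>t. \<bar>f t\<bar> \<le> C * exp (\<epsilon> * \<bar>t\<bar>)" "\<And>t. \<bar>g t\<bar> \<le> C' * exp (\<epsilon> * \<bar>t\<bar>)"
      using f g unfolding slow_weights_def by blast
    then have "\<bar>f t + g t\<bar> \<le> (C + C') * exp (\<epsilon> * \<bar>t\<bar>)" for t
      unfolding distrib_right by (intro order_trans[OF abs_triangle_ineq] add_mono)
    then show "\<exists>C. \<forall>t. \<bar>f t + g t\<bar> \<le> C * exp (\<epsilon> * \<bar>t\<bar>)" by blast
  qed (use f g in \<open>auto simp: slow_weights_def\<close>)
qed

lemma weight_cone_fast: "weight_cone fast_weights"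
  unfolding weight_cone_def
proof (intro conjI ballI allI impI)
  show "(\<lambda>t. 0) \<in> fast_weights" by (rule fast_weightsI[of _ 1 0]) auto
  fix f assume f: "f \<in> fast_weights"
  then obtain c1 C1 where 1: "c1 > 0" "\<And>t. \<bar>f t\<bar> \<le> C1 * exp (- c1 * \<bar>t\<bar>)" "f \<in> borel_measurable borel"
    unfolding fast_weights_def by blast
  show "(\<lambda>t. c * f t) \<in> fast_weights" if c: "c \<ge> 0" for c
  proof (rule fast_weightsI[OF _ 1(1), of _ "c * C1"])
    show "\<bar>c * f t\<bar> \<le> c * C1 * exp (- c1 * \<bar>t\<bar>)" for t
      using c mult_left_mono[OF 1(2)[of t] c] by (simp add: abs_mult mult.assoc)
  qed (use 1 in simp)
  fix g assume "g \<in> fast_weights"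
  then obtain c2 C2 where 2: "c2 > 0" "\<And>t. \<bar>g t\<bar> \<le> C2 * exp (- c2 * \<bar>t\<bar>)" "g \<in> borel_measurable borel"
    unfolding fast_weights_def by blast
  show "(\<lambda>t. f t + g t) \<in> fast_weights"
  proof (rule fast_weightsI[of _ "min c1 c2" "C1 + C2"])
    fix t
    have "\<bar>f t + g t\<bar> \<le> C1 * exp (- c1 * \<bar>t\<bar>) + C2 * exp (- c2 * \<bar>t\<bar>)"
      using 1(2)[of t] 2(2)[of t] abs_triangle_ineq[of "f t" "g t"] by linarith
    also have "\<dots> \<le> C1 * exp (- min c1 c2 * \<bar>t\<bar>) + C2 * exp (- min c1 c2 * \<bar>t\<bar>)"
      by (intro add_mono mult_left_mono exp_bound_nonneg[OF 1(2)] exp_bound_nonneg[OF 2(2)])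
        (auto intro!: mult_right_mono)
    finally show "\<bar>f t + g t\<bar> \<le> (C1 + C2) * exp (- min c1 c2 * \<bar>t\<bar>)" by (simp add: distrib_right)
  qed (use 1 2 in auto)
qed

lemma one_slow: "(\<lambda>t. 1) \<in> slow_weights"
  by (intro slow_weightsI) (auto intro!: exI[of _ 1])

lemma abs_slow: "(\<lambda>t. \<bar>t\<bar>) \<in> slow_weights"
proof (intro slow_weightsI)
  fix \<epsilon> :: real assume \<epsilon>: "\<epsilon> > 0"
  have "\<bar>t\<bar> \<le> 1 / \<epsilon> * exp (\<epsilon> * \<bar>t\<bar>)" for t
  proof -
    have "\<epsilon> * \<bar>t\<bar> \<le> exp (\<epsilon> * \<bar>t\<bar>)" by (rule order_trans[OF _ exp_ge_add_one_self]) simp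
    then show ?thesis using \<epsilon> by (simp add: field_simps)
  qed
  then show "\<exists>C. \<forall>t. \<bar>\<bar>t\<bar>\<bar> \<le> C * exp (\<epsilon> * \<bar>t\<bar>)" unfolding abs_abs by blast
qed simp

text \<open>Half of the decay rate is spent on absorbing the slow factor, which is possible because
  slow functions are bounded by every growing exponential.\<close>

lemma fast_slow_mult: "f \<in> fast_weights \<Longrightarrow> g \<in> slow_weights \<Longrightarrow> (\<lambda>t. f t * g t) \<in> fast_weights"
proof -
  assume f: "f \<in> fast_weights" and g: "g \<in> slow_weights"
  obtain c C where 1: "c > 0" "\<And>t. \<bar>f t\<bar> \<le> C * exp (- c * \<bar>t\<bar>)" "f \<in> borel_measurable borel"
    using f unfolding fast_weights_def by blast
  have "c / 2 > 0" using 1 by simp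
  then obtain K where 2: "\<And>t. \<bar>g t\<bar> \<le> K * exp (c / 2 * \<bar>t\<bar>)" "g \<in> borel_measurable borel"
    using g unfolding slow_weights_def by blast
  show ?thesis
  proof (rule fast_weightsI[of _ "c / 2" "C * K"])
    fix t
    have "\<bar>f t * g t\<bar> \<le> (C * exp (- c * \<bar>t\<bar>)) * (K * exp (c / 2 * \<bar>t\<bar>))"
      unfolding abs_mult by (intro mult_mono 1 2 mult_nonneg_nonneg exp_bound_nonneg[OF 1(2)]) auto
    also have "\<dots> = C * K * exp (- (c / 2) * \<bar>t\<bar>)" by (simp flip: exp_add)
    finally show "\<bar>f t * g t\<bar> \<le> C * K * exp (- (c / 2) * \<bar>t\<bar>)" .
  qed (use 1 2 in auto)
qed

lemma slow_mult: "f \<in> slow_weights \<Longrightarrow> g \<in> slow_weights \<Longrightarrow> (\<lambda>t. f t * g t) \<in> slow_weights"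
proof (rule slow_weightsI)
  assume f: "f \<in> slow_weights" and g: "g \<in> slow_weights"
  fix \<epsilon> :: real assume "\<epsilon> > 0"
  then have "\<epsilon> / 2 > 0" by simp
  then obtain C K where 1: "\<And>t. \<bar>f t\<bar> \<le> C * exp (\<epsilon> / 2 * \<bar>t\<bar>)" "\<And>t. \<bar>g t\<bar> \<le> K * exp (\<epsilon> / 2 * \<bar>t\<bar>)"
    using f g unfolding slow_weights_def by blast
  have "\<bar>f t * g t\<bar> \<le> C * K * exp (\<epsilon> * \<bar>t\<bar>)" for t
  proof -
    have "\<bar>f t * g t\<bar> \<le> (C * exp (\<epsilon> / 2 * \<bar>t\<bar>)) * (K * exp (\<epsilon> / 2 * \<bar>t\<bar>))"
      unfolding abs_mult by (intro mult_mono 1 mult_nonneg_nonneg exp_bound_nonneg[OF 1(1)]) auto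
    also have "\<dots> = C * K * exp (\<epsilon> * \<bar>t\<bar>)" by (simp flip: exp_add)
    finally show ?thesis .
  qed
  then show "\<exists>C. \<forall>t. \<bar>f t * g t\<bar> \<le> C * exp (\<epsilon> * \<bar>t\<bar>)" by blast
qed (auto simp: slow_weights_def)

lemma fast_subset_slow: "fast_weights \<subseteq> slow_weights"
proof
  fix f assume "f \<in> fast_weights"
  then obtain c C where 1: "c > 0" "\<And>t. \<bar>f t\<bar> \<le> C * exp (- c * \<bar>t\<bar>)" "f \<in> borel_measurable borel"
    unfolding fast_weights_def by blast
  have "\<bar>f t\<bar> \<le> C * exp (\<epsilon> * \<bar>t\<bar>)" if "\<epsilon> > 0" for \<epsilon> t
  proof (rule order_trans[OF 1(2)], intro mult_left_mono exp_bound_nonneg[OF 1(2)])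
    have "- c * \<bar>t\<bar> \<le> 0" "0 \<le> \<epsilon> * \<bar>t\<bar>" using 1 that by auto
    then show "exp (- c * \<bar>t\<bar>) \<le> exp (\<epsilon> * \<bar>t\<bar>)" by simp
  qed
  then show "f \<in> slow_weights" using 1 by (intro slow_weightsI) blast+
qed

lemma integrable_exp_abs:
  fixes c :: real
  assumes c: "c > 0"
  shows "integrable lborel (\<lambda>t. exp (- c * \<bar>t\<bar>))"
proof -
  have "((\<lambda>x. exp (- c * x)) has_integral exp (- c * 0) / c) {0..}"
    by (rule has_integral_exp_minus_to_infinity[OF c])
  then have "(\<lambda>x. exp (- c * x)) integrable_on {0..}" by (rule has_integral_integrable)
  then have "(\<lambda>x. exp (- c * x)) absolutely_integrable_on {0..}"
    by (rule nonnegative_absolutely_integrable_1) simp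
  then have "integrable lebesgue (\<lambda>x. indicat_real {0..} x *\<^sub>R exp (- c * x))"
    by (simp add: set_integrable_def)
  then have 1: "integrable lborel (\<lambda>x. indicat_real {0..} x *\<^sub>R exp (- c * x))"
    by (subst (asm) integrable_completion) auto
  have 2: "integrable lborel (\<lambda>x. indicat_real {0..} (0 + (-1) * x) *\<^sub>R exp (- c * (0 + (-1) * x)))"
    by (rule lborel_integrable_real_affine[OF 1]) simp
  show ?thesis
  proof (rule Bochner_Integration.integrable_bound[OF Bochner_Integration.integrable_add[OF 1 2]])
    show "AE t in lborel. norm (exp (- c * \<bar>t\<bar>)) \<le> norm (indicat_real {0..} t *\<^sub>R exp (- c * t) + indicat_real {0..} (0 + (-1) * t) *\<^sub>R exp (- c * (0 + (-1) * t)))"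
      by (intro AE_I2) (auto simp: indicator_def abs_if)
  qed simp
qed

lemma integrable_fast: "g \<in> fast_weights \<Longrightarrow> integrable lborel g"
proof -
  assume "g \<in> fast_weights"
  then obtain c C where 1: "c > 0" "\<And>t. \<bar>g t\<bar> \<le> C * exp (- c * \<bar>t\<bar>)" "g \<in> borel_measurable borel"
    unfolding fast_weights_def by blast
  have "integrable lborel (\<lambda>t. C * exp (- c * \<bar>t\<bar>))"
    using integrable_exp_abs[OF 1(1)] by simp
  then show ?thesis
    by (rule Bochner_Integration.integrable_bound) (use 1 in \<open>auto intro!: AE_I2 order_trans[OF _ abs_ge_self]\<close>)
qed

lemma dominated_weight_mono: "w \<subseteq> w' \<Longrightarrow> dominated M w W \<Phi> \<Longrightarrow> dominated M w' W \<Phi>"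
proof -
  assume w: "w \<subseteq> w'" and dom: "dominated M w W \<Phi>"
  show ?thesis
  proof (rule dominatedI)
    fix x assume x: "x \<in> W"
    obtain e g where "e > 0" "g \<in> w" "\<forall>y\<in>ball x e \<inter> W. \<forall>t\<in>space M. \<bar>\<Phi> t y\<bar> \<le> g t"
      by (rule dominatedE[OF dom x])
    then show "\<exists>e>0. \<exists>g\<in>w'. \<forall>y\<in>ball x e \<inter> W. \<forall>t\<in>space M. \<bar>\<Phi> t y\<bar> \<le> g t"
      using w by (intro exI[of _ e] conjI bexI[of _ g]) auto
  qed (use dom in \<open>auto simp: dominated_def\<close>)
qed

lemma dom_Ck_weight_mono: "w \<subseteq> w' \<Longrightarrow> dom_Ck M w k W \<Phi> \<Longrightarrow> dom_Ck M w' k W \<Phi>"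
  by (induction k arbitrary: \<Phi>) (auto intro: dominated_weight_mono)

lemma frechet_derivative_translate:
  fixes f :: "'a::real_normed_vector \<Rightarrow> 'b::real_normed_vector"
  assumes "\<And>x. f (x + a) = f x" "f differentiable at (x + a)"
  shows "frechet_derivative f (at (x + a)) = frechet_derivative f (at x)"
proof -
  have "((\<lambda>x. x + a) has_derivative (\<lambda>v. v)) (at x)"
    by (auto intro!: derivative_eq_intros)
  from has_derivative_compose[OF this differentiable_has_derivative[OF assms(2)]]
  have "(f has_derivative frechet_derivative f (at (x + a))) (at x)" by (simp add: assms(1))
  then show ?thesis by (simp add: frechet_derivative_eqI)
qed

lemma bdd_Ck_periodic:
  fixes f :: "real \<Rightarrow> real"
  assumes "Ck_on k UNIV f" "\<And>x. f (x + 2 * pi) = f x"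
  shows "bdd_Ck k UNIV f"
  using assms
proof (induction k arbitrary: f)
  have base: "bdd_Ck 0 UNIV f" if c: "continuous_on UNIV f" and per: "\<And>x. f (x + 2 * pi) = f x" for f :: "real \<Rightarrow> real"
  proof -
    have "compact (f ` {0..2 * pi})"
      by (intro compact_continuous_image continuous_on_subset[OF c]) auto
    then obtain C where "\<forall>y\<in>f ` {0..2 * pi}. norm y \<le> C"
      using compact_imp_bounded bounded_iff by blast
    then have C: "\<And>x. x \<in> {0..2 * pi} \<Longrightarrow> \<bar>f x\<bar> \<le> C" by simp
    have perk: "f (x + 2 * pi * of_int k) = f x" for x k by (rule periodic_int[where f = f, OF per])
    have "\<bar>f x\<bar> \<le> C" for x
    proof -
      obtain k :: int where "x + 2 * pi * of_int k \<in> {0..2 * pi}" using reduce_angle by blast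
      then show ?thesis using C[of "x + 2 * pi * of_int k"] perk[of x k] by simp
    qed
    then show ?thesis using c by auto
  qed
  {
    case 0
    then show ?case unfolding Ck_on.simps by (rule base)
  next
    case (Suc k)
    have diff: "f differentiable at x" for x using Suc.prems(1) by simp
    have "bdd_Ck k UNIV (\<lambda>x. frechet_derivative f (at x) v)" for v
      using Suc.prems diff
      by (intro Suc.IH Ck_on_SucD(1)) (simp_all add: frechet_derivative_translate)
    moreover have "bdd_Ck 0 UNIV f" by (rule base[OF Ck_on_imp_continuous_on[OF Suc.prems(1)] Suc.prems(2)])
    ultimately show ?case using diff by (simp del: bdd_Ck.simps(1))
  }
qed

lemma order_le_Suc_imp: "order_le (Suc k) r \<Longrightarrow> order_le k r"
  by (cases r) auto

section \<open>Orbits and their derivatives as weighted families\<close>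

context pendulum_orbit
begin

text \<open>On the unit ball around \<open>x\<close> a shift costs at most the factor
  \<open>exp (c * (|x| + 1))\<close>. The factor is unbounded in \<open>x\<close>, which is the
  reason for local domination.\<close>

lemma dominated_shift_fast:
  assumes "continuous_on UNIV e" "c > 0" "\<And>t. \<bar>e t\<bar> \<le> C * exp (- c * \<bar>t\<bar>)"
  shows "dominated lborel fast_weights UNIV (\<lambda>t x::real. e (x + t))"
proof (rule dominatedI)
  fix x :: real
  have "(\<lambda>t. e (x + t)) \<in> borel_measurable borel"
    by (intro borel_measurable_continuous_onI continuous_on_compose2[OF assms(1)] continuous_intros) auto
  then show "(\<lambda>t. e (x + t)) \<in> borel_measurable lborel" by simp
  let ?g = "\<lambda>t. C * exp (c * (\<bar>x\<bar> + 1)) * exp (- c * \<bar>t\<bar>)"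
  have "\<bar>e (y + t)\<bar> \<le> ?g t" if "y \<in> ball x 1" for y t
  proof -
    have "\<bar>y\<bar> \<le> \<bar>x\<bar> + 1" using that by (auto simp: dist_real_def)
    then have "\<bar>t\<bar> - (\<bar>x\<bar> + 1) \<le> \<bar>y + t\<bar>" by linarith
    then have "c * (\<bar>t\<bar> - (\<bar>x\<bar> + 1)) \<le> c * \<bar>y + t\<bar>" using assms(2) by (intro mult_left_mono) auto
    then have "exp (- c * \<bar>y + t\<bar>) \<le> exp (c * (\<bar>x\<bar> + 1) + - c * \<bar>t\<bar>)" by (simp add: algebra_simps)
    then have "C * exp (- c * \<bar>y + t\<bar>) \<le> C * exp (c * (\<bar>x\<bar> + 1) + - c * \<bar>t\<bar>)"
      by (intro mult_left_mono exp_bound_nonneg[OF assms(3)])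
    from order_trans[OF assms(3)[of "y + t"] this] show ?thesis by (simp only: exp_add mult.assoc)
  qed
  moreover have "?g \<in> fast_weights"
    by (rule fast_weightsI[of _ c "C * exp (c * (\<bar>x\<bar> + 1))"])
      (use assms(2) exp_bound_nonneg[OF assms(3)] in \<open>auto simp: abs_mult\<close>)
  ultimately show "\<exists>e'>0. \<exists>g\<in>fast_weights. \<forall>y\<in>ball x e' \<inter> UNIV. \<forall>t\<in>space lborel. \<bar>e (y + t)\<bar> \<le> g t"
    by (intro exI[of _ 1] conjI bexI[of _ ?g]) auto
next
  fix t :: real
  show "continuous_on UNIV (\<lambda>x. e (x + t))"
    by (intro continuous_on_compose2[OF assms(1)] continuous_intros) auto
qed

lemma p_bound: obtains c C where "c > 0" "\<And>t. \<bar>p t\<bar> \<le> C * exp (- c * \<bar>t\<bar>)" "\<And>t. \<bar>deriv V (q t)\<bar> \<le> C * exp (- c * \<bar>t\<bar>)"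
proof -
  obtain c C k where d: "c > 0" "C \<ge> 0" "\<And>t. \<bar>p t\<bar> \<le> C * exp (- c * \<bar>t\<bar>)"
    "\<And>t. \<bar>q t - 2 * pi * of_int (k t)\<bar> \<le> C * exp (- c * \<bar>t\<bar>)" by (rule decay) blast
  obtain K where K: "K > 0" "\<And>x. \<bar>deriv (deriv V) x\<bar> \<le> K" by (rule V''_bdd) blast
  show ?thesis
  proof (rule that[OF d(1), of "max C (K * C)"])
    fix t
    show "\<bar>p t\<bar> \<le> max C (K * C) * exp (- c * \<bar>t\<bar>)"
      by (rule order_trans[OF d(3)]) (intro mult_right_mono, auto)
    have "\<bar>deriv V (q t)\<bar> \<le> K * \<bar>q t - 2 * pi * of_int (k t)\<bar>"
      using V'_bound[OF K(2), of "k t" "q t - 2 * pi * of_int (k t)"] by simp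
    also have "\<dots> \<le> K * (C * exp (- c * \<bar>t\<bar>))" using K(1) d(4)[of t] by (intro mult_left_mono) auto
    also have "\<dots> = (K * C) * exp (- c * \<bar>t\<bar>)" by simp
    also have "\<dots> \<le> max C (K * C) * exp (- c * \<bar>t\<bar>)" by (intro mult_right_mono) auto
    finally show "\<bar>deriv V (q t)\<bar> \<le> max C (K * C) * exp (- c * \<bar>t\<bar>)" .
  qed
qed

lemma continuous_on_q: "continuous_on A q" and continuous_on_p: "continuous_on A p"
  using continuous_q continuous_p by (auto intro!: continuous_at_imp_continuous_on)

lemma continuous_on_V'q: "continuous_on A (\<lambda>t. deriv V (q t))"
proof (rule continuous_at_imp_continuous_on, rule ballI)
  fix t
  have "isCont (deriv V) (q t)" using DV' DERIV_isCont by blast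
  then show "isCont (\<lambda>t. deriv V (q t)) t" using continuous_q isCont_o2 by blast
qed

lemma q_bounded: "\<bar>q t\<bar> \<le> \<bar>q 0\<bar> + 2 * pi"
  using q_range[of t 0] by linarith

lemma dominated_q_slow: "dominated lborel slow_weights UNIV (\<lambda>t x::real. q (x + t))"
proof (rule dominatedI)
  fix x :: real
  have "(\<lambda>t. q (x + t)) \<in> borel_measurable borel"
    by (intro borel_measurable_continuous_onI continuous_on_compose2[OF continuous_on_q[of UNIV]] continuous_intros) auto
  then show "(\<lambda>t. q (x + t)) \<in> borel_measurable lborel" by simp
  have "(\<lambda>t. (\<bar>q 0\<bar> + 2 * pi) * 1) \<in> slow_weights"
    using weight_cone_slow[unfolded weight_cone_def, THEN conjunct2, THEN conjunct2, rule_format, OF one_slow] by simp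
  then show "\<exists>e'>0. \<exists>g\<in>slow_weights. \<forall>y\<in>ball x e' \<inter> UNIV. \<forall>t\<in>space lborel. \<bar>q (y + t)\<bar> \<le> g t"
    using q_bounded by (intro exI[of _ 1] conjI bexI[of _ "\<lambda>t. (\<bar>q 0\<bar> + 2 * pi) * 1"]) auto
next
  fix t :: real
  show "continuous_on UNIV (\<lambda>x. q (x + t))"
    by (intro continuous_on_compose2[OF continuous_on_q[of UNIV]] continuous_intros) auto
qed

lemma has_derivative_shift:
  assumes "\<And>t. (e has_real_derivative e' t) (at t)"
  shows "((\<lambda>x. e (x + t)) has_derivative (\<lambda>v. v * e' (x + t))) (at x)"
proof -
  have "((\<lambda>x. e (x + t)) has_real_derivative e' (x + t)) (at x)"
    using assms[of "x + t"] by (simp add: DERIV_shift)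
  then show ?thesis by (simp add: has_field_derivative_def mult_commute_abs)
qed

text \<open>A joint induction, since Hamilton's equations express the derivative of each family by
  the other: that of \<open>p\<close> is a multiple of the force, and that of the force is the
  second derivative of \<open>V\<close> along \<open>q\<close> times a multiple of \<open>p\<close>.
  The former factor is only slow, as \<open>q\<close> does not tend to 0, but \<open>p\<close> is
  fast. The force family is one order behind because it contains a derivative of
  \<open>V\<close>.\<close>

lemma orbit_families_aux:
  "(order_le k r \<longrightarrow> dom_Ck lborel fast_weights k UNIV (\<lambda>t x::real. p (x + t))) \<and>
   (order_le (Suc k) r \<longrightarrow> dom_Ck lborel fast_weights k UNIV (\<lambda>t x::real. deriv V (q (x + t))))"
proof (induction k)
  obtain c C where d: "c > 0" "\<And>t. \<bar>p t\<bar> \<le> C * exp (- c * \<bar>t\<bar>)" "\<And>t. \<bar>deriv V (q t)\<bar> \<le> C * exp (- c * \<bar>t\<bar>)"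
    by (rule p_bound) blast
  have domp: "dominated lborel fast_weights UNIV (\<lambda>t x::real. p (x + t))"
    by (rule dominated_shift_fast[OF continuous_on_p d(1,2)])
  have domV: "dominated lborel fast_weights UNIV (\<lambda>t x::real. deriv V (q (x + t)))"
    by (rule dominated_shift_fast[OF continuous_on_V'q d(1,3)])
  {
    case 0
    show ?case using domp domV by simp
  next
    case (Suc k)
    have A: "dom_Ck lborel fast_weights (Suc k) UNIV (\<lambda>t x::real. p (x + t))" if "order_le (Suc k) r"
    proof (rule dom_Ck_SucI[OF open_UNIV weight_cone_fast domp])
      show "((\<lambda>x. p (x + t)) has_derivative (\<lambda>v. v * (- \<sigma> * deriv V (q (x + t))))) (at x)" for t x
        by (rule has_derivative_shift[OF Dp])
      fix b :: real
      have "dom_Ck lborel fast_weights k UNIV (\<lambda>t x::real. deriv V (q (x + t)))"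
        using Suc.IH that by blast
      from dom_Ck_scale[OF open_UNIV weight_cone_fast this, of "b * (- \<sigma>)"]
      show "dom_Ck lborel fast_weights k UNIV (\<lambda>t x. b * (- \<sigma> * deriv V (q (x + t))))" by (simp add: mult.assoc)
    qed
    have B: "dom_Ck lborel fast_weights (Suc k) UNIV (\<lambda>t x::real. deriv V (q (x + t)))" if r2: "order_le (Suc (Suc k)) r"
    proof (rule dom_Ck_SucI[OF open_UNIV weight_cone_fast domV])
      have D: "((\<lambda>t. deriv V (q t)) has_real_derivative deriv (deriv V) (q t) * (\<sigma> * p t)) (at t)" for t
        by (rule DERIV_chain2[OF DV' Dq])
      show "((\<lambda>x. deriv V (q (x + t))) has_derivative (\<lambda>v. v * (deriv (deriv V) (q (x + t)) * (\<sigma> * p (x + t))))) (at x)" for t x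
        by (rule has_derivative_shift[OF D])
      fix b :: real
      have pk: "dom_Ck lborel fast_weights k UNIV (\<lambda>t x::real. p (x + t))"
        using Suc.IH order_le_Suc_imp[OF order_le_Suc_imp[OF r2]] by blast
      have qk: "dom_Ck lborel slow_weights k UNIV (\<lambda>t x::real. q (x + t))"
      proof (cases k)
        case 0
        then show ?thesis using dominated_q_slow by simp
      next
        case (Suc j)
        show ?thesis unfolding Suc
        proof (rule dom_Ck_SucI[OF open_UNIV weight_cone_slow dominated_q_slow])
          show "((\<lambda>x. q (x + t)) has_derivative (\<lambda>v. v * (\<sigma> * p (x + t)))) (at x)" for t x
            by (rule has_derivative_shift[OF Dq])
          fix b :: real
          have "dom_Ck lborel slow_weights j UNIV (\<lambda>t x::real. p (x + t))"
            by (rule dom_Ck_weight_mono[OF fast_subset_slow dom_Ck_Suc_imp]) (use pk Suc in simp)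
          from dom_Ck_scale[OF open_UNIV weight_cone_slow this, of "b * \<sigma>"]
          show "dom_Ck lborel slow_weights j UNIV (\<lambda>t x. b * (\<sigma> * p (x + t)))" by (simp add: mult.assoc)
        qed
      qed
      have "Ck_on k UNIV (deriv (deriv V))"
        by (intro Ck_on_deriv(1) Ck_V r2)
      then have "bdd_Ck k UNIV (deriv (deriv V))"
        using V''_periodic[of _ 1] by (intro bdd_Ck_periodic) auto
      then have "dom_Ck lborel slow_weights k UNIV (\<lambda>t x::real. deriv (deriv V) (q (x + t)))"
        by (intro dom_Ck_compose[OF open_UNIV open_UNIV weight_cone_slow one_slow, where \<gamma> = "\<lambda>t x. q (x + t)" and G = "deriv (deriv V)"])
          (simp_all add: qk slow_mult)
      then have "dom_Ck lborel fast_weights k UNIV (\<lambda>t x. p (x + t) * deriv (deriv V) (q (x + t)))"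
        by (intro dom_Ck_mult[OF open_UNIV weight_cone_fast _ pk, where ?w2.0 = slow_weights] fast_slow_mult)
      from dom_Ck_scale[OF open_UNIV weight_cone_fast this, of "b * \<sigma>"]
      show "dom_Ck lborel fast_weights k UNIV (\<lambda>t x. b * (deriv (deriv V) (q (x + t)) * (\<sigma> * p (x + t))))"
        by (simp add: mult_ac)
    qed
    show ?case using A B by blast
  }
qed

lemma dom_Ck_p: "order_le k r \<Longrightarrow> dom_Ck lborel fast_weights k UNIV (\<lambda>t x::real. p (x + t))"
  using orbit_families_aux by blast

lemma dom_Ck_V'q: "order_le (Suc k) r \<Longrightarrow> dom_Ck lborel fast_weights k UNIV (\<lambda>t x::real. deriv V (q (x + t)))"
  using orbit_families_aux by blast

lemma dom_Ck_q:
  assumes "order_le k r"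
  shows "dom_Ck lborel slow_weights k UNIV (\<lambda>t x::real. q (x + t))"
proof (cases k)
  case 0
  then show ?thesis using dominated_q_slow by simp
next
  case (Suc j)
  show ?thesis unfolding Suc
  proof (rule dom_Ck_SucI[OF open_UNIV weight_cone_slow dominated_q_slow])
    show "((\<lambda>x. q (x + t)) has_derivative (\<lambda>v. v * (\<sigma> * p (x + t)))) (at x)" for t x
      by (rule has_derivative_shift[OF Dq])
    fix b :: real
    have "dom_Ck lborel slow_weights j UNIV (\<lambda>t x::real. p (x + t))"
      by (rule dom_Ck_weight_mono[OF fast_subset_slow dom_Ck_p[OF order_le_Suc_imp]]) (use assms Suc in simp)
    from dom_Ck_scale[OF open_UNIV weight_cone_slow this, of "b * \<sigma>"]
    show "dom_Ck lborel slow_weights j UNIV (\<lambda>t x. b * (\<sigma> * p (x + t)))" by (simp add: mult.assoc)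
  qed
qed

end

section \<open>The Melnikov potential\<close>

lemma dom_Ck_of_Ck_on:
  fixes f :: "'a::euclidean_space \<Rightarrow> real"
  assumes "open W" "weight_cone w" "(\<lambda>t. 1) \<in> w" "Ck_on k W f"
  shows "dom_Ck M w k W (\<lambda>t. f)"
  using assms(4)
proof (induction k arbitrary: f)
  have dom: "dominated M w W (\<lambda>t. f)" if c: "continuous_on W f" for f :: "'a \<Rightarrow> real"
  proof (rule dominatedI)
    fix x :: 'a assume x: "x \<in> W"
    obtain e where e: "e > 0" "\<And>y. y \<in> W \<Longrightarrow> dist y x < e \<Longrightarrow> dist (f y) (f x) < 1"
      using c x unfolding continuous_on_iff by (metis zero_less_one)
    have b: "\<bar>f y\<bar> \<le> \<bar>f x\<bar> + 1" if "y \<in> ball x e \<inter> W" for y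
      using e(2)[of y] that by (auto simp: dist_commute dist_real_def)
    have "(\<lambda>t. (\<bar>f x\<bar> + 1) * 1) \<in> w"
      using assms(2)[unfolded weight_cone_def, THEN conjunct2, THEN conjunct2, rule_format, OF assms(3)] by simp
    then show "\<exists>e>0. \<exists>g\<in>w. \<forall>y\<in>ball x e \<inter> W. \<forall>t\<in>space M. \<bar>f y\<bar> \<le> g t"
      using e(1) b by (intro exI[of _ e] conjI bexI[of _ "\<lambda>_. (\<bar>f x\<bar> + 1) * 1"]) auto
  qed (use c in auto)
  {
    case 0
    then show ?case using dom by simp
  next
    case (Suc k)
    have "dominated M w W (\<lambda>t. f)" by (rule dom[OF Ck_on_imp_continuous_on[OF Suc.prems]])
    moreover have "dom_Ck M w k W (\<lambda>t x. frechet_derivative f (at x) v)" for v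
      by (rule Suc.IH[OF Ck_on_SucD(1)[OF Suc.prems]])
    ultimately show ?case using Suc.prems by simp
  }
qed

lemma dominated_continuous_compose:
  assumes "dominated M w W \<Phi>" "continuous_on W' A" "A ` W' \<subseteq> W"
  shows "dominated M w W' (\<lambda>t x. \<Phi> t (A x))"
proof (rule dominatedI)
  show "continuous_on W' (\<lambda>x. \<Phi> t (A x))" if "t \<in> space M" for t
    by (rule continuous_on_compose2[of W "\<Phi> t", OF _ assms(2,3)]) (use assms(1) that in \<open>simp add: dominated_def\<close>)
  fix x assume x: "x \<in> W'"
  obtain e g where g: "e > 0" "g \<in> w" "\<forall>y\<in>ball (A x) e \<inter> W. \<forall>t\<in>space M. \<bar>\<Phi> t y\<bar> \<le> g t"
    by (rule dominatedE[OF assms(1), of "A x"]) (use assms(3) x in auto)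
  obtain d where d: "d > 0" "\<And>y. y \<in> W' \<Longrightarrow> dist y x < d \<Longrightarrow> dist (A y) (A x) < e"
    using assms(2)[unfolded continuous_on_iff, rule_format, OF x g(1)] by auto
  show "\<exists>e>0. \<exists>g\<in>w. \<forall>y\<in>ball x e \<inter> W'. \<forall>t\<in>space M. \<bar>\<Phi> t (A y)\<bar> \<le> g t"
    using d g assms(3) by (intro exI[of _ d] conjI bexI[of _ g]) (auto simp: dist_commute)
qed (use assms in \<open>auto simp: dominated_def\<close>)

text \<open>Translation invariance of Lebesgue measure removes \<tau> from the bound. The estimates
  that are uniform in the shifts rest on this.\<close>

lemma integral_exp_shift_bound:
  fixes f :: "real \<Rightarrow> real" and \<tau> :: "real^'n::finite"
  assumes c: "c > 0" and f: "f \<in> borel_measurable borel" "\<And>t. \<bar>f t\<bar> \<le> N * (\<Sum>i\<in>UNIV. exp (- c * \<bar>\<tau> $ i + t\<bar>))"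
  shows "integrable lborel f" "\<bar>\<integral>t. f t \<partial>lborel\<bar> \<le> N * (CARD('n) * (\<integral>t. exp (- c * \<bar>t\<bar>) \<partial>lborel))"
proof -
  let ?J = "\<integral>t. exp (- c * \<bar>t\<bar>) \<partial>lborel"
  have int: "integrable lborel (\<lambda>t. exp (- c * \<bar>\<tau> $ i + t\<bar>))" for i
    using lborel_integrable_real_affine[OF integrable_exp_abs[OF c], of 1 "\<tau> $ i"] by simp
  have val: "(\<integral>t. exp (- c * \<bar>\<tau> $ i + t\<bar>) \<partial>lborel) = ?J" for i
    using lborel_integral_real_affine[of 1 "\<lambda>t. exp (- c * \<bar>t\<bar>)" "\<tau> $ i"] by simp
  have intS: "integrable lborel (\<lambda>t. N * (\<Sum>i\<in>UNIV. exp (- c * \<bar>\<tau> $ i + t\<bar>)))"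
    by (intro integrable_mult_right Bochner_Integration.integrable_sum int)
  show I: "integrable lborel f"
  proof (rule Bochner_Integration.integrable_bound[OF intS])
    show "AE t in lborel. norm (f t) \<le> norm (N * (\<Sum>i\<in>UNIV. exp (- c * \<bar>\<tau> $ i + t\<bar>)))"
      unfolding real_norm_def by (intro AE_I2 order_trans[OF f(2) abs_ge_self])
  qed (use f in simp)
  have "norm (\<integral>t. f t \<partial>lborel) \<le> (\<integral>t. norm (f t) \<partial>lborel)" by (rule integral_norm_bound)
  also have "\<dots> \<le> (\<integral>t. N * (\<Sum>i\<in>UNIV. exp (- c * \<bar>\<tau> $ i + t\<bar>)) \<partial>lborel)"
    by (rule integral_mono) (use I intS f(2) in auto)
  also have "\<dots> = N * (\<Sum>i\<in>(UNIV::'n set). ?J)"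
    using int val by (subst integral_mult_right_zero) (simp add: Bochner_Integration.integral_sum)
  finally show "\<bar>\<integral>t. f t \<partial>lborel\<bar> \<le> N * (CARD('n) * ?J)" by simp
qed

lemma Mreal_Lipschitz:
  fixes g :: "('n::finite, 'd::finite) rphase \<Rightarrow> real" and N :: real
  assumes "convex D" "convex B" and g: "\<And>z. z \<in> Mreal D B \<Longrightarrow> g differentiable at z"
    "\<And>z b. z \<in> Mreal D B \<Longrightarrow> b \<in> Basis \<Longrightarrow> \<bar>frechet_derivative g (at z) b\<bar> \<le> N"
    and xy: "x \<in> Mreal D B" "y \<in> Mreal D B"
  shows "\<bar>g x - g y\<bar> \<le> DIM(('n, 'd) rphase) * N * norm (x - y)"
proof -
  have "convex (Mreal D B :: ('n, 'd) rphase set)"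
  proof -
    have "Mreal D B = D \<times> (UNIV \<times> (B \<times> UNIV))" by (auto simp: Mreal_def)
    then show ?thesis using assms(1,2) by (simp add: convex_Times)
  qed
  then have "norm (g x - g y) \<le> (DIM(('n, 'd) rphase) * N) * norm (x - y)"
  proof (rule differentiable_bound[where f' = "\<lambda>z. frechet_derivative g (at z)"])
    fix z :: "('n, 'd) rphase" assume z: "z \<in> Mreal D B"
    note D = differentiable_has_derivative[OF g(1)[OF z]]
    show "(g has_derivative frechet_derivative g (at z)) (at z within Mreal D B)"
      using D by (rule has_derivative_at_withinI)
    show "onorm (frechet_derivative g (at z)) \<le> DIM(('n, 'd) rphase) * N"
    proof (rule onorm_le)
      fix v
      have "norm (frechet_derivative g (at z) v) = \<bar>\<Sum>b\<in>Basis. (v \<bullet> b) * frechet_derivative g (at z) b\<bar>"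
        using linear_Basis_expand[OF has_derivative_linear[OF D], of v] by simp
      also have "\<dots> \<le> (\<Sum>b\<in>(Basis :: ('n, 'd) rphase set). norm v * N)"
      proof (rule order_trans[OF sum_abs sum_mono])
        fix b :: "('n, 'd) rphase" assume b: "b \<in> Basis"
        then show "\<bar>(v \<bullet> b) * frechet_derivative g (at z) b\<bar> \<le> norm v * N"
          unfolding abs_mult by (intro mult_mono Basis_le_norm g(2) z) auto
      qed
      finally show "norm (frechet_derivative g (at z) v) \<le> DIM(('n, 'd) rphase) * N * norm v" by (simp add: mult_ac)
    qed
  qed (use xy in auto)
  then show ?thesis by simp
qed

lemma norm_vec_le_sum: "norm (x :: real^'n) \<le> (\<Sum>i\<in>UNIV. \<bar>x $ i\<bar>)"
  unfolding norm_vec_def real_norm_def by (rule L2_set_le_sum) simp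

lemma nice_differentiable: "nice D B g \<Longrightarrow> z \<in> Mreal D B \<Longrightarrow> g differentiable at z"
  using bdd_Ck_SucD(2)[of 0] unfolding nice_def by blast

lemma nice_derivative_bdd:
  fixes g :: "('n::finite, 'd::finite) rphase \<Rightarrow> real"
  assumes "nice D B g"
  obtains N where "0 \<le> N" "\<And>z b. z \<in> Mreal D B \<Longrightarrow> b \<in> Basis \<Longrightarrow> \<bar>frechet_derivative g (at z) b\<bar> \<le> N"
proof -
  have "\<exists>M. \<forall>z\<in>Mreal D B. \<bar>frechet_derivative g (at z) b\<bar> \<le> M" for b
    using assms bdd_Ck_SucD(1)[of 0 "Mreal D B" g b] unfolding nice_def by auto
  then obtain M where M: "\<And>b z. z \<in> Mreal D B \<Longrightarrow> \<bar>frechet_derivative g (at z) b\<bar> \<le> M b" by metis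
  show ?thesis
  proof (rule that[of "\<Sum>b\<in>Basis. \<bar>M b\<bar>"])
    fix z b :: "('n, 'd) rphase" assume "z \<in> Mreal D B" "b \<in> Basis"
    then have "\<bar>frechet_derivative g (at z) b\<bar> \<le> \<bar>M b\<bar>" using M[of z b] by simp
    also have "\<dots> \<le> (\<Sum>b\<in>Basis. \<bar>M b\<bar>)" using \<open>b \<in> Basis\<close> by (intro member_le_sum) auto
    finally show "\<bar>frechet_derivative g (at z) b\<bar> \<le> (\<Sum>b\<in>Basis. \<bar>M b\<bar>)" .
  qed (simp add: sum_nonneg)
qed

section \<open>The Melnikov integrand\<close>

locale melnikov =
  fixes r :: regularity and D :: "(real^'n::finite) set" and B :: "(real^'d::finite) set"
    and h :: "real^'d \<Rightarrow> real" and \<sigma> :: "'n \<Rightarrow> real" and V p0 q0 :: "'n \<Rightarrow> real \<Rightarrow> real"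
  assumes D: "open D" "convex D" "0 \<in> D" and B: "open B" "convex B"
    and h: "regular_on r B h" and orb: "\<And>i. pendulum_orbit r (V i) (\<sigma> i) (p0 i) (q0 i)"
    and p0_D: "range (orbit_at p0) \<subseteq> D"
begin

text \<open>The parameter space of the triples \<open>(\<tau>, I, \<theta>)\<close>, taken at time
  \<open>s = 0\<close>.\<close>

definition W :: "((real^'n) \<times> (real^'d) \<times> (real^'d)) set" where
  "W = {x. fst (snd x) \<in> B}"

definition orbit_pt :: "real \<Rightarrow> (real^'n) \<times> (real^'d) \<times> (real^'d) \<Rightarrow> ('n, 'd) rphase" where
  "orbit_pt t x = (orbit_at p0 (fst x + t *\<^sub>R ones), orbit_at q0 (fst x + t *\<^sub>R ones), fst (snd x),
     snd (snd x) + t *\<^sub>R freq h (fst (snd x)), t)"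

definition rest_pt :: "real \<Rightarrow> (real^'n) \<times> (real^'d) \<times> (real^'d) \<Rightarrow> ('n, 'd) rphase" where
  "rest_pt t x = (0, 0, fst (snd x), snd (snd x) + t *\<^sub>R freq h (fst (snd x)), t)"

definition dp where "dp i u = - \<sigma> i * deriv (V i) (q0 i u)"
definition dq where "dq i u = \<sigma> i * p0 i u"

definition ep :: "'n \<Rightarrow> ('n, 'd) rphase" where "ep i = (axis i 1, 0)"
definition eq :: "'n \<Rightarrow> ('n, 'd) rphase" where "eq i = (0, axis i 1, 0)"
definition e\<phi> :: "'d \<Rightarrow> ('n, 'd) rphase" where "e\<phi> j = (0, 0, 0, axis j 1, 0)"

text \<open>The derivative of the integrand in \<open>\<tau> $ i\<close> by the chain rule; the rest
  point does not move with \<tau>. Integrability comes from the decaying factors \<open>dp\<close>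
  and \<open>dq\<close>, whereas in \<open>pot\<close> and \<open>phase_grad\<close> it comes from
  the subtraction of the rest point.\<close>

definition grad_int where
  "grad_int g i t x = frechet_derivative g (at (orbit_pt t x)) (ep i) * dp i (fst x $ i + t)
     + frechet_derivative g (at (orbit_pt t x)) (eq i) * dq i (fst x $ i + t)"

definition pot where "pot g x = - (\<integral>t. g (orbit_pt t x) - g (rest_pt t x) \<partial>lborel)"
definition grad where "grad g i x = - (\<integral>t. grad_int g i t x \<partial>lborel)"
definition phase_grad where
  "phase_grad g j x = - (\<integral>t. frechet_derivative g (at (orbit_pt t x)) (e\<phi> j)
     - frechet_derivative g (at (rest_pt t x)) (e\<phi> j) \<partial>lborel)"

lemma open_W: "open W"
proof -
  have "W = (\<lambda>x. fst (snd x)) -` B" by (auto simp: W_def)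
  then show ?thesis using B by (auto intro!: open_vimage continuous_intros)
qed

lemma e_Basis: "ep i \<in> Basis" "eq i \<in> Basis" "e\<phi> j \<in> Basis"
  by (auto simp: ep_def eq_def e\<phi>_def Basis_prod_def axis_in_Basis_iff zero_prod_def)

lemma orbit_pt_in: "x \<in> W \<Longrightarrow> orbit_pt t x \<in> Mreal D B"
  using p0_D by (auto simp: orbit_pt_def Mreal_def W_def)

lemma rest_pt_in: "x \<in> W \<Longrightarrow> rest_pt t x \<in> Mreal D B"
  using D by (auto simp: rest_pt_def Mreal_def W_def)

lemma order_le_2: "k \<le> 3 \<Longrightarrow> order_le k r"
  using orb[of undefined] pendulum.order_le_r unfolding pendulum_orbit_def by blast

lemma dom_Ck_pcomp: "order_le k r \<Longrightarrow> dom_Ck lborel fast_weights k W (\<lambda>t x. p0 i (fst x $ i + t))"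
  by (rule dom_Ck_linear_compose[OF open_UNIV open_W _ _ pendulum_orbit.dom_Ck_p[OF orb], of "\<lambda>x. fst x $ i"])
    (auto intro!: bounded_linear_compose[OF bounded_linear_vec_nth] bounded_linear_fst)

lemma dom_Ck_dp: "order_le (Suc k) r \<Longrightarrow> dom_Ck lborel fast_weights k W (\<lambda>t x. dp i (fst x $ i + t))"
  unfolding dp_def
  by (intro dom_Ck_scale[OF open_W weight_cone_fast])
    (rule dom_Ck_linear_compose[OF open_UNIV open_W _ _ pendulum_orbit.dom_Ck_V'q[OF orb], of "\<lambda>x. fst x $ i"],
     auto intro!: bounded_linear_compose[OF bounded_linear_vec_nth] bounded_linear_fst)

lemma dom_Ck_dq: "order_le k r \<Longrightarrow> dom_Ck lborel fast_weights k W (\<lambda>t x. dq i (fst x $ i + t))"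
  unfolding dq_def by (intro dom_Ck_scale[OF open_W weight_cone_fast] dom_Ck_pcomp)

lemma dom_Ck_qcomp: "order_le k r \<Longrightarrow> dom_Ck lborel slow_weights k W (\<lambda>t x. q0 i (fst x $ i + t))"
  by (rule dom_Ck_linear_compose[OF open_UNIV open_W _ _ pendulum_orbit.dom_Ck_q[OF orb], of "\<lambda>x. fst x $ i"])
    (auto intro!: bounded_linear_compose[OF bounded_linear_vec_nth] bounded_linear_fst)

lemma Ck_freq: "order_le (Suc k) r \<Longrightarrow> Ck_on k B (\<lambda>I. freq h I $ j)"
  using Ck_on_SucD(1)[OF regular_on_imp_Ck_on[OF B(1) h]] by (simp add: freq_def del: Ck_on.simps)

lemma Ck_freq_W: "order_le (Suc k) r \<Longrightarrow> Ck_on k W (\<lambda>x. freq h (fst (snd x)) $ j)"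
  by (rule Ck_on_compose[OF B(1) open_W Ck_freq])
    (auto simp: W_def intro!: Ck_on_bounded_linear bounded_linear_fst_comp bounded_linear_snd)

text \<open>The angle component contains \<open>t *\<^sub>R freq h I\<close>. It grows with
  \<open>t\<close>, hence the slow weights, and it involves a derivative of \<open>h\<close>, hence
  \<open>Suc k\<close> in the hypothesis.\<close>

lemma dom_Ck_orbit_pt:
  assumes r: "order_le (Suc k) r" and b: "b \<in> Basis"
  shows "dom_Ck lborel slow_weights k W (\<lambda>t x. orbit_pt t x \<bullet> b)"
proof -
  have rk: "order_le k r" using r by (rule order_le_Suc_imp)
  have bl: "bounded_linear (\<lambda>x :: (real^'n) \<times> (real^'d) \<times> (real^'d). fst (snd x) $ j)"
    "bounded_linear (\<lambda>x :: (real^'n) \<times> (real^'d) \<times> (real^'d). snd (snd x) $ j)" for j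
    by (intro bounded_linear_compose[OF bounded_linear_vec_nth] bounded_linear_fst_comp bounded_linear_snd_comp bounded_linear_snd)+
  consider i where "b = (axis i 1, 0)" | i where "b = (0, axis i 1, 0)" | j where "b = (0, 0, axis j 1, 0)"
    | j where "b = (0, 0, 0, axis j 1, 0)" | "b = (0, 0, 0, 0, 1)"
    using b by (auto simp: Basis_prod_def Basis_vec_def zero_prod_def)
  then show ?thesis
  proof cases
    case (1 i)
    then have "(\<lambda>t x. orbit_pt t x \<bullet> b) = (\<lambda>t x. p0 i (fst x $ i + t))"
      by (simp add: orbit_pt_def orbit_at_def inner_axis fun_eq_iff)
    then show ?thesis using dom_Ck_weight_mono[OF fast_subset_slow dom_Ck_pcomp[OF rk]] by simp
  next
    case (2 i)
    then have "(\<lambda>t x. orbit_pt t x \<bullet> b) = (\<lambda>t x. q0 i (fst x $ i + t))"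
      by (simp add: orbit_pt_def orbit_at_def inner_axis fun_eq_iff)
    then show ?thesis using dom_Ck_qcomp[OF rk] by simp
  next
    case (3 j)
    then have "(\<lambda>t x. orbit_pt t x \<bullet> b) = (\<lambda>t x. fst (snd x) $ j)"
      by (simp add: orbit_pt_def inner_axis fun_eq_iff)
    then show ?thesis
      using dom_Ck_of_Ck_on[OF open_W weight_cone_slow one_slow Ck_on_bounded_linear[OF bl(1)]] by simp
  next
    case (4 j)
    then have e: "(\<lambda>t x. orbit_pt t x \<bullet> b) = (\<lambda>t x. snd (snd x) $ j + t * freq h (fst (snd x)) $ j)"
      by (simp add: orbit_pt_def inner_axis fun_eq_iff)
    have "dom_Ck lborel slow_weights k W (\<lambda>t x. t)"
      by (rule dom_Ck_const[OF weight_cone_slow _ abs_slow]) auto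
    then have "dom_Ck lborel slow_weights k W (\<lambda>t x. t * freq h (fst (snd x)) $ j)"
      by (rule dom_Ck_mult[OF open_W weight_cone_slow slow_mult, rotated 2])
        (auto intro!: dom_Ck_of_Ck_on[OF open_W weight_cone_slow one_slow] Ck_freq_W r)
    then show ?thesis unfolding e
      by (intro dom_Ck_add[OF open_W weight_cone_slow] dom_Ck_of_Ck_on[OF open_W weight_cone_slow one_slow]
          Ck_on_bounded_linear bl(2))
  next
    case 5
    then have "(\<lambda>t x. orbit_pt t x \<bullet> b) = (\<lambda>t x. t)"
      by (simp add: orbit_pt_def fun_eq_iff)
    then show ?thesis by (simp only:) (rule dom_Ck_const[OF weight_cone_slow _ abs_slow], auto)
  qed
qed

lemma dom_Ck_rest_pt_0:
  assumes b: "b \<in> Basis"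
  shows "dominated lborel slow_weights W (\<lambda>t x. rest_pt t x \<bullet> b)"
proof -
  have "dom_Ck lborel slow_weights 0 W (\<lambda>t x. orbit_pt t x \<bullet> b)"
    by (rule dom_Ck_orbit_pt[OF _ b]) (rule order_le_2, simp)
  then have o: "dominated lborel slow_weights W (\<lambda>t x. orbit_pt t x \<bullet> b)" by simp
  show ?thesis
  proof (cases "\<exists>b'. b = (0, 0, b')")
    case True
    then have "(\<lambda>t x. rest_pt t x \<bullet> b) = (\<lambda>t x. orbit_pt t x \<bullet> b)"
      by (auto simp: orbit_pt_def rest_pt_def fun_eq_iff)
    then show ?thesis using o by simp
  next
    case False
    then have "(\<lambda>t x. rest_pt t x \<bullet> b) = (\<lambda>t x. 0)"
      using b by (auto simp: Basis_prod_def rest_pt_def fun_eq_iff zero_prod_def)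
    then show ?thesis using dom_Ck_zero[OF weight_cone_slow, of lborel 0 W] by simp
  qed
qed

lemma dom_Ck_nice_orbit:
  assumes "nice D B g" "order_le (Suc k) r"
  shows "dom_Ck lborel slow_weights k W (\<lambda>t x. g (orbit_pt t x))"
  by (rule dom_Ck_compose[OF open_Mreal[OF D(1) B(1)] open_W weight_cone_slow one_slow, where \<gamma> = orbit_pt and G = g])
    (use assms in \<open>auto simp: slow_mult orbit_pt_in dom_Ck_orbit_pt nice_def\<close>)

text \<open>Derivatives of \<open>g\<close> along the orbit are merely slow as families, since
  differentiation in \<open>I\<close> brings out powers of \<open>t\<close>; the factor
  \<open>dp\<close> or \<open>dq\<close> makes the products fast.\<close>

lemma dom_Ck_grad_int:
  assumes "nice D B g" "order_le (Suc k) r"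
  shows "dom_Ck lborel fast_weights k W (grad_int g i)"
proof -
  have m: "dom_Ck lborel fast_weights k W (\<lambda>t x. frechet_derivative g (at (orbit_pt t x)) v * e t x)"
    if e: "dom_Ck lborel fast_weights k W e" for e v
  proof -
    have "dom_Ck lborel slow_weights k W (\<lambda>t x. frechet_derivative g (at (orbit_pt t x)) v)"
      by (rule dom_Ck_nice_orbit[OF nice_derivative[OF D(1) B(1) assms(1)] assms(2)])
    then have "dom_Ck lborel fast_weights k W (\<lambda>t x. e t x * frechet_derivative g (at (orbit_pt t x)) v)"
      by (intro dom_Ck_mult[OF open_W weight_cone_fast _ e, where ?w2.0 = slow_weights] fast_slow_mult)
    then show ?thesis by (simp add: mult.commute)
  qed
  show ?thesis unfolding grad_int_def[abs_def]
    using assms(2) by (intro dom_Ck_add[OF open_W weight_cone_fast] m dom_Ck_dp dom_Ck_dq order_le_Suc_imp[OF assms(2)])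
qed

lemma Ck_grad:
  assumes "nice D B g" "order_le (Suc k) r"
  shows "Ck_on k W (grad g i)"
  unfolding grad_def[abs_def]
  by (intro Ck_on_minus[OF open_W] dom_Ck_integral(1)[OF open_W integrable_fast dom_Ck_grad_int[OF assms]])


text \<open>There are finitely many pendulums, so the smallest rate and the largest constant serve
  all of them.\<close>

lemma decay_uniform:
  obtains c C k where "c > 0" "C > 0" "\<And>i t. \<bar>p0 i t\<bar> \<le> C * exp (- c * \<bar>t\<bar>)"
    "\<And>i t. \<bar>q0 i t - 2 * pi * of_int (k i t)\<bar> \<le> C * exp (- c * \<bar>t\<bar>)"
    "\<And>i t. \<bar>dp i t\<bar> \<le> C * exp (- c * \<bar>t\<bar>)" "\<And>i t. \<bar>dq i t\<bar> \<le> C * exp (- c * \<bar>t\<bar>)"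
    "\<And>i t. \<bar>deriv (deriv (V i)) (q0 i t)\<bar> \<le> C"
proof -
  have "\<exists>c C. \<exists>k :: real \<Rightarrow> int. c > 0 \<and> C > 0 \<and> (\<forall>t. \<bar>p0 i t\<bar> \<le> C * exp (- c * \<bar>t\<bar>) \<and>
     \<bar>q0 i t - 2 * pi * of_int (k t)\<bar> \<le> C * exp (- c * \<bar>t\<bar>) \<and> \<bar>dp i t\<bar> \<le> C * exp (- c * \<bar>t\<bar>) \<and>
     \<bar>deriv (deriv (V i)) (q0 i t)\<bar> \<le> C)" for i
  proof -
    interpret pendulum_orbit r "V i" "\<sigma> i" "p0 i" "q0 i" by (rule orb)
    obtain c1 C1 k where 1: "c1 > 0" "C1 \<ge> 0" "\<And>t. \<bar>p0 i t\<bar> \<le> C1 * exp (- c1 * \<bar>t\<bar>)"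
      "\<And>t. \<bar>q0 i t - 2 * pi * of_int (k t)\<bar> \<le> C1 * exp (- c1 * \<bar>t\<bar>)" by (rule decay) blast
    obtain c2 C2 where 2: "c2 > 0" "\<And>t. \<bar>p0 i t\<bar> \<le> C2 * exp (- c2 * \<bar>t\<bar>)"
      "\<And>t. \<bar>deriv (V i) (q0 i t)\<bar> \<le> C2 * exp (- c2 * \<bar>t\<bar>)" by (rule p_bound) blast
    obtain K where K: "K > 0" "\<And>x. \<bar>deriv (deriv (V i)) x\<bar> \<le> K" by (rule V''_bdd) blast
    have C2: "0 \<le> C2" by (rule exp_bound_nonneg[OF 2(2)])
    define c C where "c = min c1 c2" and "C = max (max C1 C2) K"
    have le: "C1 * exp (- c1 * \<bar>t\<bar>) \<le> C * exp (- c * \<bar>t\<bar>)" "C2 * exp (- c2 * \<bar>t\<bar>) \<le> C * exp (- c * \<bar>t\<bar>)" for t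
      using 1(2) C2 by (auto intro!: mult_mono mult_right_mono simp: c_def C_def)
    have "c > 0" "C > 0" using 1 2 K by (auto simp: c_def C_def)
    moreover have "\<bar>dp i t\<bar> \<le> C * exp (- c * \<bar>t\<bar>)" for t
      using order_trans[OF 2(3) le(2)] by (simp add: dp_def abs_mult \<sigma>_sq)
    moreover have "\<bar>deriv (deriv (V i)) (q0 i t)\<bar> \<le> C" for t
      using K(2)[of "q0 i t"] by (simp add: C_def)
    ultimately show ?thesis using order_trans[OF 1(3) le(1)] order_trans[OF 1(4) le(1)] by blast
  qed
  then have "\<exists>c C. \<exists>k :: 'n \<Rightarrow> real \<Rightarrow> int. \<forall>i. c i > 0 \<and> C i > 0 \<and> (\<forall>t. \<bar>p0 i t\<bar> \<le> C i * exp (- c i * \<bar>t\<bar>) \<and>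
     \<bar>q0 i t - 2 * pi * of_int (k i t)\<bar> \<le> C i * exp (- c i * \<bar>t\<bar>) \<and> \<bar>dp i t\<bar> \<le> C i * exp (- c i * \<bar>t\<bar>) \<and>
     \<bar>deriv (deriv (V i)) (q0 i t)\<bar> \<le> C i)" by metis
  then obtain c C k where *: "\<And>i. c i > 0" "\<And>i. C i > 0" "\<And>i t. \<bar>p0 i t\<bar> \<le> C i * exp (- c i * \<bar>t\<bar>)"
     "\<And>i t. \<bar>q0 i t - 2 * pi * of_int (k i t)\<bar> \<le> C i * exp (- c i * \<bar>t\<bar>)" "\<And>i t. \<bar>dp i t\<bar> \<le> C i * exp (- c i * \<bar>t\<bar>)"
     "\<And>i t. \<bar>deriv (deriv (V i)) (q0 i t)\<bar> \<le> C i" by blast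
  define c' C' where "c' = Min (range c)" and "C' = Max (range C)"
  have c': "c' \<le> c i" "c' > 0" and C': "C i \<le> C'" "C' > 0" for i
    using * by (auto simp: c'_def C'_def Max_gr_iff)
  have le: "C i * exp (- c i * \<bar>t\<bar>) \<le> C' * exp (- c' * \<bar>t\<bar>)" for i t
    using c'(1)[of i] C'(1)[of i] *(2)[of i] C'(2)
    by (intro mult_mono) (auto intro!: mult_right_mono)
  show ?thesis
  proof (rule that[of c' C' k])
    show "\<bar>dq i t\<bar> \<le> C' * exp (- c' * \<bar>t\<bar>)" for i t
      using order_trans[OF *(3) le, of i t] pendulum_orbit.\<sigma>_sq(2)[OF orb, of i] by (simp add: dq_def abs_mult)
  qed (use c' C' order_trans[OF *(3) le] order_trans[OF *(4) le] order_trans[OF *(5) le] order_trans[OF *(6) C'(1)] in auto)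
qed

lemma measurable_nice_orbit:
  assumes "nice D B g" "x \<in> W"
  shows "(\<lambda>t. g (orbit_pt t x)) \<in> borel_measurable borel" "(\<lambda>t. g (rest_pt t x)) \<in> borel_measurable borel"
proof -
  have "dominated lborel slow_weights W (\<lambda>t x. orbit_pt t x \<bullet> b)" if b: "b \<in> Basis" for b
    using dom_Ck_orbit_pt[OF order_le_2 b, of 0] by simp
  then have "dominated lborel slow_weights W (\<lambda>t x. g (orbit_pt t x))"
    using assms by (intro dominated_compose[OF open_Mreal[OF D(1) B(1)] open_W weight_cone_slow one_slow])
      (auto simp: orbit_pt_in nice_def simp del: bdd_Ck.simps)
  then show "(\<lambda>t. g (orbit_pt t x)) \<in> borel_measurable borel" using assms by (simp add: dominated_def)
  have "dominated lborel slow_weights W (\<lambda>t x. g (rest_pt t x))"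
    using assms by (intro dominated_compose[OF open_Mreal[OF D(1) B(1)] open_W weight_cone_slow one_slow _ dom_Ck_rest_pt_0])
      (auto simp: rest_pt_in nice_def simp del: bdd_Ck.simps)
  then show "(\<lambda>t. g (rest_pt t x)) \<in> borel_measurable borel" using assms by (simp add: dominated_def)
qed

text \<open>By periodicity in \<open>q\<close> the rest point may be moved to the lifted equilibria
  that the pendulums approach. The orbit is exponentially close to it, with one \<open>C\<close>
  from the momenta and one from the positions, and \<open>g\<close> is Lipschitz on the convex set
  \<open>Mreal D B\<close>.\<close>

lemma nice_diff_le:
  fixes N :: real
  assumes g: "nice D B g" and x: "x \<in> W" and N: "\<And>z b. z \<in> Mreal D B \<Longrightarrow> b \<in> Basis \<Longrightarrow> \<bar>frechet_derivative g (at z) b\<bar> \<le> N"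
    and d: "\<And>i t. \<bar>p0 i t\<bar> \<le> C * exp (- c * \<bar>t\<bar>)"
    "\<And>i t. \<bar>q0 i t - 2 * pi * of_int (k i t)\<bar> \<le> C * exp (- c * \<bar>t\<bar>)"
  shows "\<bar>g (orbit_pt t x) - g (rest_pt t x)\<bar> \<le>
      DIM(('n, 'd) rphase) * N * (2 * C) * (\<Sum>i\<in>UNIV. exp (- c * \<bar>fst x $ i + t\<bar>))"
proof -
  have N0: "0 \<le> N" using N[OF orbit_pt_in[OF x] e_Basis(1)] abs_ge_zero order_trans by blast
  let ?s = "(0, period (\<lambda>i. k i (fst x $ i + t)), 0) :: ('n, 'd) rphase"
  let ?y = "rest_pt t x + ?s"
  have y: "?y \<in> Mreal D B" using rest_pt_in[OF x, of t] by (auto simp: rest_pt_def Mreal_def zero_prod_def)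
  have "g ?y = g (rest_pt t x)" using g rest_pt_in[OF x] unfolding nice_def by blast
  then have "\<bar>g (orbit_pt t x) - g (rest_pt t x)\<bar> \<le> DIM(('n, 'd) rphase) * N * norm (orbit_pt t x - ?y)"
    using Mreal_Lipschitz[OF D(2) B(2) nice_differentiable[OF g] N orbit_pt_in[OF x] y] by simp
  also have "\<dots> \<le> DIM(('n, 'd) rphase) * N * (\<Sum>i\<in>UNIV. (2 * C) * exp (- c * \<bar>fst x $ i + t\<bar>))"
  proof (rule mult_left_mono)
    let ?a = "orbit_at p0 (fst x + t *\<^sub>R ones)" and ?b = "orbit_at q0 (fst x + t *\<^sub>R ones) - period (\<lambda>i. k i (fst x $ i + t))"
    have "orbit_pt t x - ?y = (?a, 0) + (0, ?b, 0)"
      by (simp add: orbit_pt_def rest_pt_def zero_prod_def)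
    then have "norm (orbit_pt t x - ?y) \<le> norm ?a + norm ?b"
      using norm_triangle_ineq[of "(?a, 0)" "(0, ?b, 0) :: ('n, 'd) rphase"] by (simp add: norm_Pair)
    also have "\<dots> \<le> (\<Sum>i\<in>UNIV. \<bar>?a $ i\<bar>) + (\<Sum>i\<in>UNIV. \<bar>?b $ i\<bar>)" by (intro add_mono norm_vec_le_sum)
    also have "\<dots> = (\<Sum>i\<in>UNIV. \<bar>?a $ i\<bar> + \<bar>?b $ i\<bar>)" by (simp add: sum.distrib)
    also have "\<dots> \<le> (\<Sum>i\<in>UNIV. (2 * C) * exp (- c * \<bar>fst x $ i + t\<bar>))"
    proof (rule sum_mono)
      fix i
      show "\<bar>?a $ i\<bar> + \<bar>?b $ i\<bar> \<le> (2 * C) * exp (- c * \<bar>fst x $ i + t\<bar>)"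
        using d(1)[of i "fst x $ i + t"] d(2)[of i "fst x $ i + t"] by (simp add: orbit_at_def period_def)
    qed
    finally show "norm (orbit_pt t x - ?y) \<le> (\<Sum>i\<in>UNIV. (2 * C) * exp (- c * \<bar>fst x $ i + t\<bar>))" .
  qed (use N0 in simp)
  also have "\<dots> = DIM(('n, 'd) rphase) * N * (2 * C) * (\<Sum>i\<in>UNIV. exp (- c * \<bar>fst x $ i + t\<bar>))"
    by (simp only: sum_distrib_left[symmetric] mult.assoc)
  finally show ?thesis .
qed

lemma integral_nice_diff_le:
  "\<exists>K\<ge>0. \<forall>g x N. nice D B g \<longrightarrow> x \<in> W \<longrightarrow> (\<forall>z\<in>Mreal D B. \<forall>b\<in>Basis. \<bar>frechet_derivative g (at z) b\<bar> \<le> N) \<longrightarrow>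
     \<bar>\<integral>t. g (orbit_pt t x) - g (rest_pt t x) \<partial>lborel\<bar> \<le> K * N"
proof -
  obtain c C k where d: "c > 0" "C > 0" "\<And>i t. \<bar>p0 i t\<bar> \<le> C * exp (- c * \<bar>t\<bar>)"
    "\<And>i t. \<bar>q0 i t - 2 * pi * of_int (k i t)\<bar> \<le> C * exp (- c * \<bar>t\<bar>)" by (rule decay_uniform) blast
  let ?K = "DIM(('n, 'd) rphase) * (2 * C) * (CARD('n) * (\<integral>t. exp (- c * \<bar>t\<bar>) \<partial>lborel))"
  show ?thesis
  proof (intro exI[of _ ?K] conjI allI impI)
    show "0 \<le> ?K" using d by (intro mult_nonneg_nonneg) auto
    fix g x N
    assume g: "nice D B g" "x \<in> W" "\<forall>z\<in>Mreal D B. \<forall>b\<in>Basis. \<bar>frechet_derivative g (at z) b\<bar> \<le> N"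
    have "\<bar>\<integral>t. g (orbit_pt t x) - g (rest_pt t x) \<partial>lborel\<bar> \<le>
        (DIM(('n, 'd) rphase) * N * (2 * C)) * (CARD('n) * (\<integral>t. exp (- c * \<bar>t\<bar>) \<partial>lborel))"
    proof (rule integral_exp_shift_bound(2)[where \<tau> = "fst x", OF d(1)])
      show "(\<lambda>t. g (orbit_pt t x) - g (rest_pt t x)) \<in> borel_measurable borel"
        using measurable_nice_orbit[OF g(1,2)] by simp
      show "\<bar>g (orbit_pt t x) - g (rest_pt t x)\<bar> \<le>
          DIM(('n, 'd) rphase) * N * (2 * C) * (\<Sum>i\<in>UNIV. exp (- c * \<bar>fst x $ i + t\<bar>))" for t
        by (rule nice_diff_le[OF g(1,2) _ d(3,4)]) (use g(3) in blast)
    qed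
    then show "\<bar>\<integral>t. g (orbit_pt t x) - g (rest_pt t x) \<partial>lborel\<bar> \<le> ?K * N" by (simp add: mult_ac)
  qed
qed

text \<open>The weight must serve all shifts near a given one, so the exponentials centred at the
  components of \<tau> are replaced by one centred at 0, at the price of a factor that depends on
  \<open>x\<close>.\<close>

lemma dominated_nice_diff:
  assumes g: "nice D B g"
  shows "dominated lborel fast_weights W (\<lambda>t x. g (orbit_pt t x) - g (rest_pt t x))"
proof (rule dominatedI)
  fix x assume x: "x \<in> W"
  show "(\<lambda>t. g (orbit_pt t x) - g (rest_pt t x)) \<in> borel_measurable lborel"
    using measurable_nice_orbit[OF g x] by simp
  obtain c C k where d: "c > 0" "C > 0" "\<And>i t. \<bar>p0 i t\<bar> \<le> C * exp (- c * \<bar>t\<bar>)"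
    "\<And>i t. \<bar>q0 i t - 2 * pi * of_int (k i t)\<bar> \<le> C * exp (- c * \<bar>t\<bar>)" by (rule decay_uniform) blast
  obtain N where N: "0 \<le> N" "\<And>z b. z \<in> Mreal D B \<Longrightarrow> b \<in> Basis \<Longrightarrow> \<bar>frechet_derivative g (at z) b\<bar> \<le> N"
    using nice_derivative_bdd[OF g] by blast
  let ?K = "DIM(('n, 'd) rphase) * N * (2 * C)"
  let ?g = "\<lambda>t. ?K * (CARD('n) * exp (c * (norm (fst x) + 1))) * exp (- c * \<bar>t\<bar>)"
  have "\<bar>g (orbit_pt t y) - g (rest_pt t y)\<bar> \<le> ?g t" if y: "y \<in> ball x 1" "y \<in> W" for y t
  proof -
    have n: "norm (fst y) \<le> norm (fst x) + 1"
    proof -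
      have "norm (fst y - fst x) \<le> norm (y - x)" by (metis fst_diff norm_fst_le prod.collapse)
      then show ?thesis using y(1) norm_triangle_sub[of "fst y" "fst x"] by (simp add: dist_norm norm_minus_commute)
    qed
    have "\<bar>g (orbit_pt t y) - g (rest_pt t y)\<bar> \<le> ?K * (\<Sum>i\<in>UNIV. exp (- c * \<bar>fst y $ i + t\<bar>))"
      by (rule nice_diff_le[OF g y(2) N(2) d(3,4)])
    also have "\<dots> \<le> ?K * (\<Sum>i\<in>(UNIV::'n set). exp (c * (norm (fst x) + 1)) * exp (- c * \<bar>t\<bar>))"
    proof (intro mult_left_mono sum_mono)
      fix i :: 'n
      have "\<bar>fst y $ i\<bar> \<le> norm (fst x) + 1" using n component_le_norm_cart[of "fst y" i] by linarith
      then have "\<bar>t\<bar> - (norm (fst x) + 1) \<le> \<bar>fst y $ i + t\<bar>" by linarith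
      then have "c * (\<bar>t\<bar> - (norm (fst x) + 1)) \<le> c * \<bar>fst y $ i + t\<bar>" using d(1) by (intro mult_left_mono) auto
      then show "exp (- c * \<bar>fst y $ i + t\<bar>) \<le> exp (c * (norm (fst x) + 1)) * exp (- c * \<bar>t\<bar>)"
        by (simp add: algebra_simps flip: exp_add)
    qed (use N d in auto)
    finally show ?thesis by (simp add: mult_ac)
  qed
  moreover have "?g \<in> fast_weights"
    by (rule fast_weightsI[OF _ d(1), of _ "?K * (CARD('n) * exp (c * (norm (fst x) + 1)))"]) (use N d in \<open>auto simp: abs_mult\<close>)
  ultimately show "\<exists>e>0. \<exists>h\<in>fast_weights. \<forall>y\<in>ball x e \<inter> W. \<forall>t\<in>space lborel. \<bar>g (orbit_pt t y) - g (rest_pt t y)\<bar> \<le> h t"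
    by (intro exI[of _ 1] conjI bexI[of _ ?g]) auto
next
  fix t
  have c: "continuous_on W (\<lambda>x. orbit_pt t x \<bullet> b)" "continuous_on W (\<lambda>x. rest_pt t x \<bullet> b)" if b: "b \<in> Basis" for b
    using dom_Ck_orbit_pt[OF order_le_2 b, of 0] dom_Ck_rest_pt_0[OF b] by (auto simp: dominated_def)
  have "continuous_on W (orbit_pt t)" "continuous_on W (rest_pt t)"
    unfolding continuous_on_componentwise[of W "orbit_pt t"] continuous_on_componentwise[of W "rest_pt t"] using c by auto
  note co = this
  have cg: "continuous_on (Mreal D B) g" using g bdd_Ck.simps(1) unfolding nice_def by blast
  show "continuous_on W (\<lambda>x. g (orbit_pt t x) - g (rest_pt t x))"
    by (rule continuous_on_diff[OF continuous_on_compose2[OF cg co(1)] continuous_on_compose2[OF cg co(2)]])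
      (auto simp: orbit_pt_in rest_pt_in)
qed

end

section \<open>Derivatives of the potential in the shifts and the angles\<close>

lemma has_derivative_vecI:
  fixes f :: "'a::real_normed_vector \<Rightarrow> real^'n"
  assumes "\<And>i. ((\<lambda>x. f x $ i) has_derivative (\<lambda>v. f' v $ i)) (at x)"
  shows "(f has_derivative f') (at x)"
  unfolding has_derivative_componentwise_within[of f] using assms by (auto simp: Basis_vec_def inner_axis)

lemma vec_eq_sum_axis: "(\<Sum>i\<in>UNIV. (c i) *\<^sub>R axis i (1::real)) = (\<chi> i. c i)"
  using basis_expansion[of "\<chi> i. c i"] by (simp add: scalar_mult_eq_scaleR)

context melnikov
begin

lemma sum_e: "(\<Sum>i\<in>UNIV. c i *\<^sub>R ep i) = ((\<chi> i. c i), 0)" "(\<Sum>i\<in>UNIV. c i *\<^sub>R eq i) = (0, (\<chi> i. c i), 0)"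
  "(\<Sum>j\<in>UNIV. c' j *\<^sub>R e\<phi> j) = (0, 0, 0, (\<chi> j. c' j), 0)"
  by (simp_all add: ep_def eq_def e\<phi>_def sum_prod vec_eq_sum_axis zero_prod_def)

lemma Dp0: "(p0 i has_real_derivative dp i u) (at u)"
  and Dq0: "(q0 i has_real_derivative dq i u) (at u)"
  using pendulum_orbit.Dp[OF orb] pendulum_orbit.Dq[OF orb] by (auto simp: dp_def dq_def)

lemma has_derivative_component:
  assumes "\<And>u. (e has_real_derivative e' u) (at u)"
  shows "((\<lambda>\<tau> :: real^'n. e (\<tau> $ i + t)) has_derivative (\<lambda>v. e' (\<tau> $ i + t) * v $ i)) (at \<tau>)"
proof -
  have "((\<lambda>\<tau> :: real^'n. \<tau> $ i + t) has_derivative (\<lambda>v. v $ i)) (at \<tau>)"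
    by (auto intro!: derivative_eq_intros bounded_linear_imp_has_derivative bounded_linear_vec_nth)
  from has_derivative_compose[OF this assms[unfolded has_field_derivative_def]] show ?thesis .
qed

lemma has_derivative_orbit_at:
  "((\<lambda>\<tau>. orbit_at p0 (\<tau> + t *\<^sub>R ones)) has_derivative (\<lambda>v. \<chi> i. dp i (\<tau> $ i + t) * v $ i)) (at \<tau>)"
  "((\<lambda>\<tau>. orbit_at q0 (\<tau> + t *\<^sub>R ones)) has_derivative (\<lambda>v. \<chi> i. dq i (\<tau> $ i + t) * v $ i)) (at \<tau>)"
  by (rule has_derivative_vecI, simp add: orbit_at_def has_derivative_component[OF Dp0] has_derivative_component[OF Dq0])+

lemma has_derivative_orbit_pt:
  "((\<lambda>y. orbit_pt t (fst y, I, snd y)) has_derivative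
     (\<lambda>v. (\<chi> i. dp i (fst y $ i + t) * fst v $ i, \<chi> i. dq i (fst y $ i + t) * fst v $ i, 0, snd v, 0))) (at y)"
proof -
  have f: "(fst has_derivative fst) (at y)" by (rule bounded_linear_imp_has_derivative[OF bounded_linear_fst])
  have s: "(snd has_derivative snd) (at y)" by (rule bounded_linear_imp_has_derivative[OF bounded_linear_snd])
  have "((\<lambda>y. snd y + t *\<^sub>R freq h I) has_derivative snd) (at y)"
    using has_derivative_add[OF s has_derivative_const[of "t *\<^sub>R freq h I"]] by simp
  then show ?thesis
    unfolding orbit_pt_def fst_conv snd_conv
    by (intro has_derivative_Pair has_derivative_compose[OF f has_derivative_orbit_at(1)]
        has_derivative_compose[OF f has_derivative_orbit_at(2)] has_derivative_const)
qed

lemma has_derivative_rest_pt: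
  "((\<lambda>y. rest_pt t (fst y, I, snd y)) has_derivative (\<lambda>v. (0, 0, 0, snd v, 0))) (at y)"
proof -
  have s: "(snd has_derivative snd) (at y)" by (rule bounded_linear_imp_has_derivative[OF bounded_linear_snd])
  have "((\<lambda>y. snd y + t *\<^sub>R freq h I) has_derivative snd) (at y)"
    using has_derivative_add[OF s has_derivative_const[of "t *\<^sub>R freq h I"]] by simp
  then show ?thesis
    unfolding rest_pt_def fst_conv snd_conv by (intro has_derivative_Pair has_derivative_const)
qed

lemma linear_phase_expand:
  fixes G :: "('n, 'd) rphase \<Rightarrow> real"
  assumes "linear G"
  shows "G (\<chi> i. a i, \<chi> i. b i, 0, w, 0) = (\<Sum>i\<in>UNIV. a i * G (ep i) + b i * G (eq i)) + (\<Sum>j\<in>UNIV. w $ j * G (e\<phi> j))"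
proof -
  have "(\<chi> i. a i, \<chi> i. b i, 0, w, 0) = (\<Sum>i\<in>UNIV. a i *\<^sub>R ep i) + (\<Sum>i\<in>UNIV. b i *\<^sub>R eq i) + (\<Sum>j\<in>UNIV. w $ j *\<^sub>R e\<phi> j)"
    by (simp add: sum_e zero_prod_def)
  then show ?thesis
    by (simp only: linear_add[OF assms] linear_sum[OF assms] linear_cmul[OF assms] real_scaleR_def sum.distrib)
qed

lemma has_derivative_nice_orbit:
  assumes "nice D B g" "I \<in> B"
  shows "((\<lambda>y. g (orbit_pt t (fst y, I, snd y))) has_derivative
    (\<lambda>v. (\<Sum>i\<in>UNIV. grad_int g i t (fst y, I, snd y) * fst v $ i) +
       (\<Sum>j\<in>UNIV. frechet_derivative g (at (orbit_pt t (fst y, I, snd y))) (e\<phi> j) * snd v $ j))) (at y)"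
proof -
  have "orbit_pt t (fst y, I, snd y) \<in> Mreal D B" by (rule orbit_pt_in) (simp add: W_def assms)
  then have Dg: "(g has_derivative frechet_derivative g (at (orbit_pt t (fst y, I, snd y)))) (at (orbit_pt t (fst y, I, snd y)))"
    by (intro differentiable_has_derivative nice_differentiable[OF assms(1)])
  from has_derivative_compose[OF has_derivative_orbit_pt this] show ?thesis
    unfolding linear_phase_expand[OF has_derivative_linear[OF Dg]]
    by (simp add: grad_int_def algebra_simps)
qed

lemma has_derivative_nice_rest:
  assumes "nice D B g" "I \<in> B"
  shows "((\<lambda>y. g (rest_pt t (fst y, I, snd y))) has_derivative
    (\<lambda>v. (\<Sum>j\<in>UNIV. frechet_derivative g (at (rest_pt t (fst y, I, snd y))) (e\<phi> j) * snd v $ j))) (at y)"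
proof -
  have "rest_pt t (fst y, I, snd y) \<in> Mreal D B" by (rule rest_pt_in) (simp add: W_def assms)
  then have Dg: "(g has_derivative frechet_derivative g (at (rest_pt t (fst y, I, snd y)))) (at (rest_pt t (fst y, I, snd y)))"
    by (intro differentiable_has_derivative nice_differentiable[OF assms(1)])
  have z: "(0, 0, 0, w, 0) = (\<chi> i. 0, \<chi> i. 0, 0, w, 0::real)" for w :: "real^'d" by (simp add: vec_eq_iff)
  from has_derivative_compose[OF has_derivative_rest_pt Dg] show ?thesis
    unfolding z linear_phase_expand[OF has_derivative_linear[OF Dg]]
    by (simp add: algebra_simps)
qed

lemma continuous_slice: "continuous_on A (\<lambda>y. (fst y, I, snd y))"
  by (intro continuous_intros)

lemma dominated_slice:
  assumes "dominated lborel fast_weights W \<Phi>" "I \<in> B"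
  shows "dominated lborel fast_weights UNIV (\<lambda>t y. \<Phi> t (fst y, I, snd y))"
  by (rule dominated_continuous_compose[OF assms(1) continuous_slice]) (use assms(2) in \<open>auto simp: W_def\<close>)

text \<open>The action is frozen. In the direction of \<tau> the differentiated orbit terms decay by
  themselves; in the direction of \<theta> the orbit and the rest point are differentiated together,
  and their difference decays.\<close>

lemma has_derivative_pot:
  assumes g: "nice D B g" and I: "I \<in> B"
  shows "((\<lambda>y. pot g (fst y, I, snd y)) has_derivative
    (\<lambda>v. (\<Sum>i\<in>UNIV. grad g i (fst y, I, snd y) * fst v $ i) + (\<Sum>j\<in>UNIV. phase_grad g j (fst y, I, snd y) * snd v $ j))) (at y)"
proof -
  let ?\<Phi> = "\<lambda>t y. g (orbit_pt t (fst y, I, snd y)) - g (rest_pt t (fst y, I, snd y))"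
  let ?P = "\<lambda>j t y. frechet_derivative g (at (orbit_pt t (fst y, I, snd y))) (e\<phi> j) - frechet_derivative g (at (rest_pt t (fst y, I, snd y))) (e\<phi> j)"
  let ?D = "\<lambda>t y v. (\<Sum>i\<in>UNIV. grad_int g i t (fst y, I, snd y) * fst v $ i) + (\<Sum>j\<in>UNIV. ?P j t y * snd v $ j)"
  have D\<Phi>: "(?\<Phi> t has_derivative ?D t y) (at y)" for t y
    using has_derivative_diff[OF has_derivative_nice_orbit[OF g I, where t = t and y = y] has_derivative_nice_rest[OF g I, where t = t and y = y]]
    by (simp add: left_diff_distrib sum_subtractf algebra_simps)
  have gi: "dominated lborel fast_weights UNIV (\<lambda>t y. grad_int g i t (fst y, I, snd y))" for i
    by (rule dominated_slice[OF dom_Ck_imp_dominated[OF dom_Ck_grad_int[OF g order_le_2]] I, of 1]) simp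
  have ph: "dominated lborel fast_weights UNIV (?P j)" for j
    by (rule dominated_slice[OF dominated_nice_diff[OF nice_derivative[OF D(1) B(1) g]] I])
  have "dom_Ck lborel fast_weights (Suc 0) UNIV ?\<Phi>"
  proof (rule dom_Ck_SucI[OF open_UNIV weight_cone_fast])
    show "dominated lborel fast_weights UNIV ?\<Phi>" by (rule dominated_slice[OF dominated_nice_diff[OF g] I])
    show "(?\<Phi> t has_derivative ?D t y) (at y)" for t y by (rule D\<Phi>)
    fix b :: "(real^'n) \<times> (real^'d)" assume "b \<in> Basis"
    then consider i where "b = (axis i 1, 0)" | j where "b = (0, axis j 1)"
      by (auto simp: Basis_prod_def Basis_vec_def)
    then show "dom_Ck lborel fast_weights 0 UNIV (\<lambda>t y. ?D t y b)"
    proof cases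
      case (1 i)
      then have "(\<lambda>t y. ?D t y b) = (\<lambda>t y. grad_int g i t (fst y, I, snd y))"
        by (simp add: axis_def if_distrib cong: if_cong)
      then show ?thesis using gi by simp
    next
      case (2 j)
      then have "(\<lambda>t y. ?D t y b) = ?P j"
        by (simp add: axis_def if_distrib cong: if_cong)
      then show ?thesis using ph by simp
    qed
  qed
  from dom_Ck_integral(2)[OF open_UNIV integrable_fast this, of y]
  have "((\<lambda>y. \<integral>t. ?\<Phi> t y \<partial>lborel) has_derivative (\<lambda>v. \<integral>t. ?D t y v \<partial>lborel)) (at y)"
    by (simp add: frechet_derivative_eqI[OF D\<Phi>])
  from has_derivative_minus[OF this]
  have 1: "((\<lambda>y. pot g (fst y, I, snd y)) has_derivative (\<lambda>v. - (\<integral>t. ?D t y v \<partial>lborel))) (at y)"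
    by (simp add: pot_def)
  have int: "integrable lborel (\<lambda>t. grad_int g i t (fst y, I, snd y))" "integrable lborel (\<lambda>t. ?P j t y)" for i j
    using integrable_dominated[OF integrable_fast gi, of y i] integrable_dominated[OF integrable_fast ph, of y j] by simp_all
  have "(\<integral>t. ?D t y v \<partial>lborel) = (\<Sum>i\<in>UNIV. (\<integral>t. grad_int g i t (fst y, I, snd y) \<partial>lborel) * fst v $ i) + (\<Sum>j\<in>UNIV. (\<integral>t. ?P j t y \<partial>lborel) * snd v $ j)" for v
    by (subst Bochner_Integration.integral_add)
      (auto intro!: Bochner_Integration.integrable_sum integrable_mult_left int simp: Bochner_Integration.integral_sum int simp del: Bochner_Integration.integral_diff)
  then show ?thesis
    using 1 by (simp add: grad_def phase_grad_def sum_negf)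
qed

lemma has_derivative_pot_\<tau>:
  assumes "nice D B g" "I \<in> B"
  shows "((\<lambda>\<tau>. pot g (\<tau>, I, \<theta>)) has_derivative (\<lambda>v. \<Sum>i\<in>UNIV. grad g i (\<tau>, I, \<theta>) * v $ i)) (at \<tau>)"
proof -
  have "((\<lambda>\<tau>. (\<tau>, \<theta>)) has_derivative (\<lambda>v. (v, 0))) (at \<tau>)"
    by (intro has_derivative_Pair has_derivative_ident has_derivative_const)
  from has_derivative_compose[OF this has_derivative_pot[OF assms]] show ?thesis by simp
qed

lemma has_derivative_pot_\<theta>:
  assumes "nice D B g" "I \<in> B"
  shows "((\<lambda>\<theta>. pot g (\<tau>, I, \<theta>)) has_derivative (\<lambda>w. \<Sum>j\<in>UNIV. phase_grad g j (\<tau>, I, \<theta>) * w $ j)) (at \<theta>)"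
proof -
  have "((\<lambda>\<theta>. (\<tau>, \<theta>)) has_derivative (\<lambda>v. (0, v))) (at \<theta>)"
    by (intro has_derivative_Pair has_derivative_ident has_derivative_const)
  from has_derivative_compose[OF this has_derivative_pot[OF assms]] show ?thesis by simp
qed

lemma grad_eq: "nice D B g \<Longrightarrow> I \<in> B \<Longrightarrow> grad g i (\<tau>, I, \<theta>) = frechet_derivative (\<lambda>\<tau>. pot g (\<tau>, I, \<theta>)) (at \<tau>) (axis i 1)"
  by (simp add: frechet_derivative_eqI[OF has_derivative_pot_\<tau>] axis_def if_distrib cong: if_cong)

lemma phase_grad_eq: "nice D B g \<Longrightarrow> I \<in> B \<Longrightarrow> phase_grad g j (\<tau>, I, \<theta>) = frechet_derivative (\<lambda>\<theta>. pot g (\<tau>, I, \<theta>)) (at \<theta>) (axis j 1)"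
  by (simp add: frechet_derivative_eqI[OF has_derivative_pot_\<theta>] axis_def if_distrib cong: if_cong)

lemma grad_differentiable: "nice D B g \<Longrightarrow> x \<in> W \<Longrightarrow> grad g i differentiable at x"
  using Ck_on_SucD(2)[OF Ck_grad[OF _ order_le_2, of g "Suc 0"]] by simp

text \<open>The index order is dictated by \<open>hessian\<close> and gives the transpose of the
  Jacobian matrix of \<open>grad\<close>; later only determinants are compared.\<close>

lemma hessian_pot:
  assumes "nice D B g" "I \<in> B"
  shows "hessian (\<lambda>\<tau>. pot g (\<tau>, I, \<theta>)) \<tau> = (\<chi> i j. frechet_derivative (grad g j) (at (\<tau>, I, \<theta>)) (axis i 1, 0))"
proof -
  have "frechet_derivative (\<lambda>\<tau>. grad g j (\<tau>, I, \<theta>)) (at \<tau>) v = frechet_derivative (grad g j) (at (\<tau>, I, \<theta>)) (v, 0)" for j v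
  proof -
    have 1: "((\<lambda>\<tau>. (\<tau>, I, \<theta>)) has_derivative (\<lambda>v. (v, 0, 0))) (at \<tau>)"
      by (intro has_derivative_Pair has_derivative_ident has_derivative_const)
    have "grad g j differentiable at (\<tau>, I, \<theta>)"
      by (rule grad_differentiable[OF assms(1)]) (simp add: W_def assms)
    from has_derivative_compose[OF 1 differentiable_has_derivative[OF this]]
    show ?thesis by (simp add: frechet_derivative_eqI zero_prod_def)
  qed
  then show ?thesis
    by (simp add: hessian_def grad_eq[OF assms, symmetric])
qed

lemma poincare_fun_eq: "poincare_fun h p0 q0 H \<tau> I \<phi> s = pot (real_part H) (\<tau> - s *\<^sub>R ones, I, \<phi> - s *\<^sub>R freq h I)"
proof -
  let ?x = "(\<tau> - s *\<^sub>R ones, I, \<phi> - s *\<^sub>R freq h I)"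
  let ?f = "\<lambda>t. real_part H (orbit_pt t ?x) - real_part H (rest_pt t ?x)"
  have "(\<integral>t. ?f t \<partial>lborel) = (\<integral>t. ?f (s + 1 * t) \<partial>lborel)"
    using lborel_integral_real_affine[of 1 ?f s] by simp
  moreover have "orbit_pt (s + 1 * t) ?x = (orbit_at p0 (\<tau> + t *\<^sub>R ones), orbit_at q0 (\<tau> + t *\<^sub>R ones),
                        I, \<phi> + t *\<^sub>R freq h I, s + t)"
    "rest_pt (s + 1 * t) ?x = (0, 0, I, \<phi> + t *\<^sub>R freq h I, s + t)" for t
    by (simp_all add: orbit_pt_def rest_pt_def algebra_simps)
  ultimately show ?thesis by (simp add: poincare_fun_def pot_def)
qed


section \<open>Estimates uniform in the shifts\<close>

lemma measurable_grad_int: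
  assumes "nice D B g" "x \<in> W"
  shows "(\<lambda>t. grad_int g i t x) \<in> borel_measurable borel"
  using dom_Ck_imp_dominated[OF dom_Ck_grad_int[OF assms(1) order_le_2[of 1, simplified]]] assms(2)
  by (simp add: dominated_def)

lemma D_dp: "(dp i has_real_derivative - (deriv (deriv (V i)) (q0 i u) * p0 i u)) (at u)"
proof -
  interpret pendulum_orbit r "V i" "\<sigma> i" "p0 i" "q0 i" by (rule orb)
  have *: "((\<lambda>u. - \<sigma> i * deriv (V i) (q0 i u)) has_real_derivative - \<sigma> i * (deriv (deriv (V i)) (q0 i u) * (\<sigma> i * p0 i u))) (at u)"
    by (intro DERIV_cmult DERIV_chain2[OF DV' Dq])
  have "- \<sigma> i * (deriv (deriv (V i)) (q0 i u) * (\<sigma> i * p0 i u)) = - (deriv (deriv (V i)) (q0 i u) * p0 i u) * (\<sigma> i * \<sigma> i)"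
    by (simp only: mult_ac mult_minus_left mult_minus_right)
  also have "\<dots> = - (deriv (deriv (V i)) (q0 i u) * p0 i u)" by (simp only: \<sigma>_sq mult_1_right)
  finally show ?thesis using * by (simp only: dp_def[abs_def])
qed

lemma D_dq: "(dq i has_real_derivative \<sigma> i * dp i u) (at u)"
  unfolding dq_def[abs_def] by (intro DERIV_cmult Dp0)

lemma has_derivative_grad_int:
  assumes g: "nice D B g" and I: "I \<in> B"
  shows "((\<lambda>\<tau>. grad_int g i t (\<tau>, I, \<theta>)) has_derivative
    (\<lambda>v. (\<Sum>l\<in>UNIV. grad_int (\<lambda>z. frechet_derivative g (at z) (ep i)) l t (\<tau>, I, \<theta>) * v $ l) * dp i (\<tau> $ i + t)
       + frechet_derivative g (at (orbit_pt t (\<tau>, I, \<theta>))) (ep i) * (- (deriv (deriv (V i)) (q0 i (\<tau> $ i + t)) * p0 i (\<tau> $ i + t)) * v $ i)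
       + ((\<Sum>l\<in>UNIV. grad_int (\<lambda>z. frechet_derivative g (at z) (eq i)) l t (\<tau>, I, \<theta>) * v $ l) * dq i (\<tau> $ i + t)
       + frechet_derivative g (at (orbit_pt t (\<tau>, I, \<theta>))) (eq i) * (\<sigma> i * dp i (\<tau> $ i + t) * v $ i)))) (at \<tau>)"
proof -
  have y: "((\<lambda>\<tau>. (\<tau>, \<theta>)) has_derivative (\<lambda>v. (v, 0))) (at \<tau>)"
    by (intro has_derivative_Pair has_derivative_ident has_derivative_const)
  have G: "((\<lambda>\<tau>. frechet_derivative g (at (orbit_pt t (\<tau>, I, \<theta>))) w) has_derivative
     (\<lambda>v. \<Sum>l\<in>UNIV. grad_int (\<lambda>z. frechet_derivative g (at z) w) l t (\<tau>, I, \<theta>) * v $ l)) (at \<tau>)" for w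
    using has_derivative_compose[OF y has_derivative_nice_orbit[OF nice_derivative[OF D(1) B(1) g, of w] I]] by simp
  note 1 = has_derivative_mult[OF G has_derivative_component[OF D_dp]]
  note 2 = has_derivative_mult[OF G has_derivative_component[OF D_dq]]
  show ?thesis
    unfolding grad_int_def[of g i t "(_, I, \<theta>)"] fst_conv
    by (rule has_derivative_eq_rhs[OF has_derivative_add[OF 1 2]]) (simp add: fun_eq_iff algebra_simps)
qed

lemma grad_int_le:
  assumes "x \<in> W" "\<And>z b. z \<in> Mreal D B \<Longrightarrow> b \<in> Basis \<Longrightarrow> \<bar>frechet_derivative g (at z) b\<bar> \<le> N"
    "\<bar>dp i (fst x $ i + t)\<bar> \<le> E" "\<bar>dq i (fst x $ i + t)\<bar> \<le> E"
  shows "\<bar>grad_int g i t x\<bar> \<le> 2 * N * E"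
proof -
  have N: "\<bar>frechet_derivative g (at (orbit_pt t x)) b\<bar> \<le> N" if "b \<in> Basis" for b
    using assms(1,2) that orbit_pt_in by blast
  have N0: "0 \<le> N" using N[OF e_Basis(1)] abs_ge_zero order_trans by blast
  have "\<bar>frechet_derivative g (at (orbit_pt t x)) (ep i) * dp i (fst x $ i + t)\<bar> \<le> N * E"
    "\<bar>frechet_derivative g (at (orbit_pt t x)) (eq i) * dq i (fst x $ i + t)\<bar> \<le> N * E"
    unfolding abs_mult using N0 by (intro mult_mono N e_Basis assms(3,4); simp)+
  then show ?thesis unfolding grad_int_def
    using abs_triangle_ineq[of "frechet_derivative g (at (orbit_pt t x)) (ep i) * dp i (fst x $ i + t)" "frechet_derivative g (at (orbit_pt t x)) (eq i) * dq i (fst x $ i + t)"]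
    by linarith
qed

lemma frechet_derivative_grad_\<tau>:
  assumes g: "nice D B g" and I: "I \<in> B"
  shows "frechet_derivative (grad g i) (at (\<tau>, I, \<theta>)) (v, 0) =
    - (\<integral>t. frechet_derivative (\<lambda>\<tau>. grad_int g i t (\<tau>, I, \<theta>)) (at \<tau>) v \<partial>lborel)"
proof -
  have x: "(\<tau>, I, \<theta>) \<in> W" using I by (simp add: W_def)
  have dom: "dom_Ck lborel fast_weights (Suc 0) W (grad_int g i)"
    by (rule dom_Ck_grad_int[OF g order_le_2]) simp
  have diff: "grad_int g i t differentiable at (\<tau>, I, \<theta>)" for t
    using dom x by simp
  have "(grad g i has_derivative (\<lambda>v. - (\<integral>t. frechet_derivative (grad_int g i t) (at (\<tau>, I, \<theta>)) v \<partial>lborel))) (at (\<tau>, I, \<theta>))"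
    unfolding grad_def[abs_def]
    by (intro has_derivative_minus dom_Ck_integral(2)[OF open_W integrable_fast dom _ x]) simp_all
  moreover have "frechet_derivative (\<lambda>\<tau>. grad_int g i t (\<tau>, I, \<theta>)) (at \<tau>) v = frechet_derivative (grad_int g i t) (at (\<tau>, I, \<theta>)) (v, 0)" for t
  proof -
    have 1: "((\<lambda>\<tau>. (\<tau>, I, \<theta>)) has_derivative (\<lambda>v. (v, 0, 0))) (at \<tau>)"
      by (intro has_derivative_Pair has_derivative_ident has_derivative_const)
    from has_derivative_compose[OF 1 differentiable_has_derivative[OF diff[of t]]]
    show ?thesis by (simp add: frechet_derivative_eqI zero_prod_def)
  qed
  ultimately show ?thesis by (simp add: frechet_derivative_eqI)
qed

text \<open>Linear control by the first two derivatives of \<open>g\<close>, with a constant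
  independent of \<tau>, \<open>I\<close> and \<theta>. It is applied to the difference of two
  nearby perturbations.\<close>

lemma melnikov_estimates:
  "\<exists>K\<ge>0. \<forall>g N I \<tau> \<theta>. nice D B g \<longrightarrow> I \<in> B \<longrightarrow>
     (\<forall>z\<in>Mreal D B. \<forall>b\<in>Basis. \<bar>frechet_derivative g (at z) b\<bar> \<le> N) \<longrightarrow>
     (\<forall>z\<in>Mreal D B. \<forall>b\<in>Basis. \<forall>b'\<in>Basis. \<bar>frechet_derivative (\<lambda>z. frechet_derivative g (at z) b) (at z) b'\<bar> \<le> N) \<longrightarrow>
     (\<forall>i. \<bar>grad g i (\<tau>, I, \<theta>)\<bar> \<le> K * N) \<and> (\<forall>j. \<bar>phase_grad g j (\<tau>, I, \<theta>)\<bar> \<le> K * N) \<and>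
     (\<forall>i l. \<bar>frechet_derivative (grad g i) (at (\<tau>, I, \<theta>)) (axis l 1, 0)\<bar> \<le> K * N)"
proof -
  obtain c C k where d: "c > 0" "C > 0" "\<And>i t. \<bar>p0 i t\<bar> \<le> C * exp (- c * \<bar>t\<bar>)"
    "\<And>i t. \<bar>q0 i t - 2 * pi * of_int (k i t)\<bar> \<le> C * exp (- c * \<bar>t\<bar>)"
    "\<And>i t. \<bar>dp i t\<bar> \<le> C * exp (- c * \<bar>t\<bar>)" "\<And>i t. \<bar>dq i t\<bar> \<le> C * exp (- c * \<bar>t\<bar>)"
    "\<And>i t. \<bar>deriv (deriv (V i)) (q0 i t)\<bar> \<le> C" by (rule decay_uniform) blast
  obtain K1 where K1: "K1 \<ge> 0" "\<And>g x N. nice D B g \<Longrightarrow> x \<in> W \<Longrightarrow> (\<forall>z\<in>Mreal D B. \<forall>b\<in>Basis. \<bar>frechet_derivative g (at z) b\<bar> \<le> N) \<Longrightarrow>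
     \<bar>\<integral>t. g (orbit_pt t x) - g (rest_pt t x) \<partial>lborel\<bar> \<le> K1 * N" using integral_nice_diff_le by blast
  define J where "J = CARD('n) * (\<integral>t. exp (- c * \<bar>t\<bar>) \<partial>lborel)"
  have J: "J \<ge> 0" by (simp add: J_def)
  \<comment> \<open>One summand for each estimate: \<open>K1\<close> for the phase gradient, the
    second for the gradient, the third for the Jacobian.\<close>
  let ?K = "K1 + 2 * C * J + (5 * C\<^sup>2 + C) * J"
  show ?thesis
  proof (intro exI[of _ ?K] conjI allI impI)
    show "?K \<ge> 0" using K1 J d by (intro add_nonneg_nonneg mult_nonneg_nonneg) auto
    fix g N I \<tau> \<theta>
    assume g: "nice D B g" and I: "I \<in> B"
      and N1: "\<forall>z\<in>Mreal D B. \<forall>b\<in>Basis. \<bar>frechet_derivative g (at z) b\<bar> \<le> N"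
      and N2: "\<forall>z\<in>Mreal D B. \<forall>b\<in>Basis. \<forall>b'\<in>Basis. \<bar>frechet_derivative (\<lambda>z. frechet_derivative g (at z) b) (at z) b'\<bar> \<le> N"
    have x: "(\<tau>, I, \<theta>) \<in> W" using I by (simp add: W_def)
    have N: "0 \<le> N" using N1 orbit_pt_in[OF x] e_Basis(1) abs_ge_zero order_trans by blast
    have parts: "K1 * N \<le> ?K * N" "2 * N * C * J \<le> ?K * N" "(5 * C\<^sup>2 + C) * N * J \<le> ?K * N"
      using N K1(1) J d(2) by (auto simp: algebra_simps intro!: add_nonneg_nonneg mult_nonneg_nonneg)
    have single: "exp (- c * \<bar>\<tau> $ i + t\<bar>) \<le> (\<Sum>i\<in>UNIV. exp (- c * \<bar>\<tau> $ i + t\<bar>))" for i t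
      by (rule member_le_sum) auto
    show "\<bar>grad g i (\<tau>, I, \<theta>)\<bar> \<le> ?K * N" for i
    proof -
      have "\<bar>\<integral>t. grad_int g i t (\<tau>, I, \<theta>) \<partial>lborel\<bar> \<le> (2 * N * C) * (CARD('n) * (\<integral>t. exp (- c * \<bar>t\<bar>) \<partial>lborel))"
      proof (rule integral_exp_shift_bound(2)[where \<tau> = \<tau>, OF d(1) measurable_grad_int[OF g x]])
        fix t
        have "\<bar>grad_int g i t (\<tau>, I, \<theta>)\<bar> \<le> 2 * N * (C * exp (- c * \<bar>\<tau> $ i + t\<bar>))"
          by (rule grad_int_le[OF x]) (use N1 d(5)[of i "\<tau> $ i + t"] d(6)[of i "\<tau> $ i + t"] in auto)
        also have "\<dots> \<le> 2 * N * (C * (\<Sum>i\<in>UNIV. exp (- c * \<bar>\<tau> $ i + t\<bar>)))"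
          using N d(2) by (intro mult_left_mono single) auto
        finally show "\<bar>grad_int g i t (\<tau>, I, \<theta>)\<bar> \<le> 2 * N * C * (\<Sum>i\<in>UNIV. exp (- c * \<bar>\<tau> $ i + t\<bar>))" by (simp only: mult.assoc)
      qed
      then show ?thesis using parts(2) by (simp add: grad_def J_def)
    qed
    show "\<bar>phase_grad g j (\<tau>, I, \<theta>)\<bar> \<le> ?K * N" for j
    proof -
      have "\<bar>phase_grad g j (\<tau>, I, \<theta>)\<bar> \<le> K1 * N"
        unfolding phase_grad_def abs_minus_cancel
        by (rule K1(2)[OF nice_derivative[OF D(1) B(1) g] x]) (use N2 e_Basis in blast)
      then show ?thesis using parts(1) by linarith
    qed
    show "\<bar>frechet_derivative (grad g i) (at (\<tau>, I, \<theta>)) (axis l 1, 0)\<bar> \<le> ?K * N" for i l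
    proof -
      let ?f = "\<lambda>t. frechet_derivative (\<lambda>\<tau>. grad_int g i t (\<tau>, I, \<theta>)) (at \<tau>) (axis l 1)"
      let ?gP = "\<lambda>z. frechet_derivative g (at z) (ep i)" and ?gQ = "\<lambda>z. frechet_derivative g (at z) (eq i)"
      let ?a = "\<lambda>t. \<tau> $ i + t"
      let ?d = "if l = i then 1 else (0::real)"
      have f: "?f t = grad_int ?gP l t (\<tau>, I, \<theta>) * dp i (?a t)
         + ?gP (orbit_pt t (\<tau>, I, \<theta>)) * (- (deriv (deriv (V i)) (q0 i (?a t)) * p0 i (?a t)) * ?d)
         + (grad_int ?gQ l t (\<tau>, I, \<theta>) * dq i (?a t)
         + ?gQ (orbit_pt t (\<tau>, I, \<theta>)) * (\<sigma> i * dp i (?a t) * ?d))" for t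
        by (simp add: frechet_derivative_eqI[OF has_derivative_grad_int[OF g I]] axis_def if_distrib cong: if_cong)
      have C1: "C * exp (- c * \<bar>t\<bar>) \<le> C" for t using d(1,2) mult_left_mono[of "exp (- c * \<bar>t\<bar>)" 1 C] by simp
      have gP: "\<bar>grad_int ?gP l t (\<tau>, I, \<theta>)\<bar> \<le> 2 * N * C" and gQ: "\<bar>grad_int ?gQ l t (\<tau>, I, \<theta>)\<bar> \<le> 2 * N * C" for t
        by (rule grad_int_le[OF x]; use N2 e_Basis order_trans[OF d(5) C1] order_trans[OF d(6) C1] in auto)+
      have "\<bar>?f t\<bar> \<le> (5 * C\<^sup>2 + C) * N * exp (- c * \<bar>?a t\<bar>)" for t
      proof -
        let ?e = "exp (- c * \<bar>?a t\<bar>)"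
        have a: "\<bar>grad_int ?gP l t (\<tau>, I, \<theta>) * dp i (?a t)\<bar> \<le> (2 * N * C) * (C * ?e)"
          "\<bar>grad_int ?gQ l t (\<tau>, I, \<theta>) * dq i (?a t)\<bar> \<le> (2 * N * C) * (C * ?e)"
          unfolding abs_mult using N d(2) by (intro mult_mono gP gQ d(5,6); simp)+
        have NP: "\<bar>?gP (orbit_pt t (\<tau>, I, \<theta>))\<bar> \<le> N" "\<bar>?gQ (orbit_pt t (\<tau>, I, \<theta>))\<bar> \<le> N"
          using N1 orbit_pt_in[OF x] e_Basis by blast+
        have "\<bar>- (deriv (deriv (V i)) (q0 i (?a t)) * p0 i (?a t)) * ?d\<bar> \<le> C * (C * ?e) * 1"
          unfolding abs_mult abs_minus_cancel using d(2) by (intro mult_mono d(3,7)) auto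
        then have b: "\<bar>?gP (orbit_pt t (\<tau>, I, \<theta>)) * (- (deriv (deriv (V i)) (q0 i (?a t)) * p0 i (?a t)) * ?d)\<bar> \<le> N * (C * (C * ?e))"
          unfolding abs_mult[of "?gP _"] using N by (intro mult_mono NP) auto
        have "\<bar>\<sigma> i * dp i (?a t) * ?d\<bar> \<le> 1 * (C * ?e) * 1"
          unfolding abs_mult using d(2) pendulum_orbit.\<sigma>_sq(2)[OF orb, of i] by (intro mult_mono d(5)) auto
        then have c': "\<bar>?gQ (orbit_pt t (\<tau>, I, \<theta>)) * (\<sigma> i * dp i (?a t) * ?d)\<bar> \<le> N * (C * ?e)"
          unfolding abs_mult[of "?gQ _"] using N by (intro mult_mono NP) auto
        \<comment> \<open>The product rule gives four terms: two of size
          \<open>2 * C\<^sup>2\<close> from the second derivatives of \<open>g\<close>, one of size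
          \<open>C\<^sup>2\<close> from the derivative of \<open>dp\<close> and one of size
          \<open>C\<close> from that of \<open>dq\<close>. In each of them one exponential is kept
          for integrability.\<close>
        have "\<bar>?f t\<bar> \<le> (2 * N * C) * (C * ?e) + N * (C * (C * ?e)) + ((2 * N * C) * (C * ?e) + N * (C * ?e))"
          unfolding f by (intro order_trans[OF abs_triangle_ineq] add_mono a b c')
        also have "\<dots> = (5 * C\<^sup>2 + C) * N * ?e" by (simp add: algebra_simps power2_eq_square)
        finally show ?thesis .
      qed
      also have "(5 * C\<^sup>2 + C) * N * exp (- c * \<bar>?a t\<bar>) \<le> (5 * C\<^sup>2 + C) * N * (\<Sum>i\<in>UNIV. exp (- c * \<bar>\<tau> $ i + t\<bar>))" for t
        using N d(2) by (intro mult_left_mono single mult_nonneg_nonneg) auto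
      finally have bound: "\<bar>?f t\<bar> \<le> (5 * C\<^sup>2 + C) * N * (\<Sum>i\<in>UNIV. exp (- c * \<bar>\<tau> $ i + t\<bar>))" for t .
      have meas: "?f \<in> borel_measurable borel"
      proof -
        have pm: "p0 j \<in> borel_measurable borel" "dp j \<in> borel_measurable borel" "dq j \<in> borel_measurable borel"
          "(\<lambda>u. deriv (deriv (V j)) (q0 j u)) \<in> borel_measurable borel" for j
        proof -
          have "continuous_on UNIV (p0 j)" "continuous_on UNIV (dp j)" "continuous_on UNIV (dq j)" "continuous_on UNIV (q0 j)"
            by (auto intro!: continuous_at_imp_continuous_on DERIV_isCont Dp0 D_dp D_dq Dq0)
          moreover have "continuous_on UNIV (deriv (deriv (V j)))"
            using pendulum.cont_V'' orb unfolding pendulum_orbit_def by blast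
          ultimately show "p0 j \<in> borel_measurable borel" "dp j \<in> borel_measurable borel" "dq j \<in> borel_measurable borel"
            "(\<lambda>u. deriv (deriv (V j)) (q0 j u)) \<in> borel_measurable borel"
            by (auto intro!: borel_measurable_continuous_onI continuous_on_compose2[of UNIV "deriv (deriv (V j))"])
        qed
        have sh: "(\<lambda>t. w (?a t)) \<in> borel_measurable borel" if "w \<in> borel_measurable borel" for w :: "real \<Rightarrow> real"
          using measurable_compose[OF _ that, of "?a" borel] by simp
        note n = nice_derivative[OF D(1) B(1) g]
        show ?thesis unfolding f
          by (intro borel_measurable_add borel_measurable_times borel_measurable_uminus borel_measurable_const
              measurable_grad_int[OF n x] measurable_nice_orbit(1)[OF n x] sh[OF pm(1)] sh[OF pm(2)] sh[OF pm(3)] sh[OF pm(4)])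
      qed
      have "\<bar>\<integral>t. ?f t \<partial>lborel\<bar> \<le> ((5 * C\<^sup>2 + C) * N) * (CARD('n) * (\<integral>t. exp (- c * \<bar>t\<bar>) \<partial>lborel))"
        by (rule integral_exp_shift_bound(2)[where \<tau> = \<tau>, OF d(1) meas bound])
      then show ?thesis
        using parts(3) unfolding frechet_derivative_grad_\<tau>[OF g I] by (simp add: J_def)
    qed
  qed
qed

end

section \<open>Critical points and good perturbations\<close>

lemma has_derivative_shift_iff:
  fixes f :: "'a::real_normed_vector \<Rightarrow> 'b::real_normed_vector"
  shows "((\<lambda>x. f (x - a)) has_derivative F) (at x) \<longleftrightarrow> (f has_derivative F) (at (x - a))"
proof
  assume "(f has_derivative F) (at (x - a))"
  moreover have "((\<lambda>x. x - a) has_derivative (\<lambda>v. v)) (at x)" by (auto intro!: derivative_eq_intros)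
  ultimately show "((\<lambda>x. f (x - a)) has_derivative F) (at x)" using has_derivative_compose by blast
next
  assume *: "((\<lambda>x. f (x - a)) has_derivative F) (at x)"
  have "((\<lambda>x. x + a) has_derivative (\<lambda>v. v)) (at (x - a))" by (auto intro!: derivative_eq_intros)
  from has_derivative_compose[OF this, of "\<lambda>x. f (x - a)" F] * show "(f has_derivative F) (at (x - a))" by simp
qed

lemma frechet_derivative_shift: "frechet_derivative (\<lambda>x. f (x - a)) (at x) = frechet_derivative f (at (x - a))"
  by (simp add: frechet_derivative_def has_derivative_shift_iff)

lemma nondegenerate_critical_point_shift:
  "nondegenerate_critical_point (\<lambda>x. f (x - a)) x \<longleftrightarrow> nondegenerate_critical_point f (x - a)"
proof -
  have "hessian (\<lambda>x. f (x - a)) x = hessian f (x - a)"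
    unfolding hessian_def dirs_deriv.simps frechet_derivative_shift
    by (subst frechet_derivative_shift[of "\<lambda>x. frechet_derivative f (at x) _"]) (rule refl)
  then show ?thesis by (simp add: nondegenerate_critical_point_def has_derivative_shift_iff)
qed

lemma period_gap:
  assumes "norm (period l - period l') < 2 * pi"
  shows "l = l'"
proof
  fix i
  have "\<bar>(period l - period l') $ i\<bar> < 2 * pi" using component_le_norm_cart[of "period l - period l'" i] assms by linarith
  then have "2 * pi * \<bar>of_int (l i - l' i)\<bar> < 2 * pi * 1"
    by (simp add: period_def abs_mult flip: right_diff_distrib of_int_diff)
  then have "\<bar>of_int (l i - l' i) :: real\<bar> < 1" using pi_gt_zero by (simp add: mult_less_cancel_left_pos)
  then have "\<bar>l i - l' i\<bar> < 1" by linarith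
  then show "l i = l' i" by simp
qed

lemma Ck_on_reg_pred: "at_least_three r \<Longrightarrow> regular_open (reg_pred r) A f \<Longrightarrow> open A \<Longrightarrow> Ck_on 1 A f"
  by (cases r) (auto simp: at_least_three_def intro: Ck_on_mono simp del: Ck_on.simps)

lemma regular_open_reg_pred:
  assumes "at_least_three r" "\<And>k. order_le (Suc k) r \<Longrightarrow> Ck_on k A f"
  shows "regular_open (reg_pred r) A f"
  using assms by (cases r) (auto simp: at_least_three_def)

section \<open>Good perturbations described by gradient, Hessian and phase derivative\<close>

context melnikov
begin

text \<open>Nondegeneracy in the form used by the implicit function theorem: the matrix is the
  Jacobian of the gradient, that is, the transpose of \<open>hessian\<close>.\<close>

definition crit where
  "crit g I \<tau> \<theta> \<longleftrightarrow> (\<forall>i. grad g i (\<tau>, I, \<theta>) = 0) \<and>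
     det (\<chi> i j. frechet_derivative (grad g i) (at (\<tau>, I, \<theta>)) (axis j 1, 0)) \<noteq> 0"

lemma nondegenerate_iff_crit:
  assumes "nice D B g" "I \<in> B"
  shows "nondegenerate_critical_point (\<lambda>\<tau>. pot g (\<tau>, I, \<theta>)) \<tau> \<longleftrightarrow> crit g I \<tau> \<theta>"
proof -
  note D1 = has_derivative_pot_\<tau>[OF assms, of \<theta> \<tau>]
  have "((\<lambda>\<tau>. pot g (\<tau>, I, \<theta>)) has_derivative (\<lambda>_. 0)) (at \<tau>) \<longleftrightarrow> (\<forall>i. grad g i (\<tau>, I, \<theta>) = 0)"
  proof
    assume "((\<lambda>\<tau>. pot g (\<tau>, I, \<theta>)) has_derivative (\<lambda>_. 0)) (at \<tau>)"
    then show "\<forall>i. grad g i (\<tau>, I, \<theta>) = 0"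
      using grad_eq[OF assms] by (simp add: frechet_derivative_eqI)
  qed (use D1 in simp)
  moreover have "det (hessian (\<lambda>\<tau>. pot g (\<tau>, I, \<theta>)) \<tau>) =
     det (\<chi> i j. frechet_derivative (grad g i) (at (\<tau>, I, \<theta>)) (axis j 1, 0))"
    unfolding hessian_pot[OF assms]
    by (subst det_transpose[symmetric]) (simp add: transpose_def)
  ultimately show ?thesis by (simp add: nondegenerate_critical_point_def crit_def)
qed

lemma poincare_fun_periodic:
  assumes "H \<in> Comega \<kappa> D B" "0 < \<kappa>" "I \<in> B"
  shows "poincare_fun h p0 q0 H \<tau> I (\<phi> + period l) (s + 2 * pi * of_int m) = poincare_fun h p0 q0 H \<tau> I \<phi> s"
proof -
  have pD: "orbit_at p0 x \<in> D" for x using p0_D by auto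
  have "real_part H (p, q, I, \<phi> + period l + t *\<^sub>R w, s + 2 * pi * of_int m + t) = real_part H (p, q, I, \<phi> + t *\<^sub>R w, s + t)"
    if "p \<in> D" for p q t w
    using real_part_periodic[OF assms(1,2) that assms(3), of q "\<lambda>_. 0" "\<phi> + t *\<^sub>R w" l "s + t" m]
    by (simp add: period_zero algebra_simps)
  then show ?thesis unfolding poincare_fun_def by (simp add: pD D(3))
qed

lemma poincare_fun_lift:
  assumes "H \<in> Comega \<kappa> D B" "0 < \<kappa>" "I \<in> B"
  shows "poincare_fun h p0 q0 H \<tau> I \<phi> s = pot (real_part H)
    (\<tau> - (s + 2 * pi * of_int m) *\<^sub>R ones, I, \<phi> + period l - (s + 2 * pi * of_int m) *\<^sub>R freq h I)"
  using poincare_fun_eq[of H \<tau> I "\<phi> + period l" "s + 2 * pi * of_int m"] poincare_fun_periodic[OF assms] by simp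

lemma continuous_freq: "continuous_on B (freq h)"
  unfolding continuous_on_componentwise[of B "freq h"]
  using Ck_on_imp_continuous_on[OF Ck_freq[OF order_le_2[of "Suc 0"]]] by (auto simp: Basis_vec_def inner_axis)

text \<open>The implicit function theorem gives a branch \<open>T\<close> of critical points near
  one lifted point. The work lies in spreading it over all lifts: \<open>U\<close> has to be
  invariant under periods, the critical point has to be single valued and periodic on it, and every
  \<theta> in the domain of the reduced function must receive one value only.\<close>

lemma good_perturbationsI:
  assumes H: "H \<in> Comega \<kappa> D B" "0 < \<kappa>" and I0: "I0 \<in> Bs" "Bs \<subseteq> B" and r3: "at_least_three r"
    and c: "crit (real_part H) I0 \<tau>0 \<theta>0" and j: "phase_grad (real_part H) j (\<tau>0, I0, \<theta>0) \<noteq> 0"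
  shows "H \<in> good_perturbations r \<kappa> D B Bs h p0 q0 I0 a"
proof -
  define g where "g = real_part H"
  have g: "nice D B g" unfolding g_def by (rule nice_real_part[OF D(1) B(1) H])
  have I0B: "I0 \<in> B" using I0 by blast
  obtain V T where V: "open V" "(I0, \<theta>0) \<in> V" "T (I0, \<theta>0) = \<tau>0" "\<And>y. y \<in> V \<Longrightarrow> (T y, y) \<in> W"
    "\<And>y i. y \<in> V \<Longrightarrow> grad g i (T y, y) = 0" "\<And>y. y \<in> V \<Longrightarrow> T differentiable at y"
    "\<And>y. y \<in> V \<Longrightarrow> det (\<chi> i j. frechet_derivative (grad g i) (at (T y, y)) (axis j 1, 0)) \<noteq> 0"
  proof (rule implicit_function_exists[OF open_W, of \<tau>0 "(I0, \<theta>0)" "grad g"])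
    show "(\<tau>0, I0, \<theta>0) \<in> W" using I0B by (simp add: W_def)
    show "Ck_on 1 W (grad g i)" for i by (rule Ck_grad[OF g order_le_2]) simp
  qed (use c in \<open>auto simp: crit_def g_def\<close>)
  have TC: "Ck_on k V T" if "order_le (Suc k) r" for k
    by (rule implicit_function_Ck[OF open_W V(1) Ck_grad[OF g that] V(4,5,7,6)])
  have Vcrit: "crit g I (T (I, \<theta>)) \<theta>" "I \<in> B" if "(I, \<theta>) \<in> V" for I \<theta>
    using V(4,5,7)[OF that] by (auto simp: crit_def W_def)
  define s0 where "s0 = a + pi"
  define \<phi>0 where "\<phi>0 = \<theta>0 + s0 *\<^sub>R freq h I0"
  obtain \<epsilon> where \<epsilon>: "\<epsilon> > 0" "\<epsilon> < pi" "\<And>I \<phi> s. dist I I0 < \<epsilon> \<Longrightarrow> dist \<phi> \<phi>0 < \<epsilon> \<Longrightarrow> \<bar>s - s0\<bar> < \<epsilon> \<Longrightarrow> (I, \<phi> - s *\<^sub>R freq h I) \<in> V"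
    "\<And>I. dist I I0 < \<epsilon> \<Longrightarrow> I \<in> B \<and> \<epsilon> * (1 + norm (freq h I)) < pi"
  proof -
    have "continuous_on (B \<times> UNIV) (\<lambda>x. (fst x, fst (snd x) - snd (snd x) *\<^sub>R freq h (fst x)))"
      by (intro continuous_intros continuous_on_compose2[OF continuous_freq]) auto
    then have "open ((B \<times> UNIV) \<inter> (\<lambda>x. (fst x, fst (snd x) - snd (snd x) *\<^sub>R freq h (fst x))) -` V)"
      using V(1) B(1) by (intro continuous_open_preimage open_Times) auto
    moreover have "(I0, \<phi>0, s0) \<in> (B \<times> UNIV) \<inter> (\<lambda>x. (fst x, fst (snd x) - snd (snd x) *\<^sub>R freq h (fst x))) -` V"
      using I0B V(2) by (simp add: \<phi>0_def)
    ultimately obtain e1 where e1: "e1 > 0" "ball (I0, \<phi>0, s0) e1 \<subseteq> (B \<times> UNIV) \<inter> (\<lambda>x. (fst x, fst (snd x) - snd (snd x) *\<^sub>R freq h (fst x))) -` V"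
      using open_contains_ball by blast
    obtain e2 where e2: "e2 > 0" "ball I0 e2 \<subseteq> B" using B(1) I0B open_contains_ball by blast
    obtain e3 where e3: "e3 > 0" "\<And>I. I \<in> B \<Longrightarrow> dist I I0 < e3 \<Longrightarrow> dist (freq h I) (freq h I0) < 1"
      using continuous_freq I0B unfolding continuous_on_iff by (metis zero_less_one)
    define M where "M = norm (freq h I0) + 1"
    \<comment> \<open>One third of \<open>e1\<close>, because three coordinate distances are added.
      The last entry yields the bound that involves the frequency, with \<open>M\<close> dominating
      \<open>norm (freq h I)\<close> near \<open>I0\<close>.\<close>
    define \<epsilon> where "\<epsilon> = min (min (e1 / 3) e2) (min e3 (pi / (2 * (1 + M))))"
    have M: "M \<ge> 1" by (simp add: M_def)
    have pos: "\<epsilon> > 0" using e1 e2 e3 M by (simp add: \<epsilon>_def)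
    have small: "\<epsilon> * (1 + M) \<le> pi / 2"
    proof -
      have "\<epsilon> \<le> pi / (2 * (1 + M))" by (simp add: \<epsilon>_def)
      then show ?thesis using M by (simp add: field_simps)
    qed
    show ?thesis
    proof (rule that[OF pos])
      have "\<epsilon> * 1 \<le> \<epsilon> * (1 + M)" using pos M by (intro mult_left_mono) auto
      then show "\<epsilon> < pi" using small pi_gt_zero by linarith
      show "(I, \<phi> - s *\<^sub>R freq h I) \<in> V" if "dist I I0 < \<epsilon>" "dist \<phi> \<phi>0 < \<epsilon>" "\<bar>s - s0\<bar> < \<epsilon>" for I \<phi> s
      proof -
        have "dist (I, \<phi>, s) (I0, \<phi>0, s0) \<le> dist I I0 + (dist \<phi> \<phi>0 + dist s s0)"
        proof -
          have "dist (a, b) (c, d) \<le> dist a c + dist b d" for a c :: "'x::metric_space" and b d :: "'y::metric_space"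
            unfolding dist_prod_def using sqrt_sum_squares_le_sum[of "dist a c" "dist b d"] by simp
          then show ?thesis by (meson add_left_mono order_trans)
        qed
        also have "\<dots> < e1" using that by (simp add: \<epsilon>_def dist_real_def)
        finally have "(I, \<phi>, s) \<in> ball (I0, \<phi>0, s0) e1" by (simp add: dist_commute)
        then show ?thesis using e1(2) by auto
      qed
      show "I \<in> B \<and> \<epsilon> * (1 + norm (freq h I)) < pi" if "dist I I0 < \<epsilon>" for I
      proof
        show IB: "I \<in> B" using that e2 by (auto simp: \<epsilon>_def dist_commute)
        have "dist (freq h I) (freq h I0) < 1" using e3(2)[OF IB] that by (simp add: \<epsilon>_def)
        then have "norm (freq h I) \<le> M" unfolding M_def dist_norm using norm_triangle_sub[of "freq h I" "freq h I0"] by linarith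
        then have "\<epsilon> * (1 + norm (freq h I)) \<le> \<epsilon> * (1 + M)" using pos by (intro mult_left_mono) auto
        then show "\<epsilon> * (1 + norm (freq h I)) < pi" using small pi_gt_zero by linarith
      qed
    qed
  qed
  \<comment> \<open>\<open>s0\<close> is the midpoint of the interval from which the lift of the time is taken, so that only
    \<open>m = 0\<close> is admissible; the bound \<open>\<epsilon> (1 + |\<omega>(I)|) < \<pi>\<close> makes \<open>l\<close> depend on \<open>\<theta>\<close> only.\<close>
  define near where "near = (\<lambda>\<phi> s l m. dist (\<phi> + period l) \<phi>0 < \<epsilon> \<and> \<bar>s + 2 * pi * of_int m - s0\<bar> < \<epsilon>)"
  define J where "J = {(\<phi>, s). \<exists>l m. near \<phi> s l m}"
  \<comment> \<open>The chosen lift is moved to time 0 along the unperturbed flow, the branch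
    \<open>T\<close> is evaluated there, and the elapsed time is added back to all shifts.\<close>
  define lift where "lift = (\<lambda>I \<phi> s l m. T (I, \<phi> + period l - (s + 2 * pi * of_int m) *\<^sub>R freq h I) + (s + 2 * pi * of_int m) *\<^sub>R ones)"
  define \<tau>s where "\<tau>s = (\<lambda>(I, \<phi>, s). THE \<tau>. \<exists>l m. near \<phi> s l m \<and> \<tau> = lift I \<phi> s l m)"
  define U where "U = (Bs \<inter> ball I0 \<epsilon>) \<times> J"
  \<comment> \<open>As \<epsilon> is below \<open>pi\<close>, at most one lift of
    \<open>(\<phi>, s)\<close> is close to the centre, so the definite description in \<tau>s has a
    unique value.\<close>
  have near_unique: "l = l' \<and> m = m'" if 1: "near \<phi> s l m" and 2: "near \<phi> s l' m'" for \<phi> s l m l' m'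
  proof
    have "norm (period l - period l') \<le> dist (\<phi> + period l) \<phi>0 + dist (\<phi> + period l') \<phi>0"
      using dist_triangle2[of "\<phi> + period l" "\<phi> + period l'" \<phi>0] by (simp add: dist_norm)
    also have "\<dots> < 2 * pi" using 1 2 \<epsilon>(2) unfolding near_def by linarith
    finally show "l = l'" by (rule period_gap)
    have "\<bar>2 * pi * of_int m - 2 * pi * of_int m'\<bar> < 2 * pi"
      using 1 2 \<epsilon>(2) unfolding near_def by linarith
    then have "2 * pi * \<bar>of_int (m - m')\<bar> < 2 * pi * 1" by (simp add: abs_mult flip: right_diff_distrib)
    then have "\<bar>of_int (m - m') :: real\<bar> < 1" using pi_gt_zero by (simp add: mult_less_cancel_left_pos)
    then show "m = m'" by linarith
  qed
  have \<tau>s: "\<tau>s (I, \<phi>, s) = lift I \<phi> s l m" if "near \<phi> s l m" for I \<phi> s l m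
    unfolding \<tau>s_def prod.case using that near_unique by (intro the_equality) blast+
  have near_shift: "near (\<phi> + period l') (s + 2 * pi * of_int m') (\<lambda>i. l i - l' i) (m - m') \<longleftrightarrow> near \<phi> s l m" for \<phi> s l l' m m'
  proof -
    have "period (\<lambda>i. l i - l' i) = period l - period l'" by (simp add: period_def vec_eq_iff right_diff_distrib)
    then show ?thesis by (simp add: near_def algebra_simps)
  qed
  have torus: "torus_open J"
    unfolding torus_open_def
  proof (intro conjI allI impI)
    have "J = (\<Union>l m. {x. dist (fst x + period l) \<phi>0 < \<epsilon>} \<inter> {x. \<bar>snd x + 2 * pi * of_int m - s0\<bar> < \<epsilon>})"
      by (auto simp: J_def near_def)
    also have "open \<dots>" by (intro open_UN ballI open_Int open_Collect_less continuous_intros)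
    finally show "open J" .
    fix \<phi> s l m assume "(\<phi>, s) \<in> J"
    then show "(\<phi> + period l, s + 2 * pi * of_int m) \<in> J"
      unfolding J_def using near_shift by blast
  qed
  have UD: "I \<in> B" "I \<in> Bs" "dist I I0 < \<epsilon>" "\<exists>l m. near \<phi> s l m" if "(I, \<phi>, s) \<in> U" for I \<phi> s
    using that I0(2) by (auto simp: U_def J_def dist_commute)
  have near_V: "(I, \<phi> + period l - (s + 2 * pi * of_int m) *\<^sub>R freq h I) \<in> V" if "dist I I0 < \<epsilon>" "near \<phi> s l m" for I \<phi> s l m
    by (rule \<epsilon>(3)) (use that in \<open>auto simp: near_def\<close>)
  have i: "condition_i r Bs I0 (poincare_fun h p0 q0 H) U \<tau>s"
    unfolding condition_i_def
  proof (intro conjI)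
    show "\<exists>c \<rho> J. c \<in> Bs \<and> \<rho> > 0 \<and> torus_open J \<and> U = (Bs \<inter> ball c \<rho>) \<times> J"
      using I0 \<epsilon>(1) torus U_def by blast
    have "near \<phi>0 s0 (\<lambda>_. 0) 0" using \<epsilon>(1) by (simp add: near_def period_zero)
    then have "(I0, \<phi>0, s0) \<in> U" using I0 \<epsilon>(1) by (auto simp: U_def J_def)
    then show "{x. fst x = I0} \<inter> U \<noteq> {}" by force
    show "\<forall>I \<phi> s l m. (I, \<phi>, s) \<in> U \<longrightarrow> \<tau>s (I, \<phi> + period l, s + 2 * pi * of_int m) = \<tau>s (I, \<phi>, s)"
    proof (intro allI impI)
      fix I \<phi> s l' m' assume "(I, \<phi>, s) \<in> U"
      then obtain l m where n: "near \<phi> s l m" using UD by blast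
      have n': "near (\<phi> + period l') (s + 2 * pi * of_int m') (\<lambda>i. l i - l' i) (m - m')" using n near_shift by blast
      have "period (\<lambda>i. l i - l' i) = period l - period l'" by (simp add: period_def vec_eq_iff right_diff_distrib)
      then show "\<tau>s (I, \<phi> + period l', s + 2 * pi * of_int m') = \<tau>s (I, \<phi>, s)"
        unfolding \<tau>s[OF n] \<tau>s[OF n'] lift_def by (simp add: algebra_simps)
    qed
    show "regular_on (reg_pred r) U \<tau>s"
      unfolding regular_on_def
    proof
      fix x assume x: "x \<in> U"
      obtain I \<phi> s where xe: "x = (I, \<phi>, s)" by (cases x)
      then obtain l m where n: "near \<phi> s l m" using UD x by blast
      \<comment> \<open>An open set of the ambient space on which one and the same lift is used. The
        formula \<open>lift\<close> is regular on \<open>A\<close> and agrees with \<tau>s on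
        \<open>A \<inter> U\<close>; it is thus the local extension that \<open>regular_on\<close>
        asks for when \<open>Bs \<inter> ball I0 \<epsilon>\<close> is not open.\<close>
      define A where "A = {x. dist (fst x) I0 < \<epsilon> \<and> dist (fst (snd x) + period l) \<phi>0 < \<epsilon> \<and> \<bar>snd (snd x) + 2 * pi * of_int m - s0\<bar> < \<epsilon>}"
      have A: "open A" unfolding A_def by (intro open_Collect_conj open_Collect_less continuous_intros)
      have AB: "I \<in> B" if "(I, \<phi>, s) \<in> A" for I \<phi> s using that \<epsilon>(4) by (auto simp: A_def)
      let ?\<psi> = "\<lambda>x. (fst x, fst (snd x) + period l - (snd (snd x) + 2 * pi * of_int m) *\<^sub>R freq h (fst x))"
      have "regular_open (reg_pred r) A (\<lambda>x. lift (fst x) (fst (snd x)) (snd (snd x)) l m)"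
      proof (rule regular_open_reg_pred[OF r3])
        fix k assume k: "order_le (Suc k) r"
        have w: "Ck_on k A (\<lambda>x. freq h (fst x) $ j)" for j
          by (rule Ck_on_compose[OF B(1) A Ck_freq[OF k]]) (use AB in \<open>auto intro!: Ck_on_bounded_linear bounded_linear_fst\<close>)
        have lin: "Ck_on k A (\<lambda>x. fst (snd x) $ j)" "Ck_on k A (\<lambda>x. snd (snd x))" for j
          by (intro Ck_on_bounded_linear bounded_linear_compose[OF bounded_linear_vec_nth] bounded_linear_fst_comp bounded_linear_snd_comp bounded_linear_snd)+
        have "Ck_on k A (\<lambda>x. fst (snd x) + period l - (snd (snd x) + 2 * pi * of_int m) *\<^sub>R freq h (fst x))"
          unfolding Ck_on_vec_iff[OF A]
        proof
          fix j
          have "Ck_on k A (\<lambda>x. (fst (snd x) $ j + period l $ j) - (snd (snd x) + 2 * pi * of_int m) * freq h (fst x) $ j)"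
            by (intro Ck_on_diff[OF A] Ck_on_add[OF A] Ck_on_mult[OF A] lin w Ck_on_const)
          then show "Ck_on k A (\<lambda>x. (fst (snd x) + period l - (snd (snd x) + 2 * pi * of_int m) *\<^sub>R freq h (fst x)) $ j)" by simp
        qed
        then have \<psi>: "Ck_on k A ?\<psi>"
          by (rule Ck_on_Pair[OF A Ck_on_bounded_linear[OF bounded_linear_fst]])
        have \<psi>V: "?\<psi> ` A \<subseteq> V" using \<epsilon>(3) by (auto simp: A_def)
        show "Ck_on k A (\<lambda>x. lift (fst x) (fst (snd x)) (snd (snd x)) l m)"
          unfolding Ck_on_vec_iff[OF A]
        proof
          fix i
          have "Ck_on k V (\<lambda>y. T y $ i)" using TC[OF k] unfolding Ck_on_vec_iff[OF V(1)] by blast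
          from Ck_on_compose[OF V(1) A this \<psi> \<psi>V]
          have "Ck_on k A (\<lambda>x. T (?\<psi> x) $ i + (snd (snd x) + 2 * pi * of_int m))"
            by (intro Ck_on_add[OF A] lin Ck_on_const)
          then show "Ck_on k A (\<lambda>x. lift (fst x) (fst (snd x)) (snd (snd x)) l m $ i)" by (simp add: lift_def)
        qed
      qed
      moreover have "x \<in> A" using n UD(3) x unfolding xe by (simp add: A_def near_def)
      moreover have "\<forall>y\<in>A \<inter> U. lift (fst y) (fst (snd y)) (snd (snd y)) l m = \<tau>s y"
      proof
        fix y assume y: "y \<in> A \<inter> U"
        obtain I' \<phi>' s' where ye: "y = (I', \<phi>', s')" by (cases y)
        have "near \<phi>' s' l m" using y unfolding ye by (simp add: A_def near_def)
        from \<tau>s[OF this, of I'] show "lift (fst y) (fst (snd y)) (snd (snd y)) l m = \<tau>s y" by (simp add: ye)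
      qed
      ultimately show "\<exists>W f. open W \<and> x \<in> W \<and> regular_open (reg_pred r) W f \<and> (\<forall>y\<in>W \<inter> U. f y = \<tau>s y)"
        using A by blast
    qed
    show "\<forall>(I, \<phi>, s)\<in>U. nondegenerate_critical_point (\<lambda>\<tau>. poincare_fun h p0 q0 H \<tau> I \<phi> s) (\<tau>s (I, \<phi>, s))"
    proof (intro ballI, clarify)
      fix I \<phi> s assume x: "(I, \<phi>, s) \<in> U"
      then obtain l m where n: "near \<phi> s l m" using UD by blast
      let ?s = "s + 2 * pi * of_int m"
      let ?\<theta> = "\<phi> + period l - ?s *\<^sub>R freq h I"
      have IV: "(I, ?\<theta>) \<in> V" using near_V[OF UD(3)[OF x] n] .
      have "(\<lambda>\<tau>. poincare_fun h p0 q0 H \<tau> I \<phi> s) = (\<lambda>\<tau>. pot g (\<tau> - ?s *\<^sub>R ones, I, ?\<theta>))"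
        using poincare_fun_lift[OF H UD(1)[OF x]] by (simp add: g_def)
      moreover have "nondegenerate_critical_point (\<lambda>\<tau>. pot g (\<tau> - ?s *\<^sub>R ones, I, ?\<theta>)) (\<tau>s (I, \<phi>, s))"
        unfolding nondegenerate_critical_point_shift[of "\<lambda>\<tau>. pot g (\<tau>, I, ?\<theta>)"] nondegenerate_iff_crit[OF g UD(1)[OF x]] \<tau>s[OF n]
        using Vcrit(1)[OF IV] by (simp add: lift_def)
      ultimately show "nondegenerate_critical_point (\<lambda>\<tau>. poincare_fun h p0 q0 H \<tau> I \<phi> s) (\<tau>s (I, \<phi>, s))" by simp
    qed
  qed
  let ?L = "poincare_fun h p0 q0 H"
  have adm: "\<exists>l. near (\<theta> + s *\<^sub>R freq h I) s l 0" "dist I I0 < \<epsilon>" "I \<in> B"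
    if "s \<in> admissible_times (freq h) a U I \<theta>" for s I \<theta>
  proof -
    have s: "a \<le> s" "s < a + 2 * pi" and U: "(I, \<theta> + s *\<^sub>R freq h I, s) \<in> U"
      using that by (auto simp: admissible_times_def)
    obtain l m where n: "near (\<theta> + s *\<^sub>R freq h I) s l m" using UD(4)[OF U] by blast
    have b: "\<bar>s + 2 * pi * of_int m - (a + pi)\<bar> < pi" using n \<epsilon>(2) unfolding near_def s0_def by linarith
    have "m = 0"
    proof (rule ccontr)
      assume "m \<noteq> 0"
      then consider "m \<ge> 1" | "m \<le> -1" by linarith
      then show False
      proof cases
        case 1
        then have "2 * pi * 1 \<le> 2 * pi * of_int m" by (intro mult_left_mono) auto
        then show False using b s by linarith
      next
        case 2
        then have "2 * pi * of_int m \<le> 2 * pi * (-1)" by (intro mult_left_mono) auto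
        then show False using b s by linarith
      qed
    qed
    then show "\<exists>l. near (\<theta> + s *\<^sub>R freq h I) s l 0" using n by blast
    show "dist I I0 < \<epsilon>" "I \<in> B" using UD[OF U] by auto
  qed
  have val: "?L (\<tau>s (I, \<theta> + s *\<^sub>R freq h I, s)) I (\<theta> + s *\<^sub>R freq h I) s = pot g (T (I, \<theta> + period l), I, \<theta> + period l)"
    if "near (\<theta> + s *\<^sub>R freq h I) s l 0" "I \<in> B" for s I \<theta> l
    unfolding poincare_fun_lift[OF H that(2), where m = 0 and l = l] \<tau>s[OF that(1)] lift_def g_def
    by (simp add: algebra_simps)
  have uniq: "\<exists>!v. v \<in> reduced_values (freq h) a ?L U \<tau>s I \<theta>" if dom: "(I, \<theta>) \<in> reduced_dom (freq h) a U" for I \<theta>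
  proof -
    obtain s where s: "s \<in> admissible_times (freq h) a U I \<theta>" using dom by (auto simp: reduced_dom_def)
    obtain l where l: "near (\<theta> + s *\<^sub>R freq h I) s l 0" using adm(1)[OF s] by blast
    show ?thesis
    proof (rule ex1I)
      show "?L (\<tau>s (I, \<theta> + s *\<^sub>R freq h I, s)) I (\<theta> + s *\<^sub>R freq h I) s \<in> reduced_values (freq h) a ?L U \<tau>s I \<theta>"
        using s by (auto simp: reduced_values_def)
      fix v assume "v \<in> reduced_values (freq h) a ?L U \<tau>s I \<theta>"
      then obtain s' where s': "s' \<in> admissible_times (freq h) a U I \<theta>"
        and v: "v = ?L (\<tau>s (I, \<theta> + s' *\<^sub>R freq h I, s')) I (\<theta> + s' *\<^sub>R freq h I) s'" by (auto simp: reduced_values_def)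
      obtain l' where l': "near (\<theta> + s' *\<^sub>R freq h I) s' l' 0" using adm(1)[OF s'] by blast
      have "l = l'"
      proof (rule period_gap)
        have "norm (period l - period l') = norm (((\<theta> + s *\<^sub>R freq h I + period l) - \<phi>0) - ((\<theta> + s' *\<^sub>R freq h I + period l') - \<phi>0) - (s - s') *\<^sub>R freq h I)"
          by (simp add: algebra_simps)
        also have "\<dots> \<le> dist (\<theta> + s *\<^sub>R freq h I + period l) \<phi>0 + dist (\<theta> + s' *\<^sub>R freq h I + period l') \<phi>0 + \<bar>s - s'\<bar> * norm (freq h I)"
          unfolding dist_norm by (intro order_trans[OF norm_triangle_ineq4] add_mono norm_triangle_ineq4) simp
        also have "\<dots> \<le> \<epsilon> + \<epsilon> + (2 * \<epsilon>) * norm (freq h I)"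
        proof -
          have "\<bar>s - s'\<bar> \<le> 2 * \<epsilon>" using l l' unfolding near_def by (simp add: abs_le_iff abs_less_iff)
          then show ?thesis using l l' unfolding near_def by (intro add_mono mult_right_mono) auto
        qed
        also have "\<dots> = 2 * (\<epsilon> * (1 + norm (freq h I)))" by (simp add: algebra_simps)
        also have "\<dots> < 2 * pi" using \<epsilon>(4)[OF adm(2)[OF s]] by simp
        finally show "norm (period l - period l') < 2 * pi" .
      qed
      then show "v = ?L (\<tau>s (I, \<theta> + s *\<^sub>R freq h I, s)) I (\<theta> + s *\<^sub>R freq h I) s"
        unfolding v using val[OF l adm(3)[OF s]] val[OF l' adm(3)[OF s]] by simp
    qed
  qed
  \<comment> \<open>At the fixed time \<open>s0\<close> the zero lift works for all \<theta> near
    \<theta>0, which gives the reduced function an explicit form there.\<close>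
  have s0a: "s0 \<in> admissible_times (freq h) a U I0 \<theta>" and near0: "near (\<theta> + s0 *\<^sub>R freq h I0) s0 (\<lambda>_. 0) 0"
    if "dist \<theta> \<theta>0 < \<epsilon>" for \<theta>
  proof -
    show n: "near (\<theta> + s0 *\<^sub>R freq h I0) s0 (\<lambda>_. 0) 0"
      using that \<epsilon>(1) by (simp add: near_def \<phi>0_def period_zero dist_norm)
    then show "s0 \<in> admissible_times (freq h) a U I0 \<theta>"
      using I0 \<epsilon>(1) unfolding admissible_times_def U_def J_def by (auto simp: s0_def)
  qed
  have red: "reduced_poincare (freq h) a ?L U \<tau>s I0 \<theta> = pot g (T (I0, \<theta>), I0, \<theta>)" if \<theta>: "dist \<theta> \<theta>0 < \<epsilon>" for \<theta>
  proof -
    have dom: "(I0, \<theta>) \<in> reduced_dom (freq h) a U" using s0a[OF \<theta>] by (auto simp: reduced_dom_def)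
    have "?L (\<tau>s (I0, \<theta> + s0 *\<^sub>R freq h I0, s0)) I0 (\<theta> + s0 *\<^sub>R freq h I0) s0 \<in> reduced_values (freq h) a ?L U \<tau>s I0 \<theta>"
      using s0a[OF \<theta>] by (auto simp: reduced_values_def)
    then have "reduced_poincare (freq h) a ?L U \<tau>s I0 \<theta> = ?L (\<tau>s (I0, \<theta> + s0 *\<^sub>R freq h I0, s0)) I0 (\<theta> + s0 *\<^sub>R freq h I0) s0"
      unfolding reduced_poincare_def using uniq[OF dom] by (intro the1_equality)
    then show ?thesis using val[OF near0[OF \<theta>] I0B] by (simp add: period_zero)
  qed
  \<comment> \<open>The part of the derivative that passes through \<open>T\<close> is multiplied by
    the gradient, which vanishes at the critical point; the phase gradient alone is left.\<close>
  have "((\<lambda>\<theta>. pot g (T (I0, \<theta>), I0, \<theta>)) has_derivative (\<lambda>w. \<Sum>j\<in>UNIV. phase_grad g j (\<tau>0, I0, \<theta>0) * w $ j)) (at \<theta>0)"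
  proof -
    have "((\<lambda>\<theta>. (I0, \<theta>)) has_derivative (\<lambda>w. (0, w))) (at \<theta>0)"
      by (intro has_derivative_Pair has_derivative_ident has_derivative_const)
    from has_derivative_compose[OF this differentiable_has_derivative[OF V(6)[OF V(2)]]]
    have "((\<lambda>\<theta>. (T (I0, \<theta>), \<theta>)) has_derivative (\<lambda>w. (frechet_derivative T (at (I0, \<theta>0)) (0, w), w))) (at \<theta>0)"
      by (intro has_derivative_Pair has_derivative_ident)
    from has_derivative_compose[OF this has_derivative_pot[OF g I0B]] show ?thesis
      using c by (simp add: V(3) crit_def g_def)
  qed
  then have der: "(reduced_poincare (freq h) a ?L U \<tau>s I0 has_derivative (\<lambda>w. \<Sum>j\<in>UNIV. phase_grad g j (\<tau>0, I0, \<theta>0) * w $ j)) (at \<theta>0)"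
    by (rule has_derivative_transform_within_open[OF _ open_ball, of _ _ _ _ \<theta>0 \<epsilon>]) (use \<epsilon>(1) red in \<open>auto simp: dist_commute\<close>)
  have ii: "condition_ii (freq h) a I0 ?L U \<tau>s"
    unfolding condition_ii_def
  proof (intro conjI exI)
    show "\<forall>(I, \<theta>)\<in>reduced_dom (freq h) a U. \<exists>!v. v \<in> reduced_values (freq h) a ?L U \<tau>s I \<theta>"
    proof
      fix x assume "x \<in> reduced_dom (freq h) a U"
      then show "case x of (I, \<theta>) \<Rightarrow> \<exists>!v. v \<in> reduced_values (freq h) a ?L U \<tau>s I \<theta>"
        using uniq[of "fst x" "snd x"] by (simp only: case_prod_beta prod.collapse)
    qed
    show "(I0, \<theta>0) \<in> reduced_dom (freq h) a U" using s0a[of \<theta>0] \<epsilon>(1) by (auto simp: reduced_dom_def)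
    have "(\<Sum>j'\<in>UNIV. phase_grad g j' (\<tau>0, I0, \<theta>0) * axis j 1 $ j') = phase_grad g j (\<tau>0, I0, \<theta>0)"
      by (simp add: axis_def if_distrib cong: if_cong)
    then show "(\<lambda>w. \<Sum>j\<in>UNIV. phase_grad g j (\<tau>0, I0, \<theta>0) * w $ j) \<noteq> (\<lambda>_. 0)"
      using j unfolding g_def by metis
  qed (rule der)
  show ?thesis unfolding good_perturbations_def using H i ii by blast
qed


text \<open>An admissible time \<open>s\<close> for \<theta>0 is kept fixed. It remains admissible
  for nearby \<theta>, so the reduced function is \<open>pot\<close> composed with a map that is
  differentiable at \<theta>0, and the vanishing gradient again leaves only the phase derivative. A
  nonzero derivative therefore has a nonzero phase gradient component.\<close>

lemma good_perturbationsD: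
  assumes "H \<in> good_perturbations r \<kappa> D B Bs h p0 q0 I0 a" "0 < \<kappa>" "Bs \<subseteq> B" "at_least_three r" "I0 \<in> Bs"
  shows "\<exists>\<tau> \<theta> j. crit (real_part H) I0 \<tau> \<theta> \<and> phase_grad (real_part H) j (\<tau>, I0, \<theta>) \<noteq> 0"
proof -
  let ?L = "poincare_fun h p0 q0 H"
  have HC: "H \<in> Comega \<kappa> D B" using assms(1) by (simp add: good_perturbations_def)
  define g where "g = real_part H"
  have g: "nice D B g" unfolding g_def by (rule nice_real_part[OF D(1) B(1) HC assms(2)])
  have I0: "I0 \<in> B" using assms by blast
  obtain U \<tau>s where i: "condition_i r Bs I0 ?L U \<tau>s" and ii: "condition_ii (freq h) a I0 ?L U \<tau>s"
    using assms(1) unfolding good_perturbations_def by blast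
  obtain \<theta>0 d where dom: "(I0, \<theta>0) \<in> reduced_dom (freq h) a U"
    and d: "(reduced_poincare (freq h) a ?L U \<tau>s I0 has_derivative d) (at \<theta>0)" "d \<noteq> (\<lambda>_. 0)"
    and uniq: "\<And>I \<theta>. (I, \<theta>) \<in> reduced_dom (freq h) a U \<Longrightarrow> \<exists>!v. v \<in> reduced_values (freq h) a ?L U \<tau>s I \<theta>"
  proof -
    from ii[unfolded condition_ii_def] obtain \<theta>0 d where 1: "(I0, \<theta>0) \<in> reduced_dom (freq h) a U"
      "(reduced_poincare (freq h) a ?L U \<tau>s I0 has_derivative d) (at \<theta>0)" "d \<noteq> (\<lambda>_. 0)" by (elim conjE exE)
    have 2: "\<exists>!v. v \<in> reduced_values (freq h) a ?L U \<tau>s I \<theta>" if "(I, \<theta>) \<in> reduced_dom (freq h) a U" for I \<theta>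
      using bspec[OF conjunct1[OF ii[unfolded condition_ii_def]] that] by (simp only: prod.case)
    show thesis by (rule that[OF 1 2])
  qed
  obtain s where s: "s \<in> admissible_times (freq h) a U I0 \<theta>0" using dom by (auto simp: reduced_dom_def)
  let ?w = "freq h I0"
  let ?z = "\<lambda>\<theta>. (I0, \<theta> + s *\<^sub>R ?w, s)"
  have zU: "?z \<theta>0 \<in> U" using s by (simp add: admissible_times_def)
  from i[unfolded condition_i_def] obtain c \<rho> J where J: "torus_open J" "U = (Bs \<inter> ball c \<rho>) \<times> J" by (elim conjE exE)
  have reg: "regular_on (reg_pred r) U \<tau>s" using i unfolding condition_i_def by (elim conjE)
  have ndU: "\<forall>(I, \<phi>, s)\<in>U. nondegenerate_critical_point (\<lambda>\<tau>. ?L \<tau> I \<phi> s) (\<tau>s (I, \<phi>, s))"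
    using i unfolding condition_i_def by (elim conjE)
  from bspec[OF reg[unfolded regular_on_def] zU]
  obtain A f where A: "open A" "?z \<theta>0 \<in> A" "regular_open (reg_pred r) A f" and f: "\<forall>y\<in>A \<inter> U. f y = \<tau>s y" by (elim exE conjE)
  note A = A bspec[OF f]
  \<comment> \<open>The action does not leave \<open>I0\<close>, so openness of \<open>A\<close> and
    \<open>J\<close> suffices here even if \<open>I0\<close> lies on the boundary of
    \<open>Bs\<close>.\<close>
  define Q where "Q = {\<theta>. ?z \<theta> \<in> A \<and> snd (?z \<theta>) \<in> J}"
  have Q: "open Q"
  proof -
    have "Q = ?z -` A \<inter> (\<lambda>\<theta>. snd (?z \<theta>)) -` J" by (auto simp: Q_def)
    also have "open \<dots>"
      using A(1) J(1) unfolding torus_open_def by (intro open_Int open_vimage continuous_intros) auto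
    finally show ?thesis .
  qed
  have \<theta>0Q: "\<theta>0 \<in> Q" using A(2) zU J(2) by (simp add: Q_def)
  have QU: "?z \<theta> \<in> A \<inter> U" if "\<theta> \<in> Q" for \<theta> using that zU J(2) by (auto simp: Q_def)
  have fdiff: "f differentiable at (?z \<theta>0)"
    using Ck_on_reg_pred[OF assms(4) A(3,1)] A(2) by simp
  have "(?z has_derivative (\<lambda>v. (0, v, 0))) (at \<theta>0)"
    by (auto intro!: derivative_eq_intros)
  from has_derivative_compose[OF this differentiable_has_derivative[OF fdiff]]
  have "((\<lambda>\<theta>. f (?z \<theta>)) has_derivative (\<lambda>v. frechet_derivative f (at (?z \<theta>0)) (0, v, 0))) (at \<theta>0)" .
  then have "((\<lambda>\<theta>. f (?z \<theta>) - s *\<^sub>R ones) has_derivative (\<lambda>v. frechet_derivative f (at (?z \<theta>0)) (0, v, 0) - 0)) (at \<theta>0)"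
    by (intro has_derivative_diff has_derivative_const)
  then have "((\<lambda>\<theta>. (f (?z \<theta>) - s *\<^sub>R ones, \<theta>)) has_derivative (\<lambda>v. (frechet_derivative f (at (?z \<theta>0)) (0, v, 0) - 0, v))) (at \<theta>0)"
    by (intro has_derivative_Pair has_derivative_ident)
  note inner = this
  define \<tau> where "\<tau> = \<tau>s (?z \<theta>0) - s *\<^sub>R ones"
  have f0: "f (?z \<theta>0) - s *\<^sub>R ones = \<tau>" using A(4)[OF QU[OF \<theta>0Q]] by (simp add: \<tau>_def)
  have "nondegenerate_critical_point (\<lambda>\<tau>. ?L \<tau> I0 (\<theta>0 + s *\<^sub>R ?w) s) (\<tau>s (?z \<theta>0))"
    using bspec[OF ndU zU] by (simp only: prod.case)
  moreover have "(\<lambda>\<tau>. ?L \<tau> I0 (\<theta>0 + s *\<^sub>R ?w) s) = (\<lambda>\<tau>. pot g (\<tau> - s *\<^sub>R ones, I0, \<theta>0))"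
    by (simp add: poincare_fun_eq g_def)
  ultimately have crit: "crit g I0 \<tau> \<theta>0"
    unfolding \<tau>_def by (simp add: nondegenerate_critical_point_shift[of "\<lambda>\<tau>. pot g (\<tau>, I0, \<theta>0)"] nondegenerate_iff_crit[OF g I0])
  have red: "reduced_poincare (freq h) a ?L U \<tau>s I0 \<theta> = pot g (f (?z \<theta>) - s *\<^sub>R ones, I0, \<theta>)" if \<theta>: "\<theta> \<in> Q" for \<theta>
  proof -
    have adm: "s \<in> admissible_times (freq h) a U I0 \<theta>"
      using s QU[OF \<theta>] by (simp add: admissible_times_def)
    then have "?L (\<tau>s (?z \<theta>)) I0 (\<theta> + s *\<^sub>R ?w) s \<in> reduced_values (freq h) a ?L U \<tau>s I0 \<theta>"
      by (auto simp: reduced_values_def)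
    moreover have "(I0, \<theta>) \<in> reduced_dom (freq h) a U" using adm by (auto simp: reduced_dom_def)
    ultimately have "reduced_poincare (freq h) a ?L U \<tau>s I0 \<theta> = ?L (\<tau>s (?z \<theta>)) I0 (\<theta> + s *\<^sub>R ?w) s"
      unfolding reduced_poincare_def using uniq by (intro the1_equality)
    also have "\<dots> = pot g (f (?z \<theta>) - s *\<^sub>R ones, I0, \<theta>)"
      using A(4)[OF QU[OF \<theta>]] by (simp add: poincare_fun_eq g_def)
    finally show ?thesis .
  qed
  have "((\<lambda>\<theta>. pot g (f (?z \<theta>) - s *\<^sub>R ones, I0, \<theta>)) has_derivative (\<lambda>w. \<Sum>j\<in>UNIV. phase_grad g j (\<tau>, I0, \<theta>0) * w $ j)) (at \<theta>0)"
    using has_derivative_compose[OF inner has_derivative_pot[OF g I0]] crit by (simp add: f0 crit_def)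
  then have "(reduced_poincare (freq h) a ?L U \<tau>s I0 has_derivative (\<lambda>w. \<Sum>j\<in>UNIV. phase_grad g j (\<tau>, I0, \<theta>0) * w $ j)) (at \<theta>0)"
    by (rule has_derivative_transform_within_open[OF _ Q \<theta>0Q]) (simp add: red)
  then have "d = (\<lambda>w. \<Sum>j\<in>UNIV. phase_grad g j (\<tau>, I0, \<theta>0) * w $ j)"
    using d(1) has_derivative_unique by blast
  then have "\<exists>j. phase_grad g j (\<tau>, I0, \<theta>0) \<noteq> 0" using d(2) by auto
  then show ?thesis using crit unfolding g_def by blast
qed

lemma good_perturbations_iff:
  assumes "0 < \<kappa>" "Bs \<subseteq> B" "at_least_three r" "I0 \<in> Bs"
  shows "H \<in> good_perturbations r \<kappa> D B Bs h p0 q0 I0 a \<longleftrightarrow> H \<in> Comega \<kappa> D B \<and>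
    (\<exists>\<tau> \<theta> j. crit (real_part H) I0 \<tau> \<theta> \<and> phase_grad (real_part H) j (\<tau>, I0, \<theta>) \<noteq> 0)"
proof
  assume H: "H \<in> good_perturbations r \<kappa> D B Bs h p0 q0 I0 a"
  then have "H \<in> Comega \<kappa> D B" by (simp add: good_perturbations_def)
  with good_perturbationsD[OF H assms] show "H \<in> Comega \<kappa> D B \<and>
    (\<exists>\<tau> \<theta> j. crit (real_part H) I0 \<tau> \<theta> \<and> phase_grad (real_part H) j (\<tau>, I0, \<theta>) \<noteq> 0)" by blast
next
  assume "H \<in> Comega \<kappa> D B \<and>
    (\<exists>\<tau> \<theta> j. crit (real_part H) I0 \<tau> \<theta> \<and> phase_grad (real_part H) j (\<tau>, I0, \<theta>) \<noteq> 0)"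
  then show "H \<in> good_perturbations r \<kappa> D B Bs h p0 q0 I0 a"
    using good_perturbationsI[OF _ assms(1,4,2,3)] by blast
qed

lemma nice_add:
  assumes "nice D B f" "nice D B g"
  shows "nice D B (\<lambda>x. f x + g x)"
proof -
  have "bdd_Ck k S (\<lambda>x. f x + g x)" if "open S" "bdd_Ck k S f" "bdd_Ck k S g" for k S and f g :: "('n, 'd) rphase \<Rightarrow> real"
    using that(2,3)
  proof (induction k arbitrary: f g)
    case 0
    then obtain b c where "\<forall>x\<in>S. \<bar>f x\<bar> \<le> b" "\<forall>x\<in>S. \<bar>g x\<bar> \<le> c" by auto
    then have "\<forall>x\<in>S. \<bar>f x + g x\<bar> \<le> b + c"
      by (auto intro!: order_trans[OF abs_triangle_ineq] add_mono)
    then show ?case using 0 by (auto intro: continuous_on_add)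
  next
    case (Suc k)
    obtain b c where "\<forall>x\<in>S. \<bar>f x\<bar> \<le> b" "\<forall>x\<in>S. \<bar>g x\<bar> \<le> c" using Suc.prems by auto
    then have "\<forall>x\<in>S. \<bar>f x + g x\<bar> \<le> b + c"
      by (auto intro!: order_trans[OF abs_triangle_ineq] add_mono)
    moreover have "bdd_Ck k S (\<lambda>x. frechet_derivative (\<lambda>x. f x + g x) (at x) v)" for v
    proof (rule bdd_Ck_cong[OF that(1)])
      show "bdd_Ck k S (\<lambda>x. frechet_derivative f (at x) v + frechet_derivative g (at x) v)"
        by (rule Suc.IH[OF bdd_Ck_SucD(1)[OF Suc.prems(1)] bdd_Ck_SucD(1)[OF Suc.prems(2)]])
      show "frechet_derivative f (at x) v + frechet_derivative g (at x) v = frechet_derivative (\<lambda>x. f x + g x) (at x) v" if "x \<in> S" for x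
        using frechet_derivative_eqI[OF has_derivative_add[OF differentiable_has_derivative differentiable_has_derivative, of f x g]] Suc.prems that by simp
    qed
    ultimately show ?case using Suc.prems by (auto intro: continuous_on_add)
  qed
  then show ?thesis using assms open_Mreal[OF D(1) B(1)] unfolding nice_def by auto
qed

lemma
  assumes f: "nice D B f" and g: "nice D B g" and I: "I \<in> B"
  shows pot_add: "pot (\<lambda>x. f x + g x) (\<tau>, I, \<theta>) = pot f (\<tau>, I, \<theta>) + pot g (\<tau>, I, \<theta>)"
    and grad_add: "grad (\<lambda>x. f x + g x) i (\<tau>, I, \<theta>) = grad f i (\<tau>, I, \<theta>) + grad g i (\<tau>, I, \<theta>)"
    and phase_grad_add: "phase_grad (\<lambda>x. f x + g x) j (\<tau>, I, \<theta>) = phase_grad f j (\<tau>, I, \<theta>) + phase_grad g j (\<tau>, I, \<theta>)"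
    and frechet_grad_add: "frechet_derivative (grad (\<lambda>x. f x + g x) i) (at (\<tau>, I, \<theta>)) v =
      frechet_derivative (grad f i) (at (\<tau>, I, \<theta>)) v + frechet_derivative (grad g i) (at (\<tau>, I, \<theta>)) v"
proof -
  note fg = nice_add[OF f g]
  have pot: "pot (\<lambda>x. f x + g x) (\<tau>, I, \<theta>) = pot f (\<tau>, I, \<theta>) + pot g (\<tau>, I, \<theta>)" if I: "I \<in> B" for I \<tau> \<theta>
  proof -
    have x: "(\<tau>, I, \<theta>) \<in> W" using I by (simp add: W_def)
    have "integrable lborel (\<lambda>t. f (orbit_pt t (\<tau>, I, \<theta>)) - f (rest_pt t (\<tau>, I, \<theta>)))"
      "integrable lborel (\<lambda>t. g (orbit_pt t (\<tau>, I, \<theta>)) - g (rest_pt t (\<tau>, I, \<theta>)))"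
      using integrable_dominated[OF integrable_fast dominated_nice_diff[OF f] x]
        integrable_dominated[OF integrable_fast dominated_nice_diff[OF g] x] by simp_all
    from Bochner_Integration.integral_add[OF this] show ?thesis unfolding pot_def by (simp add: algebra_simps)
  qed
  show "pot (\<lambda>x. f x + g x) (\<tau>, I, \<theta>) = pot f (\<tau>, I, \<theta>) + pot g (\<tau>, I, \<theta>)" by (rule pot[OF I])
  have grad: "grad (\<lambda>x. f x + g x) i (\<tau>, I, \<theta>) = grad f i (\<tau>, I, \<theta>) + grad g i (\<tau>, I, \<theta>)" if I: "I \<in> B" for I \<tau> \<theta>
    unfolding grad_eq[OF fg I] pot[OF I]
    using frechet_derivative_eqI[OF has_derivative_add[OF has_derivative_pot_\<tau>[OF f I] has_derivative_pot_\<tau>[OF g I]]]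
    by (simp add: axis_def if_distrib cong: if_cong)
  show "grad (\<lambda>x. f x + g x) i (\<tau>, I, \<theta>) = grad f i (\<tau>, I, \<theta>) + grad g i (\<tau>, I, \<theta>)" by (rule grad[OF I])
  show "phase_grad (\<lambda>x. f x + g x) j (\<tau>, I, \<theta>) = phase_grad f j (\<tau>, I, \<theta>) + phase_grad g j (\<tau>, I, \<theta>)"
    unfolding phase_grad_eq[OF fg I] pot[OF I]
    using frechet_derivative_eqI[OF has_derivative_add[OF has_derivative_pot_\<theta>[OF f I] has_derivative_pot_\<theta>[OF g I]]]
    by (simp add: axis_def if_distrib cong: if_cong)
  have x: "(\<tau>, I, \<theta>) \<in> W" using I by (simp add: W_def)
  have "grad (\<lambda>x. f x + g x) i y = grad f i y + grad g i y" if "y \<in> W" for y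
    using grad[of "fst (snd y)" "fst y" "snd (snd y)"] that by (simp add: W_def)
  from frechet_derivative_cong_open(1)[OF open_W x this]
  have "frechet_derivative (grad (\<lambda>x. f x + g x) i) (at (\<tau>, I, \<theta>)) = frechet_derivative (\<lambda>y. grad f i y + grad g i y) (at (\<tau>, I, \<theta>))" .
  also have "\<dots> = (\<lambda>v. frechet_derivative (grad f i) (at (\<tau>, I, \<theta>)) v + frechet_derivative (grad g i) (at (\<tau>, I, \<theta>)) v)"
    by (intro frechet_derivative_eqI has_derivative_add differentiable_has_derivative grad_differentiable[OF f x] grad_differentiable[OF g x])
  finally show "frechet_derivative (grad (\<lambda>x. f x + g x) i) (at (\<tau>, I, \<theta>)) v =
      frechet_derivative (grad f i) (at (\<tau>, I, \<theta>)) v + frechet_derivative (grad g i) (at (\<tau>, I, \<theta>)) v" by simp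
qed

end

section \<open>Openness\<close>

lemma norm_matrix_vector_le:
  fixes A :: "real^'n^'m"
  assumes "\<And>i j. \<bar>A $ i $ j\<bar> \<le> b"
  shows "norm (A *v v) \<le> real CARD('m) * real CARD('n) * b * norm v"
proof -
  have "norm (A *v v) \<le> onorm ((*v) A) * norm v"
    by (rule onorm) (rule matrix_vector_mul_bounded_linear)
  also have "\<dots> \<le> real CARD('m) * real CARD('n) * b * norm v"
    by (intro mult_right_mono onorm_le_matrix_component assms) auto
  finally show ?thesis .
qed

lemma inj_matrix_det_nz:
  fixes A :: "real^'n^'n"
  assumes "\<And>v. A *v v = 0 \<Longrightarrow> v = 0"
  shows "det A \<noteq> 0"
proof -
  have "inj ((*v) A)" using assms linear_injective_0[OF matrix_vector_mul_linear, of A] by blast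
  then show ?thesis using det_nz_iff_inj[OF matrix_vector_mul_linear, of A] by (simp add: matrix_of_matrix_vector_mul)
qed

text \<open>The zero is found as a minimum of \<open>|G + P|\<close> over a small ball.\<close>
lemma nondegenerate_zero_persists:
  fixes G :: "real^'n \<Rightarrow> real^'n" and A :: "real^'n \<Rightarrow> real^'n^'n"
  assumes DG: "\<And>x. (G has_derivative (*v) (A x)) (at x)" and contA: "continuous (at x0) A"
    and zero: "G x0 = 0" and det: "det (A x0) \<noteq> 0" and r: "0 < r"
  shows "\<exists>\<epsilon>>0. \<forall>P A'. (\<forall>x. (P has_derivative (*v) (A' x)) (at x)) \<longrightarrow> (\<forall>x. norm (P x) \<le> \<epsilon>) \<longrightarrow>
    (\<forall>x i j. \<bar>A' x $ i $ j\<bar> \<le> \<epsilon>) \<longrightarrow> (\<exists>x\<in>cball x0 r. G x + P x = 0 \<and> det (A x + A' x) \<noteq> 0)"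
proof -
  have "inj ((*v) (A x0))" using det det_nz_iff_inj[OF matrix_vector_mul_linear, of "A x0"] by (simp add: matrix_of_matrix_vector_mul)
  from linear_inj_bounded_below_pos[OF matrix_vector_mul_linear this]
  obtain c where c: "c > 0" "\<And>v. c * norm v \<le> norm (A x0 *v v)" by blast
  define m where "m = real CARD('n) * real CARD('n)"
  have m: "m > 0" by (simp add: m_def)
  \<comment> \<open>A matrix with entries up to \<open>c / (4 * m)\<close> has operator norm at most
    \<open>c / 4\<close>, since \<open>m\<close> is the number of entries.\<close>
  have "c / (4 * m) > 0" using c(1) m by simp
  from contA[unfolded continuous_at_eps_delta, THEN spec, THEN mp, OF this]
  obtain d where d: "d > 0" "\<And>x. dist x x0 < d \<Longrightarrow> dist (A x) (A x0) < c / (4 * m)" by blast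
  have near: "norm ((A x - A x0) *v v) \<le> c / 4 * norm v" if "dist x x0 < d" for x v
  proof -
    have "\<bar>(A x - A x0) $ i $ j\<bar> \<le> c / (4 * m)" for i j
    proof -
      have "\<bar>(A x - A x0) $ i $ j\<bar> \<le> norm ((A x - A x0) $ i)" by (rule component_le_norm_cart)
      also have "\<dots> \<le> norm (A x - A x0)" by (rule Finite_Cartesian_Product.norm_nth_le)
      finally show ?thesis using d(2)[OF that] by (simp add: dist_norm)
    qed
    from norm_matrix_vector_le[of "A x - A x0", OF this, of v] show ?thesis using m by (simp add: m_def)
  qed
  define \<rho> where "\<rho> = min r (d / 2)"
  have \<rho>: "\<rho> > 0" "\<rho> \<le> r" "\<rho> < d" using r d(1) by (auto simp: \<rho>_def)
  \<comment> \<open>The linear part contributes at least \<open>c\<close> times the distance; the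
    mean value theorem bounds the remainder by \<open>c / 4\<close> times the distance.\<close>
  have low: "3 * c / 4 * norm (x - x0) \<le> norm (G x)" if x: "x \<in> cball x0 \<rho>" for x
  proof -
    have "norm ((G x - A x0 *v x) - (G x0 - A x0 *v x0)) \<le> c / 4 * norm (x - x0)"
    proof (rule differentiable_bound[of "cball x0 \<rho>" _ "\<lambda>x v. (A x - A x0) *v v"])
      fix y assume y: "y \<in> cball x0 \<rho>"
      have "((\<lambda>x. G x - A x0 *v x) has_derivative (\<lambda>v. A y *v v - A x0 *v v)) (at y)"
        by (intro has_derivative_diff DG bounded_linear_imp_has_derivative matrix_vector_mul_bounded_linear)
      then show "((\<lambda>x. G x - A x0 *v x) has_derivative (\<lambda>v. (A y - A x0) *v v)) (at y within cball x0 \<rho>)"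
        by (auto simp: matrix_vector_mult_diff_rdistrib intro: has_derivative_at_withinI)
      show "onorm (\<lambda>v. (A y - A x0) *v v) \<le> c / 4"
        by (rule onorm_le) (rule near, use y \<rho>(3) in \<open>simp add: dist_commute\<close>)
    qed (use x \<rho> in auto)
    then have "norm (G x - A x0 *v (x - x0)) \<le> c / 4 * norm (x - x0)"
      by (simp add: zero matrix_vector_mult_diff_distrib algebra_simps)
    moreover have "norm (A x0 *v (x - x0)) \<le> norm (G x) + norm (G x - A x0 *v (x - x0))"
      using norm_triangle_ineq4[of "G x" "G x - A x0 *v (x - x0)"] by simp
    ultimately show ?thesis using c(2)[of "x - x0"] by simp
  qed
  \<comment> \<open>The first entry keeps the perturbed matrix injective, with lower bound
    \<open>c / 2\<close>; the second keeps the minimum away from the sphere.\<close>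
  define \<epsilon> where "\<epsilon> = min (c / (4 * m)) (c * \<rho> / 4)"
  have \<epsilon>: "\<epsilon> > 0" "\<epsilon> \<le> c / (4 * m)" "\<epsilon> \<le> c * \<rho> / 4" using c(1) m \<rho>(1) by (auto simp: \<epsilon>_def)
  show ?thesis
  proof (intro exI[of _ \<epsilon>] conjI allI impI \<epsilon>(1))
    fix P :: "real^'n \<Rightarrow> real^'n" and A' :: "real^'n \<Rightarrow> real^'n^'n"
    assume DP: "\<forall>x. (P has_derivative (*v) (A' x)) (at x)" and P: "\<forall>x. norm (P x) \<le> \<epsilon>"
      and A': "\<forall>x i j. \<bar>A' x $ i $ j\<bar> \<le> \<epsilon>"
    let ?F = "\<lambda>x. G x + P x"
    have DF: "(?F has_derivative (\<lambda>v. A x *v v + A' x *v v)) (at x)" for x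
      using DG DP by (intro has_derivative_add) auto
    have "continuous_on (cball x0 \<rho>) (\<lambda>x. ?F x \<bullet> ?F x)"
      by (intro continuous_intros continuous_at_imp_continuous_on ballI has_derivative_continuous[OF DG] has_derivative_continuous[OF spec[OF DP]])
    moreover have "cball x0 \<rho> \<noteq> {}" using \<rho>(1) by simp
    ultimately obtain x where x: "x \<in> cball x0 \<rho>" "\<And>y. y \<in> cball x0 \<rho> \<Longrightarrow> ?F x \<bullet> ?F x \<le> ?F y \<bullet> ?F y"
      using continuous_attains_inf[OF compact_cball] by blast
    have le: "norm (?F x) \<le> \<epsilon>"
    proof -
      have "norm (?F x) \<le> norm (?F x0)" using x(2)[of x0] \<rho>(1) by (simp add: norm_le)
      also have "\<dots> \<le> \<epsilon>" using P by (simp add: zero)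
      finally show ?thesis .
    qed
    \<comment> \<open>At the centre \<open>|G + P|\<close> is at most \<epsilon>, whereas on the
      sphere it is at least \<open>3 * c * \<rho> / 4 - \<epsilon>\<close>, which is larger.\<close>
    have "norm (x - x0) < \<rho>"
    proof (rule ccontr)
      assume "\<not> norm (x - x0) < \<rho>"
      then have "3 * c / 4 * \<rho> \<le> 3 * c / 4 * norm (x - x0)" using c(1) by (intro mult_left_mono) auto
      also have "\<dots> \<le> norm (G x)" by (rule low[OF x(1)])
      also have "\<dots> \<le> norm (?F x) + norm (P x)" using norm_triangle_ineq4[of "?F x" "P x"] by simp
      also have "\<dots> \<le> \<epsilon> + \<epsilon>" using le P by (intro add_mono) auto
      finally have "3 * (c * \<rho>) / 4 \<le> 2 * \<epsilon>" by simp
      moreover have "c * \<rho> > 0" using c(1) \<rho>(1) by simp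
      ultimately show False using \<epsilon>(3) by linarith
    qed
    then have xb: "x \<in> ball x0 \<rho>" by (simp add: dist_norm norm_minus_commute)
    \<comment> \<open>Stationarity of the squared norm makes \<open>?F x\<close> orthogonal to the
      range of \<open>A x + A' x\<close>. This matrix is invertible, so the range is the whole space
      and \<open>?F x\<close> is 0.\<close>
    have "((\<lambda>x. ?F x \<bullet> ?F x) has_derivative (\<lambda>v. ?F x \<bullet> (A x *v v + A' x *v v) + (A x *v v + A' x *v v) \<bullet> ?F x)) (at x)"
      by (rule has_derivative_inner[OF DF DF])
    then have "(\<lambda>v. ?F x \<bullet> (A x *v v + A' x *v v) + (A x *v v + A' x *v v) \<bullet> ?F x) = (\<lambda>v. 0)"
      by (rule differential_zero_maxmin[OF xb open_ball]) (use x(2) in auto)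
    then have orth: "?F x \<bullet> ((A x + A' x) *v v) = 0" for v
      by (simp add: fun_eq_iff matrix_vector_mult_add_rdistrib inner_commute)
    have inj: "v = 0" if "(A x + A' x) *v v = 0" for v
    proof -
      have 1: "norm ((A x - A x0) *v v) \<le> c / 4 * norm v"
        by (rule near) (use x(1) \<rho>(3) in \<open>simp add: dist_commute\<close>)
      have "\<bar>A' x $ i $ j\<bar> \<le> c / (4 * m)" for i j using A' \<epsilon>(2) order_trans by blast
      from norm_matrix_vector_le[of "A' x", OF this, of v] have 2: "norm (A' x *v v) \<le> c / 4 * norm v" using m by (simp add: m_def)
      have "A x0 *v v = (A x + A' x) *v v - (A x - A x0) *v v - A' x *v v"
        by (simp add: matrix_vector_mult_diff_rdistrib matrix_vector_mult_add_rdistrib)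
      then have "norm (A x0 *v v) \<le> norm ((A x - A x0) *v v) + norm (A' x *v v)"
        using that norm_triangle_ineq4[of "- ((A x - A x0) *v v)" "A' x *v v"] by simp
      then have "c / 2 * norm v \<le> 0" using 1 2 c(2)[of v] by simp
      then show "v = 0" using c(1) by (simp add: mult_le_0_iff)
    qed
    have det': "det (A x + A' x) \<noteq> 0" by (rule inj_matrix_det_nz[OF inj])
    then have "surj ((*v) (A x + A' x))"
      using inj linear_injective_0[OF matrix_vector_mul_linear] linear_injective_imp_surjective[OF matrix_vector_mul_linear] by blast
    then obtain v where "?F x = (A x + A' x) *v v" by blast
    then have "?F x = 0" using orth[of v] by simp
    then show "\<exists>x\<in>cball x0 r. G x + P x = 0 \<and> det (A x + A' x) \<noteq> 0"
      using det' x(1) \<rho>(2) by (intro bexI[of _ x]) auto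
  qed
qed

section \<open>Persistence of critical points of the potential\<close>

context melnikov
begin

definition grad_vec :: "(('n, 'd) rphase \<Rightarrow> real) \<Rightarrow> real^'d \<Rightarrow> real^'d \<Rightarrow> real^'n \<Rightarrow> real^'n" where
  "grad_vec g I \<theta> \<tau> = (\<chi> i. grad g i (\<tau>, I, \<theta>))"

definition jac :: "(('n, 'd) rphase \<Rightarrow> real) \<Rightarrow> real^'d \<Rightarrow> real^'d \<Rightarrow> real^'n \<Rightarrow> real^'n^'n" where
  "jac g I \<theta> \<tau> = (\<chi> i j. frechet_derivative (grad g i) (at (\<tau>, I, \<theta>)) (axis j 1, 0))"

lemma crit_iff: "crit g I \<tau> \<theta> \<longleftrightarrow> grad_vec g I \<theta> \<tau> = 0 \<and> det (jac g I \<theta> \<tau>) \<noteq> 0"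
  by (simp add: crit_def grad_vec_def jac_def vec_eq_iff)

lemma has_derivative_grad_vec:
  assumes g: "nice D B g" and I: "I \<in> B"
  shows "(grad_vec g I \<theta> has_derivative (*v) (jac g I \<theta> \<tau>)) (at \<tau>)"
proof (rule has_derivative_vecI)
  fix i
  have d: "grad g i differentiable at (\<tau>, I, \<theta>)" by (rule grad_differentiable[OF g]) (simp add: W_def I)
  have lin: "linear (frechet_derivative (grad g i) (at (\<tau>, I, \<theta>)))" by (rule linear_frechet_derivative[OF d])
  have 1: "((\<lambda>\<tau>. (\<tau>, I, \<theta>)) has_derivative (\<lambda>v. (v, 0, 0))) (at \<tau>)"
    by (intro has_derivative_Pair has_derivative_ident has_derivative_const)
  have "frechet_derivative (grad g i) (at (\<tau>, I, \<theta>)) (v, 0, 0) = (jac g I \<theta> \<tau> *v v) $ i" for v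
  proof -
    have "(v, 0, 0) = (\<Sum>j\<in>UNIV. v $ j *\<^sub>R (axis j 1, 0 :: (real^'d) \<times> (real^'d)))"
      by (simp add: sum_prod vec_eq_sum_axis zero_prod_def)
    then show ?thesis
      by (simp only: linear_sum[OF lin] linear_cmul[OF lin]) (simp add: jac_def matrix_vector_mult_def mult.commute)
  qed
  then show "((\<lambda>\<tau>. grad_vec g I \<theta> \<tau> $ i) has_derivative (\<lambda>v. (jac g I \<theta> \<tau> *v v) $ i)) (at \<tau>)"
    using has_derivative_compose[OF 1 differentiable_has_derivative[OF d]] by (simp add: grad_vec_def)
qed

lemma continuous_jac:
  assumes g: "nice D B g" and I: "I \<in> B"
  shows "continuous (at \<tau>) (jac g I \<theta>)"
proof -
  have "continuous_on UNIV (\<lambda>\<tau>. jac g I \<theta> \<tau> $ i $ j)" for i j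
  proof -
    have "continuous_on W (\<lambda>x. frechet_derivative (grad g i) (at x) (axis j 1, 0))"
      using Ck_on_SucD(1)[OF Ck_grad[OF g order_le_2, of "Suc 0"], of i "(axis j 1, 0)"] by simp
    then have "continuous_on UNIV (\<lambda>\<tau>. frechet_derivative (grad g i) (at (\<tau>, I, \<theta>)) (axis j 1, 0))"
      by (rule continuous_on_compose2) (auto intro!: continuous_intros simp: W_def I)
    then show ?thesis by (simp add: jac_def)
  qed
  then have "continuous_on UNIV (jac g I \<theta>)"
    using continuous_on_vec_lambda[of UNIV "\<lambda>i \<tau>. jac g I \<theta> \<tau> $ i"] continuous_on_vec_lambda[of UNIV "\<lambda>j \<tau>. jac g I \<theta> \<tau> $ i $ j" for i]
    by simp
  then show ?thesis by (simp add: continuous_on_eq_continuous_at)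
qed

lemma continuous_phase_grad:
  assumes g: "nice D B g" and I: "I \<in> B"
  shows "continuous_on UNIV (\<lambda>\<tau>. phase_grad g j (\<tau>, I, \<theta>))"
proof -
  have "dom_Ck lborel fast_weights 0 W (\<lambda>t x. frechet_derivative g (at (orbit_pt t x)) (e\<phi> j)
     - frechet_derivative g (at (rest_pt t x)) (e\<phi> j))"
    using dominated_nice_diff[OF nice_derivative[OF D(1) B(1) g]] by simp
  from dom_Ck_integral(1)[OF open_W integrable_fast this] have "continuous_on W (phase_grad g j)"
    unfolding phase_grad_def[abs_def] by (simp add: continuous_on_minus)
  then show ?thesis
    by (rule continuous_on_compose2) (auto intro!: continuous_intros simp: W_def I)
qed

lemma grad_vec_add:
  assumes "nice D B f" "nice D B g" "I \<in> B"
  shows "grad_vec (\<lambda>x. f x + g x) I \<theta> \<tau> = grad_vec f I \<theta> \<tau> + grad_vec g I \<theta> \<tau>"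
    and "jac (\<lambda>x. f x + g x) I \<theta> \<tau> = jac f I \<theta> \<tau> + jac g I \<theta> \<tau>"
  using assms by (simp_all add: grad_vec_def jac_def vec_eq_iff grad_add frechet_grad_add)

text \<open>The angle \<theta> is kept and only the shifts move, within \<open>s / 2\<close> of
  \<open>\<tau>0\<close>. There the phase derivative of \<open>g\<close> still exceeds half of its
  value in modulus, and the perturbation takes away at most a quarter.\<close>

lemma crit_persists:
  assumes g: "nice D B g" and I: "I \<in> B" and c: "crit g I \<tau>0 \<theta>" and j: "phase_grad g j (\<tau>0, I, \<theta>) \<noteq> 0"
  shows "\<exists>\<epsilon>>0. \<forall>f. nice D B f \<longrightarrow>
    (\<forall>z\<in>Mreal D B. \<forall>b\<in>Basis. \<bar>frechet_derivative f (at z) b\<bar> \<le> \<epsilon>) \<longrightarrow>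
    (\<forall>z\<in>Mreal D B. \<forall>b\<in>Basis. \<forall>b'\<in>Basis. \<bar>frechet_derivative (\<lambda>z. frechet_derivative f (at z) b) (at z) b'\<bar> \<le> \<epsilon>) \<longrightarrow>
    (\<exists>\<tau>. crit (\<lambda>x. g x + f x) I \<tau> \<theta> \<and> phase_grad (\<lambda>x. g x + f x) j (\<tau>, I, \<theta>) \<noteq> 0)"
proof -
  let ?p = "\<bar>phase_grad g j (\<tau>0, I, \<theta>)\<bar>"
  have "continuous (at \<tau>0) (\<lambda>\<tau>. phase_grad g j (\<tau>, I, \<theta>))"
    using continuous_phase_grad[OF g I] by (simp add: continuous_on_eq_continuous_at)
  moreover have "?p / 2 > 0" using j by simp
  ultimately obtain s where s: "s > 0" "\<forall>\<tau>. dist \<tau> \<tau>0 < s \<longrightarrow> dist (phase_grad g j (\<tau>, I, \<theta>)) (phase_grad g j (\<tau>0, I, \<theta>)) < ?p / 2"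
    unfolding continuous_at_eps_delta by blast
  have "grad_vec g I \<theta> \<tau>0 = 0" "det (jac g I \<theta> \<tau>0) \<noteq> 0" using c by (simp_all add: crit_iff)
  from nondegenerate_zero_persists[OF has_derivative_grad_vec[OF g I] continuous_jac[OF g I] this half_gt_zero[OF s(1)]]
  obtain e where e: "e > 0" and eall: "\<forall>P A'. (\<forall>x. (P has_derivative (*v) (A' x)) (at x)) \<longrightarrow> (\<forall>x. norm (P x) \<le> e) \<longrightarrow>
    (\<forall>x i j. \<bar>A' x $ i $ j\<bar> \<le> e) \<longrightarrow> (\<exists>x\<in>cball \<tau>0 (s / 2). grad_vec g I \<theta> x + P x = 0 \<and> det (jac g I \<theta> x + A' x) \<noteq> 0)"
    by (elim exE conjE)
  from melnikov_estimates obtain K where K: "K \<ge> 0" and Kall: "\<forall>g N I \<tau> \<theta>. nice D B g \<longrightarrow> I \<in> B \<longrightarrow>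
     (\<forall>z\<in>Mreal D B. \<forall>b\<in>Basis. \<bar>frechet_derivative g (at z) b\<bar> \<le> N) \<longrightarrow>
     (\<forall>z\<in>Mreal D B. \<forall>b\<in>Basis. \<forall>b'\<in>Basis. \<bar>frechet_derivative (\<lambda>z. frechet_derivative g (at z) b) (at z) b'\<bar> \<le> N) \<longrightarrow>
     (\<forall>i. \<bar>grad g i (\<tau>, I, \<theta>)\<bar> \<le> K * N) \<and> (\<forall>j. \<bar>phase_grad g j (\<tau>, I, \<theta>)\<bar> \<le> K * N) \<and>
     (\<forall>i l. \<bar>frechet_derivative (grad g i) (at (\<tau>, I, \<theta>)) (axis l 1, 0)\<bar> \<le> K * N)"
    by (elim exE conjE)
  \<comment> \<open>Division by the number of pendulums, because the norm of the gradient is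
    estimated by the sum of its components; a quarter of \<open>?p\<close> is the allowance for the
    phase derivative.\<close>
  define \<delta> where "\<delta> = min (e / CARD('n)) (?p / 4)"
  have \<delta>: "\<delta> > 0" using e j by (simp add: \<delta>_def)
  have le1: "\<delta> \<le> e / CARD('n)" by (simp add: \<delta>_def)
  moreover have "e / CARD('n) \<le> e" using e by (simp add: field_simps)
  ultimately have \<delta>e: "\<delta> \<le> e" by (rule order_trans)
  have \<delta>n: "CARD('n) * \<delta> \<le> e" using le1 by (simp add: field_simps)
  define \<epsilon> where "\<epsilon> = \<delta> / (K + 1)"
  have \<epsilon>: "\<epsilon> > 0" "K * \<epsilon> \<le> \<delta>" using \<delta> K by (auto simp: \<epsilon>_def field_simps)
  show ?thesis
  proof (intro exI[of _ \<epsilon>] conjI allI impI \<epsilon>(1))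
    fix f assume f: "nice D B f"
      and f1: "\<forall>z\<in>Mreal D B. \<forall>b\<in>Basis. \<bar>frechet_derivative f (at z) b\<bar> \<le> \<epsilon>"
      and f2: "\<forall>z\<in>Mreal D B. \<forall>b\<in>Basis. \<forall>b'\<in>Basis. \<bar>frechet_derivative (\<lambda>z. frechet_derivative f (at z) b) (at z) b'\<bar> \<le> \<epsilon>"
    have le: "\<bar>grad f i (\<tau>, I, \<theta>)\<bar> \<le> \<delta>" "\<bar>phase_grad f j (\<tau>, I, \<theta>)\<bar> \<le> \<delta>" "\<bar>jac f I \<theta> \<tau> $ i $ l\<bar> \<le> \<delta>" for i j l \<tau>
    proof -
      have "(\<forall>i. \<bar>grad f i (\<tau>, I, \<theta>)\<bar> \<le> K * \<epsilon>) \<and> (\<forall>j. \<bar>phase_grad f j (\<tau>, I, \<theta>)\<bar> \<le> K * \<epsilon>) \<and>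
        (\<forall>i l. \<bar>frechet_derivative (grad f i) (at (\<tau>, I, \<theta>)) (axis l 1, 0)\<bar> \<le> K * \<epsilon>)"
        by (rule Kall[THEN spec, THEN spec, THEN spec, THEN spec, THEN spec, THEN mp, OF f, THEN mp, OF I, THEN mp, OF f1, THEN mp, OF f2])
      then show "\<bar>grad f i (\<tau>, I, \<theta>)\<bar> \<le> \<delta>" "\<bar>phase_grad f j (\<tau>, I, \<theta>)\<bar> \<le> \<delta>" "\<bar>jac f I \<theta> \<tau> $ i $ l\<bar> \<le> \<delta>"
        by (auto simp: jac_def intro: order_trans[OF _ \<epsilon>(2)])
    qed
    have "norm (grad_vec f I \<theta> \<tau>) \<le> e" for \<tau>
    proof -
      have "norm (grad_vec f I \<theta> \<tau>) \<le> (\<Sum>i\<in>UNIV. \<bar>grad_vec f I \<theta> \<tau> $ i\<bar>)" by (rule norm_vec_le_sum)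
      also have "\<dots> \<le> (\<Sum>i\<in>(UNIV :: 'n set). \<delta>)" by (rule sum_mono) (simp add: grad_vec_def le)
      finally show ?thesis using \<delta>n by simp
    qed
    then have 1: "\<forall>\<tau>. norm (grad_vec f I \<theta> \<tau>) \<le> e" by blast
    have 2: "\<forall>\<tau> i j. \<bar>jac f I \<theta> \<tau> $ i $ j\<bar> \<le> e" by (intro allI order_trans[OF le(3) \<delta>e(1)])
    have 3: "\<forall>\<tau>. (grad_vec f I \<theta> has_derivative (*v) (jac f I \<theta> \<tau>)) (at \<tau>)" by (intro allI has_derivative_grad_vec[OF f I])
    from eall[THEN spec, THEN spec, THEN mp, OF 3, THEN mp, OF 1, THEN mp, OF 2]
    obtain \<tau> where \<tau>: "\<tau> \<in> cball \<tau>0 (s / 2)" "grad_vec g I \<theta> \<tau> + grad_vec f I \<theta> \<tau> = 0" "det (jac g I \<theta> \<tau> + jac f I \<theta> \<tau>) \<noteq> 0"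
      by (elim bexE conjE)
    have "crit (\<lambda>x. g x + f x) I \<tau> \<theta>"
      using \<tau> by (simp add: crit_iff grad_vec_add[OF g f I])
    moreover have "phase_grad (\<lambda>x. g x + f x) j (\<tau>, I, \<theta>) \<noteq> 0"
    proof -
      have "dist \<tau> \<tau>0 < s" using \<tau>(1) s(1) by (simp add: dist_commute)
      from s(2)[rule_format, OF this] have "\<bar>phase_grad g j (\<tau>, I, \<theta>) - phase_grad g j (\<tau>0, I, \<theta>)\<bar> < ?p / 2" by (simp add: dist_real_def)
      moreover have "\<bar>phase_grad f j (\<tau>, I, \<theta>)\<bar> \<le> ?p / 4" using le(2)[of j \<tau>] by (simp add: \<delta>_def)
      ultimately show ?thesis using j unfolding phase_grad_add[OF g f I] by linarith
    qed
    ultimately show "\<exists>\<tau>. crit (\<lambda>x. g x + f x) I \<tau> \<theta> \<and> phase_grad (\<lambda>x. g x + f x) j (\<tau>, I, \<theta>) \<noteq> 0" by blast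
  qed
qed

text \<open>The lists of length one and two in \<open>C3_norm\<close> supply the two derivative
  bounds of \<open>crit_persists\<close>.\<close>

lemma good_perturbations_C3_nbhd:
  assumes "0 < \<kappa>" "Bs \<subseteq> B" "at_least_three r" "I0 \<in> Bs"
    and H: "H \<in> good_perturbations r \<kappa> D B Bs h p0 q0 I0 a"
  shows "\<exists>\<epsilon>>0. \<forall>H'\<in>Comega \<kappa> D B. C3_norm D B (\<lambda>x. H x - H' x) < \<epsilon> \<longrightarrow>
    H' \<in> good_perturbations r \<kappa> D B Bs h p0 q0 I0 a"
proof -
  note iff = good_perturbations_iff[OF assms(1-4)]
  have I: "I0 \<in> B" using assms by blast
  have ne: "D \<noteq> {}" "B \<noteq> {}" using D(3) I by auto
  obtain \<tau> \<theta> j where HC: "H \<in> Comega \<kappa> D B" and c: "crit (real_part H) I0 \<tau> \<theta>" "phase_grad (real_part H) j (\<tau>, I0, \<theta>) \<noteq> 0"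
    using H unfolding iff by blast
  from crit_persists[OF nice_real_part[OF D(1) B(1) HC assms(1)] I c]
  obtain \<epsilon> where \<epsilon>: "\<epsilon> > 0" and \<epsilon>all: "\<forall>f. nice D B f \<longrightarrow>
    (\<forall>z\<in>Mreal D B. \<forall>b\<in>Basis. \<bar>frechet_derivative f (at z) b\<bar> \<le> \<epsilon>) \<longrightarrow>
    (\<forall>z\<in>Mreal D B. \<forall>b\<in>Basis. \<forall>b'\<in>Basis. \<bar>frechet_derivative (\<lambda>z. frechet_derivative f (at z) b) (at z) b'\<bar> \<le> \<epsilon>) \<longrightarrow>
    (\<exists>\<tau>. crit (\<lambda>x. real_part H x + f x) I0 \<tau> \<theta> \<and> phase_grad (\<lambda>x. real_part H x + f x) j (\<tau>, I0, \<theta>) \<noteq> 0)"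
    by (elim exE conjE)
  show ?thesis
  proof (intro exI[of _ \<epsilon>] conjI ballI impI \<epsilon>)
    fix H' assume H': "H' \<in> Comega \<kappa> D B" and lt: "C3_norm D B (\<lambda>x. H x - H' x) < \<epsilon>"
    let ?P = "\<lambda>x. H x - H' x"
    have PC: "?P \<in> Comega \<kappa> D B" by (rule Comega_diff[OF HC H'])
    have QC: "(\<lambda>z. H' z - H z) \<in> Comega \<kappa> D B" by (rule Comega_diff[OF H' HC])
    \<comment> \<open>The topology measures \<open>H - H'\<close>, while the perturbation to be
      added is \<open>H' - H\<close>; their derivatives differ only in sign.\<close>
    let ?f = "real_part (\<lambda>z. H' z - H z)"
    have f: "nice D B ?f" by (rule nice_real_part[OF D(1) B(1) QC assms(1)])
    have fP: "?f = (\<lambda>x. - real_part ?P x)" by (simp add: real_part_def fun_eq_iff)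
    have nP: "nice D B (real_part ?P)" by (rule nice_real_part[OF D(1) B(1) PC assms(1)])
    note C3 = dirs_deriv_le_C3_norm[OF D(1) B(1) ne PC assms(1)]
    have d1: "frechet_derivative ?f (at z) v = - frechet_derivative (real_part ?P) (at z) v" if "z \<in> Mreal D B" for z v
      unfolding fP by (simp add: frechet_derivative_eqI[OF has_derivative_minus[OF differentiable_has_derivative[OF nice_differentiable[OF nP that]]]])
    have d2: "frechet_derivative (\<lambda>z. frechet_derivative ?f (at z) v) (at z) w =
      - frechet_derivative (\<lambda>z. frechet_derivative (real_part ?P) (at z) v) (at z) w" if z: "z \<in> Mreal D B" for z v w
    proof -
      have "frechet_derivative (\<lambda>z. frechet_derivative ?f (at z) v) (at z) = frechet_derivative (\<lambda>z. - frechet_derivative (real_part ?P) (at z) v) (at z)"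
        by (rule frechet_derivative_cong_open(1)[OF open_Mreal[OF D(1) B(1)] z d1])
      also have "\<dots> = (\<lambda>w. - frechet_derivative (\<lambda>z. frechet_derivative (real_part ?P) (at z) v) (at z) w)"
        by (intro frechet_derivative_eqI has_derivative_minus differentiable_has_derivative nice_differentiable[OF nice_derivative[OF D(1) B(1) nP] z])
      finally show ?thesis by simp
    qed
    have 1: "\<forall>z\<in>Mreal D B. \<forall>b\<in>Basis. \<bar>frechet_derivative ?f (at z) b\<bar> \<le> \<epsilon>"
    proof (intro ballI)
      fix z b :: "('n, 'd) rphase" assume "z \<in> Mreal D B" "b \<in> Basis"
      then show "\<bar>frechet_derivative ?f (at z) b\<bar> \<le> \<epsilon>" using C3[of "[b]" z] lt by (simp add: d1)
    qed
    have 2: "\<forall>z\<in>Mreal D B. \<forall>b\<in>Basis. \<forall>b'\<in>Basis. \<bar>frechet_derivative (\<lambda>z. frechet_derivative ?f (at z) b) (at z) b'\<bar> \<le> \<epsilon>"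
    proof (intro ballI)
      fix z b b' :: "('n, 'd) rphase" assume "z \<in> Mreal D B" "b \<in> Basis" "b' \<in> Basis"
      then show "\<bar>frechet_derivative (\<lambda>z. frechet_derivative ?f (at z) b) (at z) b'\<bar> \<le> \<epsilon>"
        using C3[of "[b', b]" z] lt by (simp add: d2)
    qed
    from \<epsilon>all[THEN spec, THEN mp, OF f, THEN mp, OF 1, THEN mp, OF 2]
    obtain \<tau> where "crit (\<lambda>x. real_part H x + ?f x) I0 \<tau> \<theta>" "phase_grad (\<lambda>x. real_part H x + ?f x) j (\<tau>, I0, \<theta>) \<noteq> 0"
      by (elim exE conjE)
    moreover have "(\<lambda>x. real_part H x + ?f x) = real_part H'" by (simp add: real_part_def fun_eq_iff)
    ultimately show "H' \<in> good_perturbations r \<kappa> D B Bs h p0 q0 I0 a" unfolding iff using H' by auto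
  qed
qed

lemma openin_good_perturbations:
  assumes "0 < \<kappa>" "Bs \<subseteq> B" "at_least_three r" "I0 \<in> Bs"
  shows "openin (norm_topology (Comega \<kappa> D B) (C3_norm D B)) (good_perturbations r \<kappa> D B Bs h p0 q0 I0 a)"
    and "openin (norm_topology (Comega \<kappa> D B) (kappa_norm \<kappa> D B)) (good_perturbations r \<kappa> D B Bs h p0 q0 I0 a)"
proof -
  let ?G = "good_perturbations r \<kappa> D B Bs h p0 q0 I0 a"
  have sub: "?G \<subseteq> Comega \<kappa> D B" by (auto simp: good_perturbations_def)
  show "openin (norm_topology (Comega \<kappa> D B) (C3_norm D B)) ?G"
    unfolding openin_norm_topology using sub good_perturbations_C3_nbhd[OF assms] by blast
  have ne: "D \<noteq> {}" "B \<noteq> {}" using D(3) assms by auto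
  let ?K = "max 1 (8 / \<kappa>) ^ 3"
  have K: "?K > 0" by (rule zero_less_power) simp
  have "\<exists>\<epsilon>>0. \<forall>H'\<in>Comega \<kappa> D B. kappa_norm \<kappa> D B (\<lambda>x. H x - H' x) < \<epsilon> \<longrightarrow> H' \<in> ?G" if H: "H \<in> ?G" for H
  proof -
    obtain \<epsilon> where \<epsilon>: "\<epsilon> > 0" "\<forall>H'\<in>Comega \<kappa> D B. C3_norm D B (\<lambda>x. H x - H' x) < \<epsilon> \<longrightarrow> H' \<in> ?G"
      using good_perturbations_C3_nbhd[OF assms H] by blast
    show ?thesis
    proof (intro exI[of _ "\<epsilon> / ?K"] conjI ballI impI)
      show "\<epsilon> / ?K > 0" using \<epsilon>(1) K by simp
      fix H' assume H': "H' \<in> Comega \<kappa> D B" "kappa_norm \<kappa> D B (\<lambda>x. H x - H' x) < \<epsilon> / ?K"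
      have "C3_norm D B (\<lambda>x. H x - H' x) \<le> ?K * kappa_norm \<kappa> D B (\<lambda>x. H x - H' x)"
        by (rule C3_norm_le_kappa_norm[OF D(1) B(1) ne Comega_diff[OF subsetD[OF sub H] H'(1)] assms(1)])
      also have "\<dots> < \<epsilon>" using H'(2) K by (simp add: pos_less_divide_eq mult.commute)
      finally show "H' \<in> ?G" using \<epsilon>(2) H'(1) by blast
    qed
  qed
  then show "openin (norm_topology (Comega \<kappa> D B) (kappa_norm \<kappa> D B)) ?G"
    unfolding openin_norm_topology using sub by blast
qed

end

section \<open>Trigonometric perturbations\<close>

text \<open>Perturbations are assembled from functions holomorphic on the whole complex space, where
  sums and products are immediate. \<open>cut\<close> then selects the representative that vanishes
  off \<open>Mkappa\<close>, as \<open>Comega\<close> prescribes.\<close>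

definition trig_fun :: "real \<Rightarrow> (real^'n) set \<Rightarrow> (real^'d) set \<Rightarrow> (('n::finite, 'd::finite) cphase \<Rightarrow> complex) \<Rightarrow> bool" where
  "trig_fun \<kappa> D B F \<longleftrightarrow> cphase_periodic_on UNIV F \<and> cphase_holomorphic_on UNIV F \<and>
     bounded (F ` Mkappa \<kappa> D B) \<and> (\<forall>x. F (embed x) \<in> \<real>)"

text \<open>The periodic coordinates treated at once: they are complex linear, change by multiples
  of \<open>2 * pi\<close> under periods, and have imaginary part below \<kappa> on
  \<open>Mkappa\<close>.\<close>

definition angle_fun :: "(('n::finite, 'd::finite) cphase \<Rightarrow> complex) \<Rightarrow> bool" where
  "angle_fun a \<longleftrightarrow> (\<exists>i. a = (\<lambda>z. fst (snd z) $ i)) \<or> (\<exists>j. a = (\<lambda>z. fst (snd (snd (snd z))) $ j)) \<or>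
     a = (\<lambda>z. snd (snd (snd (snd z))))"

lemma trig_fun_const: "trig_fun \<kappa> D B (\<lambda>z. complex_of_real c)"
  unfolding trig_fun_def cphase_periodic_on_def cphase_holomorphic_on_def
proof (intro conjI ballI)
  fix z :: "('a, 'b) cphase"
  show "\<exists>f'. ((\<lambda>z. complex_of_real c) has_derivative f') (at z) \<and> (\<forall>c v. f' (cscale c v) = c * f' v)"
    by (rule exI[of _ "\<lambda>_. 0"]) simp
  show "bounded ((\<lambda>z. complex_of_real c) ` Mkappa \<kappa> D B)"
    by (rule bounded_subset[of "{complex_of_real c}"]) auto
qed auto

lemma
  assumes F: "trig_fun \<kappa> D B F" and G: "trig_fun \<kappa> D B G"
  shows trig_fun_add: "trig_fun \<kappa> D B (\<lambda>z. F z + G z)"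
    and trig_fun_mult: "trig_fun \<kappa> D B (\<lambda>z. F z * G z)"
proof -
  have per: "cphase_periodic_on UNIV F" "cphase_periodic_on UNIV G"
    and hol: "cphase_holomorphic_on UNIV F" "cphase_holomorphic_on UNIV G"
    and re: "\<And>x. F (embed x) \<in> \<real>" "\<And>x. G (embed x) \<in> \<real>"
    and bdd: "bounded (F ` Mkappa \<kappa> D B)" "bounded (G ` Mkappa \<kappa> D B)"
    using F G by (auto simp: trig_fun_def)
  obtain a b where ab: "\<And>z. z \<in> Mkappa \<kappa> D B \<Longrightarrow> norm (F z) \<le> a" "\<And>z. z \<in> Mkappa \<kappa> D B \<Longrightarrow> norm (G z) \<le> b"
    using bdd unfolding bounded_iff by blast
  have "bounded ((\<lambda>z. F z + G z) ` Mkappa \<kappa> D B)" "bounded ((\<lambda>z. F z * G z) ` Mkappa \<kappa> D B)"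
  proof -
    have "norm (F z + G z) \<le> \<bar>a\<bar> + \<bar>b\<bar>" "norm (F z * G z) \<le> \<bar>a\<bar> * \<bar>b\<bar>" if "z \<in> Mkappa \<kappa> D B" for z
      using ab[OF that] unfolding norm_mult by (intro order_trans[OF norm_triangle_ineq] add_mono mult_mono; simp)+
    then show "bounded ((\<lambda>z. F z + G z) ` Mkappa \<kappa> D B)" "bounded ((\<lambda>z. F z * G z) ` Mkappa \<kappa> D B)"
      unfolding bounded_iff by blast+
  qed
  moreover have "cphase_periodic_on UNIV (\<lambda>z. F z + G z)" "cphase_periodic_on UNIV (\<lambda>z. F z * G z)"
    using per unfolding cphase_periodic_on_def by simp_all
  moreover have "cphase_holomorphic_on UNIV (\<lambda>z. F z + G z) \<and> cphase_holomorphic_on UNIV (\<lambda>z. F z * G z)"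
  proof -
    have "(\<exists>f'. ((\<lambda>z. F z + G z) has_derivative f') (at z) \<and> (\<forall>c v. f' (cscale c v) = c * f' v)) \<and>
      (\<exists>f'. ((\<lambda>z. F z * G z) has_derivative f') (at z) \<and> (\<forall>c v. f' (cscale c v) = c * f' v))" for z
    proof -
      obtain f' g' where f': "(F has_derivative f') (at z)" "\<And>c v. f' (cscale c v) = c * f' v"
        and g': "(G has_derivative g') (at z)" "\<And>c v. g' (cscale c v) = c * g' v"
        using hol unfolding cphase_holomorphic_on_def by blast
      show ?thesis
      proof
        show "\<exists>f'. ((\<lambda>z. F z + G z) has_derivative f') (at z) \<and> (\<forall>c v. f' (cscale c v) = c * f' v)"
          by (rule exI[of _ "\<lambda>v. f' v + g' v"]) (simp add: has_derivative_add[OF f'(1) g'(1)] f'(2) g'(2) ring_distribs)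
        show "\<exists>f'. ((\<lambda>z. F z * G z) has_derivative f') (at z) \<and> (\<forall>c v. f' (cscale c v) = c * f' v)"
          by (rule exI[of _ "\<lambda>v. F z * g' v + f' v * G z"], rule conjI[OF has_derivative_mult[OF f'(1) g'(1)]])
            (simp add: f'(2) g'(2) ring_distribs mult_ac)
      qed
    qed
    then show ?thesis unfolding cphase_holomorphic_on_def by blast
  qed
  ultimately show "trig_fun \<kappa> D B (\<lambda>z. F z + G z)" "trig_fun \<kappa> D B (\<lambda>z. F z * G z)"
    using re unfolding trig_fun_def by (auto intro: Reals_add Reals_mult)
qed

lemma trig_fun_power: "trig_fun \<kappa> D B F \<Longrightarrow> trig_fun \<kappa> D B (\<lambda>z. F z ^ m)"
  by (induction m) (use trig_fun_const[of \<kappa> D B 1] in \<open>simp_all add: trig_fun_mult\<close>)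

lemma cos_periodic_int: "cos (z + complex_of_real (2 * pi * of_int k)) = cos z"
proof -
  have "sin (complex_of_real (2 * pi * of_int k)) = 0" "cos (complex_of_real (2 * pi * of_int k)) = 1"
    unfolding sin_of_real cos_of_real using sin_int_2pin[of k] cos_int_2pin[of k] by simp_all
  then show ?thesis unfolding cos_add by simp
qed

lemma trig_fun_cos_angle:
  fixes a :: "('n::finite, 'd::finite) cphase \<Rightarrow> complex"
  assumes a: "angle_fun a"
  shows "trig_fun \<kappa> D B (\<lambda>z. cos (a z + complex_of_real c))"
proof -
  have lin: "bounded_linear a"
    using a unfolding angle_fun_def
    by (auto intro!: bounded_linear_fst_comp bounded_linear_snd_comp bounded_linear_fst bounded_linear_snd
        bounded_linear_compose[OF bounded_linear_vec_nth])
  have cs: "a (cscale b v) = b * a v" for b v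
    using a unfolding angle_fun_def by (cases v) auto
  have re: "a (embed x) \<in> \<real>" for x
    using a unfolding angle_fun_def by (auto simp: embed_eq cvec_def)
  have per: "\<exists>n::int. a (p, q + cvec (period k), I, \<phi> + cvec (period l), t + complex_of_real (2 * pi * of_int m)) =
      a (p, q, I, \<phi>, t) + complex_of_real (2 * pi * of_int n)" for p q I \<phi> t k l m
    using a unfolding angle_fun_def
  proof (elim disjE exE)
    fix i assume "a = (\<lambda>z. fst (snd z) $ i)"
    then show ?thesis by (intro exI[of _ "k i"]) (simp add: cvec_def period_def)
  next
    fix j assume "a = (\<lambda>z. fst (snd (snd (snd z))) $ j)"
    then show ?thesis by (intro exI[of _ "l j"]) (simp add: cvec_def period_def)
  next
    assume "a = (\<lambda>z. snd (snd (snd (snd z))))"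
    then show ?thesis by (intro exI[of _ m]) simp
  qed
  have im: "\<bar>Im (a z)\<bar> < \<kappa>" if "z \<in> Mkappa \<kappa> D B" for z
    using that a unfolding angle_fun_def Mkappa_def by auto
  let ?F = "\<lambda>z. cos (a z + complex_of_real c)"
  show ?thesis
    unfolding trig_fun_def
  proof (intro conjI allI)
    show "cphase_periodic_on UNIV ?F"
      unfolding cphase_periodic_on_def
    proof (intro allI impI)
      fix p q I \<phi> t k l m
      obtain n :: int where n: "a (p, q + cvec (period k), I, \<phi> + cvec (period l), t + complex_of_real (2 * pi * of_int m)) =
        a (p, q, I, \<phi>, t) + complex_of_real (2 * pi * of_int n)" using per by blast
      show "cos (a (p, q + cvec (period k), I, \<phi> + cvec (period l), t + complex_of_real (2 * pi * of_int m)) + complex_of_real c) =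
        cos (a (p, q, I, \<phi>, t) + complex_of_real c)"
        unfolding n using cos_periodic_int[of "a (p, q, I, \<phi>, t) + complex_of_real c" n] by (simp only: add_ac)
    qed
    show "cphase_holomorphic_on UNIV ?F"
      unfolding cphase_holomorphic_on_def
    proof
      fix z
      have "((\<lambda>z. a z + complex_of_real c) has_derivative a) (at z)"
        using has_derivative_add[OF bounded_linear_imp_has_derivative[OF lin] has_derivative_const] by simp
      from has_derivative_compose[OF this DERIV_cos[unfolded has_field_derivative_def]]
      have "(?F has_derivative (\<lambda>v. - sin (a z + complex_of_real c) * a v)) (at z)" .
      then show "\<exists>f'. (?F has_derivative f') (at z) \<and> (\<forall>b v. f' (cscale b v) = b * f' v)"
        by (intro exI[of _ "\<lambda>v. - sin (a z + complex_of_real c) * a v"]) (simp add: cs mult_ac)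
    qed
    show "bounded (?F ` Mkappa \<kappa> D B)"
      unfolding bounded_iff
    proof (intro exI[of _ "exp \<kappa>"] ballI, elim imageE)
      fix w z assume w: "w = ?F z" and z: "z \<in> Mkappa \<kappa> D B"
      \<comment> \<open>In the exponential form of the cosine the two terms have modulus
        \<open>exp\<close> of plus or minus the imaginary part, whence the bound
        \<open>exp \<kappa>\<close>.\<close>
      let ?u = "a z + complex_of_real c"
      have "norm (cos ?u) \<le> (norm (exp (\<i> * ?u)) + norm (exp (- (\<i> * ?u)))) / 2"
        unfolding cos_exp_eq using norm_triangle_ineq[of "exp (\<i> * ?u)" "exp (- (\<i> * ?u))"] by (simp add: norm_divide)
      also have "\<dots> \<le> (exp \<kappa> + exp \<kappa>) / 2"
        using im[OF z] by (intro divide_right_mono add_mono) (auto simp: norm_exp_eq_Re)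
      finally show "norm w \<le> exp \<kappa>" using w by simp
    qed
    show "?F (embed x) \<in> \<real>" for x
      using re[of x] by (auto elim!: Reals_cases simp: cos_of_real simp flip: of_real_add)
  qed
qed

definition cut :: "real \<Rightarrow> (real^'n) set \<Rightarrow> (real^'d) set \<Rightarrow> (('n::finite, 'd::finite) cphase \<Rightarrow> complex) \<Rightarrow> ('n, 'd) cphase \<Rightarrow> complex" where
  "cut \<kappa> D B F z = (if z \<in> Mkappa \<kappa> D B then F z else 0)"

lemma Mkappa_periodic:
  "(p, q, I, \<phi>, t) \<in> Mkappa \<kappa> D B \<Longrightarrow>
   (p, q + cvec (period k), I, \<phi> + cvec (period l), t + complex_of_real (2 * pi * of_int m)) \<in> Mkappa \<kappa> D B"
  by (simp add: Mkappa_def cvec_def)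

lemma cut_Comega:
  assumes "trig_fun \<kappa> D B F"
  shows "cut \<kappa> D B F \<in> Comega \<kappa> D B"
  unfolding Comega_def mem_Collect_eq
proof (intro conjI ballI allI impI)
  show "cphase_periodic_on (Mkappa \<kappa> D B) (cut \<kappa> D B F)"
    unfolding cphase_periodic_on_def
  proof (intro allI impI)
    fix p q I \<phi> t k l m assume z: "(p, q, I, \<phi>, t) \<in> Mkappa \<kappa> D B"
    have "F (p, q + cvec (period k), I, \<phi> + cvec (period l), t + complex_of_real (2 * pi * of_int m)) = F (p, q, I, \<phi>, t)"
      using assms unfolding trig_fun_def cphase_periodic_on_def by blast
    then show "cut \<kappa> D B F (p, q + cvec (period k), I, \<phi> + cvec (period l), t + complex_of_real (2 * pi * of_int m)) = cut \<kappa> D B F (p, q, I, \<phi>, t)"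
      unfolding cut_def by (simp only: z Mkappa_periodic[OF z] if_True)
  qed
  show "cphase_holomorphic_on (Mkappa \<kappa> D B) (cut \<kappa> D B F)"
    unfolding cphase_holomorphic_on_def
  proof
    fix z assume z: "z \<in> Mkappa \<kappa> D B"
    obtain f' where f': "(F has_derivative f') (at z)" "\<forall>c v. f' (cscale c v) = c * f' v"
      using assms unfolding trig_fun_def cphase_holomorphic_on_def by blast
    have "(cut \<kappa> D B F has_derivative f') (at z)"
      by (rule has_derivative_transform_within_open[OF f'(1) open_Mkappa z]) (simp add: cut_def)
    then show "\<exists>f'. (cut \<kappa> D B F has_derivative f') (at z) \<and> (\<forall>c v. f' (cscale c v) = c * f' v)" using f'(2) by blast
  qed
  have "cut \<kappa> D B F ` Mkappa \<kappa> D B = F ` Mkappa \<kappa> D B" by (auto simp: cut_def)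
  then show "bounded (cut \<kappa> D B F ` Mkappa \<kappa> D B)" using assms by (simp add: trig_fun_def)
  show "cut \<kappa> D B F (embed x) \<in> \<real>" for x
    using assms by (simp only: cut_def trig_fun_def split: if_split) simp
qed (simp add: cut_def)

lemma cut_bounded:
  assumes "trig_fun \<kappa> D B F"
  obtains C where "C \<ge> 0" "\<And>z. norm (cut \<kappa> D B F z) \<le> C"
proof -
  obtain b where "\<And>z. z \<in> Mkappa \<kappa> D B \<Longrightarrow> norm (F z) \<le> b"
    using assms unfolding trig_fun_def bounded_iff by blast
  then have "norm (cut \<kappa> D B F z) \<le> \<bar>b\<bar>" for z
    using order_trans[OF \<open>\<And>z. z \<in> Mkappa \<kappa> D B \<Longrightarrow> norm (F z) \<le> b\<close> abs_ge_self] by (simp add: cut_def)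
  then show ?thesis by (intro that[of "\<bar>b\<bar>"]) simp_all
qed

lemma real_part_cut: "0 < \<kappa> \<Longrightarrow> x \<in> Mreal D B \<Longrightarrow> real_part (cut \<kappa> D B F) x = Re (F (embed x))"
  by (simp add: real_part_def cut_def embed_in_Mkappa)

text \<open>The factor \<open>1 - cos z\<close> vanishes at the equilibrium, so the rest point
  contributes nothing and the integral along the orbit converges; the power peaks at
  \<open>c\<close>. The type is left general because the complex version is the perturbation and the
  real one its restriction to an orbit.\<close>

definition bump :: "real \<Rightarrow> nat \<Rightarrow> 'a::{real_normed_field, banach} \<Rightarrow> 'a" where
  "bump c M z = (1 - cos z) * ((1 + cos (z - of_real c)) / 2) ^ M"

lemma trig_fun_bump:
  assumes "angle_fun a"
  shows "trig_fun \<kappa> D B (\<lambda>z. bump c M (a z))"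
proof -
  note k = trig_fun_const[of \<kappa> D B] and cs = trig_fun_cos_angle[OF assms, of \<kappa> D B]
  have 1: "trig_fun \<kappa> D B (\<lambda>z. complex_of_real 1 + complex_of_real (- 1) * cos (a z + complex_of_real 0))"
    by (intro trig_fun_add trig_fun_mult k cs)
  have 2: "trig_fun \<kappa> D B (\<lambda>z. complex_of_real (1/2) * (complex_of_real 1 + cos (a z + complex_of_real (- c))))"
    by (intro trig_fun_add trig_fun_mult k cs)
  from trig_fun_mult[OF 1 trig_fun_power[OF 2, of M]] show ?thesis by (simp add: bump_def)
qed

lemma bump_of_real: "bump c M (complex_of_real x) = complex_of_real (bump c M x)"
  by (simp only: bump_def of_real_eq_id id_apply of_real_mult of_real_power of_real_divide of_real_diff of_real_add
      of_real_1 of_real_numeral cos_of_real[symmetric])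

lemma bump_0: "bump c M 0 = 0" by (simp add: bump_def)

lemma half_one_plus_cos_nonneg: "0 \<le> (1 + cos x) / (2::real)"
proof -
  have "0 \<le> (1 + c) / 2" if "-1 \<le> c" for c :: real using that by simp
  from this[OF cos_ge_minus_one] show ?thesis .
qed

lemma bump_bound: "0 \<le> bump c M (x::real)" "bump c M x \<le> 1 - cos x"
proof -
  have "0 \<le> (1 + cos (x - c)) / 2" by (rule half_one_plus_cos_nonneg)
  moreover have "(1 + cos (x - c)) / 2 \<le> 1" by simp
  ultimately have "0 \<le> ((1 + cos (x - c)) / 2) ^ M" "((1 + cos (x - c)) / 2) ^ M \<le> 1" by (simp_all add: power_le_one)
  then show "0 \<le> bump c M x" "bump c M x \<le> 1 - cos x"
    using mult_left_le[of "((1 + cos (x - c)) / 2) ^ M" "1 - cos x"] by (simp_all add: bump_def)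
qed

lemma one_minus_cos_le:
  fixes x :: real and k :: int
  shows "1 - cos x \<le> \<bar>x - 2 * pi * of_int k\<bar>"
proof -
  have "cos x = cos (x - 2 * pi * of_int k)"
    using cos_int_2pin[of k] sin_int_2pin[of k] by (simp add: cos_diff)
  moreover have "1 - cos y \<le> \<bar>y\<bar>" for y :: real
  proof -
    have "1 - cos y = 2 * (\<bar>sin (y / 2)\<bar> * \<bar>sin (y / 2)\<bar>)" using cos_double_sin[of "y / 2"] by (simp add: power2_eq_square)
    also have "\<dots> \<le> 2 * (\<bar>y / 2\<bar> * 1)" by (intro mult_left_mono mult_mono abs_sin_x_le_abs_x abs_sin_le_one) auto
    finally show ?thesis by simp
  qed
  ultimately show ?thesis by simp
qed

section \<open>Integrals of the bump along an orbit\<close>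

context pendulum_orbit
begin

lemma integrable_one_minus_cos_q: "integrable lborel (\<lambda>u. 1 - cos (q u))"
proof -
  obtain c C k where d: "c > 0" "C \<ge> 0" "\<And>t. \<bar>p t\<bar> \<le> C * exp (- c * \<bar>t\<bar>)"
    "\<And>t. \<bar>q t - 2 * pi * of_int (k t)\<bar> \<le> C * exp (- c * \<bar>t\<bar>)" by (rule decay) blast
  have "(\<lambda>u. 1 - cos (q u)) \<in> fast_weights"
  proof (rule fast_weightsI[OF _ d(1)])
    show "(\<lambda>u. 1 - cos (q u)) \<in> borel_measurable borel"
      by (intro borel_measurable_continuous_onI continuous_intros continuous_on_q)
    show "\<bar>1 - cos (q t)\<bar> \<le> C * exp (- c * \<bar>t\<bar>)" for t
      using order_trans[OF one_minus_cos_le d(4), of t] by simp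
  qed
  then show ?thesis by (rule integrable_fast)
qed

lemma integrable_bump_mult:
  assumes "continuous_on UNIV e" "\<And>u. \<bar>e u\<bar> \<le> 1"
  shows "integrable lborel (\<lambda>u. bump c M (q u) * e u)"
proof (rule Bochner_Integration.integrable_bound[OF integrable_one_minus_cos_q])
  have "(\<lambda>u. bump c M (q u) * e u) \<in> borel_measurable borel"
    unfolding bump_def of_real_eq_id id_apply
    by (intro borel_measurable_continuous_onI continuous_intros continuous_on_q assms) auto
  then show "(\<lambda>u. bump c M (q u) * e u) \<in> borel_measurable lborel" by simp
  show "AE u in lborel. norm (bump c M (q u) * e u) \<le> norm (1 - cos (q u))"
  proof (rule AE_I2)
    fix u
    have "\<bar>bump c M (q u)\<bar> * \<bar>e u\<bar> \<le> (1 - cos (q u)) * 1"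
      using bump_bound[of c M "q u"] assms(2)[of u] by (intro mult_mono) auto
    then show "norm (bump c M (q u) * e u) \<le> norm (1 - cos (q u))" by (simp add: abs_mult)
  qed
qed

text \<open>As \<open>M\<close> grows, \<open>bump (q 0) M \<circ> q\<close> concentrates at time \<open>0\<close>, since the orbit passes
  \<open>q 0\<close> modulo \<open>2\<pi>\<close> only once.\<close>
lemma bump_cos_integral_pos:
  obtains M where "0 < (\<integral>u. bump (q 0) M (q u) * cos (\<nu> * u) \<partial>lborel)"
proof -
  \<comment> \<open>For times up to \<delta> the phase \<open>\<nu> * u\<close> is at most 1 in
    modulus, hence below \<open>pi / 3\<close>, and its cosine is at least 1/2.\<close>
  define \<delta> where "\<delta> = 1 / (\<bar>\<nu>\<bar> + 1)"
  have \<delta>: "\<delta> > 0" by (simp add: \<delta>_def)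
  have cosge: "cos (\<nu> * u) \<ge> 1 / 2" if "\<bar>u\<bar> \<le> \<delta>" for u
  proof -
    have "\<bar>\<nu> * u\<bar> \<le> \<bar>\<nu>\<bar> * \<delta>" unfolding abs_mult using that by (intro mult_left_mono) auto
    also have "\<dots> \<le> 1" by (simp add: \<delta>_def field_simps)
    also have "\<dots> \<le> pi / 3" using pi_gt3 by simp
    finally have "cos (pi / 3) \<le> cos \<bar>\<nu> * u\<bar>" using pi_gt3 by (intro cos_monotone_0_pi_le) auto
    then show ?thesis by (simp add: cos_60)
  qed
  \<comment> \<open>Outside the time interval, \<open>m\<close> separates \<open>q u\<close> from
    \<open>q 0\<close> modulo \<open>2 * pi\<close>: monotonicity gives the lower bound, and
    \<open>q_range\<close>, applied to \<open>u\<close> and the opposite end of the interval, the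
    upper one.\<close>
  define m where "m = min \<bar>q \<delta> - q 0\<bar> \<bar>q 0 - q (- \<delta>)\<bar>"
  have gap: "m > 0 \<and> (\<forall>u. \<bar>u\<bar> \<ge> \<delta> \<longrightarrow> m \<le> \<bar>q u - q 0\<bar> \<and> \<bar>q u - q 0\<bar> \<le> 2 * pi - m)"
  proof -
    obtain e where e: "\<bar>e\<bar> = 1" "\<And>s t. s < t \<Longrightarrow> e * q s < e * q t"
      using q_strict_mono that[of 1] that[of "-1"] by auto
    define Q where "Q = (\<lambda>t. e * q t)"
    have dist: "\<bar>q s - q t\<bar> = \<bar>Q s - Q t\<bar>" for s t
      using e(1) unfolding Q_def by (simp flip: right_diff_distrib add: abs_mult)
    have le: "Q s \<le> Q t" if "s \<le> t" for s t using e(2)[of s t] that by (cases "s = t") (auto simp: Q_def)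
    have b: "Q (- \<delta>) < Q 0" "Q 0 < Q \<delta>" using e(2) \<delta> by (auto simp: Q_def)
    have "m \<le> \<bar>q u - q 0\<bar> \<and> \<bar>q u - q 0\<bar> \<le> 2 * pi - m" if "\<bar>u\<bar> \<ge> \<delta>" for u
    proof (cases "u \<ge> 0")
      case True
      then have "Q \<delta> \<le> Q u" using that by (intro le) simp
      moreover have "\<bar>Q u - Q (- \<delta>)\<bar> < 2 * pi" unfolding dist[symmetric] by (rule q_range)
      ultimately show ?thesis unfolding dist m_def using b by (auto simp: min_def abs_if split: if_splits)
    next
      case False
      then have "Q u \<le> Q (- \<delta>)" using that by (intro le) simp
      moreover have "\<bar>Q u - Q \<delta>\<bar> < 2 * pi" unfolding dist[symmetric] by (rule q_range)
      ultimately show ?thesis unfolding dist m_def using b by (auto simp: min_def abs_if split: if_splits)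
    qed
    then show ?thesis using b by (simp add: m_def dist)
  qed
  have m: "0 < m" "m \<le> pi" using gap[THEN conjunct1] gap[THEN conjunct2, rule_format, of \<delta>] \<delta> by auto
  let ?\<rho> = "\<lambda>u. (1 + cos (q u - q 0)) / 2" and ?f = "\<lambda>u. 1 - cos (q u)"
  define \<rho>2 where "\<rho>2 = (1 + cos m) / 2"
  have \<rho>2: "0 \<le> \<rho>2" unfolding \<rho>2_def by (rule half_one_plus_cos_nonneg)
  have \<rho>2': "\<rho>2 < 1" using cos_monotone_0_pi[of 0 m] m by (simp add: \<rho>2_def)
  have far: "?\<rho> u \<le> \<rho>2" if "\<bar>u\<bar> \<ge> \<delta>" for u
  proof -
    let ?y = "\<bar>q u - q 0\<bar>"
    have y: "m \<le> ?y" "?y \<le> 2 * pi - m" using gap that by auto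
    have "cos ?y \<le> cos m"
    proof (cases "?y \<le> pi")
      case True then show ?thesis using y m by (intro cos_monotone_0_pi_le) auto
    next
      case False
      then have "cos (2 * pi - ?y) \<le> cos m" using y m by (intro cos_monotone_0_pi_le) auto
      then show ?thesis by (simp add: cos_diff)
    qed
    then show ?thesis by (simp add: \<rho>2_def)
  qed
  \<comment> \<open>A threshold strictly between the far bound \<open>\<rho>2\<close> and the value
    1 attained at time 0, so that the powers of the near part win.\<close>
  define \<rho>1 where "\<rho>1 = (1 + \<rho>2) / 2"
  have \<rho>1: "\<rho>2 < \<rho>1" "\<rho>1 < 1" "0 < \<rho>1" using \<rho>2 \<rho>2' by (auto simp: \<rho>1_def)
  have f0: "?f 0 > 0"
  proof -
    have "cos (q 0) \<noteq> 1"
    proof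
      assume "cos (q 0) = 1"
      then obtain k :: int where "q 0 = of_int k * 2 * pi" unfolding cos_one_2pi_int by blast
      then show False using q_ne[of 0 k] by (simp add: mult_ac)
    qed
    then have "cos (q 0) < 1" using order_neq_le_trans[OF _ cos_le_one] by blast
    then show ?thesis by simp
  qed
  have ev: "eventually (\<lambda>u. ?\<rho> u > \<rho>1 \<and> ?f u > ?f 0 / 2) (at 0)"
  proof (intro eventually_conj)
    have "isCont ?\<rho> 0" "isCont ?f 0" by (intro continuous_intros continuous_q; simp)+
    then have lim: "(?\<rho> \<longlongrightarrow> ?\<rho> 0) (at 0)" "(?f \<longlongrightarrow> ?f 0) (at 0)" unfolding isCont_def by blast+
    have lt: "\<rho>1 < ?\<rho> 0" "?f 0 / 2 < ?f 0" using \<rho>1 f0 by auto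
    show "eventually (\<lambda>u. ?\<rho> u > \<rho>1) (at 0)" "eventually (\<lambda>u. ?f u > ?f 0 / 2) (at 0)"
      by (rule order_tendstoD(1)[OF lim(1) lt(1)] order_tendstoD(1)[OF lim(2) lt(2)])+
  qed
  then obtain s where s: "s > 0" "\<And>u. u \<noteq> 0 \<Longrightarrow> dist u 0 < s \<Longrightarrow> ?\<rho> u > \<rho>1 \<and> ?f u > ?f 0 / 2"
    unfolding eventually_at by blast
  define \<eta> where "\<eta> = min (s / 2) \<delta>"
  have \<eta>: "\<eta> > 0" "\<eta> \<le> \<delta>" "\<eta> < s" using s \<delta> by (auto simp: \<eta>_def)
  have near: "?\<rho> u \<ge> \<rho>1" "?f u \<ge> ?f 0 / 2" if "\<bar>u\<bar> \<le> \<eta>" for u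
    using s(2)[of u] that \<eta>(3) \<rho>1 f0 by (cases "u = 0"; simp)+
  let ?F = "\<integral>u. ?f u \<partial>lborel"
  \<comment> \<open>Near 0 both bump and cosine are bounded below, in the middle zone the integrand
    is nonnegative, and far away it is at least minus the bump.\<close>
  have ptw: "\<rho>1 ^ M * (?f 0 / 4) * indicator {- \<eta>..\<eta>} u - \<rho>2 ^ M * ?f u \<le> bump (q 0) M (q u) * cos (\<nu> * u)" for M u
  proof -
    have pos: "0 \<le> \<rho>2 ^ M * ?f u" using \<rho>2 cos_le_one[of "q u"] by simp
    have b: "0 \<le> bump (q 0) M (q u)" by (rule bump_bound)
    consider "\<bar>u\<bar> \<le> \<eta>" | "\<eta> < \<bar>u\<bar>" "\<bar>u\<bar> < \<delta>" | "\<eta> < \<bar>u\<bar>" "\<delta> \<le> \<bar>u\<bar>" by linarith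
    then show ?thesis
    proof cases
      case 1
      have "(?f 0 / 2 * \<rho>1 ^ M) * (1 / 2) \<le> bump (q 0) M (q u) * cos (\<nu> * u)"
        unfolding bump_def of_real_eq_id id_apply using near[OF 1] \<rho>1(3) f0 1 \<eta>(2)
        by (intro mult_mono power_mono cosge mult_nonneg_nonneg zero_le_power) auto
      moreover have "indicator {- \<eta>..\<eta>} u = (1::real)" using 1 by (auto simp: indicator_def)
      ultimately show ?thesis using pos by (simp add: mult_ac)
    next
      case 2
      then have "0 \<le> bump (q 0) M (q u) * cos (\<nu> * u)" using cosge[of u] by (intro mult_nonneg_nonneg b) simp
      moreover have "indicator {- \<eta>..\<eta>} u = (0::real)" using 2 by (auto simp: indicator_def)
      ultimately show ?thesis using pos by simp
    next
      case 3
      have "bump (q 0) M (q u) \<le> ?f u * \<rho>2 ^ M"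
        unfolding bump_def of_real_eq_id id_apply by (intro mult_left_mono power_mono far 3(2) half_one_plus_cos_nonneg) simp
      moreover have "- bump (q 0) M (q u) \<le> bump (q 0) M (q u) * cos (\<nu> * u)"
        using mult_left_mono[OF cos_ge_minus_one b, of "\<nu> * u"] by simp
      moreover have "indicator {- \<eta>..\<eta>} u = (0::real)" using 3(1) by (auto simp: indicator_def)
      ultimately show ?thesis by (simp add: mult_ac)
    qed
  qed
  have low: "\<rho>1 ^ M * (?f 0 / 4) * (2 * \<eta>) - \<rho>2 ^ M * ?F \<le> (\<integral>u. bump (q 0) M (q u) * cos (\<nu> * u) \<partial>lborel)" for M
  proof -
    have i1: "integrable lborel (\<lambda>u. \<rho>1 ^ M * (?f 0 / 4) * indicator {- \<eta>..\<eta>} u)"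
      by (intro integrable_mult_right integrable_real_indicator) (use \<eta>(1) in simp_all)
    have i2: "integrable lborel (\<lambda>u. \<rho>2 ^ M * ?f u)" by (rule integrable_mult_right[OF integrable_one_minus_cos_q])
    have "(\<integral>u. \<rho>1 ^ M * (?f 0 / 4) * indicator {- \<eta>..\<eta>} u - \<rho>2 ^ M * ?f u \<partial>lborel) \<le> (\<integral>u. bump (q 0) M (q u) * cos (\<nu> * u) \<partial>lborel)"
      by (rule integral_mono[OF Bochner_Integration.integrable_diff[OF i1 i2] integrable_bump_mult ptw]) (auto intro!: continuous_intros)
    moreover have "(\<integral>u. \<rho>1 ^ M * (?f 0 / 4) * indicator {- \<eta>..\<eta>} u \<partial>lborel) = \<rho>1 ^ M * (?f 0 / 4) * (2 * \<eta>)"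
      using \<eta>(1) by (subst integral_mult_right_zero) simp
    moreover have "(\<integral>u. \<rho>2 ^ M * ?f u \<partial>lborel) = \<rho>2 ^ M * ?F" by (rule integral_mult_right_zero)
    ultimately show ?thesis unfolding Bochner_Integration.integral_diff[OF i1 i2] by linarith
  qed
  \<comment> \<open>Relative to \<open>\<rho>1 ^ M\<close>, the far contribution decays
    geometrically while the near one stays fixed.\<close>
  have "(\<lambda>M. (\<rho>2 / \<rho>1) ^ M * ?F) \<longlonglongrightarrow> 0 * ?F"
    using \<rho>1 \<rho>2 by (intro tendsto_mult LIMSEQ_power_zero tendsto_const) simp
  moreover have "0 * ?F < (?f 0 / 4) * (2 * \<eta>)" using f0 \<eta>(1) by simp
  ultimately have "eventually (\<lambda>M. (\<rho>2 / \<rho>1) ^ M * ?F < (?f 0 / 4) * (2 * \<eta>)) sequentially" by (rule order_tendstoD)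
  then obtain M where M: "(\<rho>2 / \<rho>1) ^ M * ?F < (?f 0 / 4) * (2 * \<eta>)" by (auto simp: eventually_sequentially)
  have "\<rho>1 ^ M > 0" using \<rho>1 by simp
  moreover have "\<rho>1 ^ M * ((\<rho>2 / \<rho>1) ^ M * ?F) = \<rho>2 ^ M * ?F" using \<rho>1 by (simp add: power_divide)
  ultimately have "\<rho>2 ^ M * ?F < \<rho>1 ^ M * (?f 0 / 4) * (2 * \<eta>)"
    using mult_strict_left_mono[OF M, of "\<rho>1 ^ M"] by (simp only: mult.assoc)
  then show ?thesis using low[of M] by (intro that[of M]) linarith
qed

end

text \<open>The determinant is a polynomial in the shift. It is not the zero polynomial, because a
  shift beyond a bound for the norm of \<open>A\<close> gives an injective matrix; its finitely many
  roots leave arbitrarily small admissible shifts.\<close>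

lemma exists_small_shift_det_nz:
  fixes A :: "real^'n^'n"
  assumes "\<delta> > 0"
  shows "\<exists>x>0. x < \<delta> \<and> det (A + (\<chi> i j. if i = j then x else 0)) \<noteq> 0"
proof -
  define p where "p = (\<Sum>\<pi>\<in>{\<pi>. \<pi> permutes (UNIV :: 'n set)}. [:of_int (sign \<pi>):] * (\<Prod>i\<in>UNIV. [:A $ i $ \<pi> i:] + (if i = \<pi> i then [:0, 1:] else 0)))"
  have p: "poly p x = det (A + (\<chi> i j. if i = j then x else 0))" for x
    unfolding p_def det_def by (simp add: poly_sum poly_prod if_distrib[of "\<lambda>q. poly q x"] cong: if_cong)
  obtain b where b: "\<And>i j. \<bar>A $ i $ j\<bar> \<le> b"
  proof -
    have "\<bar>A $ i $ j\<bar> \<le> norm A" for i j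
      using component_le_norm_cart[of "A $ i" j] Finite_Cartesian_Product.norm_nth_le[of A i] by linarith
    then show thesis by (rule that)
  qed
  define K where "K = real CARD('n) * real CARD('n) * b"
  have b0: "0 \<le> b" using b[of undefined undefined] by linarith
  have "det (A + (\<chi> i j. if i = j then K + 1 else 0)) \<noteq> 0"
  proof (rule inj_matrix_det_nz)
    fix v :: "real^'n"
    assume "(A + (\<chi> i j. if i = j then K + 1 else 0)) *v v = 0"
    moreover have "(\<chi> i j. if i = j then K + 1 else 0) *v v = (K + 1) *\<^sub>R v"
      by (simp add: matrix_vector_mult_def vec_eq_iff if_distrib[of "\<lambda>c. c * _"] cong: if_cong)
    ultimately have "(K + 1) *\<^sub>R v = - (A *v v)" by (simp add: matrix_vector_mult_add_rdistrib add_eq_0_iff)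
    then have "norm ((K + 1) *\<^sub>R v) = norm (A *v v)" by simp
    also have "\<dots> \<le> K * norm v" unfolding K_def by (rule norm_matrix_vector_le[OF b])
    finally have "(K + 1) * norm v \<le> K * norm v" using b0 by (simp add: K_def)
    then show "v = 0" by (simp add: algebra_simps)
  qed
  then have "p \<noteq> 0" using p[of "K + 1"] by auto
  then have "finite {x. poly p x = 0}" by (rule poly_roots_finite)
  then have "\<not> {0<..<\<delta>} \<subseteq> {x. poly p x = 0}" using assms infinite_Ioo finite_subset by blast
  then show ?thesis using p by auto
qed

section \<open>Perturbations with prescribed potentials\<close>

context melnikov
begin

text \<open>Shifting time by \<open>\<tau> $ i\<close> centres the bump and turns the angle into
  \<open>A \<theta> - \<nu> * \<tau> $ i + \<nu> * u\<close>. The addition theorems leave a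
  combination of cosine and sine whose coefficients are built from the moments \<alpha> and \<beta>.
  Since \<alpha> > 0, every combination is reached, with a perturbation bounded linearly by its
  amplitudes.\<close>

lemma bump_pot:
  assumes I: "I \<in> B" and \<kappa>: "0 < \<kappa>" and a: "angle_fun a"
    and along: "\<And>t \<tau> \<theta>. a (embed (orbit_pt t (\<tau>, I, \<theta>))) = complex_of_real (A \<theta> + \<nu> * t)"
  shows "\<exists>C\<ge>0. \<forall>X Y. \<exists>P\<in>Comega \<kappa> D B. (\<forall>z. norm (P z) \<le> C * (\<bar>X\<bar> + \<bar>Y\<bar>)) \<and>
    (\<forall>\<tau> \<theta>. pot (real_part P) (\<tau>, I, \<theta>) = X * cos (A \<theta> - \<nu> * \<tau> $ i) + Y * sin (A \<theta> - \<nu> * \<tau> $ i))"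
proof -
  interpret pendulum_orbit r "V i" "\<sigma> i" "p0 i" "q0 i" by (rule orb)
  obtain M where M: "0 < (\<integral>u. bump (q0 i 0) M (q0 i u) * cos (\<nu> * u) \<partial>lborel)" by (rule bump_cos_integral_pos)
  let ?\<psi> = "bump (q0 i 0) M :: real \<Rightarrow> real"
  define \<alpha> where "\<alpha> = (\<integral>u. ?\<psi> (q0 i u) * cos (\<nu> * u) \<partial>lborel)"
  define \<beta> where "\<beta> = (\<integral>u. ?\<psi> (q0 i u) * sin (\<nu> * u) \<partial>lborel)"
  define n where "n = \<alpha>\<^sup>2 + \<beta>\<^sup>2"
  have n: "n > 0" using M unfolding n_def \<alpha>_def by (intro add_pos_nonneg) auto
  have int: "integrable lborel (\<lambda>u. ?\<psi> (q0 i u) * cos (\<nu> * u))" "integrable lborel (\<lambda>u. ?\<psi> (q0 i u) * sin (\<nu> * u))"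
    by (rule integrable_bump_mult; auto intro!: continuous_intros)+
  let ?Q = "\<lambda>z :: ('n, 'd) cphase. fst (snd z) $ i"
  have aq: "angle_fun ?Q" by (auto simp: angle_fun_def)
  \<comment> \<open>Phase shifts 0 and \<open>- (pi / 2)\<close> produce the cosine and the sine of
    the angle.\<close>
  define F1 where "F1 z = bump (q0 i 0) M (?Q z) * cos (a z + complex_of_real 0)" for z
  define F2 where "F2 z = bump (q0 i 0) M (?Q z) * cos (a z + complex_of_real (- (pi / 2)))" for z
  have F: "trig_fun \<kappa> D B F1" "trig_fun \<kappa> D B F2"
    unfolding F1_def[abs_def] F2_def[abs_def] by (intro trig_fun_mult trig_fun_bump aq trig_fun_cos_angle a)+
  obtain C1 where C1: "C1 \<ge> 0" "\<And>z. norm (cut \<kappa> D B F1 z) \<le> C1" by (rule cut_bounded[OF F(1)]) blast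
  obtain C2 where C2: "C2 \<ge> 0" "\<And>z. norm (cut \<kappa> D B F2 z) \<le> C2" by (rule cut_bounded[OF F(2)]) blast
  define c where "c = (\<bar>\<alpha>\<bar> + \<bar>\<beta>\<bar>) / n"
  have c: "c \<ge> 0" using n by (simp add: c_def)
  show ?thesis
  proof (intro exI[of _ "(C1 + C2) * c"] conjI allI)
    show "0 \<le> (C1 + C2) * c" using C1(1) C2(1) c by simp
    fix X Y :: real
    \<comment> \<open>The solution of the two linear equations \<open>XY\<close>, whose determinant
      is \<open>n\<close>; the sign comes from the minus in front of the integral in
      \<open>pot\<close>.\<close>
    define x where "x = (\<beta> * Y - \<alpha> * X) / n"
    define y where "y = (- \<beta> * X - \<alpha> * Y) / n"
    have XY: "- \<alpha> * x - \<beta> * y = X" "\<beta> * x - \<alpha> * y = Y"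
    proof -
      have xn: "x * n = \<beta> * Y - \<alpha> * X" "y * n = - \<beta> * X - \<alpha> * Y" using n by (simp_all add: x_def y_def)
      have "(- \<alpha> * x - \<beta> * y) * n = - \<alpha> * (x * n) - \<beta> * (y * n)" "(\<beta> * x - \<alpha> * y) * n = \<beta> * (x * n) - \<alpha> * (y * n)"
        by (simp_all add: algebra_simps)
      then have "(- \<alpha> * x - \<beta> * y) * n = X * n" "(\<beta> * x - \<alpha> * y) * n = Y * n"
        unfolding xn by (simp_all add: n_def algebra_simps power2_eq_square)
      then show "- \<alpha> * x - \<beta> * y = X" "\<beta> * x - \<alpha> * y = Y" using n by simp_all
    qed
    have xy: "\<bar>x\<bar> \<le> c * (\<bar>X\<bar> + \<bar>Y\<bar>)" "\<bar>y\<bar> \<le> c * (\<bar>X\<bar> + \<bar>Y\<bar>)"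
    proof -
      have "\<bar>\<beta> * Y - \<alpha> * X\<bar> \<le> (\<bar>\<alpha>\<bar> + \<bar>\<beta>\<bar>) * (\<bar>X\<bar> + \<bar>Y\<bar>)" "\<bar>- \<beta> * X - \<alpha> * Y\<bar> \<le> (\<bar>\<alpha>\<bar> + \<bar>\<beta>\<bar>) * (\<bar>X\<bar> + \<bar>Y\<bar>)"
        using abs_triangle_ineq4[of "\<beta> * Y" "\<alpha> * X"] abs_triangle_ineq4[of "- \<beta> * X" "\<alpha> * Y"]
          mult_nonneg_nonneg[OF abs_ge_zero abs_ge_zero, of \<alpha> Y] mult_nonneg_nonneg[OF abs_ge_zero abs_ge_zero, of \<alpha> X]
          mult_nonneg_nonneg[OF abs_ge_zero abs_ge_zero, of \<beta> X] mult_nonneg_nonneg[OF abs_ge_zero abs_ge_zero, of \<beta> Y]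
        unfolding ring_distribs abs_mult abs_minus_cancel by linarith+
      then show "\<bar>x\<bar> \<le> c * (\<bar>X\<bar> + \<bar>Y\<bar>)" "\<bar>y\<bar> \<le> c * (\<bar>X\<bar> + \<bar>Y\<bar>)"
        using n unfolding x_def y_def c_def abs_divide times_divide_eq_left by (simp_all add: divide_right_mono)
    qed
    let ?F = "\<lambda>z. complex_of_real x * F1 z + complex_of_real y * F2 z"
    let ?P = "cut \<kappa> D B ?F"
    have tF: "trig_fun \<kappa> D B ?F" by (intro trig_fun_add trig_fun_mult trig_fun_const F)
    show "\<exists>P\<in>Comega \<kappa> D B. (\<forall>z. norm (P z) \<le> (C1 + C2) * c * (\<bar>X\<bar> + \<bar>Y\<bar>)) \<and>
      (\<forall>\<tau> \<theta>. pot (real_part P) (\<tau>, I, \<theta>) = X * cos (A \<theta> - \<nu> * \<tau> $ i) + Y * sin (A \<theta> - \<nu> * \<tau> $ i))"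
    proof (intro bexI[of _ ?P] conjI allI)
      show "?P \<in> Comega \<kappa> D B" by (rule cut_Comega[OF tF])
      fix z
      have "norm (?P z) \<le> \<bar>x\<bar> * norm (cut \<kappa> D B F1 z) + \<bar>y\<bar> * norm (cut \<kappa> D B F2 z)"
        using norm_triangle_ineq[of "complex_of_real x * F1 z" "complex_of_real y * F2 z"] by (simp add: cut_def norm_mult)
      also have "\<dots> \<le> (c * (\<bar>X\<bar> + \<bar>Y\<bar>)) * C1 + (c * (\<bar>X\<bar> + \<bar>Y\<bar>)) * C2"
        using c by (intro add_mono mult_mono xy C1 C2 mult_nonneg_nonneg) auto
      finally show "norm (?P z) \<le> (C1 + C2) * c * (\<bar>X\<bar> + \<bar>Y\<bar>)" by (simp add: algebra_simps)
    next
      fix \<tau> \<theta>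
      have W: "(\<tau>, I, \<theta>) \<in> W" using I by (simp add: W_def)
      let ?y = "A \<theta> - \<nu> * \<tau> $ i"
      let ?f = "\<lambda>t. ?\<psi> (q0 i (\<tau> $ i + t)) * (x * cos (A \<theta> + \<nu> * t) + y * sin (A \<theta> + \<nu> * t))"
      have o: "real_part ?P (orbit_pt t (\<tau>, I, \<theta>)) = ?f t" for t
      proof -
        have "?Q (embed (orbit_pt t (\<tau>, I, \<theta>))) = complex_of_real (q0 i (\<tau> $ i + t))"
          by (simp add: embed_eq orbit_pt_def cvec_def orbit_at_def)
        then have "?F (embed (orbit_pt t (\<tau>, I, \<theta>))) = complex_of_real (x * (?\<psi> (q0 i (\<tau> $ i + t)) * cos (A \<theta> + \<nu> * t + 0)) +
          y * (?\<psi> (q0 i (\<tau> $ i + t)) * cos (A \<theta> + \<nu> * t + - (pi / 2))))"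
          unfolding F1_def F2_def along by (simp only: bump_of_real of_real_add[symmetric] cos_of_real of_real_mult[symmetric])
        moreover have "cos (A \<theta> + \<nu> * t + - (pi / 2)) = sin (A \<theta> + \<nu> * t)" unfolding cos_add by simp
        ultimately show ?thesis
          unfolding real_part_cut[OF \<kappa> orbit_pt_in[OF W]] by (simp add: algebra_simps)
      qed
      have rest: "real_part ?P (rest_pt t (\<tau>, I, \<theta>)) = 0" for t
      proof -
        have "?Q (embed (rest_pt t (\<tau>, I, \<theta>))) = 0" by (simp add: embed_eq rest_pt_def cvec_def)
        then show ?thesis
          unfolding real_part_cut[OF \<kappa> rest_pt_in[OF W]] F1_def F2_def by (simp add: bump_0)
      qed
      have "(\<integral>t. ?f t \<partial>lborel) = (\<integral>u. ?f (- \<tau> $ i + 1 * u) \<partial>lborel)"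
        using lborel_integral_real_affine[of 1 ?f "- \<tau> $ i"] by simp
      also have "\<dots> = (\<integral>u. (x * cos ?y + y * sin ?y) * (?\<psi> (q0 i u) * cos (\<nu> * u)) + (y * cos ?y - x * sin ?y) * (?\<psi> (q0 i u) * sin (\<nu> * u)) \<partial>lborel)"
      proof (rule Bochner_Integration.integral_cong[OF refl])
        fix u
        have e: "A \<theta> + \<nu> * (- \<tau> $ i + 1 * u) = ?y + \<nu> * u" "\<tau> $ i + (- \<tau> $ i + 1 * u) = u" by (simp_all add: algebra_simps)
        show "?f (- \<tau> $ i + 1 * u) = (x * cos ?y + y * sin ?y) * (?\<psi> (q0 i u) * cos (\<nu> * u)) + (y * cos ?y - x * sin ?y) * (?\<psi> (q0 i u) * sin (\<nu> * u))"
          unfolding e cos_add sin_add by (simp add: algebra_simps)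
      qed
      also have "\<dots> = (x * cos ?y + y * sin ?y) * \<alpha> + (y * cos ?y - x * sin ?y) * \<beta>"
        unfolding \<alpha>_def \<beta>_def
        by (subst Bochner_Integration.integral_add[OF integrable_mult_right[OF int(1)] integrable_mult_right[OF int(2)]])
          (simp only: integral_mult_right_zero)
      finally have "pot (real_part ?P) (\<tau>, I, \<theta>) = - ((x * cos ?y + y * sin ?y) * \<alpha> + (y * cos ?y - x * sin ?y) * \<beta>)"
        unfolding pot_def by (simp add: o rest)
      also have "\<dots> = (- \<alpha> * x - \<beta> * y) * cos ?y + (\<beta> * x - \<alpha> * y) * sin ?y" by (simp add: algebra_simps)
      finally show "pot (real_part ?P) (\<tau>, I, \<theta>) = X * cos ?y + Y * sin ?y" unfolding XY .
    qed
  qed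
qed

text \<open>The explicit time serves as the angle, with \<open>A = 0\<close> and \<nu> = 1, and one
  bump is taken for each pendulum.\<close>

lemma torque_pot:
  assumes I: "I \<in> B" and \<kappa>: "0 < \<kappa>"
  shows "\<exists>C\<ge>0. \<forall>X Y. \<exists>P\<in>Comega \<kappa> D B. (\<forall>z. norm (P z) \<le> C * (\<Sum>i\<in>UNIV. \<bar>X i\<bar> + \<bar>Y i\<bar>)) \<and>
    (\<forall>\<tau> \<theta>. pot (real_part P) (\<tau>, I, \<theta>) = (\<Sum>i\<in>UNIV. X i * cos (\<tau> $ i) + Y i * sin (\<tau> $ i)))"
proof -
  let ?a = "\<lambda>z :: ('n, 'd) cphase. snd (snd (snd (snd z)))"
  have a: "angle_fun ?a" by (auto simp: angle_fun_def)
  have along: "?a (embed (orbit_pt t (\<tau>, I, \<theta>))) = complex_of_real ((\<lambda>\<theta>. 0) \<theta> + 1 * t)" for t \<tau> \<theta>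
    by (simp add: embed_eq orbit_pt_def)
  have "\<forall>i. \<exists>C. C \<ge> 0 \<and> (\<forall>X Y. \<exists>P\<in>Comega \<kappa> D B. (\<forall>z. norm (P z) \<le> C * (\<bar>X\<bar> + \<bar>Y\<bar>)) \<and>
    (\<forall>\<tau> \<theta>. pot (real_part P) (\<tau>, I, \<theta>) = X * cos (0 - 1 * \<tau> $ i) + Y * sin (0 - 1 * \<tau> $ i)))"
    by (intro allI bump_pot[OF I \<kappa> a along])
  from choice[OF this] obtain C where C: "\<And>i. C i \<ge> 0" and ex: "\<And>i. \<forall>X Y. \<exists>P\<in>Comega \<kappa> D B. (\<forall>z. norm (P z) \<le> C i * (\<bar>X\<bar> + \<bar>Y\<bar>)) \<and>
    (\<forall>\<tau> \<theta>. pot (real_part P) (\<tau>, I, \<theta>) = X * cos (0 - 1 * \<tau> $ i) + Y * sin (0 - 1 * \<tau> $ i))" by blast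
  show ?thesis
  proof (intro exI[of _ "\<Sum>i\<in>UNIV. C i"] conjI allI)
    show "0 \<le> (\<Sum>i\<in>UNIV. C i)" using C by (simp add: sum_nonneg)
    fix X Y :: "'n \<Rightarrow> real"
    \<comment> \<open>The sign of \<open>Y i\<close> is reversed because the sine is taken at
      \<open>- \<tau> $ i\<close>.\<close>
    have "\<exists>P. P \<in> Comega \<kappa> D B \<and> (\<forall>z. norm (P z) \<le> C i * (\<bar>X i\<bar> + \<bar>Y i\<bar>)) \<and>
      (\<forall>\<tau> \<theta>. pot (real_part P) (\<tau>, I, \<theta>) = X i * cos (\<tau> $ i) + Y i * sin (\<tau> $ i))" for i
      using ex[of i, THEN spec, THEN spec, of "X i" "- Y i"] by auto
    then have "\<forall>i. \<exists>P. P \<in> Comega \<kappa> D B \<and> (\<forall>z. norm (P z) \<le> C i * (\<bar>X i\<bar> + \<bar>Y i\<bar>)) \<and>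
      (\<forall>\<tau> \<theta>. pot (real_part P) (\<tau>, I, \<theta>) = X i * cos (\<tau> $ i) + Y i * sin (\<tau> $ i))" by (rule allI)
    from choice[OF this] obtain P where P: "\<And>i. P i \<in> Comega \<kappa> D B" "\<And>i z. norm (P i z) \<le> C i * (\<bar>X i\<bar> + \<bar>Y i\<bar>)"
      "\<And>i \<tau> \<theta>. pot (real_part (P i)) (\<tau>, I, \<theta>) = X i * cos (\<tau> $ i) + Y i * sin (\<tau> $ i)" by blast
    have sum: "(\<lambda>z. \<Sum>i\<in>S. P i z) \<in> Comega \<kappa> D B \<and>
      (\<forall>\<tau> \<theta>. pot (real_part (\<lambda>z. \<Sum>i\<in>S. P i z)) (\<tau>, I, \<theta>) = (\<Sum>i\<in>S. X i * cos (\<tau> $ i) + Y i * sin (\<tau> $ i)))"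
      if "finite S" "S \<noteq> {}" for S using that
    proof (induction rule: finite_ne_induct)
      case (singleton i) then show ?case using P by simp
    next
      case (insert i S)
      let ?R = "\<lambda>z. \<Sum>i\<in>S. P i z"
      have RC: "?R \<in> Comega \<kappa> D B" using insert.IH by blast
      have e: "(\<lambda>z. \<Sum>i\<in>insert i S. P i z) = (\<lambda>z. P i z + ?R z)" using insert.hyps by simp
      have re: "real_part (\<lambda>z. P i z + ?R z) = (\<lambda>x. real_part (P i) x + real_part ?R x)" by (simp add: real_part_def fun_eq_iff)
      have "pot (real_part (\<lambda>z. P i z + ?R z)) (\<tau>, I, \<theta>) = pot (real_part (P i)) (\<tau>, I, \<theta>) + pot (real_part ?R) (\<tau>, I, \<theta>)" for \<tau> \<theta>
        unfolding re by (rule pot_add[OF nice_real_part[OF D(1) B(1) P(1) \<kappa>] nice_real_part[OF D(1) B(1) RC \<kappa>] I])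
      then show ?case unfolding e using Comega_add[OF P(1) RC] insert by (simp add: P(3))
    qed
    show "\<exists>P\<in>Comega \<kappa> D B. (\<forall>z. norm (P z) \<le> (\<Sum>i\<in>UNIV. C i) * (\<Sum>i\<in>UNIV. \<bar>X i\<bar> + \<bar>Y i\<bar>)) \<and>
      (\<forall>\<tau> \<theta>. pot (real_part P) (\<tau>, I, \<theta>) = (\<Sum>i\<in>UNIV. X i * cos (\<tau> $ i) + Y i * sin (\<tau> $ i)))"
    proof (intro bexI[of _ "\<lambda>z. \<Sum>i\<in>UNIV. P i z"] conjI allI)
      fix z
      have "norm (\<Sum>i\<in>UNIV. P i z) \<le> (\<Sum>i\<in>UNIV. C i * (\<bar>X i\<bar> + \<bar>Y i\<bar>))" by (rule sum_norm_le[OF P(2)])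
      also have "\<dots> \<le> (\<Sum>i\<in>UNIV. (\<Sum>i\<in>UNIV. C i) * (\<bar>X i\<bar> + \<bar>Y i\<bar>))"
        by (intro sum_mono mult_right_mono member_le_sum) (auto simp: C)
      finally show "norm (\<Sum>i\<in>UNIV. P i z) \<le> (\<Sum>i\<in>UNIV. C i) * (\<Sum>i\<in>UNIV. \<bar>X i\<bar> + \<bar>Y i\<bar>)" by (simp only: sum_distrib_left)
    qed (use sum[of UNIV] in auto)
  qed
qed

text \<open>These potentials do not depend on \<theta>, so adding one leaves the phase gradient
  untouched; and they are sums of functions of the single shifts, so their Hessian is
  diagonal.\<close>

lemma torque_derivatives:
  assumes g: "nice D B g" and I: "I \<in> B"
    and pot: "\<And>\<tau> \<theta>. pot g (\<tau>, I, \<theta>) = (\<Sum>i\<in>UNIV. X i * cos (\<tau> $ i) + Y i * sin (\<tau> $ i))"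
  shows "grad_vec g I \<theta> \<tau> = (\<chi> i. Y i * cos (\<tau> $ i) - X i * sin (\<tau> $ i))"
    and "jac g I \<theta> \<tau> = (\<chi> i j. if i = j then - (X i * cos (\<tau> $ i)) - Y i * sin (\<tau> $ i) else 0)"
    and "phase_grad g j (\<tau>, I, \<theta>) = 0"
proof -
  have nth: "((\<lambda>\<tau> :: real^'n. \<tau> $ i) has_derivative (\<lambda>v. v $ i)) (at \<tau>)" for i \<tau>
    by (rule bounded_linear_imp_has_derivative[OF bounded_linear_vec_nth])
  have cs: "((\<lambda>\<tau> :: real^'n. cos (\<tau> $ i)) has_derivative (\<lambda>v. - sin (\<tau> $ i) * v $ i)) (at \<tau>)"
    "((\<lambda>\<tau> :: real^'n. sin (\<tau> $ i)) has_derivative (\<lambda>v. cos (\<tau> $ i) * v $ i)) (at \<tau>)" for i \<tau>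
    using has_derivative_compose[OF nth DERIV_cos[unfolded has_field_derivative_def]]
      has_derivative_compose[OF nth DERIV_sin[unfolded has_field_derivative_def]] by simp_all
  have gr: "grad_vec g I \<theta> = (\<lambda>\<tau>. \<chi> i. Y i * cos (\<tau> $ i) - X i * sin (\<tau> $ i))" for \<theta>
  proof (rule ext, simp only: vec_eq_iff grad_vec_def vec_lambda_beta, rule allI)
    fix \<tau> i
    have "((\<lambda>\<tau>. \<Sum>i\<in>UNIV. X i * cos (\<tau> $ i) + Y i * sin (\<tau> $ i)) has_derivative
      (\<lambda>v. \<Sum>i\<in>UNIV. X i * (- sin (\<tau> $ i) * v $ i) + Y i * (cos (\<tau> $ i) * v $ i))) (at \<tau>)"
      by (intro has_derivative_sum has_derivative_add has_derivative_mult_right cs)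
    then show "grad g i (\<tau>, I, \<theta>) = Y i * cos (\<tau> $ i) - X i * sin (\<tau> $ i)"
      unfolding grad_eq[OF g I] pot
      by (simp add: frechet_derivative_eqI axis_def sum.distrib sum_negf sum_subtractf if_distrib[of "\<lambda>c. _ * c"] cong: if_cong)
  qed
  then show "grad_vec g I \<theta> \<tau> = (\<chi> i. Y i * cos (\<tau> $ i) - X i * sin (\<tau> $ i))" by simp
  have "(grad_vec g I \<theta> has_derivative (\<lambda>v. \<chi> i. Y i * (- sin (\<tau> $ i) * v $ i) - X i * (cos (\<tau> $ i) * v $ i))) (at \<tau>)"
    unfolding gr by (rule has_derivative_vecI, unfold vec_lambda_beta) (intro has_derivative_diff has_derivative_mult_right cs)
  from has_derivative_unique[OF has_derivative_grad_vec[OF g I] this]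
  have *: "jac g I \<theta> \<tau> *v v = (\<chi> i. Y i * (- sin (\<tau> $ i) * v $ i) - X i * (cos (\<tau> $ i) * v $ i))" for v
    by (simp add: fun_eq_iff)
  show "jac g I \<theta> \<tau> = (\<chi> i j. if i = j then - (X i * cos (\<tau> $ i)) - Y i * sin (\<tau> $ i) else 0)"
  proof (unfold matrix_eq *, intro allI)
    fix v :: "real^'n"
    have "(\<Sum>j\<in>UNIV. (if i = j then c i else 0) * v $ j) = c i * v $ i" for c i
      by (simp add: if_distrib[of "\<lambda>c. c * _"] cong: if_cong)
    from this[of _ "\<lambda>i. - (X i * cos (\<tau> $ i)) - Y i * sin (\<tau> $ i)"]
    show "(\<chi> i. Y i * (- sin (\<tau> $ i) * v $ i) - X i * (cos (\<tau> $ i) * v $ i)) =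
      (\<chi> i j. if i = j then - (X i * cos (\<tau> $ i)) - Y i * sin (\<tau> $ i) else 0) *v v"
      by (simp add: vec_eq_iff matrix_vector_mult_def left_diff_distrib)
  qed
  show "phase_grad g j (\<tau>, I, \<theta>) = 0"
    unfolding phase_grad_eq[OF g I] pot by (simp add: frechet_derivative_eqI[OF has_derivative_const])
qed

lemma almost_critical_point:
  assumes g: "nice D B g" and I: "I \<in> B" and \<delta>: "\<delta> > 0"
  shows "\<exists>\<tau>. \<forall>i. \<bar>grad g i (\<tau>, I, \<theta>)\<bar> \<le> \<delta>"
proof -
  let ?f = "\<lambda>\<tau>. pot g (\<tau>, I, \<theta>)"
  obtain K where K: "K \<ge> 0" "\<And>\<tau>. \<bar>?f \<tau>\<bar> \<le> K"
  proof -
    obtain N where N: "0 \<le> N" "\<And>z b. z \<in> Mreal D B \<Longrightarrow> b \<in> Basis \<Longrightarrow> \<bar>frechet_derivative g (at z) b\<bar> \<le> N"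
      by (rule nice_derivative_bdd[OF g]) blast
    from integral_nice_diff_le obtain K where K: "K \<ge> 0" and all: "\<forall>g x N. nice D B g \<longrightarrow> x \<in> W \<longrightarrow>
      (\<forall>z\<in>Mreal D B. \<forall>b\<in>Basis. \<bar>frechet_derivative g (at z) b\<bar> \<le> N) \<longrightarrow>
      \<bar>\<integral>t. g (orbit_pt t x) - g (rest_pt t x) \<partial>lborel\<bar> \<le> K * N" by (elim exE conjE)
    have N': "\<forall>z\<in>Mreal D B. \<forall>b\<in>Basis. \<bar>frechet_derivative g (at z) b\<bar> \<le> N" by (intro ballI N(2))
    have "\<bar>?f \<tau>\<bar> \<le> K * N" for \<tau>
    proof -
      have x: "(\<tau>, I, \<theta>) \<in> W" using I by (simp add: W_def)
      show ?thesis
        unfolding pot_def abs_minus_cancel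
        by (rule all[THEN spec, THEN spec, THEN spec, THEN mp, OF g, THEN mp, OF x, THEN mp, OF N'])
    qed
    then show thesis using K N(1) by (intro that[of "K * N"]) auto
  qed
  \<comment> \<open>At the minimum the gradient is \<open>- 2 * \<epsilon>\<close> times \<tau>, and
    \<epsilon> times the square of \<open>norm \<tau>\<close> is at most \<open>2 * K\<close>. The
    squared norm of the gradient is then at most \<open>8 * K * \<epsilon>\<close>; the summand 1
    covers \<open>K = 0\<close>.\<close>
  define \<epsilon> where "\<epsilon> = \<delta>\<^sup>2 / (8 * K + 1)"
  have \<epsilon>: "\<epsilon> > 0" "8 * K * \<epsilon> \<le> \<delta>\<^sup>2" using \<delta> K(1) by (auto simp: \<epsilon>_def field_simps)
  let ?\<Phi> = "\<lambda>\<tau>. ?f \<tau> + \<epsilon> * (\<tau> \<bullet> \<tau>)"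
  have D\<Phi>: "(?\<Phi> has_derivative (\<lambda>v. (\<Sum>i\<in>UNIV. grad g i (\<tau>, I, \<theta>) * v $ i) + \<epsilon> * (\<tau> \<bullet> v + v \<bullet> \<tau>))) (at \<tau>)" for \<tau>
    by (intro has_derivative_add has_derivative_pot_\<tau>[OF g I] has_derivative_mult_right has_derivative_inner has_derivative_ident)
  \<comment> \<open>Beyond \<open>R\<close> the quadratic term exceeds \<open>2 * K\<close>, a bound
    for the oscillation of the potential, so the minimum over the ball is a global one.\<close>
  define R where "R = sqrt ((2 * K + 1) / \<epsilon>)"
  have R: "R > 0" "\<epsilon> * R\<^sup>2 = 2 * K + 1" using K(1) \<epsilon>(1) by (auto simp: R_def)
  have "continuous_on (cball 0 R) ?\<Phi>"
    by (intro continuous_at_imp_continuous_on ballI has_derivative_continuous[OF D\<Phi>])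
  moreover have "cball (0 :: real^'n) R \<noteq> {}" using R(1) by simp
  ultimately obtain \<tau> where \<tau>: "\<tau> \<in> cball 0 R" "\<And>x. x \<in> cball 0 R \<Longrightarrow> ?\<Phi> \<tau> \<le> ?\<Phi> x"
    using continuous_attains_inf[OF compact_cball] by blast
  have \<tau>0: "?\<Phi> \<tau> \<le> ?f 0" using \<tau>(2)[of 0] R(1) by simp
  have min: "?\<Phi> \<tau> \<le> ?\<Phi> x" for x
  proof (cases "x \<in> cball 0 R")
    case False
    then have "R\<^sup>2 \<le> x \<bullet> x" using R(1) unfolding dot_square_norm by (intro power_mono) auto
    then have "\<epsilon> * R\<^sup>2 \<le> \<epsilon> * (x \<bullet> x)" using \<epsilon>(1) by (intro mult_left_mono) auto
    then show ?thesis using \<tau>0 R(2) K(2)[of x] K(2)[of 0] by linarith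
  qed (rule \<tau>(2))
  have "(\<lambda>v. (\<Sum>i\<in>UNIV. grad g i (\<tau>, I, \<theta>) * v $ i) + \<epsilon> * (\<tau> \<bullet> v + v \<bullet> \<tau>)) = (\<lambda>v. 0)"
    by (rule differential_zero_maxmin[OF UNIV_I open_UNIV D\<Phi>]) (use min in blast)
  then have zero: "(\<Sum>i\<in>UNIV. grad g i (\<tau>, I, \<theta>) * v $ i) + \<epsilon> * (\<tau> \<bullet> v + v \<bullet> \<tau>) = 0" for v by (rule fun_cong)
  have g\<tau>: "grad g i (\<tau>, I, \<theta>) = - (2 * \<epsilon> * \<tau> $ i)" for i
  proof -
    have "(\<Sum>i'\<in>UNIV. grad g i' (\<tau>, I, \<theta>) * (axis i 1 :: real^'n) $ i') = grad g i (\<tau>, I, \<theta>)"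
      by (simp add: axis_def if_distrib[of "\<lambda>c. _ * c"] cong: if_cong)
    then show ?thesis using zero[of "axis i 1"] by (simp add: inner_axis inner_axis')
  qed
  have "\<epsilon> * (\<tau> \<bullet> \<tau>) \<le> 2 * K" using \<tau>0 K(2)[of \<tau>] K(2)[of 0] by linarith
  then have "4 * \<epsilon> * (\<epsilon> * (\<tau> \<bullet> \<tau>)) \<le> 4 * \<epsilon> * (2 * K)" using \<epsilon>(1) by (intro mult_left_mono) auto
  then have sq: "(2 * \<epsilon> * norm \<tau>)\<^sup>2 \<le> \<delta>\<^sup>2" using \<epsilon>(2) by (simp add: power_mult_distrib dot_square_norm power2_eq_square mult_ac)
  have "2 * \<epsilon> * norm \<tau> \<le> \<delta>" using power2_le_imp_le[OF sq] \<delta> by simp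
  moreover have "\<bar>grad g i (\<tau>, I, \<theta>)\<bar> \<le> 2 * \<epsilon> * norm \<tau>" for i
    using component_le_norm_cart[of \<tau> i] \<epsilon>(1) by (simp add: g\<tau> abs_mult)
  ultimately show ?thesis using order_trans by blast
qed

end

section \<open>Density\<close>

context melnikov
begin

text \<open>The almost critical point \<tau> is kept throughout. First \<open>Q\<close> makes the
  phase derivative nonzero, at the cost of moving the gradient by at most the frequency times
  \<delta>. Then \<open>P\<close> cancels whatever gradient is present and shifts the Hessian,
  without effect on the phase derivative.\<close>

lemma exists_small_good_perturbation:
  assumes \<kappa>: "0 < \<kappa>" and Bs: "Bs \<subseteq> B" and r3: "at_least_three r" and I0: "I0 \<in> Bs"
    and f: "f \<in> Comega \<kappa> D B" and \<epsilon>: "\<epsilon> > 0"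
  shows "\<exists>P\<in>Comega \<kappa> D B. (\<forall>z. norm (P z) < \<epsilon>) \<and> (\<lambda>z. f z + P z) \<in> good_perturbations r \<kappa> D B Bs h p0 q0 I0 a"
proof -
  have I: "I0 \<in> B" using Bs I0 by blast
  \<comment> \<open>Any pendulum and any angle will do, so the indices are arbitrary elements of
    their nonempty types.\<close>
  define k where "k = (undefined :: 'n)"
  define j where "j = (undefined :: 'd)"
  let ?\<nu> = "freq h I0 $ j"
  let ?a = "\<lambda>z :: ('n, 'd) cphase. fst (snd (snd (snd z))) $ j"
  have a: "angle_fun ?a" by (auto simp: angle_fun_def)
  have along: "?a (embed (orbit_pt t (\<tau>, I0, \<theta>))) = complex_of_real ((\<lambda>\<theta>. \<theta> $ j) \<theta> + ?\<nu> * t)" for t \<tau> \<theta>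
    by (simp add: embed_eq orbit_pt_def cvec_def mult.commute)
  from bump_pot[OF I \<kappa> a along, of k]
  obtain C2 where C2: "C2 \<ge> 0" and ex2: "\<forall>X Y. \<exists>P\<in>Comega \<kappa> D B. (\<forall>z. norm (P z) \<le> C2 * (\<bar>X\<bar> + \<bar>Y\<bar>)) \<and>
    (\<forall>\<tau> \<theta>. pot (real_part P) (\<tau>, I0, \<theta>) = X * cos (\<theta> $ j - ?\<nu> * \<tau> $ k) + Y * sin (\<theta> $ j - ?\<nu> * \<tau> $ k))"
    by (elim exE conjE)
  from torque_pot[OF I \<kappa>]
  obtain C1 where C1: "C1 \<ge> 0" and ex1: "\<forall>X Y. \<exists>P\<in>Comega \<kappa> D B. (\<forall>z. norm (P z) \<le> C1 * (\<Sum>i\<in>UNIV. \<bar>X i\<bar> + \<bar>Y i\<bar>)) \<and>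
    (\<forall>\<tau> \<theta>. pot (real_part P) (\<tau>, I0, \<theta>) = (\<Sum>i\<in>UNIV. X i * cos (\<tau> $ i) + Y i * sin (\<tau> $ i)))"
    by (elim exE conjE)
  let ?n = "real CARD('n)"
  \<comment> \<open>The size of \<open>Q + P\<close> per unit of \<delta>: two amplitudes of at most
    \<delta> in \<open>Q\<close>, and for each pendulum at most
    \<open>2 * (2 + \<bar>?\<nu>\<bar>) * \<delta>\<close> for the two amplitudes in
    \<open>P\<close>.\<close>
  define K where "K = 2 * C2 + C1 * (?n * (2 * (2 + \<bar>?\<nu>\<bar>)))"
  have K: "K \<ge> 0" using C1 C2 unfolding K_def by (intro add_nonneg_nonneg mult_nonneg_nonneg) auto
  define \<delta> where "\<delta> = \<epsilon> / (K + 1)"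
  have \<delta>: "\<delta> > 0" "K * \<delta> < \<epsilon>" using K \<epsilon> by (auto simp: \<delta>_def field_simps)
  note niceC = nice_real_part[OF D(1) B(1) _ \<kappa>]
  have rp: "real_part (\<lambda>z. F z + G z) = (\<lambda>x. real_part F x + real_part G x)" for F G :: "('n, 'd) cphase \<Rightarrow> complex"
    by (simp add: real_part_def fun_eq_iff)
  from almost_critical_point[OF niceC[OF f] I \<delta>(1), of 0]
  obtain \<tau> where \<tau>: "\<forall>i. \<bar>grad (real_part f) i (\<tau>, I0, 0)\<bar> \<le> \<delta>" by (elim exE)
  \<comment> \<open>At least one of \<delta> and \<delta> / 2 does not cancel the phase derivative
    already present.\<close>
  obtain \<eta> where \<eta>: "0 < \<eta>" "\<eta> \<le> \<delta>" "phase_grad (real_part f) j (\<tau>, I0, 0) + \<eta> \<noteq> 0"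
    using that[of \<delta>] that[of "\<delta> / 2"] \<delta>(1) by (cases "phase_grad (real_part f) j (\<tau>, I0, 0) + \<delta> = 0") auto
  let ?y = "- ?\<nu> * \<tau> $ k"
  have le\<eta>: "\<bar>u * \<eta>\<bar> \<le> \<delta>" if "\<bar>u\<bar> \<le> 1" for u
    using mult_mono[OF that \<eta>(2)] \<eta>(1) by (simp add: abs_mult)
  \<comment> \<open>The amplitudes are those for which the oscillation has derivative exactly \<eta>
    at the phase \<open>?y\<close>, the value of the argument at \<tau> and \<theta> = 0.\<close>
  obtain Q where Q: "Q \<in> Comega \<kappa> D B" and Qle: "\<And>z. norm (Q z) \<le> C2 * (\<bar>- sin ?y * \<eta>\<bar> + \<bar>cos ?y * \<eta>\<bar>)"
    and Qpot: "\<And>\<tau> \<theta>. pot (real_part Q) (\<tau>, I0, \<theta>) = (- sin ?y * \<eta>) * cos (\<theta> $ j - ?\<nu> * \<tau> $ k) + (cos ?y * \<eta>) * sin (\<theta> $ j - ?\<nu> * \<tau> $ k)"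
    using ex2[THEN spec, THEN spec, of "- sin ?y * \<eta>" "cos ?y * \<eta>"] by (elim bexE conjE) blast
  have Qle': "norm (Q z) \<le> C2 * (2 * \<delta>)" for z
  proof -
    have "\<bar>- sin ?y * \<eta>\<bar> + \<bar>cos ?y * \<eta>\<bar> \<le> \<delta> + \<delta>" by (intro add_mono le\<eta>) simp_all
    then show ?thesis using order_trans[OF Qle mult_left_mono[OF _ C2]] by simp
  qed
  note nQ = niceC[OF Q]
  have osc: "((\<lambda>u. (- sin ?y * \<eta>) * cos u + (cos ?y * \<eta>) * sin u) has_real_derivative \<eta>) (at ?y)"
  proof -
    have "((\<lambda>u. (- sin ?y * \<eta>) * cos u + (cos ?y * \<eta>) * sin u) has_real_derivative
      (- sin ?y * \<eta>) * (- sin ?y) + (cos ?y * \<eta>) * cos ?y) (at ?y)"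
      by (intro DERIV_add DERIV_cmult DERIV_cos DERIV_sin)
    moreover have "(- s * \<eta>) * (- s) + (c * \<eta>) * c = \<eta> * (s\<^sup>2 + c\<^sup>2)" for s c
      by (simp add: algebra_simps power2_eq_square)
    ultimately show ?thesis by (simp only: sin_cos_squared_add mult_1_right)
  qed
  have Qphase: "phase_grad (real_part Q) j (\<tau>, I0, 0) = \<eta>"
  proof -
    have "((\<lambda>\<theta> :: real^'d. \<theta> $ j - ?\<nu> * \<tau> $ k) has_derivative (\<lambda>v. v $ j)) (at 0)"
      by (auto intro!: derivative_eq_intros bounded_linear_imp_has_derivative bounded_linear_vec_nth)
    from has_derivative_compose[OF this, of "\<lambda>u. (- sin ?y * \<eta>) * cos u + (cos ?y * \<eta>) * sin u" "(*) \<eta>"] osc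
    have "((\<lambda>\<theta>. pot (real_part Q) (\<tau>, I0, \<theta>)) has_derivative (\<lambda>v. \<eta> * v $ j)) (at 0)"
      unfolding Qpot has_field_derivative_def by simp
    then show ?thesis unfolding phase_grad_eq[OF nQ I] by (simp add: frechet_derivative_eqI axis_def)
  qed
  have Qgrad: "\<bar>grad (real_part Q) i (\<tau>, I0, 0)\<bar> \<le> \<bar>?\<nu>\<bar> * \<delta>" for i
  proof -
    have "((\<lambda>\<tau> :: real^'n. (0 :: real^'d) $ j - ?\<nu> * \<tau> $ k) has_derivative (\<lambda>v. 0 - ?\<nu> * v $ k)) (at \<tau>)"
      by (intro has_derivative_diff has_derivative_const has_derivative_mult_right bounded_linear_imp_has_derivative bounded_linear_vec_nth)
    from has_derivative_compose[OF this, of "\<lambda>u. (- sin ?y * \<eta>) * cos u + (cos ?y * \<eta>) * sin u" "(*) \<eta>"] osc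
    have "((\<lambda>\<tau>. pot (real_part Q) (\<tau>, I0, 0)) has_derivative (\<lambda>v. \<eta> * (- (?\<nu> * v $ k)))) (at \<tau>)"
      unfolding Qpot has_field_derivative_def by simp
    then have "grad (real_part Q) i (\<tau>, I0, 0) = - (?\<nu> * \<eta>) * (if k = i then 1 else 0)"
      unfolding grad_eq[OF nQ I] by (simp add: frechet_derivative_eqI axis_def)
    moreover have "\<bar>?\<nu>\<bar> * \<eta> \<le> \<bar>?\<nu>\<bar> * \<delta>" using \<eta>(2) by (intro mult_left_mono) auto
    ultimately show ?thesis using \<eta>(1) \<delta>(1) by (simp add: abs_mult)
  qed
  let ?f1 = "\<lambda>z. f z + Q z"
  have f1: "?f1 \<in> Comega \<kappa> D B" by (rule Comega_add[OF f Q])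
  let ?g1 = "real_part ?f1"
  note n1 = niceC[OF f1]
  have grad1: "\<bar>grad ?g1 i (\<tau>, I0, 0)\<bar> \<le> \<delta> + \<bar>?\<nu>\<bar> * \<delta>" for i
    unfolding rp grad_add[OF niceC[OF f] nQ I]
    by (rule order_trans[OF abs_triangle_ineq add_mono[OF spec[OF \<tau>] Qgrad]])
  have phase1: "phase_grad ?g1 j (\<tau>, I0, 0) \<noteq> 0"
    unfolding rp phase_grad_add[OF niceC[OF f] nQ I] Qphase by (rule \<eta>(3))
  from exists_small_shift_det_nz[OF \<delta>(1), of "jac ?g1 I0 0 \<tau>"]
  obtain x where x: "0 < x" "x < \<delta>" "det (jac ?g1 I0 0 \<tau> + (\<chi> i j. if i = j then x else 0)) \<noteq> 0" by (elim exE conjE)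
  define G where "G i = - grad ?g1 i (\<tau>, I0, 0)" for i
  \<comment> \<open>Up to a sign, \<open>(X i, Y i)\<close> is \<open>(G i, x)\<close> rotated by
    the angle \<open>\<tau> $ i\<close> with its entries exchanged: the torque then has gradient
    component \<open>G i\<close> and diagonal Hessian entry \<open>x\<close> at \<tau>.\<close>
  define X where "X i = - G i * sin (\<tau> $ i) - x * cos (\<tau> $ i)" for i
  define Y where "Y i = G i * cos (\<tau> $ i) - x * sin (\<tau> $ i)" for i
  have XY: "\<bar>X i\<bar> + \<bar>Y i\<bar> \<le> 2 * (2 + \<bar>?\<nu>\<bar>) * \<delta>" for i
  proof -
    have s: "\<bar>- G i * sin (\<tau> $ i)\<bar> \<le> \<bar>G i\<bar>" "\<bar>G i * cos (\<tau> $ i)\<bar> \<le> \<bar>G i\<bar>" "\<bar>x * cos (\<tau> $ i)\<bar> \<le> x" "\<bar>x * sin (\<tau> $ i)\<bar> \<le> x"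
      using x(1) by (simp_all add: abs_mult mult_left_le)
    have "\<bar>X i\<bar> \<le> \<bar>G i\<bar> + x" "\<bar>Y i\<bar> \<le> \<bar>G i\<bar> + x"
      unfolding X_def Y_def by (rule order_trans[OF abs_triangle_ineq4 add_mono]; rule s)+
    moreover have "\<bar>G i\<bar> \<le> \<delta> + \<bar>?\<nu>\<bar> * \<delta>" using grad1[of i] by (simp add: G_def)
    ultimately show ?thesis using x(2) by (simp add: algebra_simps)
  qed
  obtain P where P: "P \<in> Comega \<kappa> D B" and Ple: "\<And>z. norm (P z) \<le> C1 * (\<Sum>i\<in>UNIV. \<bar>X i\<bar> + \<bar>Y i\<bar>)"
    and Ppot: "\<And>\<tau> \<theta>. pot (real_part P) (\<tau>, I0, \<theta>) = (\<Sum>i\<in>UNIV. X i * cos (\<tau> $ i) + Y i * sin (\<tau> $ i))"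
    using ex1[THEN spec, THEN spec, of X Y] by (elim bexE conjE) blast
  note nP = niceC[OF P]
  note Pd = torque_derivatives[OF nP I Ppot, where \<theta> = 0 and \<tau> = \<tau>]
  have "(G * c - x * s) * c - (- G * s - x * c) * s = G * (s\<^sup>2 + c\<^sup>2)" "- ((- G * s - x * c) * c) - (G * c - x * s) * s = x * (s\<^sup>2 + c\<^sup>2)"
    for G c s :: real by (simp_all add: algebra_simps power2_eq_square)
  then have XY2: "Y i * cos (\<tau> $ i) - X i * sin (\<tau> $ i) = G i" "- (X i * cos (\<tau> $ i)) - Y i * sin (\<tau> $ i) = x" for i
    unfolding X_def Y_def by (simp_all only: sin_cos_squared_add mult_1_right)
  let ?f2 = "\<lambda>z. f z + (Q z + P z)"
  have f2: "?f2 \<in> Comega \<kappa> D B" by (intro Comega_add f Q P)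
  have rp2: "real_part ?f2 = (\<lambda>x. ?g1 x + real_part P x)" by (simp add: real_part_def fun_eq_iff)
  have "grad_vec (real_part ?f2) I0 0 \<tau> = 0"
    unfolding rp2 grad_vec_add[OF n1 nP I] Pd XY2 by (simp add: grad_vec_def G_def vec_eq_iff)
  moreover have "det (jac (real_part ?f2) I0 0 \<tau>) \<noteq> 0"
    unfolding rp2 grad_vec_add[OF n1 nP I] Pd XY2 by (rule x(3))
  moreover have "phase_grad (real_part ?f2) j (\<tau>, I0, 0) \<noteq> 0"
    unfolding rp2 phase_grad_add[OF n1 nP I] Pd using phase1 by simp
  ultimately have "?f2 \<in> good_perturbations r \<kappa> D B Bs h p0 q0 I0 a"
    unfolding good_perturbations_iff[OF \<kappa> Bs r3 I0] crit_iff using f2 by blast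
  moreover have "norm (Q z + P z) < \<epsilon>" for z
  proof -
    have "(\<Sum>i\<in>UNIV. \<bar>X i\<bar> + \<bar>Y i\<bar>) \<le> ?n * (2 * (2 + \<bar>?\<nu>\<bar>) * \<delta>)"
      using sum_mono[of UNIV "\<lambda>i. \<bar>X i\<bar> + \<bar>Y i\<bar>", OF XY] by simp
    then have "norm (P z) \<le> C1 * (?n * (2 * (2 + \<bar>?\<nu>\<bar>) * \<delta>))" by (rule order_trans[OF Ple mult_left_mono[OF _ C1]])
    then have "norm (Q z + P z) \<le> C2 * (2 * \<delta>) + C1 * (?n * (2 * (2 + \<bar>?\<nu>\<bar>) * \<delta>))"
      by (intro order_trans[OF norm_triangle_ineq] add_mono Qle')
    also have "\<dots> = K * \<delta>" by (simp add: K_def algebra_simps)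
    finally show ?thesis using \<delta>(2) by simp
  qed
  ultimately show ?thesis using Comega_add[OF Q P] by (intro bexI[of _ "\<lambda>z. Q z + P z"]) auto
qed

lemma closure_good_perturbations:
  assumes \<kappa>: "0 < \<kappa>" and Bs: "Bs \<subseteq> B" and r3: "at_least_three r" and I0: "I0 \<in> Bs"
  shows "norm_topology (Comega \<kappa> D B) (kappa_norm \<kappa> D B) closure_of (good_perturbations r \<kappa> D B Bs h p0 q0 I0 a) = Comega \<kappa> D B"
proof (rule antisym)
  let ?T = "norm_topology (Comega \<kappa> D B) (kappa_norm \<kappa> D B)" and ?G = "good_perturbations r \<kappa> D B Bs h p0 q0 I0 a"
  show "?T closure_of ?G \<subseteq> Comega \<kappa> D B"
    using closure_of_subset_topspace[of ?T ?G] by (simp add: topspace_norm_topology)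
  show "Comega \<kappa> D B \<subseteq> ?T closure_of ?G"
  proof
    fix f assume f: "f \<in> Comega \<kappa> D B"
    have "\<exists>g\<in>?G. g \<in> U" if U: "f \<in> U" "openin ?T U" for U
    proof -
      obtain \<epsilon> where \<epsilon>: "\<epsilon> > 0" "\<And>g. g \<in> Comega \<kappa> D B \<Longrightarrow> kappa_norm \<kappa> D B (\<lambda>x. f x - g x) < \<epsilon> \<Longrightarrow> g \<in> U"
        using U unfolding openin_norm_topology by blast
      \<comment> \<open>Half of \<epsilon>, because the supremum of values strictly below a bound
        may equal the bound.\<close>
      obtain P where P: "P \<in> Comega \<kappa> D B" "\<And>z. norm (P z) < \<epsilon> / 2" "(\<lambda>z. f z + P z) \<in> ?G"
        using exists_small_good_perturbation[OF assms f half_gt_zero[OF \<epsilon>(1)]] by blast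
      have ne: "Mkappa \<kappa> D B \<noteq> {}"
        using embed_in_Mkappa[OF \<kappa>, of "(0, 0, I0, 0, 0)"] D(3) I0 Bs by (auto simp: Mreal_def simp del: embed.simps)
      have "kappa_norm \<kappa> D B (\<lambda>x. f x - (f x + P x)) \<le> \<epsilon> / 2"
        unfolding kappa_norm_def
      proof (rule cSUP_least[OF ne])
        show "norm (f z - (f z + P z)) \<le> \<epsilon> / 2" for z using less_imp_le[OF P(2)[of z]] by simp
      qed
      then have "(\<lambda>z. f z + P z) \<in> U" using \<epsilon>(1) by (intro \<epsilon>(2) Comega_add f P(1)) simp
      then show ?thesis using P(3) by blast
    qed
    then show "f \<in> ?T closure_of ?G" using f by (auto simp: in_closure_of topspace_norm_topology)
  qed
qed

end

theorem theorem4p5: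
  fixes r :: regularity
    and D Ds :: "(real^'n) set"
    and B Bs :: "(real^'d) set"
    and RD RB rD rB \<kappa> a :: real
    and cD :: "real^'n"
    and cB I0 :: "real^'d"
    and h :: "real^'d \<Rightarrow> real"
    and \<sigma> :: "'n \<Rightarrow> real"
    and V p0 q0 :: "'n \<Rightarrow> real \<Rightarrow> real"
    and G :: "(('n, 'd) cphase \<Rightarrow> complex) set"
  assumes "at_least_three r"
    and "D = ball 0 RD" and "B = ball 0 RB"
    and "Ds = cball cD rD" and "0 < rD" and "Ds \<subseteq> D"
    and "Bs = cball cB rB" and "0 < rB" and "Bs \<subseteq> B"
    and "regular_on r B h"
    and "\<And>i. \<sigma> i = 1 \<or> \<sigma> i = - 1"
    and "\<And>i. pendulum_potential r (V i)"
    and "\<And>i. homoclinic_orbit (\<sigma> i) (V i) (p0 i) (q0 i)"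
    and "range (orbit_at p0) \<subseteq> Ds"
    and "0 < \<kappa>"
    and "I0 \<in> Bs"
    and "G = good_perturbations r \<kappa> D B Bs h p0 q0 I0 a"
  shows "norm_topology (Comega \<kappa> D B) (kappa_norm \<kappa> D B) closure_of G = Comega \<kappa> D B \<and>
         openin (norm_topology (Comega \<kappa> D B) (kappa_norm \<kappa> D B)) G \<and>
         openin (norm_topology (Comega \<kappa> D B) (C3_norm D B)) G"
proof -
  \<comment> \<open>The centre of \<open>Ds\<close> lies in \<open>D\<close>, so the radius of
    \<open>D\<close> is positive and \<open>D\<close> contains 0, the momentum of the rest
    point.\<close>
  have "cD \<in> D" using assms(4-6) by auto
  then have "RD > 0" using assms(2) by (metis ball_empty empty_iff not_less)
  then interpret melnikov r D B h \<sigma> V p0 q0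
    using assms by unfold_locales auto
  note * = assms(15) assms(9) assms(1) assms(16)
  show ?thesis
    unfolding assms(17) by (intro conjI closure_good_perturbations openin_good_perturbations *)
qed

end
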